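(* Let $\mathbb{RP}^n$ be the round real projective space of diameter $\pi$, let $\mathbb{S}_{\mathbb{RP}^n}=\mathbb{S}^1\vee\dots\vee\mathbb{S}^n$ be the wedge sum of unit round spheres with the gluing metric, and let $\zeta_n=\arccos\big(\tfrac{-1}{n+1}\big)$. Coefficients are in $\mathbb{F}_2$. (1) For any integers $n\ge 1$ and $m\ge 0$, $$d_{\mathrm{I}}\big(\mathrm{H}_m^{\mathrm{VR}}(\mathbb{S}_{\mathbb{RP}^n}),\mathrm{H}_m^{\mathrm{VR}}(\mathbb{RP}^n)\big)\le\frac{\pi-\zeta_n}{2}<\frac{\pi}{4}.$$ (2) For any integers $n,m,k$ with $0<k\le m\le n$ and $\binom{m-k}{k}$ odd, $$d_{\mathrm{I}}\big(\mathrm{Im}_{\mathrm{Sq}^k}^{\mathrm{VR}}(\mathbb{S}_{\mathbb{RP}^n}),\mathrm{Im}_{\mathrm{Sq}^k}^{\mathrm{VR}}(\mathbb{RP}^n)\big)\ge\frac{\pi}{3},$$ where $\mathrm{Sq}^k$ denotes the Steenrod square $\mathrm{H}^{m-k}(-;\mathbb{F}_2)\to\mathrm{H}^{m}(-;\mathbb{F}_2)$ landing in degree $m$.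
   Context: Homology and cohomology are reduced, with $\mathbb{F}_2$ coefficients (zero, in degrees $\ge 0$, for the empty space). Metrics: round spheres carry the geodesic distance; $\mathbb{S}^i$ denotes the round sphere of radius $1$ (diameter $\pi$), and $\mathbb{RP}^n$ is the quotient of the round sphere of radius $2$ by the antipodal map with the quotient metric $d([x],[x'])=\min\{d(x,x'),d(x,-x')\}$. The gluing metric on a wedge of pointed metric spaces $(\mathcal{X}_i,x_i)$ restricts to $d_{\mathcal{X}_i}$ on each $\mathcal{X}_i$ and is $d(x,x')=d_{\mathcal{X}_i}(x,x_i)+d_{\mathcal{X}_j}(x',x_j)$ for $x\in\mathcal{X}_i$, $x'\in\mathcal{X}_j$, $i\neq j$. For a metric space $\mathcal{X}$ and $r>0$, $\mathrm{VR}_r(\mathcal{X})$ is the geometric realization of the simplicial complex with vertices the points of $\mathcal{X}$ and simplices the finite subsets of diameter strictly less than $r$; $\mathrm{VR}_r(\mathcal{X})=\emptyset$ for $r\le 0$. $\mathrm{H}_m^{\mathrm{VR}}(\mathcal{X})$ is the functor $\mathbb{R}\to\mathrm{Vec}$, $r\mapsto\mathrm{H}_m(\mathrm{VR}_r(\mathcal{X}))$. $\mathrm{Im}_{\mathrm{Sq}^k}^{\mathrm{VR}}(\mathcal{X})$ is the functor $\mathbb{R}^{\mathrm{op}}\to\mathrm{Vec}$ sending $r$ to the image of $\mathrm{Sq}^k\colon\mathrm{H}^{m-k}(\mathrm{VR}_r(\mathcal{X}))\to\mathrm{H}^{m}(\mathrm{VR}_r(\mathcal{X}))$, with structure maps restricted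 from cohomology. Interleaving distance: a $\delta$-interleaving ($\delta\ge0$) of $F,G\colon\mathbb{R}\to\mathrm{Vec}$ is a pair of natural families $\phi_r\colon F_r\to G_{r+\delta}$, $\psi_r\colon G_r\to F_{r+\delta}$ with $\psi_{r+\delta}\phi_r$ and $\phi_{r+\delta}\psi_r$ equal to the structure maps $F_r\to F_{r+2\delta}$, $G_r\to G_{r+2\delta}$; for functors on $\mathbb{R}^{\mathrm{op}}$ all arrows between indices are reversed ($\phi_r\colon F_{r+\delta}\to G_r$, etc.). $d_{\mathrm{I}}(F,G)$ is the infimum of $\delta\ge 0$ such that $F,G$ are $\delta$-interleaved. *)

theory Defs
  imports "HOL-Analysis.Analysis" "HOL-Homology.Homology" "HOL-Library.Z2" "HOL-Library.Extended_Real"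
begin

section \<open>Linear algebra over the field with two elements\<close>

definition F2 :: "bit ring" where
  "F2 = \<lparr>carrier = UNIV, mult = (*), one = 1, zero = 0, add = (+)\<rparr>"

definition linear_maps ::
  "('r, 'x) ring_scheme \<Rightarrow> ('r, 'a, 'y) module_scheme \<Rightarrow> ('r, 'b, 'z) module_scheme \<Rightarrow> ('a \<Rightarrow> 'b) set" where
  "linear_maps R M N =
     {h \<in> carrier M \<rightarrow> carrier N.
        (\<forall>x\<in>carrier M. \<forall>y\<in>carrier M. h (x \<oplus>\<^bsub>M\<^esub> y) = h x \<oplus>\<^bsub>N\<^esub> h y) \<and>
        (\<forall>a\<in>carrier R. \<forall>x\<in>carrier M. h (a \<odot>\<^bsub>M\<^esub> x) = a \<odot>\<^bsub>N\<^esub> h x)}"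

text \<open>A module record extends a ring record; its ring multiplication and unit play no role.\<close>

definition quot_module :: "('r, 'a, 'y) module_scheme \<Rightarrow> 'a set \<Rightarrow> ('r, 'a set) module" where
  "quot_module M N =
     \<lparr>carrier = a_rcosets\<^bsub>M\<^esub> N, mult = undefined, one = undefined,
      zero = N, add = (\<lambda>A B. A <+>\<^bsub>M\<^esub> B),
      smult = (\<lambda>a A. \<Union>x\<in>A. N +>\<^bsub>M\<^esub> (a \<odot>\<^bsub>M\<^esub> x))\<rparr>"

section \<open>Interleaving distance\<close>

text \<open>
  The same record serves for functors on the reals and on the opposite category.
  For \<open>r \<le> s\<close>, \<open>pmap F r s\<close> is the structure map attached to the pair: from
  \<open>pobj F r\<close> to \<open>pobj F s\<close> for a covariant functor, and from \<open>pobj F s\<close> to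
  \<open>pobj F r\<close> for a contravariant one.
\<close>

record ('r, 'a) persistence =
  pobj :: "real \<Rightarrow> ('r, 'a) module"
  pmap :: "real \<Rightarrow> real \<Rightarrow> 'a \<Rightarrow> 'a"

definition shift_map ::
  "('r, 'x) ring_scheme \<Rightarrow> real \<Rightarrow> ('r, 'a) persistence \<Rightarrow> ('r, 'b) persistence \<Rightarrow>
   (real \<Rightarrow> 'a \<Rightarrow> 'b) \<Rightarrow> bool" where
  "shift_map R \<delta> F G \<phi> \<longleftrightarrow>
     (\<forall>r. \<phi> r \<in> linear_maps R (pobj F r) (pobj G (r + \<delta>))) \<and>
     (\<forall>r s. r \<le> s \<longrightarrow>
        (\<forall>x\<in>carrier (pobj F r). \<phi> s (pmap F r s x) = pmap G (r + \<delta>) (s + \<delta>) (\<phi> r x)))"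

definition interleaved ::
  "('r, 'x) ring_scheme \<Rightarrow> real \<Rightarrow> ('r, 'a) persistence \<Rightarrow> ('r, 'b) persistence \<Rightarrow> bool" where
  "interleaved R \<delta> F G \<longleftrightarrow>
     (\<exists>\<phi> \<psi>. shift_map R \<delta> F G \<phi> \<and> shift_map R \<delta> G F \<psi> \<and>
        (\<forall>r. \<forall>x\<in>carrier (pobj F r). \<psi> (r + \<delta>) (\<phi> r x) = pmap F r (r + 2 * \<delta>) x) \<and>
        (\<forall>r. \<forall>y\<in>carrier (pobj G r). \<phi> (r + \<delta>) (\<psi> r y) = pmap G r (r + 2 * \<delta>) y))"

definition op_shift_map ::
  "('r, 'x) ring_scheme \<Rightarrow> real \<Rightarrow> ('r, 'a) persistence \<Rightarrow> ('r, 'b) persistence \<Rightarrow>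
   (real \<Rightarrow> 'a \<Rightarrow> 'b) \<Rightarrow> bool" where
  "op_shift_map R \<delta> F G \<phi> \<longleftrightarrow>
     (\<forall>r. \<phi> r \<in> linear_maps R (pobj F (r + \<delta>)) (pobj G r)) \<and>
     (\<forall>r s. r \<le> s \<longrightarrow>
        (\<forall>x\<in>carrier (pobj F (s + \<delta>)).
           \<phi> r (pmap F (r + \<delta>) (s + \<delta>) x) = pmap G r s (\<phi> s x)))"

definition op_interleaved ::
  "('r, 'x) ring_scheme \<Rightarrow> real \<Rightarrow> ('r, 'a) persistence \<Rightarrow> ('r, 'b) persistence \<Rightarrow> bool" where
  "op_interleaved R \<delta> F G \<longleftrightarrow>
     (\<exists>\<phi> \<psi>. op_shift_map R \<delta> F G \<phi> \<and> op_shift_map R \<delta> G F \<psi> \<and>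
        (\<forall>r. \<forall>x\<in>carrier (pobj F (r + 2 * \<delta>)). \<psi> r (\<phi> (r + \<delta>) x) = pmap F r (r + 2 * \<delta>) x) \<and>
        (\<forall>r. \<forall>y\<in>carrier (pobj G (r + 2 * \<delta>)). \<phi> r (\<psi> (r + \<delta>) y) = pmap G r (r + 2 * \<delta>) y))"

text \<open>Extended real values, so that the infimum over no \<open>\<delta>\<close> at all is infinite.\<close>

definition interleaving_dist ::
  "('r, 'x) ring_scheme \<Rightarrow> ('r, 'a) persistence \<Rightarrow> ('r, 'b) persistence \<Rightarrow> ereal" where
  "interleaving_dist R F G = Inf {ereal \<delta> |\<delta>. 0 \<le> \<delta> \<and> interleaved R \<delta> F G}"

definition op_interleaving_dist ::
  "('r, 'x) ring_scheme \<Rightarrow> ('r, 'a) persistence \<Rightarrow> ('r, 'b) persistence \<Rightarrow> ereal" where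
  "op_interleaving_dist R F G = Inf {ereal \<delta> |\<delta>. 0 \<le> \<delta> \<and> op_interleaved R \<delta> F G}"

section \<open>Reduced singular homology and cohomology with coefficients in the field with two elements\<close>

type_synonym 'a sing_simplex = "(nat \<Rightarrow> real) \<Rightarrow> 'a"

subsection \<open>Homology\<close>

type_synonym 'a chain2 = "'a sing_simplex \<Rightarrow>\<^sub>0 bit"

definition chain2_set :: "nat \<Rightarrow> 'a topology \<Rightarrow> 'a chain2 set" where
  "chain2_set p X = {c. Poly_Mapping.keys c \<subseteq> singular_simplex_set p X}"

definition boundary2 :: "nat \<Rightarrow> 'a chain2 \<Rightarrow> 'a chain2" where
  "boundary2 p c =
     (\<Sum>\<sigma>\<in>Poly_Mapping.keys c. \<Sum>k\<le>p.
        Poly_Mapping.single (singular_face p k \<sigma>) (Poly_Mapping.lookup c \<sigma>))"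

definition augmentation2 :: "'a chain2 \<Rightarrow> bit" where
  "augmentation2 c = (\<Sum>\<sigma>\<in>Poly_Mapping.keys c. Poly_Mapping.lookup c \<sigma>)"

definition reduced_cycles2 :: "nat \<Rightarrow> 'a topology \<Rightarrow> 'a chain2 set" where
  "reduced_cycles2 p X =
     {c \<in> chain2_set p X. if p = 0 then augmentation2 c = 0 else boundary2 p c = 0}"

definition boundaries2 :: "nat \<Rightarrow> 'a topology \<Rightarrow> 'a chain2 set" where
  "boundaries2 p X = boundary2 (Suc p) ` chain2_set (Suc p) X"

definition reduced_cycle_module2 :: "nat \<Rightarrow> 'a topology \<Rightarrow> (bit, 'a chain2) module" where
  "reduced_cycle_module2 p X =
     \<lparr>carrier = reduced_cycles2 p X, mult = undefined, one = undefined, zero = 0, add = (+),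
      smult = (\<lambda>a. Poly_Mapping.map ((*) a))\<rparr>"

definition reduced_homology2 :: "nat \<Rightarrow> 'a topology \<Rightarrow> (bit, 'a chain2 set) module" where
  "reduced_homology2 p X = quot_module (reduced_cycle_module2 p X) (boundaries2 p X)"

definition chain_map2 :: "nat \<Rightarrow> ('a \<Rightarrow> 'b) \<Rightarrow> 'a chain2 \<Rightarrow> 'b chain2" where
  "chain_map2 p g c =
     (\<Sum>\<sigma>\<in>Poly_Mapping.keys c. Poly_Mapping.single (simplex_map p g \<sigma>) (Poly_Mapping.lookup c \<sigma>))"

text \<open>
  Maps on classes are written as unions over representatives; the cosets in the union all coincide.
  The space \<open>Y\<close> is the target of \<open>g\<close>.
\<close>

definition homology_map2 ::
  "nat \<Rightarrow> 'b topology \<Rightarrow> ('a \<Rightarrow> 'b) \<Rightarrow> 'a chain2 set \<Rightarrow> 'b chain2 set" where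
  "homology_map2 p Y g \<alpha> =
     (\<Union>c\<in>\<alpha>. boundaries2 p Y +>\<^bsub>reduced_cycle_module2 p Y\<^esub> chain_map2 p g c)"

subsection \<open>Cohomology\<close>

text \<open>
  A \<open>q\<close>-cochain is a function on the singular \<open>q\<close>-simplices, extended by zero to all other
  functions.
\<close>

type_synonym 'a cochain2 = "'a sing_simplex \<Rightarrow> bit"

definition cochain2_set :: "nat \<Rightarrow> 'a topology \<Rightarrow> 'a cochain2 set" where
  "cochain2_set q X = {c. \<forall>\<sigma>. \<not> singular_simplex q X \<sigma> \<longrightarrow> c \<sigma> = 0}"

definition coboundary2 :: "nat \<Rightarrow> 'a topology \<Rightarrow> 'a cochain2 \<Rightarrow> 'a cochain2" where
  "coboundary2 q X c =
     (\<lambda>\<sigma>. if singular_simplex (Suc q) X \<sigma> then \<Sum>k\<le>Suc q. c (singular_face (Suc q) k \<sigma>) else 0)"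

definition cocycles2 :: "nat \<Rightarrow> 'a topology \<Rightarrow> 'a cochain2 set" where
  "cocycles2 q X = {c \<in> cochain2_set q X. coboundary2 q X c = (\<lambda>_. 0)}"

definition reduced_coboundaries2 :: "nat \<Rightarrow> 'a topology \<Rightarrow> 'a cochain2 set" where
  "reduced_coboundaries2 q X =
     (if q = 0 then range (\<lambda>a \<sigma>. if singular_simplex 0 X \<sigma> then a else 0)
      else coboundary2 (q - 1) X ` cochain2_set (q - 1) X)"

definition cocycle_module2 :: "nat \<Rightarrow> 'a topology \<Rightarrow> (bit, 'a cochain2) module" where
  "cocycle_module2 q X =
     \<lparr>carrier = cocycles2 q X, mult = undefined, one = undefined, zero = (\<lambda>_. 0),
      add = (\<lambda>c c' \<sigma>. c \<sigma> + c' \<sigma>), smult = (\<lambda>a c \<sigma>. a * c \<sigma>)\<rparr>"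

definition reduced_cohomology2 :: "nat \<Rightarrow> 'a topology \<Rightarrow> (bit, 'a cochain2 set) module" where
  "reduced_cohomology2 q X = quot_module (cocycle_module2 q X) (reduced_coboundaries2 q X)"

definition cochain_pullback2 ::
  "nat \<Rightarrow> 'a topology \<Rightarrow> ('a \<Rightarrow> 'b) \<Rightarrow> 'b cochain2 \<Rightarrow> 'a cochain2" where
  "cochain_pullback2 q X g c =
     (\<lambda>\<sigma>. if singular_simplex q X \<sigma> then c (simplex_map q g \<sigma>) else 0)"

text \<open>Here \<open>X\<close> is the source of \<open>g\<close>.\<close>

definition cohomology_map2 ::
  "nat \<Rightarrow> 'a topology \<Rightarrow> ('a \<Rightarrow> 'b) \<Rightarrow> 'b cochain2 set \<Rightarrow> 'a cochain2 set" where
  "cohomology_map2 q X g \<alpha> =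
     (\<Union>c\<in>\<alpha>. reduced_coboundaries2 q X +>\<^bsub>cocycle_module2 q X\<^esub> cochain_pullback2 q X g c)"

subsection \<open>Steenrod squares\<close>

text \<open>
  \<open>vertex_face S \<sigma>\<close> is the face of the singular simplex \<open>\<sigma>\<close> spanned by the vertices in the finite
  nonempty set \<open>S\<close>, in increasing order.
\<close>

definition vertex_face :: "nat set \<Rightarrow> 'a sing_simplex \<Rightarrow> 'a sing_simplex" where
  "vertex_face S \<sigma> =
     restrict (\<lambda>t. \<sigma> (\<lambda>v. if v \<in> S then t (card {w \<in> S. w < v}) else 0))
       (standard_simplex (card S - 1))"

text \<open>
  Steenrod's cup-\<open>i\<close> product of a \<open>p\<close>-cochain \<open>a\<close> and a \<open>q\<close>-cochain \<open>b\<close>. On an \<open>n\<close>-simplex,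
  \<open>n = p + q - i\<close>, it is the sum over \<open>0 \<le> u\<^sub>0 < \<dots> < u\<^sub>i \<le> n\<close> of
  \<open>a (0..u\<^sub>0, u\<^sub>1..u\<^sub>2, \<dots>) * b (u\<^sub>0..u\<^sub>1, u\<^sub>2..u\<^sub>3, \<dots>)\<close>, restricted to those terms in which the two
  faces have dimensions \<open>p\<close> and \<open>q\<close>. With \<open>U = {u\<^sub>0, \<dots>, u\<^sub>i}\<close>, a vertex outside \<open>U\<close> belongs to the
  first or to the second face according to the parity of the number of elements of \<open>U\<close> below it;
  those in \<open>U\<close> belong to both.
\<close>

definition cup_first :: "nat \<Rightarrow> nat set \<Rightarrow> nat set" where
  "cup_first n U = {v. v \<le> n \<and> (v \<in> U \<or> even (card {u \<in> U. u < v}))}"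

definition cup_second :: "nat \<Rightarrow> nat set \<Rightarrow> nat set" where
  "cup_second n U = {v. v \<le> n \<and> (v \<in> U \<or> odd (card {u \<in> U. u < v}))}"

definition cup_i ::
  "nat \<Rightarrow> nat \<Rightarrow> nat \<Rightarrow> 'a topology \<Rightarrow> 'a cochain2 \<Rightarrow> 'a cochain2 \<Rightarrow> 'a cochain2" where
  "cup_i i p q X a b =
     (let n = p + q - i in
      (\<lambda>\<sigma>. if singular_simplex n X \<sigma> then
             \<Sum>U | U \<subseteq> {..n} \<and> card U = i + 1 \<and>
                 card (cup_first n U) = p + 1 \<and> card (cup_second n U) = q + 1.
               a (vertex_face (cup_first n U) \<sigma>) * b (vertex_face (cup_second n U) \<sigma>)
           else 0))"

text \<open>\<open>steenrod_square k q X\<close> maps degree \<open>q\<close> to degree \<open>q + k\<close>.\<close>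

definition steenrod_square ::
  "nat \<Rightarrow> nat \<Rightarrow> 'a topology \<Rightarrow> 'a cochain2 set \<Rightarrow> 'a cochain2 set" where
  "steenrod_square k q X \<alpha> =
     (\<Union>c\<in>\<alpha>. reduced_coboundaries2 (q + k) X +>\<^bsub>cocycle_module2 (q + k) X\<^esub>
        (if k \<le> q then cup_i (q - k) q q X c c else (\<lambda>_. 0)))"

text \<open>The image of \<open>Sq\<^sup>k\<close> landing in degree \<open>m\<close>; meaningful for \<open>k \<le> m\<close>.\<close>

definition steenrod_image :: "nat \<Rightarrow> nat \<Rightarrow> 'a topology \<Rightarrow> (bit, 'a cochain2 set) module" where
  "steenrod_image k m X =
     (reduced_cohomology2 m X)
       \<lparr>carrier := steenrod_square k (m - k) X ` carrier (reduced_cohomology2 (m - k) X)\<rparr>"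

section \<open>Vietoris--Rips complexes\<close>

definition closed_cell :: "'v set \<Rightarrow> ('v \<Rightarrow> real) set" where
  "closed_cell S = {f. (\<forall>v. 0 \<le> f v) \<and> (\<forall>v. v \<notin> S \<longrightarrow> f v = 0) \<and> sum f S = 1}"

text \<open>
  The geometric realization, in barycentric coordinates, of a simplicial complex \<open>K\<close> given by its
  set of (finite, nonempty) simplices, with the weak topology.
\<close>

definition geometric_realization :: "'v set set \<Rightarrow> ('v \<Rightarrow> real) topology" where
  "geometric_realization K =
     topology (\<lambda>W. W \<subseteq> (\<Union>S\<in>K. closed_cell S) \<and>
       (\<forall>S\<in>K. openin (subtopology (powertop_real UNIV) (closed_cell S)) (W \<inter> closed_cell S)))"

lemma istopology_geometric_realization:
  "istopology (\<lambda>W. W \<subseteq> (\<Union>S\<in>K. closed_cell S) \<and>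
       (\<forall>S\<in>K. openin (subtopology (powertop_real UNIV) (closed_cell S)) (W \<inter> closed_cell S)))"
proof -
  have 1: "openin T (V \<inter> W \<inter> C)" if "openin T (V \<inter> C)" "openin T (W \<inter> C)"
    for T :: "('a \<Rightarrow> real) topology" and V W C
  proof -
    have "V \<inter> W \<inter> C = (V \<inter> C) \<inter> (W \<inter> C)" by blast
    then show ?thesis using that by (simp add: openin_Int)
  qed
  have 2: "openin T (\<Union>\<W> \<inter> C)" if "\<And>W. W \<in> \<W> \<Longrightarrow> openin T (W \<inter> C)"
    for T :: "('a \<Rightarrow> real) topology" and \<W> C
  proof -
    have eq: "\<Union>\<W> \<inter> C = (\<Union>W\<in>\<W>. W \<inter> C)" by blast
    show ?thesis
      unfolding eq by (rule openin_Union) (use that in blast)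
  qed
  show ?thesis
    unfolding istopology_def
  proof (intro conjI allI impI ballI; (elim conjE)?)
    fix V W S
    assume "\<forall>S\<in>K. openin (subtopology (powertop_real UNIV) (closed_cell S)) (V \<inter> closed_cell S)"
      "\<forall>S\<in>K. openin (subtopology (powertop_real UNIV) (closed_cell S)) (W \<inter> closed_cell S)"
      "S \<in> K"
    then show "openin (subtopology (powertop_real UNIV) (closed_cell S)) (V \<inter> W \<inter> closed_cell S)"
      by (intro 1) blast+
  next
    fix \<W> S
    assume "\<forall>W\<in>\<W>. W \<subseteq> (\<Union>S\<in>K. closed_cell S) \<and>
       (\<forall>S\<in>K. openin (subtopology (powertop_real UNIV) (closed_cell S)) (W \<inter> closed_cell S))" "S \<in> K"
    then show "openin (subtopology (powertop_real UNIV) (closed_cell S)) (\<Union>\<W> \<inter> closed_cell S)"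
      by (intro 2) blast
  qed blast+
qed

lemma openin_geometric_realization:
  "openin (geometric_realization K) W \<longleftrightarrow>
     W \<subseteq> (\<Union>S\<in>K. closed_cell S) \<and>
     (\<forall>S\<in>K. openin (subtopology (powertop_real UNIV) (closed_cell S)) (W \<inter> closed_cell S))"
  unfolding geometric_realization_def
  by (simp add: istopology_geometric_realization topology_inverse')

lemma topspace_geometric_realization:
  "topspace (geometric_realization K) = (\<Union>S\<in>K. closed_cell S)"
proof -
  have "openin (geometric_realization K) (\<Union>S\<in>K. closed_cell S)"
    unfolding openin_geometric_realization
  proof (intro conjI ballI)
    fix S assume "S \<in> K"
    then have "(\<Union>S\<in>K. closed_cell S) \<inter> closed_cell S = closed_cell S" by blast
    then show "openin (subtopology (powertop_real UNIV) (closed_cell S))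
                 ((\<Union>S\<in>K. closed_cell S) \<inter> closed_cell S)"
      using openin_topspace[of "subtopology (powertop_real UNIV) (closed_cell S)"] by simp
  qed simp
  then show ?thesis
    by (meson openin_geometric_realization openin_subset openin_topspace subset_antisym)
qed

text \<open>For \<open>r \<le> 0\<close> this has no simplices, as every diameter is at least \<open>0\<close>.\<close>

definition vr_complex :: "'a set \<Rightarrow> ('a \<Rightarrow> 'a \<Rightarrow> real) \<Rightarrow> real \<Rightarrow> 'a set set" where
  "vr_complex M d r =
     {S. finite S \<and> S \<noteq> {} \<and> S \<subseteq> M \<and> Max ((\<lambda>(x, y). d x y) ` (S \<times> S)) < r}"

definition vr_space :: "'a set \<Rightarrow> ('a \<Rightarrow> 'a \<Rightarrow> real) \<Rightarrow> real \<Rightarrow> ('a \<Rightarrow> real) topology" where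
  "vr_space M d r = geometric_realization (vr_complex M d r)"

text \<open>In barycentric coordinates the inclusion of Vietoris--Rips complexes is the identity.\<close>

definition vr_homology ::
  "nat \<Rightarrow> 'a set \<Rightarrow> ('a \<Rightarrow> 'a \<Rightarrow> real) \<Rightarrow> (bit, ('a \<Rightarrow> real) chain2 set) persistence" where
  "vr_homology m M d =
     \<lparr>pobj = (\<lambda>r. reduced_homology2 m (vr_space M d r)),
      pmap = (\<lambda>r s. homology_map2 m (vr_space M d s) id)\<rparr>"

definition vr_steenrod_image ::
  "nat \<Rightarrow> nat \<Rightarrow> 'a set \<Rightarrow> ('a \<Rightarrow> 'a \<Rightarrow> real) \<Rightarrow> (bit, ('a \<Rightarrow> real) cochain2 set) persistence" where
  "vr_steenrod_image k m M d =
     \<lparr>pobj = (\<lambda>r. steenrod_image k m (vr_space M d r)),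
      pmap = (\<lambda>r s. cohomology_map2 m (vr_space M d r) id)\<rparr>"

section \<open>The metric spaces\<close>

subsection \<open>Round spheres\<close>

definition round_sphere :: "nat \<Rightarrow> real \<Rightarrow> (nat \<Rightarrow> real) set" where
  "round_sphere n R = {x. (\<Sum>i\<le>n. (x i)\<^sup>2) = R\<^sup>2 \<and> (\<forall>i>n. x i = 0)}"

text \<open>
  The sphere of radius \<open>R\<close> in \<open>(n + 1)\<close>-space. Off the sphere the distance is set to \<open>0\<close>, because
  the locale \<open>Metric_space\<close> asks for nonnegativity and symmetry everywhere.
\<close>

definition geodesic_dist :: "nat \<Rightarrow> real \<Rightarrow> (nat \<Rightarrow> real) \<Rightarrow> (nat \<Rightarrow> real) \<Rightarrow> real" where
  "geodesic_dist n R x y =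
     (if x \<in> round_sphere n R \<and> y \<in> round_sphere n R
      then R * arccos ((\<Sum>i\<le>n. x i * y i) / R\<^sup>2) else 0)"

lemma round_sphere_eq_nsphere: "round_sphere n 1 = topspace (nsphere n)"
  by (auto simp: round_sphere_def nsphere)

lemma uminus_round_sphere [simp]: "(\<lambda>i. - x i) \<in> round_sphere n R \<longleftrightarrow> x \<in> round_sphere n R"
  by (simp add: round_sphere_def)

lemma Metric_space_round_sphere:
  assumes "R > 0"
  shows "Metric_space (round_sphere n R) (geodesic_dist n R)"
proof -
  define ip where "ip x y = (\<Sum>i\<le>n. x i * y i) / R\<^sup>2" for x y :: "nat \<Rightarrow> real"
  let ?S = "round_sphere n R" and ?d = "geodesic_dist n R"
  have d: "?d x y = R * arccos (ip x y)" if "x \<in> ?S" "y \<in> ?S" for x y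
    using that by (simp add: geodesic_dist_def ip_def)
  have commute: "ip x y = ip y x" for x y
    by (simp add: ip_def mult.commute)
  have self: "ip x x = 1" if "x \<in> ?S" for x
    using that assms by (simp add: ip_def round_sphere_def flip: power2_eq_square)
  have lin: "ip (\<lambda>i. x i - a * y i) (\<lambda>i. z i - b * w i) =
      ip x z - b * ip x w - a * ip y z + a * b * ip y w" for x y z w a b
  proof -
    have "(\<Sum>i\<le>n. (x i - a * y i) * (z i - b * w i)) =
        (\<Sum>i\<le>n. x i * z i) - b * (\<Sum>i\<le>n. x i * w i) - a * (\<Sum>i\<le>n. y i * z i)
          + a * b * (\<Sum>i\<le>n. y i * w i)"
      unfolding sum_distrib_left by (simp add: algebra_simps flip: sum.distrib sum_subtractf)
    then show ?thesis
      by (simp add: ip_def diff_divide_distrib add_divide_distrib)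
  qed
  have CS: "(ip x y)\<^sup>2 \<le> ip x x * ip y y" for x y
  proof -
    have "(\<Sum>i\<le>n. x i * y i)\<^sup>2 \<le> (\<Sum>i\<le>n. (x i)\<^sup>2) * (\<Sum>i\<le>n. (y i)\<^sup>2)"
      by (rule Cauchy_Schwarz_ineq_sum)
    then have "(\<Sum>i\<le>n. x i * y i)\<^sup>2 / (R\<^sup>2)\<^sup>2 \<le>
        ((\<Sum>i\<le>n. (x i)\<^sup>2) * (\<Sum>i\<le>n. (y i)\<^sup>2)) / (R\<^sup>2)\<^sup>2"
      by (rule divide_right_mono) simp
    then show ?thesis
      by (simp add: ip_def power_divide power2_eq_square)
  qed
  have bound: "\<bar>ip x y\<bar> \<le> 1" if "x \<in> ?S" "y \<in> ?S" for x y
    using CS[of x y] self[OF that(1)] self[OF that(2)] by (simp add: abs_square_le_1)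
  have ip_eq: "x = y" if "x \<in> ?S" "y \<in> ?S" "ip x y = 1" for x y
  proof -
    have "ip (\<lambda>i. x i - 1 * y i) (\<lambda>i. x i - 1 * y i) = 0"
      unfolding lin using that by (simp add: self commute[of y x])
    then have "(\<Sum>i\<le>n. (x i - y i)\<^sup>2) = 0"
      using assms by (simp add: ip_def power2_eq_square)
    then have "\<forall>i\<in>{..n}. (x i - y i)\<^sup>2 = 0"
      by (subst (asm) sum_nonneg_eq_0_iff) auto
    then have le: "x i = y i" if "i \<le> n" for i
      using that by simp
    show ?thesis
    proof
      fix i show "x i = y i"
        using le that(1,2) by (cases "i \<le> n") (auto simp: round_sphere_def)
    qed
  qed
  show ?thesis
  proof
    show "0 \<le> ?d x y" for x y
      using assms bound[of x y]
      by (cases "x \<in> ?S \<and> y \<in> ?S") (auto simp: d arccos_lbound abs_le_iff, auto simp: geodesic_dist_def)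
    show "?d x y = ?d y x" for x y
      by (simp add: geodesic_dist_def mult.commute)
    show "?d x y = 0 \<longleftrightarrow> x = y" if "x \<in> ?S" "y \<in> ?S" for x y
    proof
      assume "?d x y = 0"
      then have "arccos (ip x y) = 0"
        using assms that by (simp add: d)
      then have "ip x y = 1"
        using cos_arccos_abs[OF bound[OF that]] by simp
      then show "x = y"
        using ip_eq that by blast
    qed (use that in \<open>simp add: d self\<close>)
    show "?d x z \<le> ?d x y + ?d y z" if S: "x \<in> ?S" "y \<in> ?S" "z \<in> ?S" for x y z
    proof -
      define a b c where "a = ip x y" and "b = ip y z" and "c = ip x z"
      have ab: "\<bar>a\<bar> \<le> 1" "\<bar>b\<bar> \<le> 1" "\<bar>c\<bar> \<le> 1"
        using bound S by (auto simp: a_def b_def c_def)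
      have le: "arccos c \<le> arccos a + arccos b"
      proof (cases "arccos a + arccos b \<le> pi")
        case False
        then show ?thesis
          using arccos_ubound[of c] ab(3) by (simp add: abs_le_iff)
      next
        case True
        let ?u = "\<lambda>i. x i - a * y i" and ?v = "\<lambda>i. z i - b * y i"
        have uv: "ip ?u ?v = c - a * b"
          unfolding lin by (simp add: self S a_def b_def c_def)
        have uu: "ip ?u ?u = 1 - a\<^sup>2"
          unfolding lin by (simp add: self S a_def commute[of y x] power2_eq_square)
        have vv: "ip ?v ?v = 1 - b\<^sup>2"
          unfolding lin by (simp add: self S b_def commute[of z y] power2_eq_square)
        have "(c - a * b)\<^sup>2 \<le> (1 - a\<^sup>2) * (1 - b\<^sup>2)"
          using CS[of ?u ?v] unfolding uv uu vv .
        then have "\<bar>c - a * b\<bar> \<le> sqrt ((1 - a\<^sup>2) * (1 - b\<^sup>2))"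
          by (intro real_le_rsqrt) simp
        then have "a * b - sqrt (1 - a\<^sup>2) * sqrt (1 - b\<^sup>2) \<le> c"
          by (simp add: real_sqrt_mult abs_le_iff)
        then have "cos (arccos a + arccos b) \<le> c"
          using ab by (simp add: cos_add sin_arccos_abs cos_arccos_abs)
        then have "cos (arccos a + arccos b) \<le> cos (arccos c)"
          using ab by (simp add: cos_arccos_abs)
        then show ?thesis
          using ab True arccos_lbound arccos_ubound
          by (subst (asm) cos_mono_le_eq) (auto simp: abs_le_iff)
      qed
      then show ?thesis
        using S assms unfolding a_def b_def c_def
        by (simp add: d flip: distrib_left)
    qed
  qed
qed

subsection \<open>Round projective spaces\<close>

definition rp_space :: "nat \<Rightarrow> (nat \<Rightarrow> real) set set" where
  "rp_space n = (\<lambda>x. {x, \<lambda>i. - x i}) ` round_sphere n 2"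

text \<open>The choice of representatives is irrelevant by the lemma below.\<close>

definition rp_dist :: "nat \<Rightarrow> (nat \<Rightarrow> real) set \<Rightarrow> (nat \<Rightarrow> real) set \<Rightarrow> real" where
  "rp_dist n P Q =
     (let x = (SOME x. x \<in> P); y = (SOME y. y \<in> Q)
      in min (geodesic_dist n 2 x y) (geodesic_dist n 2 x (\<lambda>i. - y i)))"

lemma rp_dist:
  "rp_dist n {x, \<lambda>i. - x i} {y, \<lambda>i. - y i} =
     min (geodesic_dist n 2 x y) (geodesic_dist n 2 x (\<lambda>i. - y i))"
proof -
  let ?d = "geodesic_dist n 2"
  let ?m = "\<lambda>x y. min (?d x y) (?d x (\<lambda>i. - y i))"
  let ?P = "{x, \<lambda>i. - x i}" and ?Q = "{y, \<lambda>i. - y i}"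
  have neg: "?d (\<lambda>i. - x i) y = ?d x (\<lambda>i. - y i)" for x y
    by (simp add: geodesic_dist_def)
  have l: "?m (\<lambda>i. - x i) y = ?m x y" and r: "?m x (\<lambda>i. - y i) = ?m x y" for x y
    by (simp_all add: neg min.commute)
  have some: "(SOME x. x \<in> {z, w}) = z \<or> (SOME x. x \<in> {z, w}) = w" for z w :: "nat \<Rightarrow> real"
    using someI_ex[of "\<lambda>x. x \<in> {z, w}"] by blast
  show ?thesis
    unfolding rp_dist_def Let_def
    using some[of x "\<lambda>i. - x i"] some[of y "\<lambda>i. - y i"] by (metis l r)
qed

lemma Metric_space_rp: "Metric_space (rp_space n) (rp_dist n)"
proof -
  let ?S = "round_sphere n 2" and ?d = "geodesic_dist n 2"
  let ?m = "\<lambda>x y. min (?d x y) (?d x (\<lambda>i. - y i))"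
  interpret S: Metric_space ?S ?d
    by (rule Metric_space_round_sphere) simp
  have ex: "\<exists>x. x \<in> ?S \<and> P = {x, \<lambda>i. - x i}" if "P \<in> rp_space n" for P
    using that by (auto simp: rp_space_def)
  have neg: "?d (\<lambda>i. - x i) y = ?d x (\<lambda>i. - y i)" for x y
    by (simp add: geodesic_dist_def)
  have comm: "?m x y = ?m y x" for x y
    using neg[of y x] S.commute[of x "\<lambda>i. - y i"] S.commute[of x y] by simp
  have tri: "?m x z \<le> ?m x y + ?m y z" if "x \<in> ?S" "y \<in> ?S" "z \<in> ?S" for x y z
  proof -
    have "?d x z \<le> ?d x y + ?d y z"
         "?d x (\<lambda>i. - z i) \<le> ?d x y + ?d y (\<lambda>i. - z i)"
         "?d x z \<le> ?d x (\<lambda>i. - y i) + ?d (\<lambda>i. - y i) z"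
         "?d x (\<lambda>i. - z i) \<le> ?d x (\<lambda>i. - y i) + ?d (\<lambda>i. - y i) (\<lambda>i. - z i)"
      by (intro S.triangle; simp add: that)+
    then show ?thesis
      unfolding neg minus_minus by (simp add: min_def split: if_splits)
  qed
  show ?thesis
  proof
    show "0 \<le> rp_dist n P Q" for P Q
      by (simp add: rp_dist_def Let_def)
    show "rp_dist n P Q = rp_dist n Q P" for P Q
      unfolding rp_dist_def Let_def by (rule comm)
    show "rp_dist n P Q = 0 \<longleftrightarrow> P = Q" if PQ: "P \<in> rp_space n" "Q \<in> rp_space n" for P Q
    proof -
      obtain x y where xy: "x \<in> ?S" "y \<in> ?S"
        and [simp]: "P = {x, \<lambda>i. - x i}" "Q = {y, \<lambda>i. - y i}"
        using ex[OF PQ(1)] ex[OF PQ(2)] by metis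
      have "?m x y = 0 \<longleftrightarrow> ?d x y = 0 \<or> ?d x (\<lambda>i. - y i) = 0"
        using S.nonneg[of x y] S.nonneg[of x "\<lambda>i. - y i"] by linarith
      also have "\<dots> \<longleftrightarrow> x = y \<or> x = (\<lambda>i. - y i)"
        using xy by simp
      also have "\<dots> \<longleftrightarrow> P = Q"
        by (auto simp: doubleton_eq_iff)
      finally show ?thesis
        by (simp add: rp_dist)
    qed
    show "rp_dist n P T \<le> rp_dist n P Q + rp_dist n Q T"
      if PQT: "P \<in> rp_space n" "Q \<in> rp_space n" "T \<in> rp_space n" for P Q T
    proof -
      obtain x y z where xyz: "x \<in> ?S" "y \<in> ?S" "z \<in> ?S"
        and eqs: "P = {x, \<lambda>i. - x i}" "Q = {y, \<lambda>i. - y i}" "T = {z, \<lambda>i. - z i}"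
        using ex[OF PQT(1)] ex[OF PQT(2)] ex[OF PQT(3)] by metis
      show ?thesis
        unfolding eqs rp_dist by (rule tri[OF xyz])
    qed
  qed
qed

subsection \<open>Wedge sums\<close>

definition wedge_rel ::
  "'i set \<Rightarrow> ('i \<Rightarrow> 'a set) \<Rightarrow> ('i \<Rightarrow> 'a) \<Rightarrow> (('i \<times> 'a) \<times> ('i \<times> 'a)) set" where
  "wedge_rel I X b =
     {((i, x), (j, y)). (i, x) \<in> Sigma I X \<and> (j, y) \<in> Sigma I X \<and>
        ((i, x) = (j, y) \<or> x = b i \<and> y = b j)}"

definition wedge_space ::
  "'i set \<Rightarrow> ('i \<Rightarrow> 'a set) \<Rightarrow> ('i \<Rightarrow> 'a) \<Rightarrow> ('i \<times> 'a) set set" where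
  "wedge_space I X b = Sigma I X // wedge_rel I X b"

definition wedge_dist ::
  "('i \<Rightarrow> 'a \<Rightarrow> 'a \<Rightarrow> real) \<Rightarrow> ('i \<Rightarrow> 'a) \<Rightarrow> ('i \<times> 'a) set \<Rightarrow> ('i \<times> 'a) set \<Rightarrow> real" where
  "wedge_dist d b P Q =
     (let (i, x) = (SOME p. p \<in> P); (j, y) = (SOME q. q \<in> Q)
      in if i = j then d i x y else d i x (b i) + d j y (b j))"

lemma wedge_dist:
  assumes M: "\<And>i. Metric_space (X i) (d i)" and b: "\<And>i. i \<in> I \<Longrightarrow> b i \<in> X i"
    and "i \<in> I" "x \<in> X i" "j \<in> I" "y \<in> X j"
  shows "wedge_dist d b (wedge_rel I X b `` {(i, x)}) (wedge_rel I X b `` {(j, y)}) =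
           (if i = j then d i x y else d i x (b i) + d j y (b j))"
proof -
  let ?P = "wedge_rel I X b `` {(i, x)}" and ?Q = "wedge_rel I X b `` {(j, y)}"
  define p where "p = (SOME p. p \<in> ?P)"
  define q where "q = (SOME q. q \<in> ?Q)"
  have "(i, x) \<in> ?P" "(j, y) \<in> ?Q" using assms by (auto simp: wedge_rel_def)
  then have pq: "p \<in> ?P" "q \<in> ?Q"
    unfolding p_def q_def by (metis someI)+
  obtain i' x' j' y' where p: "p = (i', x')" and q: "q = (j', y')"
    by (cases p, cases q)
  have I: "i' \<in> I" "j' \<in> I"
    and P: "(i' = i \<and> x' = x) \<or> (x = b i \<and> x' = b i')"
    and Q: "(j' = j \<and> y' = y) \<or> (y = b j \<and> y' = b j')"
    using pq by (auto simp: wedge_rel_def p q)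
  have 0: "d k (b k) (b k) = 0" if "k \<in> I" for k
    using Metric_space.zero[OF M] b that by blast
  have s: "d k (b k) z = d k z (b k)" for k z
    by (rule Metric_space.commute[OF M])
  have "(if i' = j' then d i' x' y' else d i' x' (b i') + d j' y' (b j')) =
        (if i = j then d i x y else d i x (b i) + d j y (b j))"
    using P
  proof
    assume 1: "i' = i \<and> x' = x"
    show ?thesis using Q
      by (elim disjE) (use 1 0 I assms(3,5) in \<open>simp_all\<close>)
  next
    assume 1: "x = b i \<and> x' = b i'"
    show ?thesis
      using Q
    proof
      assume 2: "j' = j \<and> y' = y"
      show ?thesis
        using 1 2 s[of j y] 0[OF I(1)] 0[OF assms(3)] by (cases "i = j"; cases "i' = j") auto
    next
      assume 2: "y = b j \<and> y' = b j'"
      show ?thesis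
        using 1 2 0[OF I(1)] 0[OF I(2)] 0[OF assms(3)] 0[OF assms(5)] by auto
    qed
  qed
  then show ?thesis
    unfolding wedge_dist_def p_def[symmetric] q_def[symmetric] by (simp add: p q)
qed

lemma Metric_space_wedge:
  assumes M: "\<And>i. Metric_space (X i) (d i)" and b: "\<And>i. i \<in> I \<Longrightarrow> b i \<in> X i"
  shows "Metric_space (wedge_space I X b) (wedge_dist d b)"
proof -
  let ?c = "\<lambda>i x. wedge_rel I X b `` {(i, x)}"
  let ?D = "\<lambda>i x j y. if i = j then d i x y else d i x (b i) + d j y (b j)"
  have wd: "wedge_dist d b (?c i x) (?c j y) = ?D i x j y"
    if "i \<in> I" "x \<in> X i" "j \<in> I" "y \<in> X j" for i x j y
    using M b that by (rule wedge_dist)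
  have nn: "0 \<le> d i x y" for i x y
    by (rule Metric_space.nonneg[OF M])
  have com: "d i x y = d i y x" for i x y
    by (rule Metric_space.commute[OF M])
  have zero: "d i x y = 0 \<longleftrightarrow> x = y" if "x \<in> X i" "y \<in> X i" for i x y
    using Metric_space.zero[OF M] that by blast
  have tri: "d i x z \<le> d i x y + d i y z" if "x \<in> X i" "y \<in> X i" "z \<in> X i" for i x y z
    using Metric_space.triangle[OF M] that by blast
  have ex: "\<exists>i x. i \<in> I \<and> x \<in> X i \<and> P = ?c i x" if "P \<in> wedge_space I X b" for P
    using that by (auto simp: wedge_space_def quotient_def)
  have eq: "?c i x = ?c j y \<longleftrightarrow> (i, x) = (j, y) \<or> x = b i \<and> y = b j"
    if "i \<in> I" "x \<in> X i" "j \<in> I" "y \<in> X j" for i x j y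
  proof -
    have "equiv (Sigma I X) (wedge_rel I X b)"
      by (rule equivI) (auto simp: wedge_rel_def refl_on_def sym_def trans_def)
    then have "?c i x = ?c j y \<longleftrightarrow> ((i, x), (j, y)) \<in> wedge_rel I X b"
      using that by (intro eq_equiv_class_iff) auto
    also have "\<dots> \<longleftrightarrow> (i, x) = (j, y) \<or> x = b i \<and> y = b j"
      using that by (simp add: wedge_rel_def)
    finally show ?thesis .
  qed
  show ?thesis
  proof
    show "0 \<le> wedge_dist d b P Q" for P Q
      by (simp add: wedge_dist_def Let_def nn split: prod.split)
    show "wedge_dist d b P Q = wedge_dist d b Q P" for P Q
    proof -
      obtain i x where 1: "(SOME p. p \<in> P) = (i, x)" by fastforce
      obtain j y where 2: "(SOME p. p \<in> Q) = (j, y)" by fastforce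
      show ?thesis
        using com[of i x y] by (simp add: wedge_dist_def 1 2)
    qed
    show "wedge_dist d b P Q = 0 \<longleftrightarrow> P = Q"
      if PQ: "P \<in> wedge_space I X b" "Q \<in> wedge_space I X b" for P Q
    proof -
      obtain i x j y where ij: "i \<in> I" "x \<in> X i" "j \<in> I" "y \<in> X j"
        and eqs: "P = ?c i x" "Q = ?c j y"
        using ex[OF PQ(1)] ex[OF PQ(2)] by blast
      have "?D i x j y = 0 \<longleftrightarrow> (i, x) = (j, y) \<or> x = b i \<and> y = b j"
        using ij b zero nn[of i x "b i"] nn[of j y "b j"]
        by (auto simp: add_nonneg_eq_0_iff)
      then show ?thesis
        unfolding eqs wd[OF ij] eq[OF ij] .
    qed
    show "wedge_dist d b P T \<le> wedge_dist d b P Q + wedge_dist d b Q T"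
      if PQT: "P \<in> wedge_space I X b" "Q \<in> wedge_space I X b" "T \<in> wedge_space I X b" for P Q T
    proof -
      obtain i x j y k z where ijk: "i \<in> I" "x \<in> X i" "j \<in> I" "y \<in> X j" "k \<in> I" "z \<in> X k"
        and eqs: "P = ?c i x" "Q = ?c j y" "T = ?c k z"
        using ex[OF PQT(1)] ex[OF PQT(2)] ex[OF PQT(3)] by blast
      have t: "d i x z \<le> d i x y + d i y z" if "i = j" "j = k"
        using ijk that by (intro tri) auto
      have t1: "d i x (b i) \<le> d i x y + d i y (b i)" if "i = j"
        using ijk b that by (intro tri) auto
      have t2: "d k z (b k) \<le> d k y z + d k y (b k)" if "j = k"
        using tri[of z k y "b k"] ijk b that by (simp add: com[of k y z])
      have t3: "d i x z \<le> d i x (b i) + d i z (b i)" if "i = k"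
        using tri[of x i "b i" z] ijk b that by (simp add: com[of i z "b i"] com[of k z "b k"])
      note n = nn[of j y "b j"]
      have "?D i x k z \<le> ?D i x j y + ?D j y k z"
      proof (cases "i = j")
        case True
        then show ?thesis
          using t t1 by (cases "j = k") simp_all
      next
        case ij: False
        show ?thesis
        proof (cases "j = k")
          case True
          then show ?thesis
            using ij t2 by simp
        next
          case jk: False
          then show ?thesis
            using ij t3 n by (cases "i = k") simp_all
        qed
      qed
      then show ?thesis
        unfolding eqs wd[OF ijk(1-4)] wd[OF ijk(3-6)] wd[OF ijk(1,2,5,6)] .
    qed
  qed
qed

text \<open>
  The wedge of the unit spheres of dimensions \<open>1, \<dots>, n\<close> at base points \<open>b i\<close>, and its gluing
  metric.
\<close>

definition sphere_wedge :: "(nat \<Rightarrow> nat \<Rightarrow> real) \<Rightarrow> nat \<Rightarrow> (nat \<times> (nat \<Rightarrow> real)) set set" where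
  "sphere_wedge b n = wedge_space {1..n} (\<lambda>i. round_sphere i 1) b"

definition sphere_wedge_dist ::
  "(nat \<Rightarrow> nat \<Rightarrow> real) \<Rightarrow> (nat \<times> (nat \<Rightarrow> real)) set \<Rightarrow> (nat \<times> (nat \<Rightarrow> real)) set \<Rightarrow> real" where
  "sphere_wedge_dist b = wedge_dist (\<lambda>i. geodesic_dist i 1) b"

lemma Metric_space_sphere_wedge:
  assumes "\<And>i. i \<in> {1..n} \<Longrightarrow> b i \<in> round_sphere i 1"
  shows "Metric_space (sphere_wedge b n) (sphere_wedge_dist b)"
  unfolding sphere_wedge_def sphere_wedge_dist_def
  by (rule Metric_space_wedge) (use assms Metric_space_round_sphere in auto)

section \<open>The critical scale\<close>

definition zeta :: "nat \<Rightarrow> real" where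
  "zeta n = arccos (- 1 / (real n + 1))"

end

theory Submission
  imports Defs
begin

text \<open>
  Up to scale \<open>\<pi>/2\<close> both families carry exactly one class in each degree \<open>1, \<dots>, n\<close>, present from the
  start: for spheres, the Vietoris--Rips complex is compared with a cross-polytope by rounding
  directions, and for projective spaces the Smith sequence of the antipodal action is used. Pushing
  all points towards a base point kills every cycle within a further \<open>\<pi>/3\<close>. Hence the homologies are
  \<open>\<pi>/6\<close>-interleaved, and \<open>\<pi>/6 \<le> (\<pi> - \<zeta>\<^sub>n)/2\<close> because \<open>\<zeta>\<^sub>n \<le> 2\<pi>/3\<close>.

  For the squares, a cocycle of degree \<open>q < m\<close> on the wedge, at a scale up to \<open>\<pi>/2\<close>, is a coboundary
  on the subcomplex of the \<open>m\<close>-sphere, which carries all \<open>m\<close>-cycles; so every square of it vanishes.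
  On the projective space, up to scale \<open>2\<pi>/3\<close>, there is a cocycle \<open>w\<close> of degree one whose powers up to
  the \<open>n\<close>-th are not coboundaries at any smaller scale, and counting the terms of the cup-\<open>i\<close> product
  gives \<open>w\<^sup>q \<union>\<^sub>i w\<^sup>q = w\<^sup>m\<close> when the binomial coefficient is odd. An interleaving with \<open>\<delta> < \<pi>/3\<close>
  would factor a nonzero structure map on the class of \<open>w\<^sup>m\<close> through zero.
\<close>

section \<open>Chains modulo two\<close>

text \<open>Neither homotopy type is determined. Both families are compared through ordered chains,
  whose homotopies come from coning inside carriers; singular chains are tied to them by subdivision
  and vertex labels. The scales have geometric origins. On a unit sphere, scale at most pi/2 makes
  inner products inside a simplex positive, so that simplices lie in half-spaces. On the projective
  space, scale \<open>r\<close> is angle \<open>r/2\<close> upstairs, and for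
  \<open>r \<le> 2 pi/3\<close> simplices lift coherently to the double cover. For the upper bound,
  pushing by pi/6 kills whatever lives at a scale beyond pi/2 within pi/3, and pushing by pi/3 kills
  an early class soon after 2 pi/3; so one class per degree on (0, pi/2] is all that must be
  matched, and the homology above pi/2 is never computed. For the lower bound,
  \<open>\<delta> < pi/3\<close> leaves room for a scale \<open>r > 0\<close> with the middle scale
  \<open>r + \<delta> \<le> pi/2\<close> on the wedge and the outer scale
  \<open>r + 2 \<delta> \<le> 2 pi/3\<close> on the projective space.\<close>

abbreviation sng :: "'x \<Rightarrow> 'x \<Rightarrow>\<^sub>0 bit" where
  "sng x \<equiv> Poly_Mapping.single x 1"

abbreviation keys :: "('x \<Rightarrow>\<^sub>0 bit) \<Rightarrow> 'x set" where
  "keys \<equiv> Poly_Mapping.keys"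

lemma bit_add_self [simp]: "(a::bit) + a = 0"
  by (cases a) simp_all

lemma chain_add_self [simp]: "(c::'x \<Rightarrow>\<^sub>0 bit) + c = 0"
  by (rule poly_mapping_eqI) (simp add: lookup_add)

lemma chain_add_self_left [simp]: "(c::'x \<Rightarrow>\<^sub>0 bit) + (c + d) = d"
  by (simp flip: add.assoc)

lemma bit_add_self_left [simp]: "(a::bit) + (a + b) = b"
  by (cases a; cases b) simp_all

lemma chain_add_eq_0_iff: "(c::'x \<Rightarrow>\<^sub>0 bit) + d = 0 \<longleftrightarrow> c = d"
  by (metis chain_add_self chain_add_self_left add.right_neutral)

lemma chain_add_eq_iff: "(c::'x \<Rightarrow>\<^sub>0 bit) + d = e \<longleftrightarrow> c = d + e"
  by (metis chain_add_self_left add.commute)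

lemma lookup_keys: "x \<in> keys c \<Longrightarrow> Poly_Mapping.lookup c x = 1"
  by (simp add: in_keys_iff)

text \<open>A mod 2 chain is the finite set of its keys, so linear extension is a sum over
  \<open>keys\<close>. The target is any commutative monoid, chains and \<open>bit\<close> alike;
  additivity then rests on \<open>f x + f x = 0\<close>, which makes common keys cancel.\<close>

definition lin :: "('x \<Rightarrow> 'g) \<Rightarrow> ('x \<Rightarrow>\<^sub>0 bit) \<Rightarrow> 'g::comm_monoid_add" where
  "lin f c = (\<Sum>x\<in>keys c. f x)"

lemma lin_0 [simp]: "lin f 0 = 0"
  by (simp add: lin_def)

lemma lin_zero_fun [simp]: "lin (\<lambda>x. 0) c = 0"
  by (simp add: lin_def)

lemma lin_sng [simp]: "lin f (sng x) = f x"
  by (simp add: lin_def)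

lemma lin_add [simp]:
  assumes "\<And>x. f x + f x = 0"
  shows "lin f (c + d) = lin f c + lin f d"
proof -
  define g where "g x (b::bit) = (if b = 0 then 0 else f x)" for x b
  have g: "lin f c = (\<Sum>x\<in>keys c. g x (Poly_Mapping.lookup c x))" for c
    unfolding lin_def by (rule sum.cong) (auto simp: g_def in_keys_iff)
  show ?thesis
    unfolding g
  proof (rule setsum_keys_plus_distrib)
    show "g x (a + b) = g x a + g x b" for x a b
      by (cases a; cases b) (simp_all add: g_def assms)
  qed (simp add: g_def)
qed

lemma lin_cong: "(\<And>x. x \<in> keys c \<Longrightarrow> f x = g x) \<Longrightarrow> lin f c = lin g c"
  unfolding lin_def by (rule sum.cong) auto

lemma lin_fun_add: "lin (\<lambda>x. f x + g x) c = lin f c + lin g c"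
  by (simp add: lin_def sum.distrib)

lemma lin_sum:
  assumes "\<And>x. f x + f x = 0"
  shows "lin f (\<Sum>i\<in>I. c i) = (\<Sum>i\<in>I. lin f (c i))"
  by (induction I rule: infinite_finite_induct) (simp_all add: assms)

lemma lin_fun_sum: "lin (\<lambda>x. \<Sum>i\<in>I. f i x) c = (\<Sum>i\<in>I. lin (f i) c)"
  unfolding lin_def by (rule sum.swap)

lemma lin_lin:
  assumes "\<And>x. g x + g x = 0"
  shows "lin g (lin f c) = lin (\<lambda>x. lin g (f x)) c"
  unfolding lin_def[of f] lin_def[of "\<lambda>x. lin g (f x)"] by (rule lin_sum) (rule assms)

lemma lin_id [simp]: "lin sng c = c"
proof (rule poly_mapping_eqI)
  fix x
  have "(\<Sum>y\<in>keys c. 1 when y = x) = (Poly_Mapping.lookup c x :: bit)"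
  proof (cases "x \<in> keys c")
    case True
    then have "(\<Sum>y\<in>keys c. 1 when y = x) = (\<Sum>y\<in>{x}. (1::bit) when y = x)"
      by (intro sum.mono_neutral_right) (auto simp: when_def)
    then show ?thesis using True by (simp add: lookup_keys)
  next
    case False
    then have "(\<Sum>y\<in>keys c. (1::bit) when y = x) = 0"
      by (intro sum.neutral) (auto simp: when_def)
    then show ?thesis using False by (simp add: in_keys_iff)
  qed
  then show "Poly_Mapping.lookup (lin sng c) x = Poly_Mapping.lookup c x"
    by (simp add: lin_def lookup_sum lookup_single)
qed

lemma keys_lin: "keys (lin f c) \<subseteq> (\<Union>x\<in>keys c. keys (f x))"
  unfolding lin_def by (rule keys_sum)

lemma keys_linE:
  assumes "y \<in> keys (lin f c)"
  obtains x where "x \<in> keys c" "y \<in> keys (f x)"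
  using assms keys_lin[of f c] by blast

lemma keys_addE:
  assumes "y \<in> keys (c + d)"
  obtains "y \<in> keys c" | "y \<in> keys d"
  using assms keys_add[of c d] by blast

definition mp :: "('x \<Rightarrow> 'y) \<Rightarrow> ('x \<Rightarrow>\<^sub>0 bit) \<Rightarrow> ('y \<Rightarrow>\<^sub>0 bit)" where
  "mp f c = lin (\<lambda>x. sng (f x)) c"

lemma mp_0 [simp]: "mp f 0 = 0" and mp_sng [simp]: "mp f (sng x) = sng (f x)"
  and mp_add [simp]: "mp f (c + d) = mp f c + mp f d"
  by (simp_all add: mp_def)

lemma mp_sum: "mp f (\<Sum>i\<in>I. c i) = (\<Sum>i\<in>I. mp f (c i))"
  by (simp add: mp_def lin_sum)

lemma lin_mp:
  assumes "\<And>x. g x + g x = 0"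
  shows "lin g (mp f c) = lin (\<lambda>x. g (f x)) c"
  using assms by (simp add: mp_def lin_lin)

lemma mp_lin: "mp g (lin f c) = lin (\<lambda>x. mp g (f x)) c"
  by (simp add: mp_def lin_lin)

lemma mp_mp: "mp g (mp f c) = mp (\<lambda>x. g (f x)) c"
  by (simp add: mp_def lin_lin)

lemma mp_cong: "(\<And>x. x \<in> keys c \<Longrightarrow> f x = g x) \<Longrightarrow> mp f c = mp g c"
  unfolding mp_def by (rule lin_cong) simp

lemma mp_id: "(\<And>x. x \<in> keys c \<Longrightarrow> f x = x) \<Longrightarrow> mp f c = c"
  using mp_cong[of c f "\<lambda>x. x"] by (simp add: mp_def)

lemma keys_mp: "keys (mp f c) \<subseteq> f ` keys c"
  using keys_lin[of "\<lambda>x. sng (f x)" c] by (auto simp: mp_def)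

lemma keys_mpE:
  assumes "y \<in> keys (mp f c)"
  obtains x where "x \<in> keys c" "y = f x"
  using assms keys_mp[of f c] by blast

lemma chain_induct [consumes 1, case_names zero add]:
  assumes "keys c \<subseteq> S" "P 0" "\<And>x c. x \<in> S \<Longrightarrow> keys c \<subseteq> S \<Longrightarrow> P c \<Longrightarrow> P (sng x + c)"
  shows "P c"
proof -
  have "P (\<Sum>x\<in>A. sng x) \<and> keys (\<Sum>x\<in>A. sng x) \<subseteq> S" if "finite A" "A \<subseteq> S" for A
    using that
  proof (induction A rule: finite_induct)
    case (insert x A)
    then show ?case
      using assms(3)[of x "\<Sum>x\<in>A. sng x"] keys_add[of "sng x" "\<Sum>x\<in>A. sng x"] by auto
  qed (simp add: assms)
  from this[of "keys c"] assms(1) show ?thesis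
    using lin_id[of c] unfolding lin_def by simp
qed

section \<open>Ordered chains: formal sums of lists of vertices\<close>

definition lcone :: "'v \<Rightarrow> ('v list \<Rightarrow>\<^sub>0 bit) \<Rightarrow> ('v list \<Rightarrow>\<^sub>0 bit)" where
  "lcone x c = mp ((#) x) c"

text \<open>The chains are augmented: the empty list spans degree \<open>-1\<close>, so that the homology of this
  complex is reduced homology.\<close>

primrec bdl :: "'v list \<Rightarrow> ('v list \<Rightarrow>\<^sub>0 bit)" where
  "bdl [] = 0"
| "bdl (x # L) = sng L + lcone x (bdl L)"

definition bd :: "('v list \<Rightarrow>\<^sub>0 bit) \<Rightarrow> ('v list \<Rightarrow>\<^sub>0 bit)" where
  "bd c = lin bdl c"

lemma bd_0 [simp]: "bd 0 = 0" and bd_sng [simp]: "bd (sng L) = bdl L"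
  and bd_add [simp]: "bd (c + d) = bd c + bd d"
  by (simp_all add: bd_def)

lemma bd_lin: "bd (lin f c) = lin (\<lambda>x. bd (f x)) c"
  by (simp add: bd_def lin_lin)

lemma lcone_0 [simp]: "lcone x 0 = 0" and lcone_sng [simp]: "lcone x (sng L) = sng (x # L)"
  and lcone_add [simp]: "lcone x (c + d) = lcone x c + lcone x d"
  by (simp_all add: lcone_def)

lemma bd_lcone: "bd (lcone x c) = c + lcone x (bd c)"
proof -
  have "bd (lcone x c) = lin (\<lambda>L. sng L + lcone x (bdl L)) c"
    by (simp add: bd_def lcone_def lin_mp)
  also have "\<dots> = c + lcone x (bd c)"
    by (simp add: lin_fun_add bd_def lcone_def mp_lin)
  finally show ?thesis .
qed

lemma bd_bdl [simp]: "bd (bdl L) = 0"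
  by (induction L) (simp_all add: bd_lcone)

lemma bd_bd [simp]: "bd (bd c) = 0"
  unfolding bd_def[of c] bd_lin by simp

lemma bdl_keys: "M \<in> keys (bdl L) \<Longrightarrow> set M \<subseteq> set L \<and> length L = Suc (length M)"
proof (induction L arbitrary: M)
  case (Cons x L)
  then show ?case
    by (auto simp: lcone_def elim!: keys_addE keys_mpE) force+
qed simp

lemma bdl_eq_sum: "bdl L = (\<Sum>k<length L. sng (take k L @ drop (Suc k) L))"
  by (induction L)
    (simp_all add: sum.lessThan_Suc_shift lcone_def mp_sum del: sum.lessThan_Suc)

lemma bdl_map: "bdl (map f L) = mp (map f) (bdl L)"
  by (induction L) (simp_all add: lcone_def mp_mp)

lemma bd_mp: "bd (mp (map f) c) = mp (map f) (bd c)"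
  by (simp add: bd_def mp_lin lin_mp bdl_map)

text \<open>Degree is list length, one more than the dimension, so the augmentation sits in length
  0. Only the vertex set must lie in \<open>K\<close>; lists may repeat vertices, so vertex maps act
  even where they identify vertices.\<close>

definition on :: "'v set set \<Rightarrow> nat \<Rightarrow> ('v list \<Rightarrow>\<^sub>0 bit) \<Rightarrow> bool" where
  "on K p c \<longleftrightarrow> (\<forall>L\<in>keys c. set L \<in> K \<and> length L = p)"

lemma on_0 [simp]: "on K p 0" and on_sng [simp]: "on K p (sng L) \<longleftrightarrow> set L \<in> K \<and> length L = p"
  by (simp_all add: on_def)

lemma on_add: "on K p c \<Longrightarrow> on K p d \<Longrightarrow> on K p (c + d)"
  by (auto simp: on_def elim: keys_addE)

lemma on_sum: "(\<And>i. i \<in> I \<Longrightarrow> on K p (c i)) \<Longrightarrow> on K p (\<Sum>i\<in>I. c i)"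
  by (induction I rule: infinite_finite_induct) (simp_all add: on_add)

lemma on_lin: "(\<And>x. x \<in> keys c \<Longrightarrow> on K p (f x)) \<Longrightarrow> on K p (lin f c)"
  by (auto simp: on_def elim!: keys_linE)

lemma on_mono: "on K p c \<Longrightarrow> K \<subseteq> K' \<Longrightarrow> on K' p c"
  by (auto simp: on_def)

lemma on_mp: "on K p c \<Longrightarrow> (\<And>S. S \<in> K \<Longrightarrow> f ` S \<in> K') \<Longrightarrow> on K' p (mp (map f) c)"
  by (auto simp: on_def elim!: keys_mpE)

lemma on_lcone: "on K p c \<Longrightarrow> (\<And>S. S \<in> K \<Longrightarrow> insert x S \<in> K') \<Longrightarrow> on K' (Suc p) (lcone x c)"
  by (auto simp: on_def lcone_def elim!: keys_mpE)

definition down :: "'v set set \<Rightarrow> bool" where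
  "down K \<longleftrightarrow> (\<forall>S\<in>K. \<forall>T\<subseteq>S. T \<in> K)"

lemma on_bd: "on K (Suc p) c \<Longrightarrow> down K \<Longrightarrow> on K p (bd c)"
  unfolding on_def bd_def down_def by (auto elim!: keys_linE dest!: bdl_keys)

lemma on_0_length: "on K 0 c \<Longrightarrow> bd c = 0"
  unfolding bd_def on_def by (subst lin_cong[of c bdl "\<lambda>_. 0"]) auto

subsection \<open>Acyclic carriers\<close>

text \<open>A chain homotopy from the identity to \<open>\<phi>\<close>. The chain under the cone is
  the defect left by the homotopy on the faces; it is a cycle, so the cone from the first vertex of
  \<open>L\<close> fills it. The first argument is the length of \<open>L\<close> and carries the
  recursion, since the faces in \<open>bdl L\<close> are not structurally smaller.\<close>

primrec carr :: "nat \<Rightarrow> ('v list \<Rightarrow> ('v list \<Rightarrow>\<^sub>0 bit)) \<Rightarrow> 'v list \<Rightarrow> ('v list \<Rightarrow>\<^sub>0 bit)" where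
  "carr 0 \<phi> L = 0"
| "carr (Suc n) \<phi> L = lcone (hd L) (sng L + \<phi> L + lin (carr n \<phi>) (bdl L))"

definition htp :: "('v list \<Rightarrow> ('v list \<Rightarrow>\<^sub>0 bit)) \<Rightarrow> 'v list \<Rightarrow> ('v list \<Rightarrow>\<^sub>0 bit)" where
  "htp \<phi> L = carr (length L) \<phi> L"

lemma htp_Nil [simp]: "htp \<phi> [] = 0"
  by (simp add: htp_def)

lemma htp_unfold:
  "L \<noteq> [] \<Longrightarrow> htp \<phi> L = lcone (hd L) (sng L + \<phi> L + lin (htp \<phi>) (bdl L))"
proof -
  assume "L \<noteq> []"
  then obtain n where n: "length L = Suc n" by (cases L) auto
  have "lin (carr n \<phi>) (bdl L) = lin (htp \<phi>) (bdl L)"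
    by (rule lin_cong) (use n in \<open>auto simp: htp_def dest!: bdl_keys\<close>)
  then show ?thesis by (simp add: htp_def n)
qed

lemma htp_bdl:
  assumes "down K" and nil: "\<phi> [] = sng []"
    and cm: "\<And>L. set L \<in> K \<Longrightarrow> bd (\<phi> L) = lin \<phi> (bdl L)"
  shows "set L \<in> K \<Longrightarrow> bd (htp \<phi> L) + lin (htp \<phi>) (bdl L) = sng L + \<phi> L"
proof (induction "length L" arbitrary: L)
  case 0
  then show ?case by (simp add: nil)
next
  case (Suc n)
  then have L: "L \<noteq> []" by auto
  let ?D = "lin (htp \<phi>)"
  have "bd (?D (bdl L)) = bdl L + lin \<phi> (bdl L)"
  proof -
    have "lin (\<lambda>M. ?D (bdl M)) (bdl L) = ?D (bd (bdl L))"
      unfolding bd_def[of "bdl L"] by (simp add: lin_lin)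
    then have "bd (?D (bdl L)) = lin (\<lambda>M. bd (htp \<phi> M) + ?D (bdl M)) (bdl L)"
      by (simp add: lin_fun_add bd_lin)
    also have "\<dots> = lin (\<lambda>M. sng M + \<phi> M) (bdl L)"
    proof (rule lin_cong)
      fix M assume "M \<in> keys (bdl L)"
      then have "set M \<subseteq> set L" "length L = Suc (length M)" by (auto dest: bdl_keys)
      then show "bd (htp \<phi> M) + ?D (bdl M) = sng M + \<phi> M"
        using Suc assms(1) by (auto simp: down_def)
    qed
    finally show ?thesis by (simp add: lin_fun_add)
  qed
  then have "bd (sng L + \<phi> L + ?D (bdl L)) = 0"
    by (simp add: cm Suc.prems ac_simps)
  then show ?case
    unfolding htp_unfold[OF L] bd_lcone by (simp add: add.assoc)
qed

lemma htp_bd: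
  assumes "down K" "\<phi> [] = sng []" "\<And>L. set L \<in> K \<Longrightarrow> bd (\<phi> L) = lin \<phi> (bdl L)"
    and "on K p c"
  shows "bd (lin (htp \<phi>) c) + lin (htp \<phi>) (bd c) = c + lin \<phi> c"
proof -
  have "bd (lin (htp \<phi>) c) + lin (htp \<phi>) (bd c) = lin (\<lambda>L. bd (htp \<phi> L) + lin (htp \<phi>) (bdl L)) c"
    by (simp add: lin_fun_add bd_lin bd_def[of c] lin_lin)
  also have "\<dots> = lin (\<lambda>L. sng L + \<phi> L) c"
    by (rule lin_cong) (use assms htp_bdl[of K \<phi>] in \<open>auto simp: on_def\<close>)
  finally show ?thesis by (simp add: lin_fun_add)
qed

lemma htp_supp:
  assumes "\<And>L M. set L \<in> K \<Longrightarrow> M \<in> keys (\<phi> L) \<Longrightarrow> set M \<subseteq> C L \<and> length M = length L"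
    and "\<And>L. set L \<in> K \<Longrightarrow> set L \<subseteq> C L"
    and "\<And>L M. set L \<in> K \<Longrightarrow> M \<in> keys (bdl L) \<Longrightarrow> C M \<subseteq> C L"
    and "down K"
  shows "set L \<in> K \<Longrightarrow> N \<in> keys (htp \<phi> L) \<Longrightarrow> set N \<subseteq> C L \<and> length N = Suc (length L)"
proof (induction "length L" arbitrary: L N)
  case (Suc n)
  then have L: "L \<noteq> []" by auto
  from Suc.prems(2) obtain N' where N: "N = hd L # N'"
    and N': "N' \<in> keys (sng L + \<phi> L + lin (htp \<phi>) (bdl L))"
    unfolding htp_unfold[OF L] lcone_def by (rule keys_mpE)
  have "set N' \<subseteq> C L \<and> length N' = length L"
    using N'
  proof (elim keys_addE keys_linE)
    fix M assume M: "M \<in> keys (bdl L)" "N' \<in> keys (htp \<phi> M)"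
    then have "set M \<in> K" "length L = Suc (length M)"
      using bdl_keys[OF M(1)] assms(4) Suc.prems by (auto simp: down_def)
    then show ?thesis using Suc.hyps(1)[of M N'] Suc.hyps(2) M assms(3)[OF Suc.prems(1) M(1)] by auto
  qed (use assms Suc.prems in auto)
  moreover have "hd L \<in> C L" using assms(2)[OF Suc.prems(1)] L by auto
  ultimately show ?case by (simp add: N)
qed simp

text \<open>A full subcomplex is a cone, so the homotopy can be built by coning off in one dimension after
  another.\<close>

lemma carrier_homotopy:
  assumes "down K" "\<phi> [] = sng []" "\<And>L. set L \<in> K \<Longrightarrow> bd (\<phi> L) = lin \<phi> (bdl L)"
    and "\<And>L M. set L \<in> K \<Longrightarrow> M \<in> keys (\<phi> L) \<Longrightarrow> set M \<subseteq> C L \<and> length M = length L"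
    and "\<And>L. set L \<in> K \<Longrightarrow> set L \<subseteq> C L"
    and "\<And>L M. set L \<in> K \<Longrightarrow> M \<in> keys (bdl L) \<Longrightarrow> C M \<subseteq> C L"
    and "\<And>L S. set L \<in> K \<Longrightarrow> finite S \<Longrightarrow> S \<subseteq> C L \<Longrightarrow> S \<in> K'"
    and c: "on K p c" "bd c = 0"
  obtains d where "on K' (Suc p) d" "c + lin \<phi> c = bd d"
proof
  show "c + lin \<phi> c = bd (lin (htp \<phi>) c)"
    using htp_bd[of K \<phi> p c] assms by simp
  show "on K' (Suc p) (lin (htp \<phi>) c)"
  proof (rule on_lin)
    fix L assume "L \<in> keys c"
    then have L: "set L \<in> K" "length L = p" using c by (auto simp: on_def)
    show "on K' (Suc p) (htp \<phi> L)"
      unfolding on_def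
    proof
      fix N assume "N \<in> keys (htp \<phi> L)"
      with htp_supp[of K \<phi> C L N] assms L show "set N \<in> K' \<and> length N = Suc p"
        by auto
    qed
  qed
qed

text \<open>The carrier of a simplex is the full simplex on its vertices and their images;
  contiguity puts it into \<open>K'\<close>.\<close>

lemma contiguous_homologous:
  assumes "down K" and "\<And>S. S \<in> K \<Longrightarrow> finite S \<Longrightarrow> S \<union> f ` S \<in> K'" "down K'"
    and "on K p c" "bd c = 0"
  obtains d where "on K' (Suc p) d" "c + mp (map f) c = bd d"
proof -
  let ?\<phi> = "\<lambda>L. sng (map f L)"
  obtain d where "on K' (Suc p) d" "c + lin ?\<phi> c = bd d"
  proof (rule carrier_homotopy[of K ?\<phi> "\<lambda>L. set L \<union> f ` set L" K' p c])
    show "bd (?\<phi> L) = lin ?\<phi> (bdl L)" for L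
      by (simp add: bdl_map mp_def)
    show "S \<in> K'" if "set L \<in> K" "finite S" "S \<subseteq> set L \<union> f ` set L" for L S
      using that assms(2)[of "set L"] assms(3) by (auto simp: down_def)
    show "set M \<union> f ` set M \<subseteq> set L \<union> f ` set L" if "M \<in> keys (bdl L)" for L M
      using bdl_keys[OF that] by auto
  qed (use assms in auto)
  then show thesis using that by (simp add: mp_def)
qed

text \<open>The cone vertex is always the first vertex, so the homotopy commutes with vertex maps.
  It can therefore be built once on a standard simplex and be transported to every singular simplex
  and its faces.\<close>

lemma htp_natural:
  assumes nat: "\<And>L. set L \<in> K \<Longrightarrow> \<phi>' (map g L) = mp (map g) (\<phi> L)" and "down K"
  shows "set L \<in> K \<Longrightarrow> htp \<phi>' (map g L) = mp (map g) (htp \<phi> L)"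
proof (induction "length L" arbitrary: L)
  case (Suc n)
  then have L: "L \<noteq> []" by auto
  have "lin (htp \<phi>') (bdl (map g L)) = lin (\<lambda>M. htp \<phi>' (map g M)) (bdl L)"
    unfolding bdl_map by (rule lin_mp) simp
  also have "\<dots> = lin (\<lambda>M. mp (map g) (htp \<phi> M)) (bdl L)"
    by (rule lin_cong) (use Suc assms(2) in \<open>fastforce simp: down_def dest!: bdl_keys\<close>)
  finally have "lin (htp \<phi>') (bdl (map g L)) = mp (map g) (lin (htp \<phi>) (bdl L))"
    by (simp add: mp_lin)
  moreover have "lcone (hd (map g L)) (mp (map g) c) = mp (map g) (lcone (hd L) c)" for c
    using L by (simp add: lcone_def mp_mp hd_map)
  ultimately show ?case
    using L by (simp add: htp_unfold nat Suc.prems del: mp_add flip: mp_add mp_sng)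
qed simp

section \<open>Barycentric subdivision of ordered affine simplices\<close>

definition bary :: "('i \<Rightarrow> real) list \<Rightarrow> 'i \<Rightarrow> real" where
  "bary L = (\<lambda>i. (\<Sum>j<length L. (L ! j) i) / real (length L))"

primrec sdk :: "nat \<Rightarrow> ('i \<Rightarrow> real) list \<Rightarrow> (('i \<Rightarrow> real) list \<Rightarrow>\<^sub>0 bit)" where
  "sdk 0 L = sng []"
| "sdk (Suc n) L = lcone (bary L) (lin (sdk n) (bdl L))"

definition sdl :: "('i \<Rightarrow> real) list \<Rightarrow> (('i \<Rightarrow> real) list \<Rightarrow>\<^sub>0 bit)" where
  "sdl L = sdk (length L) L"

lemma sdl_Nil [simp]: "sdl [] = sng []"
  by (simp add: sdl_def)

lemma sdl_unfold:
  assumes "L \<noteq> []"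
  shows "sdl L = lcone (bary L) (lin sdl (bdl L))"
proof -
  obtain n where n: "length L = Suc n" using assms by (cases L) auto
  have "lin (sdk n) (bdl L) = lin sdl (bdl L)"
    by (rule lin_cong) (use n in \<open>auto simp: sdl_def dest!: bdl_keys\<close>)
  then show ?thesis by (simp add: sdl_def n)
qed

lemma bd_sdl: "bd (sdl L) = lin sdl (bdl L)"
proof (induction "length L" arbitrary: L)
  case (Suc n)
  then have L: "L \<noteq> []" by auto
  have "bd (lin sdl (bdl L)) = lin (\<lambda>M. lin sdl (bdl M)) (bdl L)"
    unfolding bd_lin by (rule lin_cong) (use Suc in \<open>auto dest!: bdl_keys\<close>)
  also have "\<dots> = lin sdl (bd (bdl L))"
    unfolding bd_def[of "bdl L"] by (simp add: lin_lin)
  finally show ?case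
    by (simp add: sdl_unfold[OF L] bd_lcone)
qed simp

text \<open>Affinity of \<open>f\<close> enters as preservation of barycentres; it holds for face
  inclusions (\<open>bary_map_face\<close>) and for the antipodal map
  (\<open>bary_neg\<close>).\<close>

lemma sdl_map:
  assumes f: "\<And>L. L \<noteq> [] \<Longrightarrow> bary (map f L) = f (bary L)"
  shows "sdl (map f L) = mp (map f) (sdl L)"
proof (induction "length L" arbitrary: L)
  case (Suc n)
  then have L: "L \<noteq> []" by auto
  have "lin sdl (bdl (map f L)) = lin (\<lambda>M. sdl (map f M)) (bdl L)"
    unfolding bdl_map by (rule lin_mp) simp
  also have "\<dots> = lin (\<lambda>M. mp (map f) (sdl M)) (bdl L)"
    by (rule lin_cong) (use Suc in \<open>auto dest!: bdl_keys\<close>)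
  finally show ?case
    using L by (simp add: sdl_unfold f lcone_def mp_lin mp_mp)
qed simp

text \<open>Closure under barycentres stands in for the convex hull: iterated subdivision creates no
  other points, and a property passes to the hull as soon as it is stable under barycentres
  (\<open>hul_closed\<close>).\<close>

inductive_set hul :: "('i \<Rightarrow> real) set \<Rightarrow> ('i \<Rightarrow> real) set" for S where
  hul_base: "x \<in> S \<Longrightarrow> x \<in> hul S"
| hul_bary: "L \<noteq> [] \<Longrightarrow> \<forall>x\<in>set L. x \<in> hul S \<Longrightarrow> bary L \<in> hul S"

lemma hul_closed:
  assumes "S \<subseteq> T" "\<And>L. L \<noteq> [] \<Longrightarrow> set L \<subseteq> T \<Longrightarrow> bary L \<in> T"
  shows "hul S \<subseteq> T"
proof
  fix x assume "x \<in> hul S"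
  then show "x \<in> T"
    by induction (use assms in blast)+
qed

lemma hul_mono: "S \<subseteq> T \<Longrightarrow> hul S \<subseteq> hul T"
  by (rule hul_closed) (auto intro: hul.intros)

lemma hul_hul: "S \<subseteq> hul T \<Longrightarrow> hul S \<subseteq> hul T"
  by (rule hul_closed) (auto intro: hul.intros)

lemma subset_hul: "S \<subseteq> hul S"
  by (auto intro: hul.intros)

lemma sdl_keys: "M \<in> keys (sdl L) \<Longrightarrow> set M \<subseteq> hul (set L) \<and> length M = length L"
proof (induction "length L" arbitrary: L M)
  case (Suc n)
  then have L: "L \<noteq> []" by auto
  from Suc.prems obtain M' N where M: "M = bary L # M'" and N: "N \<in> keys (bdl L)" "M' \<in> keys (sdl N)"
    unfolding sdl_unfold[OF L] lcone_def by (auto elim!: keys_mpE keys_linE)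
  have "set M' \<subseteq> hul (set N)" "length M' = n"
    using Suc.hyps(1)[of N M'] Suc.hyps(2) N bdl_keys[OF N(1)] by auto
  moreover have "hul (set N) \<subseteq> hul (set L)"
    using bdl_keys[OF N(1)] by (intro hul_mono) auto
  moreover have "bary L \<in> hul (set L)"
    using L by (auto intro: hul.intros)
  ultimately show ?case
    using Suc.hyps(2) by (auto simp: M)
qed simp

definition mesh :: "real \<Rightarrow> ('i \<Rightarrow> real) set \<Rightarrow> bool" where
  "mesh e S \<longleftrightarrow> (\<forall>x\<in>S. \<forall>y\<in>S. \<forall>i. \<bar>x i - y i\<bar> \<le> e)"

lemma bary_le:
  assumes "L \<noteq> []" "\<And>x. x \<in> set L \<Longrightarrow> x i \<le> c"
  shows "bary L i \<le> c"
proof -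
  have "(\<Sum>j<length L. (L ! j) i) \<le> (\<Sum>j<length L. c)"
    by (rule sum_mono) (use assms in simp)
  then show ?thesis using assms(1) by (simp add: bary_def divide_simps mult.commute)
qed

lemma bary_ge:
  assumes "L \<noteq> []" "\<And>x. x \<in> set L \<Longrightarrow> c \<le> x i"
  shows "c \<le> bary L i"
proof -
  have "(\<Sum>j<length L. c) \<le> (\<Sum>j<length L. (L ! j) i)"
    by (rule sum_mono) (use assms in simp)
  then show ?thesis using assms(1) by (simp add: bary_def divide_simps mult.commute)
qed

lemma hul_abs_le:
  assumes "x \<in> hul S" "\<And>y. y \<in> S \<Longrightarrow> \<bar>y i - a\<bar> \<le> e"
  shows "\<bar>x i - a\<bar> \<le> e"
proof -
  have "hul S \<subseteq> {x. \<bar>x i - a\<bar> \<le> e}"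
  proof (rule hul_closed)
    fix L :: "('a \<Rightarrow> real) list" assume L: "L \<noteq> []" "set L \<subseteq> {x. \<bar>x i - a\<bar> \<le> e}"
    have "bary L i \<le> a + e" by (rule bary_le) (use L in force)+
    moreover have "a - e \<le> bary L i" by (rule bary_ge) (use L in force)+
    ultimately show "bary L \<in> {x. \<bar>x i - a\<bar> \<le> e}" by auto
  qed (use assms in auto)
  then show ?thesis using assms(1) by blast
qed

text \<open>Of the \<open>p + 1\<close> differences that are averaged, the one belonging to
  \<open>x\<close> itself vanishes: this is the contraction factor.\<close>

lemma mesh_bary:
  assumes "length L = Suc p" "mesh e (set L)" "x \<in> set L"
  shows "\<bar>bary L i - x i\<bar> \<le> real p / (real p + 1) * e"
proof -
  obtain k where k: "k < Suc p" "x = L ! k"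
    using assms by (metis in_set_conv_nth)
  have "(bary L i - x i) * (real p + 1) = (\<Sum>j<Suc p. (L ! j) i - x i)"
    by (simp add: bary_def assms(1) sum_subtractf field_simps)
  also have "\<dots> = (\<Sum>j\<in>{..<Suc p} - {k}. (L ! j) i - x i)"
    using k by (subst sum.remove[of _ k]) auto
  also have "\<bar>\<dots>\<bar> \<le> (\<Sum>j\<in>{..<Suc p} - {k}. \<bar>(L ! j) i - x i\<bar>)"
    by (rule sum_abs)
  also have "\<dots> \<le> (\<Sum>j\<in>{..<Suc p} - {k}. e)"
    by (rule sum_mono) (use assms in \<open>auto simp: mesh_def\<close>)
  also have "\<dots> = real p * e"
    using k by simp
  finally have "\<bar>bary L i - x i\<bar> * (real p + 1) \<le> real p * e"
    by (simp add: abs_mult)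
  then show ?thesis by (simp add: field_simps)
qed

lemma mesh_ge_0: "mesh e S \<Longrightarrow> S \<noteq> {} \<Longrightarrow> 0 \<le> e"
  unfolding mesh_def by (metis abs_ge_zero ex_in_conv order_trans)

text \<open>A piece is the barycentre followed by a piece of a face. Distances within the latter
  shrink by induction; distances to the barycentre are bounded at the vertices by
  \<open>mesh_bary\<close> and hence on the hull.\<close>

lemma mesh_sdl:
  assumes "mesh e (set L)" "M \<in> keys (sdl L)" "length L = Suc p"
  shows "mesh (real p / (real p + 1) * e) (set M)"
  using assms
proof (induction p arbitrary: L M)
  case 0
  from 0(3) have L: "L \<noteq> []" by auto
  have M: "length M = Suc 0" "M = bary L # tl M"
    using 0 sdl_keys[OF 0(2)] L unfolding sdl_unfold[OF L] lcone_def by (auto elim!: keys_mpE)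
  then have "set M = {bary L}" by (cases M) auto
  then show ?case by (simp add: mesh_def)
next
  case (Suc p)
  from Suc have L: "L \<noteq> []" by auto
  from Suc.prems obtain M' N where M: "M = bary L # M'" and N: "N \<in> keys (bdl L)" "M' \<in> keys (sdl N)"
    unfolding sdl_unfold[OF L] lcone_def by (auto elim!: keys_mpE keys_linE)
  have e: "0 \<le> e" using mesh_ge_0[OF Suc.prems(1)] L by auto
  have N': "set N \<subseteq> set L" "length N = Suc p" using bdl_keys[OF N(1)] Suc.prems by auto
  have "mesh e (set N)" using Suc.prems(1) N' by (auto simp: mesh_def)
  from Suc.IH[OF this N(2) N'(2)] have "mesh (real p / (real p + 1) * e) (set M')" .
  moreover have "real p / (real p + 1) * e \<le> real (Suc p) / (real (Suc p) + 1) * e"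
    by (intro mult_right_mono e) (simp add: divide_simps algebra_simps)
  ultimately have 1: "mesh (real (Suc p) / (real (Suc p) + 1) * e) (set M')"
    unfolding mesh_def by (meson order_trans)
  have M': "set M' \<subseteq> hul (set L)"
    using sdl_keys[OF N(2)] hul_mono[OF N'(1)] by auto
  have 2: "\<bar>bary L i - x i\<bar> \<le> real (Suc p) / (real (Suc p) + 1) * e" if "x \<in> set M'" for x i
  proof -
    have "\<bar>x i - bary L i\<bar> \<le> real (Suc p) / (real (Suc p) + 1) * e"
    proof (rule hul_abs_le[of x "set L"])
      show "x \<in> hul (set L)" using M' that by auto
    qed (use mesh_bary[OF Suc.prems(3,1)] in \<open>simp add: abs_minus_commute\<close>)
    then show ?thesis by (simp add: abs_minus_commute)
  qed
  then have 3: "\<bar>x i - bary L i\<bar> \<le> real (Suc p) / (real (Suc p) + 1) * e" if "x \<in> set M'" for x i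
    using that by (simp add: abs_minus_commute)
  show ?case
    unfolding M mesh_def using 1 2 3 e by (auto simp: mesh_def)
qed

primrec sdn :: "nat \<Rightarrow> ('i \<Rightarrow> real) list \<Rightarrow> (('i \<Rightarrow> real) list \<Rightarrow>\<^sub>0 bit)" where
  "sdn 0 L = sng L"
| "sdn (Suc N) L = lin sdl (sdn N L)"

lemma sdn_Nil [simp]: "sdn N [] = sng []"
  by (induction N) simp_all

lemma bd_sdn: "bd (sdn N L) = lin (sdn N) (bdl L)"
proof (induction N)
  case (Suc N)
  have "bd (lin sdl (sdn N L)) = lin sdl (bd (sdn N L))"
    unfolding bd_lin bd_sdl unfolding bd_def by (simp add: lin_lin)
  also have "\<dots> = lin (\<lambda>M. lin sdl (sdn N M)) (bdl L)"
    unfolding Suc by (simp add: lin_lin)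
  finally show ?case by (simp add: cong: lin_cong)
qed (simp cong: lin_cong)

lemma sdn_map:
  assumes f: "\<And>L. L \<noteq> [] \<Longrightarrow> bary (map f L) = f (bary L)"
  shows "sdn N (map f L) = mp (map f) (sdn N L)"
  by (induction N) (simp_all add: lin_mp sdl_map[OF f] mp_lin)

lemma sdn_keys: "M \<in> keys (sdn N L) \<Longrightarrow> set M \<subseteq> hul (set L) \<and> length M = length L"
proof (induction N arbitrary: M)
  case (Suc N)
  then obtain M' where M': "M' \<in> keys (sdn N L)" "M \<in> keys (sdl M')" by (auto elim: keys_linE)
  then show ?case
    using Suc.IH[OF M'(1)] sdl_keys[OF M'(2)] hul_hul[of "set M'" "set L"] by auto
qed (auto intro: hul.intros)

lemma mesh_sdn:
  assumes "mesh e (set L)" "M \<in> keys (sdn N L)" "length L = Suc p"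
  shows "mesh ((real p / (real p + 1)) ^ N * e) (set M)"
  using assms(2)
proof (induction N arbitrary: M)
  case 0
  then show ?case using assms(1) by simp
next
  case (Suc N)
  then obtain M' where M': "M' \<in> keys (sdn N L)" "M \<in> keys (sdl M')" by (auto elim: keys_linE)
  have "length M' = Suc p" using sdn_keys[OF M'(1)] assms by simp
  from mesh_sdl[OF Suc.IH[OF M'(1)] M'(2) this] show ?case by (simp add: mult.assoc)
qed

lemma sdn_fine:
  assumes e: "e > (0::real)"
  obtains N0 where "\<And>N L M. N \<ge> N0 \<Longrightarrow> length L = Suc p \<Longrightarrow> mesh B (set L) \<Longrightarrow>
    M \<in> keys (sdn N L) \<Longrightarrow> mesh e (set M)"
proof -
  have q: "0 \<le> real p / (real p + 1)" "real p / (real p + 1) < 1" by (simp_all add: divide_simps)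
  then have "(\<lambda>N. (real p / (real p + 1)) ^ N * B) \<longlonglongrightarrow> 0 * B"
    by (intro tendsto_intros LIMSEQ_realpow_zero)
  then have "\<forall>\<^sub>F N in sequentially. (real p / (real p + 1)) ^ N * B < e"
    using e by (intro order_tendstoD) auto
  then obtain N0 where N0: "\<And>N. N \<ge> N0 \<Longrightarrow> (real p / (real p + 1)) ^ N * B < e"
    by (auto simp: eventually_sequentially)
  show thesis
  proof (rule that)
    fix N and L M :: "('a \<Rightarrow> real) list"
    assume "N \<ge> N0" "length L = Suc p" "mesh B (set L)" "M \<in> keys (sdn N L)"
    from mesh_sdn[OF this(3,4,2)] N0[OF this(1)] show "mesh e (set M)"
      unfolding mesh_def by (meson less_imp_le order_trans)
  qed
qed

section \<open>Realizing ordered affine simplices\<close>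

definition comb :: "('i \<Rightarrow> real) list \<Rightarrow> (nat \<Rightarrow> real) \<Rightarrow> 'i \<Rightarrow> real" where
  "comb M t = (\<lambda>i. \<Sum>j<length M. t j * (M ! j) i)"

text \<open>The affine simplex with vertices \<open>M\<close> followed by \<open>H\<close>,
  restricted because singular simplices are extensional on the standard simplex.\<close>

definition sreal :: "(('i \<Rightarrow> real) \<Rightarrow> 'a) \<Rightarrow> ('i \<Rightarrow> real) list \<Rightarrow> 'a sing_simplex" where
  "sreal H M = restrict (\<lambda>t. H (comb M t)) (standard_simplex (length M - 1))"

lemma sum_simplical_face:
  assumes "k \<le> n"
  shows "(\<Sum>j<Suc n. simplical_face k t j * g j) =
    (\<Sum>j<n. t j * (g (if j < k then j else Suc j) :: real))"
proof -
  have "(\<Sum>j<Suc n. simplical_face k t j * g j) =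
    (\<Sum>j<k. t j * g j) + (\<Sum>j\<in>{Suc k..<Suc n}. t (j - 1) * g j)"
  proof -
    have *: "{..<Suc n} = ({..<k} \<union> {k}) \<union> {Suc k..<Suc n}" using assms by auto
    have "(\<Sum>j\<in>{..<k}. simplical_face k t j * g j) = (\<Sum>j<k. t j * g j)"
      "(\<Sum>j\<in>{Suc k..<Suc n}. simplical_face k t j * g j) = (\<Sum>j\<in>{Suc k..<Suc n}. t (j - 1) * g j)"
      "simplical_face k t k = 0"
      by (auto simp: simplical_face_def intro!: sum.cong)
    moreover have "(\<Sum>j<Suc n. simplical_face k t j * g j) =
        (\<Sum>j\<in>{..<k} \<union> {k}. simplical_face k t j * g j) + (\<Sum>j\<in>{Suc k..<Suc n}. simplical_face k t j * g j)"
      unfolding * by (rule sum.union_disjoint) auto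
    moreover have "(\<Sum>j\<in>{..<k} \<union> {k}. simplical_face k t j * g j) = (\<Sum>j\<in>{..<k}. simplical_face k t j * g j) + simplical_face k t k * g k"
      by (subst sum.union_disjoint) auto
    ultimately show ?thesis by simp
  qed
  also have "(\<Sum>j\<in>{Suc k..<Suc n}. t (j - 1) * g j) = (\<Sum>j\<in>{k..<n}. t j * g (Suc j))"
    by (subst sum.shift_bounds_Suc_ivl) simp
  also have "(\<Sum>j<k. t j * g j) = (\<Sum>j<k. t j * g (if j < k then j else Suc j))"
    by simp
  also have "(\<Sum>j\<in>{k..<n}. t j * g (Suc j)) = (\<Sum>j\<in>{k..<n}. t j * g (if j < k then j else Suc j))"
    by simp
  also have "(\<Sum>j<k. t j * g (if j < k then j else Suc j)) + \<dots> = (\<Sum>j\<in>{..<k} \<union> {k..<n}. t j * g (if j < k then j else Suc j))"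
    by (rule sum.union_disjoint[symmetric]) auto
  also have "{..<k} \<union> {k..<n} = {..<n}" using assms by auto
  finally show ?thesis .
qed

lemma nth_delete:
  "k < length M \<Longrightarrow> j < length M - 1 \<Longrightarrow> (take k M @ drop (Suc k) M) ! j = M ! (if j < k then j else Suc j)"
  by (auto simp: nth_append min_def)

lemma comb_face:
  assumes "k \<le> n" "length M = Suc n"
  shows "comb M (simplical_face k t) = comb (take k M @ drop (Suc k) M) t"
proof
  fix i
  have "comb M (simplical_face k t) i = (\<Sum>j<n. t j * (M ! (if j < k then j else Suc j)) i)"
    unfolding comb_def assms(2) by (rule sum_simplical_face[OF assms(1)])
  also have "\<dots> = (\<Sum>j<n. t j * ((take k M @ drop (Suc k) M) ! j) i)"
    by (rule sum.cong) (use assms in \<open>simp_all add: nth_delete\<close>)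
  finally show "comb M (simplical_face k t) i = comb (take k M @ drop (Suc k) M) t i"
    using assms by (simp add: comb_def)
qed

lemma singular_face_sreal:
  assumes "k \<le> Suc n" "length M = Suc (Suc n)"
  shows "singular_face (Suc n) k (sreal H M) = sreal H (take k M @ drop (Suc k) M)"
proof
  fix t
  have "simplical_face k t \<in> standard_simplex (Suc n)" if "t \<in> standard_simplex n"
    using that assms by (intro simplical_face_in_standard_simplex) auto
  then show "singular_face (Suc n) k (sreal H M) t = sreal H (take k M @ drop (Suc k) M) t"
    using assms by (auto simp: singular_face_def sreal_def restrict_def min_def comb_face[where n="Suc n"])
qed

lemma boundary2_eq: "boundary2 p c = lin (\<lambda>\<sigma>. \<Sum>k\<le>p. sng (singular_face p k \<sigma>)) c"
  unfolding boundary2_def lin_def by (rule sum.cong) (auto simp: lookup_keys)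

lemma boundary2_0 [simp]: "boundary2 p 0 = 0"
  and boundary2_sng: "boundary2 p (sng \<sigma>) = (\<Sum>k\<le>p. sng (singular_face p k \<sigma>))"
  and boundary2_add [simp]: "boundary2 p (c + d) = boundary2 p c + boundary2 p d"
  by (simp_all add: boundary2_eq)

lemma boundary2_lin: "boundary2 p (lin f c) = lin (\<lambda>x. boundary2 p (f x)) c"
  by (simp add: boundary2_eq lin_lin)

lemma boundary2_sreal:
  assumes "\<And>M. M \<in> keys c \<Longrightarrow> length M = Suc (Suc n)"
  shows "boundary2 (Suc n) (mp (sreal H) c) = mp (sreal H) (bd c)"
proof -
  have "boundary2 (Suc n) (mp (sreal H) c) = lin (\<lambda>M. \<Sum>k\<le>Suc n. sng (singular_face (Suc n) k (sreal H M))) c"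
    by (simp add: boundary2_eq lin_mp)
  also have "\<dots> = lin (\<lambda>M. mp (sreal H) (bdl M)) c"
  proof (rule lin_cong)
    fix M assume "M \<in> keys c"
    then have M: "length M = Suc (Suc n)" by (rule assms)
    have "(\<Sum>k\<le>Suc n. sng (singular_face (Suc n) k (sreal H M)))
      = (\<Sum>k\<le>Suc n. sng (sreal H (take k M @ drop (Suc k) M)))"
      by (rule sum.cong[OF refl], subst singular_face_sreal) (use M in auto)
    then show "(\<Sum>k\<le>Suc n. sng (singular_face (Suc n) k (sreal H M))) = mp (sreal H) (bdl M)"
      unfolding bdl_eq_sum M mp_sum lessThan_Suc_atMost by simp
  qed
  finally show ?thesis by (simp add: bd_def mp_lin)
qed

lemma comb_map_face: "comb (map (simplical_face k) M) t = simplical_face k (comb M t)"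
  by (rule ext) (auto simp: comb_def simplical_face_def intro!: sum.cong sum.neutral)

lemma bary_map_face: "L \<noteq> [] \<Longrightarrow> bary (map (simplical_face k) L) = simplical_face k (bary L)"
  by (rule ext) (auto simp: bary_def simplical_face_def intro!: sum.cong sum.neutral)

definition unitv :: "'i \<Rightarrow> 'i \<Rightarrow> real" where
  "unitv i = (\<lambda>j. if j = i then 1 else 0)"

lemma simplical_face_unitv: "simplical_face k (unitv i) = unitv (if i < k then i else Suc i)"
  by (rule ext) (auto simp: simplical_face_def unitv_def)

lemma delete_map_upt:
  "k \<le> Suc p \<Longrightarrow> take k (map f [0..<Suc (Suc p)]) @ drop (Suc k) (map f [0..<Suc (Suc p)])
     = map (\<lambda>i. f (if i < k then i else Suc i)) [0..<Suc p]"
  by (rule nth_equalityI) (auto simp: nth_append min_def simp del: upt_Suc)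

lemma bdl_map_upt:
  "bdl (map f [0..<Suc (Suc p)]) = (\<Sum>k\<le>Suc p. sng (map (\<lambda>i. f (if i < k then i else Suc i)) [0..<Suc p]))"
proof -
  have "bdl (map f [0..<Suc (Suc p)]) = (\<Sum>k\<le>Suc p. sng (take k (map f [0..<Suc (Suc p)]) @ drop (Suc k) (map f [0..<Suc (Suc p)])))"
    unfolding bdl_eq_sum by (simp only: length_map length_upt minus_nat.diff_0 lessThan_Suc_atMost)
  also have "\<dots> = (\<Sum>k\<le>Suc p. sng (map (\<lambda>i. f (if i < k then i else Suc i)) [0..<Suc p]))"
    by (rule sum.cong[OF refl]) (simp only: delete_map_upt atMost_iff)
  finally show ?thesis .
qed

text \<open>The common part of the two chain homotopies below, subdivision and straight-line homotopy:
  a homotopy of ordered affine simplices is realized in every singular simplex at once.\<close>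

lemma natural_homotopy:
  fixes H :: "nat \<Rightarrow> 'a sing_simplex \<Rightarrow> ((nat \<Rightarrow> real) \<Rightarrow> 'a)"
  assumes B: "\<And>p. bdl (B (Suc p)) = (\<Sum>k\<le>Suc p. sng (map (simplical_face (s k)) (B p)))"
    and B0: "length (B 0) = 1"
    and len: "\<And>p. length (B p) = Suc p"
    and nil: "\<phi> [] = sng []" and cm: "\<And>L. bd (\<phi> L) = lin \<phi> (bdl L)"
    and nat: "\<And>L k. \<phi> (map (simplical_face (s k)) L) = mp (map (simplical_face (s k))) (\<phi> L)"
    and supp: "\<And>p M. M \<in> keys (htp \<phi> (B p)) \<Longrightarrow> set M \<subseteq> Dom p \<and> length M = Suc (Suc p)"
    and face: "\<And>p k \<sigma> M. \<sigma> \<in> G (Suc p) \<Longrightarrow> k \<le> Suc p \<Longrightarrow> set M \<subseteq> Dom p \<Longrightarrow> M \<noteq> [] \<Longrightarrow>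
      sreal (H p (singular_face (Suc p) k \<sigma>)) M = sreal (H (Suc p) \<sigma>) (map (simplical_face (s k)) M)"
    and c: "keys c \<subseteq> G p"
  defines "P \<equiv> \<lambda>p. lin (\<lambda>\<sigma>. mp (sreal (H p \<sigma>)) (htp \<phi> (B p)))"
  shows "boundary2 (Suc p) (P p c) + (if p = 0 then 0 else P (p - 1) (boundary2 p c)) =
    lin (\<lambda>\<sigma>. sng (sreal (H p \<sigma>) (B p)) + mp (sreal (H p \<sigma>)) (\<phi> (B p))) c"
proof -
  have main: "boundary2 (Suc p) (mp (sreal (H p \<sigma>)) (htp \<phi> (B p)))
      + (if p = 0 then 0 else P (p - 1) (\<Sum>k\<le>p. sng (singular_face p k \<sigma>)))
      = sng (sreal (H p \<sigma>) (B p)) + mp (sreal (H p \<sigma>)) (\<phi> (B p))"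
    if \<sigma>: "\<sigma> \<in> G p" for \<sigma>
  proof -
    have "boundary2 (Suc p) (mp (sreal (H p \<sigma>)) (htp \<phi> (B p))) = mp (sreal (H p \<sigma>)) (bd (htp \<phi> (B p)))"
      by (rule boundary2_sreal) (use supp in blast)
    also have "bd (htp \<phi> (B p)) = sng (B p) + \<phi> (B p) + lin (htp \<phi>) (bdl (B p))"
      using htp_bdl[of UNIV \<phi> "B p"] nil cm by (simp add: down_def chain_add_eq_iff ac_simps)
    finally have 1: "boundary2 (Suc p) (mp (sreal (H p \<sigma>)) (htp \<phi> (B p))) =
      sng (sreal (H p \<sigma>) (B p)) + mp (sreal (H p \<sigma>)) (\<phi> (B p)) + mp (sreal (H p \<sigma>)) (lin (htp \<phi>) (bdl (B p)))"
      by simp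
    \<comment> \<open>The faces of the base list are images of the lower base list, so naturality of
      \<open>htp\<close> and the hypothesis \<open>face\<close> turn this term into the homotopy on
      the singular faces. In degree 0 the only face is the empty list, where \<open>htp\<close>
      vanishes.\<close>
    have 2: "mp (sreal (H p \<sigma>)) (lin (htp \<phi>) (bdl (B p))) =
       (if p = 0 then 0 else P (p - 1) (\<Sum>k\<le>p. sng (singular_face p k \<sigma>)))"
    proof (cases p)
      case 0
      from B0 obtain x where "B 0 = [x]" by (cases "B 0") auto
      then show ?thesis by (simp add: 0)
    next
      case (Suc q)
      have "mp (sreal (H p \<sigma>)) (htp \<phi> (map (simplical_face (s k)) (B q)))
        = mp (sreal (H q (singular_face p k \<sigma>))) (htp \<phi> (B q))" if "k \<le> p" for k
      proof -
        have "htp \<phi> (map (simplical_face (s k)) (B q)) = mp (map (simplical_face (s k))) (htp \<phi> (B q))"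
          by (rule htp_natural[of UNIV]) (simp_all add: nat down_def)
        then have "mp (sreal (H p \<sigma>)) (htp \<phi> (map (simplical_face (s k)) (B q)))
          = mp (\<lambda>M. sreal (H p \<sigma>) (map (simplical_face (s k)) M)) (htp \<phi> (B q))"
          by (simp add: mp_mp)
        also have "\<dots> = mp (sreal (H q (singular_face p k \<sigma>))) (htp \<phi> (B q))"
        proof (rule mp_cong)
          fix M assume "M \<in> keys (htp \<phi> (B q))"
          from supp[OF this] have "set M \<subseteq> Dom q" "M \<noteq> []" by auto
          then show "sreal (H p \<sigma>) (map (simplical_face (s k)) M) = sreal (H q (singular_face p k \<sigma>)) M"
            using face[of \<sigma> q k M] \<sigma> that Suc by simp
        qed
        finally show ?thesis .
      qed
      then show ?thesis
        by (simp add: Suc B P_def lin_sum mp_sum del: sum.atMost_Suc)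
    qed
    show ?thesis unfolding 1 2 by (simp add: add.assoc)
  qed
  have "boundary2 (Suc p) (P p c) + (if p = 0 then 0 else P (p - 1) (boundary2 p c)) =
    lin (\<lambda>\<sigma>. boundary2 (Suc p) (mp (sreal (H p \<sigma>)) (htp \<phi> (B p)))
      + (if p = 0 then 0 else P (p - 1) (\<Sum>k\<le>p. sng (singular_face p k \<sigma>)))) c"
    by (simp add: lin_fun_add P_def boundary2_lin boundary2_eq[of p] lin_lin)
  also have "\<dots> = lin (\<lambda>\<sigma>. sng (sreal (H p \<sigma>) (B p)) + mp (sreal (H p \<sigma>)) (\<phi> (B p))) c"
    by (rule lin_cong) (use main c in blast)
  finally show ?thesis .
qed

section \<open>The geometric realization of a simplicial complex\<close>

text \<open>Simplices are nonempty, as a realization requires; ordered chains use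
  \<open>insert {} K\<close>, whose empty simplex carries the augmentation.\<close>

definition simp_cx :: "'v set set \<Rightarrow> bool" where
  "simp_cx K \<longleftrightarrow> (\<forall>S\<in>K. finite S \<and> S \<noteq> {} \<and> (\<forall>T\<subseteq>S. T \<noteq> {} \<longrightarrow> T \<in> K))"

lemma simp_cxD:
  "simp_cx K \<Longrightarrow> S \<in> K \<Longrightarrow> finite S" "simp_cx K \<Longrightarrow> S \<in> K \<Longrightarrow> S \<noteq> {}"
  "simp_cx K \<Longrightarrow> S \<in> K \<Longrightarrow> T \<subseteq> S \<Longrightarrow> T \<noteq> {} \<Longrightarrow> T \<in> K"
  unfolding simp_cx_def by blast+

lemma down_aug: "simp_cx K \<Longrightarrow> down (insert {} K)"
  unfolding simp_cx_def down_def by blast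

lemma vr_complex_iff:
  "S \<in> vr_complex M d r \<longleftrightarrow> finite S \<and> S \<noteq> {} \<and> S \<subseteq> M \<and> (\<forall>x\<in>S. \<forall>y\<in>S. d x y < r)"
proof (cases "finite S \<and> S \<noteq> {}")
  case True
  then have "Max ((\<lambda>(x, y). d x y) ` (S \<times> S)) < r \<longleftrightarrow> (\<forall>z\<in>(\<lambda>(x, y). d x y) ` (S \<times> S). z < r)"
    by (intro Max_less_iff) auto
  then show ?thesis
    unfolding vr_complex_def by auto
qed (auto simp: vr_complex_def)

lemma simp_cx_vr: "simp_cx (vr_complex M d r)"
  unfolding simp_cx_def
proof (intro ballI conjI allI impI)
  fix S T assume S: "S \<in> vr_complex M d r" and T: "T \<subseteq> S" "T \<noteq> {}"
  have "finite T" using S T(1) finite_subset by (auto simp: vr_complex_def)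
  moreover have "T \<subseteq> M" "\<forall>x\<in>T. \<forall>y\<in>T. d x y < r"
    using S T(1) unfolding vr_complex_iff by blast+
  ultimately show "T \<in> vr_complex M d r" using T(2) unfolding vr_complex_iff by blast
qed (simp_all add: vr_complex_def)

abbreviation vsupp :: "('v \<Rightarrow> real) \<Rightarrow> 'v set" where
  "vsupp f \<equiv> {v. f v \<noteq> 0}"

lemma closed_cell_vsupp:
  assumes "f \<in> closed_cell S" "finite S"
  shows "vsupp f \<subseteq> S" "vsupp f \<noteq> {}" "sum f (vsupp f) = 1" "f \<in> closed_cell (vsupp f)"
proof -
  show 1: "vsupp f \<subseteq> S" using assms by (auto simp: closed_cell_def)
  show 3: "sum f (vsupp f) = 1"
  proof -
    have "sum f (vsupp f) = sum f S" using assms(2) 1 by (intro sum.mono_neutral_left) auto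
    then show ?thesis using assms(1) by (simp add: closed_cell_def)
  qed
  show "vsupp f \<noteq> {}"
  proof
    assume "vsupp f = {}"
    with 3 show False by simp
  qed
  show "f \<in> closed_cell (vsupp f)"
    using 3 assms by (auto simp: closed_cell_def)
qed

lemma realization_iff:
  assumes "simp_cx K"
  shows "f \<in> topspace (geometric_realization K) \<longleftrightarrow> (\<forall>v. 0 \<le> f v) \<and> vsupp f \<in> K \<and> sum f (vsupp f) = 1"
proof
  assume "f \<in> topspace (geometric_realization K)"
  then obtain S where S: "S \<in> K" "f \<in> closed_cell S"
    unfolding topspace_geometric_realization by blast
  note * = closed_cell_vsupp[OF S(2) simp_cxD(1)[OF assms S(1)]]
  have "\<forall>v. 0 \<le> f v" using S(2) unfolding closed_cell_def by blast
  then show "(\<forall>v. 0 \<le> f v) \<and> vsupp f \<in> K \<and> sum f (vsupp f) = 1"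
    using simp_cxD(3)[OF assms S(1) *(1,2)] *(3) by blast
next
  assume "(\<forall>v. 0 \<le> f v) \<and> vsupp f \<in> K \<and> sum f (vsupp f) = 1"
  then have "vsupp f \<in> K" "f \<in> closed_cell (vsupp f)" by (auto simp: closed_cell_def)
  then show "f \<in> topspace (geometric_realization K)"
    unfolding topspace_geometric_realization by blast
qed

lemma continuous_on_coord: "continuous_on S (\<lambda>y. y v)"
  for S :: "('v \<Rightarrow> real) set"
  by (rule continuous_on_subset[OF continuous_on_product_coordinates subset_UNIV])

lemma closed_closed_cell:
  assumes "finite S"
  shows "closed (closed_cell S)"
proof -
  have eq: "closed_cell S = (\<Inter>v. {f. 0 \<le> f v}) \<inter> (\<Inter>v\<in>-S. {f. f v = 0}) \<inter> {f. sum f S = 1}"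
    by (auto simp: closed_cell_def)
  have "closed (\<Inter>v. {f::'a \<Rightarrow> real. 0 \<le> f v})" "closed (\<Inter>v\<in>-S. {f::'a \<Rightarrow> real. f v = 0})"
    by (intro closed_INT ballI closed_Collect_le closed_Collect_eq continuous_on_const continuous_on_coord)+
  moreover have "closed {f::'a \<Rightarrow> real. sum f S = 1}"
    by (intro closed_Collect_eq continuous_on_const continuous_on_sum continuous_on_coord)
  ultimately show ?thesis
    unfolding eq by (intro closed_Int)
qed

lemma closedin_geometric_realization:
  assumes "simp_cx K"
  shows "closedin (geometric_realization K) C \<longleftrightarrow>
     C \<subseteq> topspace (geometric_realization K) \<and> (\<forall>S\<in>K. closed (C \<inter> closed_cell S))"
proof -
  let ?T = "topspace (geometric_realization K)"
  have "openin (subtopology (powertop_real UNIV) (closed_cell S)) ((?T - C) \<inter> closed_cell S)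
      \<longleftrightarrow> closed (C \<inter> closed_cell S)" if "S \<in> K" "C \<subseteq> ?T" for S
  proof -
    have sub: "closed_cell S \<subseteq> ?T" using that by (auto simp: topspace_geometric_realization)
    have "(?T - C) \<inter> closed_cell S = closed_cell S - C \<inter> closed_cell S" using sub by auto
    then have "openin (top_of_set (closed_cell S)) ((?T - C) \<inter> closed_cell S) \<longleftrightarrow>
        closedin (top_of_set (closed_cell S)) (C \<inter> closed_cell S)"
      by (simp add: closedin_def)
    also have "\<dots> \<longleftrightarrow> closed (C \<inter> closed_cell S)"
      using closed_closed_cell[of S] simp_cxD[OF assms that(1)] by (simp add: closedin_closed_eq)
    finally show ?thesis by (simp add: euclidean_product_topology)
  qed
  then show ?thesis
    unfolding closedin_def openin_geometric_realization
    by (auto simp: topspace_geometric_realization)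
qed

lemma continuous_map_realization_coord:
  "continuous_map (geometric_realization K) euclideanreal (\<lambda>y. y v)"
  unfolding continuous_map_def
proof (intro conjI allI impI)
  fix U :: "real set" assume U: "openin euclidean U"
  have "openin (subtopology (powertop_real UNIV) (closed_cell S))
      ({x \<in> topspace (geometric_realization K). x v \<in> U} \<inter> closed_cell S)" if "S \<in> K" for S
  proof -
    have "{x \<in> topspace (geometric_realization K). x v \<in> U} \<inter> closed_cell S
       = closed_cell S \<inter> (\<lambda>x. x v) -` U"
      using that by (auto simp: topspace_geometric_realization)
    moreover have "openin (top_of_set (closed_cell S)) (closed_cell S \<inter> (\<lambda>x. x v) -` U)"
      by (rule continuous_openin_preimage_gen) (use U in \<open>auto intro: continuous_on_coord\<close>)
    ultimately show ?thesis by (simp add: euclidean_product_topology)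
  qed
  then show "openin (geometric_realization K) {x \<in> topspace (geometric_realization K). x v \<in> U}"
    unfolding openin_geometric_realization by (auto simp: topspace_geometric_realization)
qed simp

text \<open>The weak topology agrees with the product topology on finite subcomplexes.\<close>

lemma continuous_map_into_realization:
  assumes K: "simp_cx K" and V: "finite V"
    and h: "\<And>y. y \<in> topspace Y \<Longrightarrow> h y \<in> topspace (geometric_realization K) \<and> vsupp (h y) \<subseteq> V"
    and c: "\<And>v. continuous_map Y euclideanreal (\<lambda>y. h y v)"
  shows "continuous_map Y (geometric_realization K) h"
  unfolding continuous_map_closedin
proof (intro conjI allI impI)
  have cont: "continuous_map Y euclidean h"
    using c by (simp add: continuous_map_componentwise_UNIV flip: euclidean_product_topology)
  fix C assume C: "closedin (geometric_realization K) C"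
  have "{x \<in> topspace Y. h x \<in> C} = (\<Union>S\<in>{S\<in>K. S \<subseteq> V}. {x \<in> topspace Y. h x \<in> C \<inter> closed_cell S})"
  proof safe
    fix x assume x: "x \<in> topspace Y" "h x \<in> C"
    from h[OF x(1)] have "vsupp (h x) \<in> K" "h x \<in> closed_cell (vsupp (h x))"
      by (auto simp: realization_iff[OF K] closed_cell_def)
    then show "x \<in> (\<Union>S\<in>{S \<in> K. S \<subseteq> V}. {x \<in> topspace Y. h x \<in> C \<inter> closed_cell S})"
      using x h[OF x(1)] by blast
  qed
  moreover have "closedin Y {x \<in> topspace Y. h x \<in> C \<inter> closed_cell S}" if "S \<in> K" for S
    using C that by (intro closedin_continuous_map_preimage[OF cont])
      (auto simp: closedin_geometric_realization[OF K])
  ultimately show "closedin Y {x \<in> topspace Y. h x \<in> C}"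
    using V by (auto intro!: closedin_Union)
qed (use h in blast)

lemma finite_closed_fun:
  assumes "finite (D :: ('v \<Rightarrow> real) set)"
  shows "closed D"
proof -
  have "closed {x}" for x :: "'v \<Rightarrow> real"
  proof -
    have "{x} = (\<Inter>v. {f. f v = x v})" by auto
    moreover have "closed (\<Inter>v. {f. f v = x v})"
      by (intro closed_INT ballI closed_Collect_eq continuous_on_const continuous_on_coord)
    ultimately show ?thesis by simp
  qed
  then have "closed (\<Union>x\<in>D. {x})" using assms by (intro closed_UN) auto
  then show ?thesis by simp
qed

text \<open>If infinitely many vertices occurred, choose for each a point of \<open>C\<close>
  involving it. A cell contains only finitely many of the chosen points, so every subset of their
  infinite set is closed: an infinite closed discrete subset of a compact set.\<close>

lemma compactin_realization:
  assumes K: "simp_cx K" and C: "compactin (geometric_realization K) C"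
  shows "finite (\<Union>y\<in>C. vsupp y)"
proof (rule ccontr)
  let ?X = "geometric_realization K"
  assume inf: "infinite (\<Union>y\<in>C. vsupp y)"
  have CX: "C \<subseteq> topspace ?X" using C by (rule compactin_subset_topspace)
  have fin: "finite (vsupp y)" if "y \<in> C" for y
  proof -
    have "vsupp y \<in> K" using CX that realization_iff[OF K] by blast
    then show ?thesis by (rule simp_cxD(1)[OF K])
  qed
  define g where "g v = (SOME y. y \<in> C \<and> v \<in> vsupp y)" for v
  define U where "U = (\<Union>y\<in>C. vsupp y)"
  have g: "g v \<in> C \<and> v \<in> vsupp (g v)" if "v \<in> U" for v
    using that someI_ex[of "\<lambda>y. y \<in> C \<and> v \<in> vsupp y"] unfolding g_def U_def by blast
  define D where "D = g ` U"
  have "U \<subseteq> (\<Union>y\<in>D. vsupp y)" using g by (auto simp: D_def)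
  then have "infinite D"
    using inf fin g by (metis (no_types, lifting) D_def U_def finite_UN finite_subset image_iff)
  have closed: "closedin ?X D'" if "D' \<subseteq> D" for D'
    unfolding closedin_geometric_realization[OF K]
  proof (intro conjI ballI)
    show "D' \<subseteq> topspace ?X" using that g CX unfolding D_def by blast
    fix S assume S: "S \<in> K"
    have "D' \<inter> closed_cell S \<subseteq> g ` S"
    proof
      fix y assume y: "y \<in> D' \<inter> closed_cell S"
      then obtain v where v: "v \<in> U" "y = g v" using \<open>D' \<subseteq> D\<close> unfolding D_def by blast
      then have "v \<in> vsupp y" using g by simp
      then have "v \<in> S" using y by (auto simp: closed_cell_def)
      then show "y \<in> g ` S" using v by simp
    qed
    then have "finite (D' \<inter> closed_cell S)"
      using simp_cxD(1)[OF K S] by (meson finite_imageI finite_subset)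
    then show "closed (D' \<inter> closed_cell S)" by (rule finite_closed_fun)
  qed
  define \<W> where "\<W> = (\<lambda>y. topspace ?X - (D - {y})) ` D"
  have "\<forall>W\<in>\<W>. openin ?X W"
    using closed by (auto simp: \<W>_def)
  moreover have "C \<subseteq> \<Union>\<W>"
    using CX \<open>infinite D\<close> by (fastforce simp: \<W>_def dest: infinite_imp_nonempty)
  ultimately obtain \<F> where \<F>: "finite \<F>" "\<F> \<subseteq> \<W>" "C \<subseteq> \<Union>\<F>"
    using C unfolding compactin_def by blast
  obtain D0 where D0: "D0 \<subseteq> D" "finite D0" "\<F> = (\<lambda>y. topspace ?X - (D - {y})) ` D0"
    using finite_subset_image[OF \<F>(1) \<F>(2)[unfolded \<W>_def]] by blast
  have "D \<subseteq> D0"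
  proof
    fix y assume "y \<in> D"
    then have "y \<in> C" using g unfolding D_def by blast
    then have "y \<in> \<Union>\<F>" using \<F>(3) by blast
    with \<open>y \<in> D\<close> show "y \<in> D0" unfolding D0(3) by blast
  qed
  then show False using D0 \<open>infinite D\<close> by (meson finite_subset)
qed

subsection \<open>Labels and small simplices\<close>

text \<open>A vertex of largest barycentric coordinate. Unlike an arbitrary vertex of positive
  coordinate it is controlled nearby: close to a given point, all peaks are among the peaks of that
  point (\<open>nbh\<close>).\<close>

definition lab :: "('v \<Rightarrow> real) \<Rightarrow> 'v" where
  "lab y = (SOME v. \<forall>w. y w \<le> y v)"

lemma lab:
  assumes "simp_cx K" "y \<in> topspace (geometric_realization K)"
  shows "y w \<le> y (lab y)" "0 < y (lab y)"
proof -
  have y: "\<forall>v. 0 \<le> y v" "vsupp y \<in> K" using assms by (auto simp: realization_iff)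
  then have fin: "finite (vsupp y)" "vsupp y \<noteq> {}" using assms(1) by (auto simp only: simp_cxD)
  obtain v where v: "v \<in> vsupp y" "y v = Max (y ` vsupp y)"
    using Max_in[of "y ` vsupp y"] fin by fastforce
  have "y w \<le> y v" for w
  proof (cases "w \<in> vsupp y")
    case True
    then show ?thesis using v fin by simp
  qed (use y in auto)
  then have *: "\<forall>w. y w \<le> y (lab y)"
    unfolding lab_def by (intro someI[of "\<lambda>v. \<forall>w. y w \<le> y v"]) blast
  then show "y w \<le> y (lab y)" by blast
  have "0 < y v" using v(1) y(1) unfolding mem_Collect_eq by (metis order_less_le)
  then show "0 < y (lab y)" using * by (meson less_le_trans)
qed

definition peaks :: "('v \<Rightarrow> real) \<Rightarrow> 'v set" where
  "peaks y = {v. \<forall>w. y w \<le> y v}"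

text \<open>For \<open>A = peaks y\<close> this is an open neighbourhood of \<open>y\<close> in
  which the label of any point has positive coordinate at every other point, which is what
  \<open>small\<close> asks of a simplex.\<close>

definition nbh :: "'v set set \<Rightarrow> 'v set \<Rightarrow> ('v \<Rightarrow> real) set" where
  "nbh K A = {y \<in> topspace (geometric_realization K). peaks y \<subseteq> A \<and> (\<forall>v\<in>A. 0 < y v)}"

lemma openin_nbh:
  fixes K :: "'v set set"
  assumes K: "simp_cx K" and A: "finite A"
  shows "openin (geometric_realization K) (nbh K A)"
  unfolding openin_geometric_realization
proof (intro conjI ballI)
  show "nbh K A \<subseteq> (\<Union>S\<in>K. closed_cell S)" by (auto simp: nbh_def topspace_geometric_realization)
  fix S assume S: "S \<in> K"
  \<comment> \<open>On a finite cell, \<open>peaks y \<subseteq> A\<close> means that each vertex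
    outside \<open>A\<close> is strictly beaten by some vertex; with finitely many vertices this is
    an open condition.\<close>
  let ?W = "(\<Inter>u\<in>S - A. \<Union>v\<in>S. {y::'v \<Rightarrow> real. y u < y v}) \<inter> (\<Inter>v\<in>A. {y. 0 < y v})"
  have fin: "finite S" "S \<noteq> {}" using simp_cxD[OF K S] by auto
  have "nbh K A \<inter> closed_cell S = closed_cell S \<inter> ?W"
  proof (intro equalityI subsetI)
    fix y assume y: "y \<in> nbh K A \<inter> closed_cell S"
    have "\<exists>v\<in>S. y u < y v" if u: "u \<in> S - A" for u
    proof -
      from y u obtain w where w: "y u < y w" by (force simp: nbh_def peaks_def not_le)
      moreover have "0 \<le> y u" using y by (auto simp: closed_cell_def)
      ultimately have "y w \<noteq> 0" by linarith
      then have "w \<in> S" using y unfolding closed_cell_def by blast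
      with w show ?thesis by blast
    qed
    then show "y \<in> closed_cell S \<inter> ?W" using y by (auto simp: nbh_def)
  next
    fix y assume y: "y \<in> closed_cell S \<inter> ?W"
    have yt: "y \<in> topspace (geometric_realization K)" using y S by (auto simp: topspace_geometric_realization)
    have "peaks y \<subseteq> A"
    proof
      fix u assume u: "u \<in> peaks y"
      have "0 < y u" using lab(2)[OF K yt] u by (auto simp: peaks_def intro: less_le_trans)
      then have "u \<in> S" using y unfolding closed_cell_def by (metis (mono_tags, lifting) IntD1 less_irrefl mem_Collect_eq)
      moreover have "\<not> (\<exists>v\<in>S. y u < y v)" using u by (auto simp: peaks_def not_less)
      ultimately show "u \<in> A" using y by blast
    qed
    then show "y \<in> nbh K A \<inter> closed_cell S" using y yt by (auto simp: nbh_def)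
  qed
  moreover have "open ?W"
  proof -
    have "open {y::'v \<Rightarrow> real. y u < y v}" "open {y::'v \<Rightarrow> real. 0 < y v}" for u v
      by (rule open_Collect_less; rule continuous_on_coord continuous_on_const)+
    then show ?thesis using fin A by (intro open_Int open_INT ballI open_UN) auto
  qed
  ultimately show "openin (subtopology (powertop_real UNIV) (closed_cell S)) (nbh K A \<inter> closed_cell S)"
    by (simp add: euclidean_product_topology openin_open_Int)
qed

text \<open>The label at one point is a vertex of the carrier of every other point. Hence the corner
  labels span a simplex (\<open>small_Lam\<close>), and the segment from a point to the linear
  simplex on the labels stays in one cell (\<open>slh_cell\<close>).\<close>

definition small :: "nat \<Rightarrow> ('v \<Rightarrow> real) sing_simplex \<Rightarrow> bool" where
  "small p \<sigma> \<longleftrightarrow> (\<forall>s\<in>standard_simplex p. \<forall>t\<in>standard_simplex p. 0 < \<sigma> t (lab (\<sigma> s)))"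

lemma comb_in_simplex:
  assumes "set M \<subseteq> standard_simplex p" "length M = Suc q" "t \<in> standard_simplex q"
  shows "comb M t \<in> standard_simplex p"
proof -
  have t: "\<And>j. 0 \<le> t j" "(\<Sum>j<length M. t j) = 1"
    using assms by (auto simp: standard_simplex_def lessThan_Suc_atMost)
  have M: "\<And>j. j < length M \<Longrightarrow> M ! j \<in> standard_simplex p" using assms by auto
  have nn: "0 \<le> comb M t i" for i
    unfolding comb_def by (rule sum_nonneg) (use t M in \<open>auto simp: standard_simplex_def\<close>)
  have 0: "comb M t i = 0" if "i > p" for i
    unfolding comb_def by (rule sum.neutral) (use M that in \<open>auto simp: standard_simplex_def\<close>)
  have "(\<Sum>i\<le>p. comb M t i) = (\<Sum>j<length M. t j * (\<Sum>i\<le>p. (M ! j) i))"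
    unfolding comb_def sum_distrib_left by (rule sum.swap)
  also have "\<dots> = (\<Sum>j<length M. t j)"
    by (rule sum.cong) (use M in \<open>auto simp: standard_simplex_def\<close>)
  finally have s: "(\<Sum>i\<le>p. comb M t i) = 1" using t by simp
  have "comb M t i \<le> 1" for i
  proof (cases "i \<le> p")
    case True
    then have "comb M t i \<le> (\<Sum>i\<le>p. comb M t i)" by (intro member_le_sum) (auto simp: nn)
    then show ?thesis using s by simp
  qed (simp add: 0)
  then show ?thesis using nn 0 s by (auto simp: standard_simplex_def)
qed

lemma comb_mesh:
  assumes "mesh e (set M)" "length M = Suc q" "t \<in> standard_simplex q"
  shows "\<bar>comb M t i - (M ! 0) i\<bar> \<le> e"
proof -
  have t: "\<And>j. 0 \<le> t j" "(\<Sum>j<length M. t j) = 1"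
    using assms by (auto simp: standard_simplex_def lessThan_Suc_atMost)
  have "comb M t i - (M ! 0) i = (\<Sum>j<length M. t j * ((M ! j) i - (M ! 0) i))"
    using t(2) by (simp add: comb_def right_diff_distrib sum_subtractf flip: sum_distrib_right)
  also have "\<bar>\<dots>\<bar> \<le> (\<Sum>j<length M. t j * e)"
    by (rule order_trans[OF sum_abs sum_mono])
      (use assms t in \<open>auto simp: abs_mult mesh_def intro!: mult_left_mono\<close>)
  also have "\<dots> = e" using t(2) by (simp flip: sum_distrib_right)
  finally show ?thesis .
qed

lemma small_pieces:
  assumes K: "simp_cx K" and \<sigma>: "singular_simplex p (geometric_realization K) \<sigma>"
  obtains e where "e > 0" "\<And>M q. set M \<subseteq> standard_simplex p \<Longrightarrow> length M = Suc q \<Longrightarrow> mesh e (set M) \<Longrightarrow>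
    small q (sreal \<sigma> M)"
proof -
  let ?X = "geometric_realization K" and ?S = "standard_simplex p"
  have cont: "continuous_map (top_of_set ?S) ?X \<sigma>"
    using \<sigma> by (simp add: singular_simplex_def euclidean_product_topology)
  have st: "\<sigma> t \<in> topspace ?X" if "t \<in> ?S" for t
    using continuous_map_image_subset_topspace[OF cont] that by auto
  have fin: "finite (peaks (\<sigma> t))" if "t \<in> ?S" for t
  proof (rule finite_subset)
    show "peaks (\<sigma> t) \<subseteq> vsupp (\<sigma> t)"
      using lab(2)[OF K st[OF that]] unfolding peaks_def by (smt (verit) Collect_mono)
    show "finite (vsupp (\<sigma> t))" using st[OF that] by (auto simp: realization_iff[OF K] simp_cxD(1)[OF K])
  qed
  have "\<exists>W. open W \<and> {x \<in> ?S. \<sigma> x \<in> nbh K (peaks (\<sigma> t))} = ?S \<inter> W" if "t \<in> ?S" for t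
  proof -
    have "openin (top_of_set ?S) {x \<in> topspace (top_of_set ?S). \<sigma> x \<in> nbh K (peaks (\<sigma> t))}"
      by (rule openin_continuous_map_preimage[OF cont openin_nbh[OF K fin[OF that]]])
    then show ?thesis by (auto simp: openin_open)
  qed
  then have "\<exists>W. \<forall>t\<in>?S. open (W t) \<and> {x \<in> ?S. \<sigma> x \<in> nbh K (peaks (\<sigma> t))} = ?S \<inter> W t"
    by (intro bchoice ballI)
  then obtain W where W: "\<And>t. t \<in> ?S \<Longrightarrow> open (W t)"
    "\<And>t. t \<in> ?S \<Longrightarrow> {x \<in> ?S. \<sigma> x \<in> nbh K (peaks (\<sigma> t))} = ?S \<inter> W t" by blast
  have tW: "t \<in> W t" if "t \<in> ?S" for t
  proof -
    have "\<sigma> t \<in> nbh K (peaks (\<sigma> t))"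
      using lab(2)[OF K st[OF that]] st[OF that] by (auto simp: nbh_def peaks_def intro: less_le_trans)
    then show ?thesis using W(2)[OF that] that by blast
  qed
  have "compact ?S"
    using compactin_standard_simplex[of p] by (simp add: euclidean_product_topology)
  then obtain \<delta> where \<delta>: "0 < \<delta>" "\<And>T. \<lbrakk>T \<subseteq> ?S; diameter T < \<delta>\<rbrakk> \<Longrightarrow> \<exists>B \<in> W ` ?S. T \<subseteq> B"
    by (rule Lebesgue_number_lemma[of ?S "W ` ?S"]) (use nonempty_standard_simplex tW W in auto)
  show thesis
  proof (rule that)
    \<comment> \<open>Mesh \<open>\<delta> / 8\<close> puts a piece within
      \<open>\<delta> / 8\<close> of its first vertex, so its points differ by at most
      \<open>\<delta> / 4\<close> in each coordinate. The product metric at most doubles this, up to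
      an arbitrarily small tail, which stays below the Lebesgue number
      \<open>\<delta>\<close>.\<close>
    show "\<delta> / 8 > 0" using \<delta>(1) by simp
    fix M q assume M: "set M \<subseteq> ?S" "length M = Suc q" "mesh (\<delta> / 8) (set M)"
    define T where "T = comb M ` standard_simplex q"
    have TS: "T \<subseteq> ?S" using comb_in_simplex[OF M(1,2)] by (auto simp: T_def)
    have dT: "dist x y \<le> \<delta> / 2" if "x \<in> T" "y \<in> T" for x y
    proof (rule field_le_epsilon)
      fix e :: real assume "0 < e"
      then obtain N where N: "(1/2)^N < e"
        using real_arch_pow_inv[of e "1/2"] by auto
      have "\<bar>x i - y i\<bar> \<le> \<delta> / 4" for i
      proof -
        obtain a b where ab: "a \<in> standard_simplex q" "b \<in> standard_simplex q" "x = comb M a" "y = comb M b"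
          using \<open>x \<in> T\<close> \<open>y \<in> T\<close> unfolding T_def by blast
        show ?thesis
          using comb_mesh[OF M(3,2) ab(1), of i] comb_mesh[OF M(3,2) ab(2), of i] unfolding ab(3,4) by linarith
      qed
      then have "Max {dist (x (from_nat n)) (y (from_nat n))|n. n \<le> N} \<le> \<delta> / 4"
        by (subst Max_le_iff) (auto simp: dist_real_def)
      then show "dist x y \<le> \<delta> / 2 + e"
        using dist_fun_le_dist_first_terms[of x y N] N by linarith
    qed
    have "diameter T \<le> \<delta> / 2"
    proof (cases "T = {}")
      case False
      then have "(SUP (x, y)\<in>T \<times> T. dist x y) \<le> \<delta> / 2"
        by (intro cSUP_least) (use dT in auto)
      then show ?thesis using False by (simp add: diameter_def)
    qed (use \<delta>(1) in \<open>simp add: diameter_def\<close>)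
    then obtain t where t: "t \<in> ?S" "T \<subseteq> W t" using \<delta>(2)[OF TS] \<delta>(1) by auto
    then have *: "\<sigma> x \<in> nbh K (peaks (\<sigma> t))" if "x \<in> T" for x
      using W(2)[of t] TS that by blast
    show "small q (sreal \<sigma> M)"
      unfolding small_def
    proof (intro ballI)
      fix a b assume ab: "a \<in> standard_simplex q" "b \<in> standard_simplex q"
      have e: "sreal \<sigma> M x = \<sigma> (comb M x)" "comb M x \<in> T" if "x \<in> standard_simplex q" for x
        using that M by (auto simp: sreal_def T_def)
      have "lab (\<sigma> (comb M a)) \<in> peaks (\<sigma> (comb M a))"
        using lab(1)[OF K st] e(2)[OF ab(1)] TS by (auto simp: peaks_def)
      then show "0 < sreal \<sigma> M b (lab (sreal \<sigma> M a))"
        using *[OF e(2)[OF ab(1)]] *[OF e(2)[OF ab(2)]] ab by (auto simp: e nbh_def)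
    qed
  qed
qed

section \<open>Singular and ordered simplicial homology of a realization\<close>

subsection \<open>Ordered simplices as singular simplices\<close>

definition inc :: "'v list \<Rightarrow> ('v \<Rightarrow> real) sing_simplex" where
  "inc L = sreal (\<lambda>x. x) (map unitv L)"

definition incc :: "('v list \<Rightarrow>\<^sub>0 bit) \<Rightarrow> ('v \<Rightarrow> real) chain2" where
  "incc c = mp inc c"

lemma incc_add [simp]: "incc (c + d) = incc c + incc d" and incc_0 [simp]: "incc 0 = 0"
  by (simp_all add: incc_def)

lemma standard_simplexD:
  assumes "t \<in> standard_simplex p"
  shows "0 \<le> t j" "t j \<le> 1" "(\<Sum>j<Suc p. t j) = 1" "j > p \<Longrightarrow> t j = 0"
  using assms by (auto simp: standard_simplex_def lessThan_Suc_atMost)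

lemma comb_unitv: "comb (map unitv L) t v = (\<Sum>j<length L. if L ! j = v then t j else 0)"
  unfolding comb_def by (rule sum.cong) (auto simp: unitv_def)

lemma comb_unitv_cell:
  assumes t: "t \<in> standard_simplex p" and L: "length L = Suc p"
    and S: "finite S" "\<And>j. j < Suc p \<Longrightarrow> L ! j \<in> S"
  shows "comb (map unitv L) t \<in> closed_cell S"
proof -
  have "(\<Sum>v\<in>S. comb (map unitv L) t v) = (\<Sum>j<Suc p. \<Sum>v\<in>S. if L ! j = v then t j else 0)"
    unfolding comb_unitv L by (rule sum.swap)
  also have "\<dots> = (\<Sum>j<Suc p. t j)"
    by (rule sum.cong) (use S in auto)
  finally have "sum (comb (map unitv L) t) S = 1" using standard_simplexD[OF t] by simp
  moreover have "0 \<le> comb (map unitv L) t v" for v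
    unfolding comb_unitv by (rule sum_nonneg) (use standard_simplexD[OF t] in auto)
  moreover have "comb (map unitv L) t v = 0" if "v \<notin> S" for v
    unfolding comb_unitv by (rule sum.neutral) (use S L that in auto)
  ultimately show ?thesis by (simp add: closed_cell_def)
qed

lemma continuous_on_comb: "continuous_on T (\<lambda>t. comb M t i)"
  unfolding comb_def
  by (intro continuous_on_sum continuous_on_mult continuous_on_const continuous_on_coord)

lemma closed_cell_realization: "S \<in> K \<Longrightarrow> f \<in> closed_cell S \<Longrightarrow> f \<in> topspace (geometric_realization K)"
  unfolding topspace_geometric_realization by blast

lemma inc_simplex:
  assumes K: "simp_cx K" and L: "set L \<in> K" "length L = Suc p"
  shows "singular_simplex p (geometric_realization K) (inc L)"
  unfolding singular_simplex_def
proof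
  have "continuous_map (subtopology (powertop_real UNIV) (standard_simplex p)) (geometric_realization K) (comb (map unitv L))"
  proof (rule continuous_map_into_realization[OF K, of "set L"])
    fix t assume "t \<in> topspace (subtopology (powertop_real UNIV) (standard_simplex p))"
    then have t: "t \<in> standard_simplex p" by simp
    have "comb (map unitv L) t \<in> closed_cell (set L)"
      by (rule comb_unitv_cell[OF t L(2)]) (use L in auto)
    then show "comb (map unitv L) t \<in> topspace (geometric_realization K) \<and> vsupp (comb (map unitv L) t) \<subseteq> set L"
      using closed_cell_realization[OF L(1)] closed_cell_vsupp(1)[of _ "set L"] by blast
  qed (simp_all add: euclidean_product_topology continuous_on_comb)
  then show "continuous_map (subtopology (powertop_real UNIV) (standard_simplex p)) (geometric_realization K) (inc L)"
    by (rule continuous_map_eq) (use L in \<open>simp add: inc_def sreal_def\<close>)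
  show "inc L \<in> extensional (standard_simplex p)"
    using L by (simp add: inc_def sreal_def)
qed

lemma incc_chain:
  assumes "simp_cx K" "on (insert {} K) (Suc p) c"
  shows "incc c \<in> chain2_set p (geometric_realization K)"
  using assms inc_simplex[OF assms(1)]
  by (fastforce simp: chain2_set_def incc_def on_def elim!: keys_mpE)

lemma boundary2_incc:
  assumes "\<And>L. L \<in> keys c \<Longrightarrow> length L = Suc (Suc p)"
  shows "boundary2 (Suc p) (incc c) = incc (bd c)"
proof -
  have *: "incc c = mp (sreal (\<lambda>x. x)) (mp (map unitv) c)" for c :: "'a list \<Rightarrow>\<^sub>0 bit"
    by (simp add: incc_def inc_def[abs_def] mp_mp)
  show ?thesis
    unfolding * by (subst boundary2_sreal) (use assms in \<open>auto simp: bd_mp elim!: keys_mpE\<close>)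
qed

subsection \<open>Vertex labels\<close>

definition Lam :: "nat \<Rightarrow> ('v \<Rightarrow> real) sing_simplex \<Rightarrow> 'v list" where
  "Lam p \<sigma> = map (\<lambda>i. lab (\<sigma> (unitv i))) [0..<Suc p]"

lemma length_Lam [simp]: "length (Lam p \<sigma>) = Suc p"
  by (simp add: Lam_def)

lemma unitv_simplex: "i \<le> p \<Longrightarrow> unitv i \<in> standard_simplex p"
  by (simp add: unitv_def)

lemma Lam_face:
  assumes "k \<le> Suc p"
  shows "Lam p (singular_face (Suc p) k \<sigma>) = map (\<lambda>i. lab (\<sigma> (unitv (if i < k then i else Suc i)))) [0..<Suc p]"
  unfolding Lam_def
  by (rule map_cong) (auto simp: singular_face_def unitv_simplex simplical_face_unitv simp del: upt_Suc)

text \<open>Reading off corner labels commutes with faces. Smallness enters in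
  \<open>small_Lam\<close>, where the labels have to span a simplex.\<close>

lemma bd_Lam: "bd (mp (Lam (Suc p)) c) = mp (Lam p) (boundary2 (Suc p) c)"
proof -
  have "bd (mp (Lam (Suc p)) c) = lin (\<lambda>\<sigma>. bdl (Lam (Suc p) \<sigma>)) c"
    by (simp add: bd_def lin_mp)
  also have "\<dots> = lin (\<lambda>\<sigma>. \<Sum>k\<le>Suc p. sng (Lam p (singular_face (Suc p) k \<sigma>))) c"
  proof (rule lin_cong)
    fix \<sigma>
    show "bdl (Lam (Suc p) \<sigma>) = (\<Sum>k\<le>Suc p. sng (Lam p (singular_face (Suc p) k \<sigma>)))"
      unfolding Lam_def[of "Suc p"] bdl_map_upt by (rule sum.cong) (simp_all only: Lam_face atMost_iff)
  qed
  also have "\<dots> = mp (Lam p) (boundary2 (Suc p) c)"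
    by (simp add: boundary2_eq mp_lin mp_sum)
  finally show ?thesis .
qed

lemma bd_Lam_0: "bd (mp (Lam 0) c) = lin (\<lambda>_. sng []) c"
  by (simp add: bd_def lin_mp Lam_def)

lemma small_Lam:
  assumes K: "simp_cx K" and \<sigma>: "singular_simplex p (geometric_realization K) \<sigma>" "small p \<sigma>"
  shows "set (Lam p \<sigma>) \<in> K"
proof -
  have s: "\<sigma> (unitv 0) \<in> topspace (geometric_realization K)"
    using \<sigma>(1) unitv_simplex[of 0 p] unfolding singular_simplex_def continuous_map_def by auto
  have "set (Lam p \<sigma>) \<subseteq> vsupp (\<sigma> (unitv 0))"
  proof
    fix v assume "v \<in> set (Lam p \<sigma>)"
    then obtain i where "i < Suc p" "v = lab (\<sigma> (unitv i))" by (auto simp: Lam_def simp del: upt_Suc)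
    then have "0 < \<sigma> (unitv 0) v"
      using \<sigma>(2) unitv_simplex[of 0 p] unitv_simplex[of i p] unfolding small_def by simp
    then show "v \<in> vsupp (\<sigma> (unitv 0))" by simp
  qed
  moreover have "vsupp (\<sigma> (unitv 0)) \<in> K" using s realization_iff[OF K] by blast
  moreover have "set (Lam p \<sigma>) \<noteq> {}" by (simp add: Lam_def)
  ultimately show ?thesis using simp_cxD(3)[OF K] by blast
qed

subsection \<open>Subdivision of singular chains\<close>

definition elist :: "nat \<Rightarrow> (nat \<Rightarrow> real) list" where
  "elist p = map unitv [0..<Suc p]"

lemma length_elist [simp]: "length (elist p) = Suc p"
  by (simp add: elist_def)

lemma set_elist: "set (elist p) \<subseteq> standard_simplex p"
  by (auto simp: elist_def unitv_simplex simp del: upt_Suc)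

lemma bdl_elist: "bdl (elist (Suc p)) = (\<Sum>k\<le>Suc p. sng (map (simplical_face k) (elist p)))"
  unfolding elist_def bdl_map_upt by (simp add: simplical_face_unitv o_def del: upt_Suc sum.atMost_Suc)

lemma bary_comb: "bary L = comb L (\<lambda>j. if j < length L then 1 / real (length L) else 0)"
  by (rule ext) (simp add: bary_def comb_def sum_divide_distrib)

lemma hul_simplex: "S \<subseteq> standard_simplex p \<Longrightarrow> hul S \<subseteq> standard_simplex p"
proof (rule hul_closed)
  fix L :: "(nat \<Rightarrow> real) list" assume L: "L \<noteq> []" "set L \<subseteq> standard_simplex p"
  then obtain q where q: "length L = Suc q" by (cases L) auto
  have "(\<lambda>j. if j < length L then 1 / real (length L) else 0) \<in> standard_simplex q"
  proof -
    have "(\<Sum>j\<le>q. if j < length L then 1 / real (length L) else 0) = (\<Sum>j\<le>q. 1 / real (Suc q))"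
      by (rule sum.cong) (auto simp: q)
    then show ?thesis by (auto simp: standard_simplex_def q)
  qed
  then show "bary L \<in> standard_simplex p"
    unfolding bary_comb by (rule comb_in_simplex[OF L(2) q])
qed

lemma comb_elist: "t \<in> standard_simplex p \<Longrightarrow> comb (elist p) t = t"
proof
  fix i assume t: "t \<in> standard_simplex p"
  have "comb (elist p) t i = (\<Sum>j<Suc p. if j = i then t j else 0)"
    unfolding comb_def by (rule sum.cong) (auto simp: elist_def unitv_def simp del: upt_Suc)
  also have "\<dots> = t i" using standard_simplexD(4)[OF t, of i] by auto
  finally show "comb (elist p) t i = t i" .
qed

lemma sreal_elist: "singular_simplex p X \<sigma> \<Longrightarrow> sreal \<sigma> (elist p) = \<sigma>"
  by (rule ext) (auto simp: sreal_def restrict_def comb_elist singular_simplex_def extensional_def)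

lemma sreal_face:
  assumes "set M \<subseteq> standard_simplex p" "M \<noteq> []"
  shows "sreal (singular_face (Suc p) k \<sigma>) M = sreal \<sigma> (map (simplical_face k) M)"
proof
  fix t
  obtain q where q: "length M = Suc q" using assms(2) by (cases M) auto
  then show "sreal (singular_face (Suc p) k \<sigma>) M t = sreal \<sigma> (map (simplical_face k) M) t"
    using comb_in_simplex[OF assms(1) q] by (auto simp: sreal_def restrict_def singular_face_def comb_map_face)
qed

definition Sd :: "nat \<Rightarrow> nat \<Rightarrow> 'a chain2 \<Rightarrow> 'a chain2" where
  "Sd N p c = lin (\<lambda>\<sigma>. mp (sreal \<sigma>) (sdn N (elist p))) c"

lemma sdn_elist_keys:
  assumes "M \<in> keys (sdn N (elist p))"
  shows "set M \<subseteq> standard_simplex p" "length M = Suc p"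
  using sdn_keys[OF assms] hul_simplex[OF set_elist] by auto

lemma boundary2_Sd:
  fixes c :: "'a chain2"
  shows "boundary2 (Suc p) (Sd N (Suc p) c) = Sd N p (boundary2 (Suc p) c)"
proof -
  have "boundary2 (Suc p) (mp (sreal \<sigma>) (sdn N (elist (Suc p)))) =
      (\<Sum>k\<le>Suc p. mp (sreal (singular_face (Suc p) k \<sigma>)) (sdn N (elist p)))" for \<sigma> :: "'a sing_simplex"
  proof -
    have "boundary2 (Suc p) (mp (sreal \<sigma>) (sdn N (elist (Suc p)))) = mp (sreal \<sigma>) (bd (sdn N (elist (Suc p))))"
      by (rule boundary2_sreal) (simp add: sdn_elist_keys(2))
    also have "bd (sdn N (elist (Suc p))) = (\<Sum>k\<le>Suc p. mp (map (simplical_face k)) (sdn N (elist p)))"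
      by (simp add: bd_sdn bdl_elist lin_sum sdn_map bary_map_face del: sum.atMost_Suc)
    also have "mp (sreal \<sigma>) \<dots> = (\<Sum>k\<le>Suc p. mp (\<lambda>M. sreal \<sigma> (map (simplical_face k) M)) (sdn N (elist p)))"
      by (simp add: mp_sum mp_mp del: sum.atMost_Suc)
    also have "\<dots> = (\<Sum>k\<le>Suc p. mp (sreal (singular_face (Suc p) k \<sigma>)) (sdn N (elist p)))"
    proof (intro sum.cong refl mp_cong)
      fix k M assume M: "M \<in> keys (sdn N (elist p))"
      have "M \<noteq> []" using sdn_elist_keys(2)[OF M] by auto
      then show "sreal \<sigma> (map (simplical_face k) M) = sreal (singular_face (Suc p) k \<sigma>) M"
        using sreal_face[OF sdn_elist_keys(1)[OF M], of k \<sigma>] by (rule_tac sym)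
    qed
    finally show ?thesis .
  qed
  then show ?thesis
    by (simp add: Sd_def boundary2_lin boundary2_eq[of _ c] lin_lin lin_sum del: sum.atMost_Suc)
qed

lemma piece_simplex:
  assumes \<sigma>: "singular_simplex p X \<sigma>" and M: "set M \<subseteq> standard_simplex p" "length M = Suc q"
  shows "singular_simplex q X (sreal \<sigma> M)"
  unfolding singular_simplex_def
proof
  have "continuous_map (top_of_set (standard_simplex q)) (top_of_set (standard_simplex p)) (comb M)"
    using comb_in_simplex[OF M]
    by (auto intro!: continuous_on_coordinatewise_then_product continuous_on_comb)
  moreover have "continuous_map (top_of_set (standard_simplex p)) X \<sigma>"
    using \<sigma> by (simp add: singular_simplex_def euclidean_product_topology)
  ultimately have "continuous_map (top_of_set (standard_simplex q)) X (\<sigma> \<circ> comb M)"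
    by (rule continuous_map_compose)
  then have "continuous_map (top_of_set (standard_simplex q)) X (sreal \<sigma> M)"
    by (rule continuous_map_eq) (use M in \<open>simp add: sreal_def\<close>)
  then show "continuous_map (subtopology (powertop_real UNIV) (standard_simplex q)) X (sreal \<sigma> M)"
    by (simp add: euclidean_product_topology)
  show "sreal \<sigma> M \<in> extensional (standard_simplex q)" using M by (simp add: sreal_def)
qed

lemma chain2_set_mp:
  "(\<And>M. M \<in> keys E \<Longrightarrow> singular_simplex p X (f M)) \<Longrightarrow> mp f E \<in> chain2_set p X"
  by (auto simp: chain2_set_def elim!: keys_mpE)

lemma chain2_set_lin:
  "(\<And>x. x \<in> keys c \<Longrightarrow> f x \<in> chain2_set p X) \<Longrightarrow> lin f c \<in> chain2_set p X"
  unfolding chain2_set_def using keys_lin[of f c] by blast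

lemma chain2_set_add: "c \<in> chain2_set p X \<Longrightarrow> d \<in> chain2_set p X \<Longrightarrow> c + d \<in> chain2_set p X"
  unfolding chain2_set_def using keys_add[of c d] by blast

lemma chain2_set_0 [simp]: "0 \<in> chain2_set p X"
  by (simp add: chain2_set_def)

text \<open>The carrier of an affine simplex is its barycentric hull. The hull of the corners stays
  in the standard simplex, so the homotopy can be pushed forward along each
  \<open>\<sigma>\<close>.\<close>

lemma Sd_homologous:
  assumes c: "c \<in> chain2_set p X" and cyc: "p = 0 \<or> boundary2 p c = 0"
  shows "c + Sd N p c \<in> boundaries2 p X"
proof -
  let ?T = "\<lambda>p. lin (\<lambda>\<sigma>. mp (sreal \<sigma>) (htp (sdn N) (elist p)))"
  have supp: "set M \<subseteq> standard_simplex p \<and> length M = Suc (Suc p)" if "M \<in> keys (htp (sdn N) (elist p))" for p M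
  proof -
    have "set M \<subseteq> hul (set (elist p)) \<and> length M = Suc (length (elist p))"
    proof (rule htp_supp[of UNIV "sdn N" "\<lambda>L. hul (set L)"])
      show "hul (set M) \<subseteq> hul (set L)" if "M \<in> keys (bdl L)" for L M :: "(nat \<Rightarrow> real) list"
        using bdl_keys[OF that] by (intro hul_mono) auto
    qed (use that sdn_keys hul_base in \<open>auto simp: down_def\<close>)
    then show ?thesis using hul_simplex[OF set_elist] by auto
  qed
  have "boundary2 (Suc p) (?T p c) + (if p = 0 then 0 else ?T (p - 1) (boundary2 p c))
    = lin (\<lambda>\<sigma>. sng (sreal \<sigma> (elist p)) + mp (sreal \<sigma>) (sdn N (elist p))) c"
    by (rule natural_homotopy[where H="\<lambda>p \<sigma>. \<sigma>" and B=elist and s="\<lambda>k. k" and \<phi>="sdn N"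
          and Dom=standard_simplex and G="\<lambda>p. UNIV"])
      (simp_all add: bdl_elist bd_sdn sdn_map bary_map_face supp sreal_face del: sum.atMost_Suc)
  also have "\<dots> = lin sng c + Sd N p c"
    unfolding lin_fun_add Sd_def
    by (intro arg_cong2[of _ _ _ _ "(+)"] lin_cong refl)
      (use c in \<open>auto simp: chain2_set_def sreal_elist\<close>)
  finally have "c + Sd N p c = boundary2 (Suc p) (?T p c)" using cyc by (cases "p = 0") auto
  moreover have "?T p c \<in> chain2_set (Suc p) X"
    using c supp by (intro chain2_set_lin chain2_set_mp piece_simplex) (auto simp: chain2_set_def)
  ultimately show ?thesis unfolding boundaries2_def by blast
qed

lemma mesh_elist: "mesh 1 (set (elist p))"
  by (auto simp: mesh_def elist_def unitv_def simp del: upt_Suc)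

lemma fine_subdivision:
  assumes K: "simp_cx K" and c: "c \<in> chain2_set p (geometric_realization K)"
  obtains N where "\<And>\<sigma> M. \<sigma> \<in> keys c \<Longrightarrow> M \<in> keys (sdn N (elist p)) \<Longrightarrow> small p (sreal \<sigma> M)"
proof -
  have "\<exists>N0. \<forall>N\<ge>N0. \<forall>M\<in>keys (sdn N (elist p)). small p (sreal \<sigma> M)" if "\<sigma> \<in> keys c" for \<sigma>
  proof -
    have "singular_simplex p (geometric_realization K) \<sigma>" using c that by (auto simp: chain2_set_def)
    then obtain e where e: "e > 0" "\<And>M q. set M \<subseteq> standard_simplex p \<Longrightarrow> length M = Suc q \<Longrightarrow> mesh e (set M) \<Longrightarrow>
        small q (sreal \<sigma> M)"
      using small_pieces[OF K] by blast
    obtain N0 where N0: "\<And>N L M. N \<ge> N0 \<Longrightarrow> length L = Suc p \<Longrightarrow> mesh 1 (set L) \<Longrightarrow>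
        M \<in> keys (sdn N L) \<Longrightarrow> mesh e (set (M :: (nat \<Rightarrow> real) list))"
      using sdn_fine[OF e(1), of p 1] by blast
    have "small p (sreal \<sigma> M)" if "N \<ge> N0" "M \<in> keys (sdn N (elist p))" for N M
      using e(2) sdn_elist_keys[OF that(2)] N0[OF that(1) _ mesh_elist that(2)] by simp
    then show ?thesis by blast
  qed
  then have "\<exists>N0. \<forall>\<sigma>\<in>keys c. \<forall>N\<ge>N0 \<sigma>. \<forall>M\<in>keys (sdn N (elist p)). small p (sreal \<sigma> M)"
    by (intro bchoice ballI)
  then obtain N0 where N0: "\<forall>\<sigma>\<in>keys c. \<forall>N\<ge>N0 \<sigma>. \<forall>M\<in>keys (sdn N (elist p)). small p (sreal \<sigma> M)"
    by blast
  show thesis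
  proof (rule that)
    fix \<sigma> M assume "\<sigma> \<in> keys c" "M \<in> keys (sdn (Max (N0 ` keys c)) (elist p))"
    moreover have "N0 \<sigma> \<le> Max (N0 ` keys c)" using \<open>\<sigma> \<in> keys c\<close> by simp
    ultimately show "small p (sreal \<sigma> M)" using N0 by blast
  qed
qed

subsection \<open>The straight-line homotopy\<close>

text \<open>Runs from \<open>\<sigma>\<close> at time 0 to the linear simplex on the corner labels
  at time 1; the point of the simplex sits in the shifted coordinates.\<close>

definition slh :: "nat \<Rightarrow> ('v \<Rightarrow> real) sing_simplex \<Rightarrow> (nat \<Rightarrow> real) \<Rightarrow> ('v \<Rightarrow> real)" where
  "slh p \<sigma> x = (\<lambda>v. (1 - x 0) * \<sigma> (\<lambda>i. x (Suc i)) v + x 0 * comb (map unitv (Lam p \<sigma>)) (\<lambda>i. x (Suc i)) v)"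

text \<open>Points of the prism over the standard simplex: the coordinate at \<open>0\<close> is the time.\<close>

definition prism :: "nat \<Rightarrow> (nat \<Rightarrow> real) set" where
  "prism p = {x. 0 \<le> x 0 \<and> x 0 \<le> 1 \<and> (\<lambda>i. x (Suc i)) \<in> standard_simplex p}"

definition plist :: "nat \<Rightarrow> (nat \<Rightarrow> real) list" where
  "plist p = map (\<lambda>i. unitv (Suc i)) [0..<Suc p]"

lemma length_plist [simp]: "length (plist p) = Suc p"
  by (simp add: plist_def)

lemma bdl_plist: "bdl (plist (Suc p)) = (\<Sum>k\<le>Suc p. sng (map (simplical_face (Suc k)) (plist p)))"
  unfolding plist_def bdl_map_upt
proof (rule sum.cong)
  fix k
  have "map (\<lambda>i. unitv (Suc (if i < k then i else Suc i))) [0..<Suc p] =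
    map (simplical_face (Suc k)) (map (\<lambda>i. unitv (Suc i)) [0..<Suc p])"
    by (simp add: simplical_face_unitv del: upt_Suc)
  then show "sng (map (\<lambda>i. unitv (Suc (if i < k then i else Suc i))) [0..<Suc p]) =
    sng (map (simplical_face (Suc k)) (map (\<lambda>i. unitv (Suc i)) [0..<Suc p]) :: (nat \<Rightarrow> real) list)"
    by (simp only:)
qed simp

lemma comb_prism:
  assumes M: "set M \<subseteq> prism p" "length M = Suc q" and t: "t \<in> standard_simplex q"
  shows "comb M t \<in> prism p"
proof -
  have m: "\<And>j. j < length M \<Longrightarrow> 0 \<le> (M ! j) 0 \<and> (M ! j) 0 \<le> 1"
    using M(1) nth_mem unfolding prism_def by blast
  have "0 \<le> comb M t 0"
    unfolding comb_def by (rule sum_nonneg) (use m standard_simplexD[OF t] in auto)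
  moreover have "comb M t 0 \<le> (\<Sum>j<Suc q. t j * 1)"
    unfolding comb_def M(2) by (rule sum_mono) (use m M(2) standard_simplexD[OF t] in \<open>auto intro!: mult_left_le\<close>)
  moreover have "(\<lambda>i. comb M t (Suc i)) = comb (map (\<lambda>x i. x (Suc i)) M) t"
    by (rule ext) (simp add: comb_def)
  moreover have "comb (map (\<lambda>x i. x (Suc i)) M) t \<in> standard_simplex p"
    by (rule comb_in_simplex[OF _ _ t]) (use M in \<open>auto simp: prism_def\<close>)
  ultimately show ?thesis
    using standard_simplexD(3)[OF t] by (simp add: prism_def)
qed

lemma slh_face:
  assumes M: "set M \<subseteq> prism p" "M \<noteq> []" and k: "k \<le> Suc p"
  shows "sreal (slh p (singular_face (Suc p) k \<sigma>)) M = sreal (slh (Suc p) \<sigma>) (map (simplical_face (Suc k)) M)"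
proof
  fix t
  obtain q where q: "length M = Suc q" using assms(2) by (cases M) auto
  have "slh p (singular_face (Suc p) k \<sigma>) x = slh (Suc p) \<sigma> (simplical_face (Suc k) x)" if x: "x \<in> prism p" for x
  proof -
    define y where "y = (\<lambda>i. x (Suc i))"
    have y: "y \<in> standard_simplex p" using x by (simp add: prism_def y_def)
    have 1: "(\<lambda>i. simplical_face (Suc k) x (Suc i)) = simplical_face k y"
      by (rule ext) (auto simp: simplical_face_def y_def)
    have 2: "simplical_face (Suc k) x 0 = x 0" by (simp add: simplical_face_def)
    have "comb (map unitv (Lam p (singular_face (Suc p) k \<sigma>))) y = comb (map unitv (Lam (Suc p) \<sigma>)) (simplical_face k y)"
    proof -
      have "map unitv (Lam p (singular_face (Suc p) k \<sigma>)) =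
          take k (map unitv (Lam (Suc p) \<sigma>)) @ drop (Suc k) (map unitv (Lam (Suc p) \<sigma>))"
        unfolding Lam_face[OF k] unfolding Lam_def map_map delete_map_upt[OF k] by simp
      then show ?thesis using comb_face[OF k, of "map unitv (Lam (Suc p) \<sigma>)" y] by simp
    qed
    then show ?thesis
      unfolding slh_def 1 2 y_def[symmetric] using y by (simp add: singular_face_def)
  qed
  then show "sreal (slh p (singular_face (Suc p) k \<sigma>)) M t = sreal (slh (Suc p) \<sigma>) (map (simplical_face (Suc k)) M) t"
    using comb_prism[OF M(1) q] q by (auto simp: sreal_def restrict_def comb_map_face)
qed

text \<open>Smallness puts all corner labels into the support of \<open>\<sigma>\<close> at the
  given point; the closed cell on that support is convex and contains both ends of the
  segment.\<close>

lemma slh_cell: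
  assumes K: "simp_cx K" and \<sigma>: "singular_simplex p (geometric_realization K) \<sigma>" "small p \<sigma>"
    and x: "x \<in> prism p"
  shows "slh p \<sigma> x \<in> closed_cell (vsupp (\<sigma> (\<lambda>i. x (Suc i))))" "vsupp (\<sigma> (\<lambda>i. x (Suc i))) \<in> K"
proof -
  define y where "y = (\<lambda>i. x (Suc i))"
  define S where "S = vsupp (\<sigma> y)"
  have y: "y \<in> standard_simplex p" and u: "0 \<le> x 0" "x 0 \<le> 1" using x by (auto simp: prism_def y_def)
  have "\<sigma> y \<in> topspace (geometric_realization K)"
    using \<sigma>(1) y unfolding singular_simplex_def continuous_map_def by auto
  then have s: "\<And>v. 0 \<le> \<sigma> y v" "S \<in> K" "sum (\<sigma> y) S = 1"
    unfolding realization_iff[OF K] S_def by blast+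
  have "Lam p \<sigma> ! j \<in> S" if "j < Suc p" for j
  proof -
    have "Lam p \<sigma> ! j = lab (\<sigma> (unitv j))" using that by (simp add: Lam_def del: upt_Suc)
    moreover have "0 < \<sigma> y (lab (\<sigma> (unitv j)))"
      using \<sigma>(2) y unitv_simplex[of j p] that unfolding small_def by simp
    ultimately show ?thesis by (simp add: S_def)
  qed
  then have c: "comb (map unitv (Lam p \<sigma>)) y \<in> closed_cell S"
    by (intro comb_unitv_cell[OF y]) (use simp_cxD(1)[OF K s(2)] in simp_all)
  have "slh p \<sigma> x \<in> closed_cell S"
    unfolding closed_cell_def slh_def y_def[symmetric]
  proof (intro CollectI conjI allI impI)
    show "0 \<le> (1 - x 0) * \<sigma> y v + x 0 * comb (map unitv (Lam p \<sigma>)) y v" for v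
      using s(1) c u by (simp add: closed_cell_def)
    show "(1 - x 0) * \<sigma> y v + x 0 * comb (map unitv (Lam p \<sigma>)) y v = 0" if "v \<notin> S" for v
      using c that by (simp add: closed_cell_def S_def)
    show "(\<Sum>v\<in>S. (1 - x 0) * \<sigma> y v + x 0 * comb (map unitv (Lam p \<sigma>)) y v) = 1"
      using c s(3) by (simp add: sum.distrib closed_cell_def flip: sum_distrib_left)
  qed
  then show "slh p \<sigma> x \<in> closed_cell (vsupp (\<sigma> (\<lambda>i. x (Suc i))))" "vsupp (\<sigma> (\<lambda>i. x (Suc i))) \<in> K"
    using s(2) by (simp_all add: S_def y_def)
qed

text \<open>Continuity into the weak topology may be checked coordinatewise once finitely many
  vertices are involved; compactness of the image of \<open>\<sigma>\<close> supplies this finite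
  set.\<close>

lemma slh_simplex:
  assumes K: "simp_cx K" and \<sigma>: "singular_simplex p (geometric_realization K) \<sigma>" "small p \<sigma>"
    and M: "set M \<subseteq> prism p" "length M = Suc q"
  shows "singular_simplex q (geometric_realization K) (sreal (slh p \<sigma>) M)"
  unfolding singular_simplex_def
proof
  let ?X = "geometric_realization K"
  have cont: "continuous_map (top_of_set (standard_simplex p)) ?X \<sigma>"
    using \<sigma>(1) by (simp add: singular_simplex_def euclidean_product_topology)
  have "compactin (top_of_set (standard_simplex p)) (standard_simplex p)"
    using compactin_standard_simplex[of p] by (simp add: euclidean_product_topology compactin_subtopology)
  then have "compactin ?X (\<sigma> ` standard_simplex p)"
    using cont by (rule image_compactin)
  then have fin: "finite (\<Union>y\<in>\<sigma> ` standard_simplex p. vsupp y)" by (rule compactin_realization[OF K])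
  define y where "y t = (\<lambda>i. comb M t (Suc i))" for t
  have y: "y t \<in> standard_simplex p" if "t \<in> standard_simplex q" for t
    using comb_prism[OF M that] by (simp add: prism_def y_def)
  have cy: "continuous_on (standard_simplex q) y"
    unfolding y_def by (intro continuous_on_coordinatewise_then_product continuous_on_comb)
  have c\<sigma>: "continuous_on (standard_simplex p) (\<lambda>y. \<sigma> y v)" for v
    using continuous_map_compose[OF cont continuous_map_realization_coord[of K v]] by (simp add: o_def)
  have "continuous_map (top_of_set (standard_simplex q)) ?X (\<lambda>t. slh p \<sigma> (comb M t))"
  proof (rule continuous_map_into_realization[OF K fin])
    fix t assume "t \<in> topspace (top_of_set (standard_simplex q))"
    then have t: "t \<in> standard_simplex q" by simp
    note * = slh_cell[OF K \<sigma> comb_prism[OF M t]]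
    have "vsupp (slh p \<sigma> (comb M t)) \<subseteq> vsupp (\<sigma> (y t))"
      using closed_cell_vsupp(1)[OF *(1) simp_cxD(1)[OF K *(2)]] by (simp add: y_def)
    then show "slh p \<sigma> (comb M t) \<in> topspace ?X \<and> vsupp (slh p \<sigma> (comb M t)) \<subseteq> (\<Union>y\<in>\<sigma> ` standard_simplex p. vsupp y)"
      using closed_cell_realization[OF *(2,1)] y[OF t] by blast
  next
    fix v
    have "continuous_on (standard_simplex q) (\<lambda>t. (1 - comb M t 0) * \<sigma> (y t) v + comb M t 0 * comb (map unitv (Lam p \<sigma>)) (y t) v)"
      by (intro continuous_on_add continuous_on_mult continuous_on_diff continuous_on_const continuous_on_comb
          continuous_on_compose2[OF c\<sigma> cy] continuous_on_compose2[OF continuous_on_comb[of UNIV] cy])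
        (use y in auto)
    then show "continuous_map (top_of_set (standard_simplex q)) euclideanreal (\<lambda>t. slh p \<sigma> (comb M t) v)"
      by (simp add: slh_def y_def)
  qed
  then have "continuous_map (top_of_set (standard_simplex q)) ?X (sreal (slh p \<sigma>) M)"
    by (rule continuous_map_eq) (use M in \<open>simp add: sreal_def\<close>)
  then show "continuous_map (subtopology (powertop_real UNIV) (standard_simplex q)) ?X (sreal (slh p \<sigma>) M)"
    by (simp add: euclidean_product_topology)
  show "sreal (slh p \<sigma>) M \<in> extensional (standard_simplex q)" using M by (simp add: sreal_def)
qed

lemma comb_plist:
  assumes "t \<in> standard_simplex p"
  shows "comb (plist p) t = (\<lambda>i. case i of 0 \<Rightarrow> 0 | Suc i \<Rightarrow> t i)"
    "comb (map (\<lambda>x. x(0 := 1)) (plist p)) t = (\<lambda>i. case i of 0 \<Rightarrow> 1 | Suc i \<Rightarrow> t i)"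
proof -
  have pl: "plist p ! j = unitv (Suc j)" if "j < Suc p" for j
    using that by (simp add: plist_def del: upt_Suc)
  have s: "(\<Sum>j<Suc p. if j = i then t j else 0) = t i" for i
    using standard_simplexD(4)[OF assms, of i] by auto
  have "comb (plist p) t i = (case i of 0 \<Rightarrow> 0 | Suc i \<Rightarrow> t i)" for i
  proof (cases i)
    case (Suc j)
    have "comb (plist p) t i = (\<Sum>l<Suc p. if l = j then t l else 0)"
      unfolding comb_def length_plist by (rule sum.cong) (auto simp: pl unitv_def Suc)
    then show ?thesis by (simp only: s Suc) simp
  qed (simp add: comb_def pl unitv_def del: sum.lessThan_Suc)
  then show "comb (plist p) t = (\<lambda>i. case i of 0 \<Rightarrow> 0 | Suc i \<Rightarrow> t i)" by blast
  have "comb (map (\<lambda>x. x(0 := 1)) (plist p)) t i = (case i of 0 \<Rightarrow> 1 | Suc i \<Rightarrow> t i)" for i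
  proof (cases i)
    case 0
    then show ?thesis using standard_simplexD(3)[OF assms] by (simp add: comb_def del: sum.lessThan_Suc)
  next
    case (Suc j)
    have "comb (map (\<lambda>x. x(0 := 1)) (plist p)) t i = (\<Sum>l<Suc p. if l = j then t l else 0)"
      unfolding comb_def length_map length_plist by (rule sum.cong) (auto simp: pl unitv_def Suc)
    then show ?thesis by (simp only: s Suc) simp
  qed
  then show "comb (map (\<lambda>x. x(0 := 1)) (plist p)) t = (\<lambda>i. case i of 0 \<Rightarrow> 1 | Suc i \<Rightarrow> t i)" by blast
qed

lemma Lam_homologous:
  assumes K: "simp_cx K" and c: "c \<in> chain2_set p (geometric_realization K)"
    and sm: "\<And>\<sigma>. \<sigma> \<in> keys c \<Longrightarrow> small p \<sigma>" and cyc: "p = 0 \<or> boundary2 p c = 0"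
  shows "c + incc (mp (Lam p) c) \<in> boundaries2 p (geometric_realization K)"
proof -
  \<comment> \<open>Lifts the bottom of the prism to its top, so that \<open>?\<phi>\<close>
    compares time 0 with time 1.\<close>
  let ?f = "\<lambda>x::nat\<Rightarrow>real. x(0 := 1)"
  let ?\<phi> = "\<lambda>L. sng (map ?f L)"
  let ?P = "\<lambda>p. lin (\<lambda>\<sigma>. mp (sreal (slh p \<sigma>)) (htp ?\<phi> (plist p)))"
  have pl: "set (plist p) \<union> ?f ` set (plist p) \<subseteq> prism p" for p
    by (auto simp: plist_def prism_def unitv_def if_distrib[of "\<lambda>x. x \<in> _"] simp del: upt_Suc)
  have supp: "set M \<subseteq> prism p \<and> length M = Suc (Suc p)" if "M \<in> keys (htp ?\<phi> (plist p))" for p M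
  proof -
    have "set M \<subseteq> set (plist p) \<union> ?f ` set (plist p) \<and> length M = Suc (length (plist p))"
    proof (rule htp_supp[of UNIV ?\<phi> "\<lambda>L. set L \<union> ?f ` set L"])
      show "set M \<union> ?f ` set M \<subseteq> set L \<union> ?f ` set L" if "M \<in> keys (bdl L)" for L M :: "(nat \<Rightarrow> real) list"
        using bdl_keys[OF that] by blast
    qed (use that in \<open>auto simp: down_def\<close>)
    then show ?thesis using pl by (metis length_plist subset_trans)
  qed
  have "boundary2 (Suc p) (?P p c) + (if p = 0 then 0 else ?P (p - 1) (boundary2 p c))
    = lin (\<lambda>\<sigma>. sng (sreal (slh p \<sigma>) (plist p)) + mp (sreal (slh p \<sigma>)) (?\<phi> (plist p))) c"
  proof (rule natural_homotopy[where H=slh and B=plist and s=Suc and \<phi>="?\<phi>"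
          and Dom=prism and G="\<lambda>p. UNIV"])
    show "?\<phi> (map (simplical_face (Suc k)) L) = mp (map (simplical_face (Suc k))) (?\<phi> L)" for L k
    proof -
      have "?f (simplical_face (Suc k) x) = simplical_face (Suc k) (?f x)" for x
        by (auto simp: simplical_face_def fun_eq_iff)
      then show ?thesis by (simp add: o_def)
    qed
  qed (simp_all add: bdl_plist bdl_map mp_def supp slh_face del: sum.atMost_Suc mp_add)
  also have "\<dots> = lin sng c + incc (mp (Lam p) c)"
  proof -
    have "sreal (slh p \<sigma>) (plist p) = \<sigma>" if "\<sigma> \<in> keys c" for \<sigma>
    proof
      fix t
      have "\<sigma> \<in> extensional (standard_simplex p)"
        using c that by (auto simp: chain2_set_def singular_simplex_def)
      then show "sreal (slh p \<sigma>) (plist p) t = \<sigma> t"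
        by (auto simp: sreal_def restrict_def comb_plist slh_def extensional_def)
    qed
    moreover have "sreal (slh p \<sigma>) (map ?f (plist p)) = inc (Lam p \<sigma>)" for \<sigma> :: "('a \<Rightarrow> real) sing_simplex"
      by (rule ext) (auto simp: sreal_def restrict_def comb_plist slh_def inc_def)
    ultimately show ?thesis
      unfolding lin_fun_add
      by (intro arg_cong2[of _ _ _ _ "(+)"] lin_cong) (auto simp: incc_def mp_mp mp_def[of "\<lambda>x. inc (Lam p x)"])
  qed
  finally have "c + incc (mp (Lam p) c) = boundary2 (Suc p) (?P p c)" using cyc by (cases "p = 0") auto
  moreover have "?P p c \<in> chain2_set (Suc p) (geometric_realization K)"
    using c supp sm by (intro chain2_set_lin chain2_set_mp slh_simplex[OF K]) (auto simp: chain2_set_def)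
  ultimately show ?thesis unfolding boundaries2_def by blast
qed

subsection \<open>The comparison\<close>

lemma single_sum: "Poly_Mapping.single x (\<Sum>i\<in>I. f i) = (\<Sum>i\<in>I. Poly_Mapping.single x (f i))"
  by (induction I rule: infinite_finite_induct) (simp_all add: single_add)

lemma augmentation2_eq: "augmentation2 z = lin (\<lambda>_. 1) z"
  unfolding augmentation2_def lin_def by (rule sum.cong) (simp_all add: lookup_keys)

lemma lin_const_sng: "lin (\<lambda>_. sng x) z = Poly_Mapping.single x (lin (\<lambda>_. 1) z)"
  unfolding lin_def single_sum by simp

lemma bd_sdn_elist_0: "lin (\<lambda>_. sng []) (sdn N (elist 0)) = (sng [] :: (nat \<Rightarrow> real) list \<Rightarrow>\<^sub>0 bit)"
proof -
  have "lin (\<lambda>_. sng []) (sdn N (elist 0)) = bd (sdn N (elist 0))"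
    unfolding bd_def
  proof (rule lin_cong)
    fix M assume "M \<in> keys (sdn N (elist 0))"
    then obtain x where "M = [x]" using sdn_elist_keys(2)[of M N 0] by (cases M) auto
    then show "sng [] = bdl M" by simp
  qed
  also have "\<dots> = sng []" by (simp add: bd_sdn elist_def)
  finally show ?thesis .
qed

text \<open>In degree 0 the augmentation becomes the coefficient of the empty list, so that reduced
  cycles correspond to cycles of the augmented complex.\<close>

lemma bd_Lam_Sd_0: "bd (mp (Lam 0) (Sd N 0 z)) = Poly_Mapping.single [] (augmentation2 z)"
proof -
  have *: "lin (\<lambda>_. sng []) (sdn N (elist 0)) = (sng [] :: 'b list \<Rightarrow>\<^sub>0 bit)"
    using bd_sdn_elist_0[of N] unfolding lin_const_sng by (metis lookup_single_eq)
  have "bd (mp (Lam 0) (Sd N 0 z)) = lin (\<lambda>\<sigma>. lin (\<lambda>_. sng []) (sdn N (elist 0))) z"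
    by (simp add: bd_Lam_0 Sd_def lin_lin lin_mp)
  then show ?thesis unfolding * by (simp add: lin_const_sng augmentation2_eq)
qed

lemma boundaries2_add:
  assumes "c \<in> boundaries2 p X" "d \<in> boundaries2 p X"
  shows "c + d \<in> boundaries2 p X"
proof -
  obtain c' d' where "c' \<in> chain2_set (Suc p) X" "d' \<in> chain2_set (Suc p) X"
    "c = boundary2 (Suc p) c'" "d = boundary2 (Suc p) d'"
    using assms unfolding boundaries2_def by blast
  then show ?thesis
    unfolding boundaries2_def using chain2_set_add[of c' "Suc p" X d'] by (metis boundary2_add imageI)
qed

lemma Sd_chain:
  assumes "c \<in> chain2_set p X"
  shows "Sd N p c \<in> chain2_set p X"
  unfolding Sd_def using assms
  by (intro chain2_set_lin chain2_set_mp piece_simplex[OF _ sdn_elist_keys]) (auto simp: chain2_set_def)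

lemma Sd_small:
  assumes "\<And>\<sigma> M. \<sigma> \<in> keys c \<Longrightarrow> M \<in> keys (sdn N (elist p)) \<Longrightarrow> small p (sreal \<sigma> M)"
  shows "\<sigma> \<in> keys (Sd N p c) \<Longrightarrow> small p \<sigma>"
  unfolding Sd_def by (elim keys_linE keys_mpE) (simp add: assms)

lemma on_Lam:
  assumes K: "simp_cx K" and c: "c \<in> chain2_set p (geometric_realization K)"
    and "\<And>\<sigma>. \<sigma> \<in> keys c \<Longrightarrow> small p \<sigma>"
  shows "on (insert {} K) (Suc p) (mp (Lam p) c)"
  unfolding on_def
proof
  fix L assume "L \<in> keys (mp (Lam p) c)"
  then obtain \<sigma> where \<sigma>: "\<sigma> \<in> keys c" "L = Lam p \<sigma>" by (rule keys_mpE)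
  then have "singular_simplex p (geometric_realization K) \<sigma>" using c by (auto simp: chain2_set_def)
  from small_Lam[OF K this assms(3)[OF \<sigma>(1)]] \<sigma>(2)
  show "set L \<in> insert {} K \<and> length L = Suc p" by simp
qed

text \<open>Surjectivity of the comparison: subdivide until all pieces are small, then slide each
  piece to the linear simplex on its corner labels.\<close>

theorem simplicial_representative:
  assumes K: "simp_cx K" and z: "z \<in> reduced_cycles2 p (geometric_realization K)"
  obtains z' where "on (insert {} K) (Suc p) z'" "bd z' = 0"
    "z + incc z' \<in> boundaries2 p (geometric_realization K)"
proof -
  let ?X = "geometric_realization K"
  have zc: "z \<in> chain2_set p ?X" using z by (simp add: reduced_cycles2_def)
  obtain N where N: "\<And>\<sigma> M. \<sigma> \<in> keys z \<Longrightarrow> M \<in> keys (sdn N (elist p)) \<Longrightarrow> small p (sreal \<sigma> M)"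
    using fine_subdivision[OF K zc] by blast
  let ?c = "Sd N p z"
  have c: "?c \<in> chain2_set p ?X" by (rule Sd_chain[OF zc])
  have sm: "\<sigma> \<in> keys ?c \<Longrightarrow> small p \<sigma>" for \<sigma> using Sd_small[OF N] by blast
  have cyc: "p = 0 \<or> boundary2 p z = 0" using z by (auto simp: reduced_cycles2_def split: if_splits)
  have cyc': "p = 0 \<or> boundary2 p ?c = 0"
    using cyc boundary2_Sd[of "p - 1" N z] by (cases p) (auto simp: Sd_def)
  have "z + ?c \<in> boundaries2 p ?X" by (rule Sd_homologous[OF zc cyc])
  moreover have "?c + incc (mp (Lam p) ?c) \<in> boundaries2 p ?X" by (rule Lam_homologous[OF K c sm cyc'])
  ultimately have "(z + ?c) + (?c + incc (mp (Lam p) ?c)) \<in> boundaries2 p ?X" by (rule boundaries2_add)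
  then have 1: "z + incc (mp (Lam p) ?c) \<in> boundaries2 p ?X" by (simp add: add.assoc)
  have 2: "bd (mp (Lam p) ?c) = 0"
  proof (cases p)
    case 0
    then show ?thesis using z by (simp add: bd_Lam_Sd_0 reduced_cycles2_def)
  next
    case (Suc q)
    then show ?thesis using cyc' by (simp add: bd_Lam)
  qed
  show thesis by (rule that[OF on_Lam[OF K c sm] 2 1])
qed

lemma inc_point:
  assumes "t \<in> standard_simplex p" "length L = Suc p" "finite (set L)"
  shows "inc L t \<in> closed_cell (set L)"
  using comb_unitv_cell[OF assms(1,2), of "set L"] assms by (simp add: inc_def sreal_def)

text \<open>Injectivity of the comparison. Subdividing and labelling a singular filling of
  \<open>incc z\<close> fills \<open>lin \<psi> z\<close> rather than \<open>z\<close>; the two are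
  homologous because \<open>\<psi>\<close> carries each simplex into itself.\<close>

theorem simplicial_boundary:
  assumes K: "simp_cx K" and z: "on (insert {} K) (Suc p) z" "bd z = 0"
    and b: "incc z \<in> boundaries2 p (geometric_realization K)"
  obtains d where "on (insert {} K) (Suc (Suc p)) d" "z = bd d"
proof -
  let ?X = "geometric_realization K"
  obtain c where c: "c \<in> chain2_set (Suc p) ?X" "incc z = boundary2 (Suc p) c"
    using b unfolding boundaries2_def by blast
  obtain N where N: "\<And>\<sigma> M. \<sigma> \<in> keys c \<Longrightarrow> M \<in> keys (sdn N (elist (Suc p))) \<Longrightarrow> small (Suc p) (sreal \<sigma> M)"
    using fine_subdivision[OF K c(1)] by blast
  define \<psi> where "\<psi> L = (if L = [] then sng [] else mp (Lam (length L - 1)) (Sd N (length L - 1) (sng (inc L))))"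
    for L :: "'a list"
  have \<psi>: "lin \<psi> x = mp (Lam q) (Sd N q (incc x))" if "\<And>L. L \<in> keys x \<Longrightarrow> length L = Suc q" for x q
  proof -
    have "lin \<psi> x = lin (\<lambda>L. mp (Lam q) (Sd N q (sng (inc L)))) x"
    proof (rule lin_cong)
      fix L assume "L \<in> keys x"
      then have "length L = Suc q" by (rule that)
      then show "\<psi> L = mp (Lam q) (Sd N q (sng (inc L)))" by (auto simp: \<psi>_def)
    qed
    then show ?thesis by (simp add: mp_lin Sd_def incc_def lin_mp)
  qed
  have cm: "bd (\<psi> L) = lin \<psi> (bdl L)" for L
  proof (cases L)
    case Nil
    then show ?thesis by (simp add: \<psi>_def)
  next
    case (Cons v L')
    show ?thesis
    proof (cases "L' = []")
      case True
      then show ?thesis using Cons by (simp add: \<psi>_def bd_Lam_Sd_0 augmentation2_eq)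
    next
      case False
      then obtain q where q: "length L = Suc (Suc q)" using Cons by (cases L') auto
      have "bd (\<psi> L) = mp (Lam q) (Sd N q (boundary2 (Suc q) (incc (sng L))))"
        using q Cons by (simp add: \<psi>_def bd_Lam boundary2_Sd incc_def)
      also have "\<dots> = mp (Lam q) (Sd N q (incc (bdl L)))"
        using q by (subst boundary2_incc) auto
      also have "\<dots> = lin \<psi> (bdl L)"
        by (rule \<psi>[symmetric]) (use q bdl_keys in fastforce)
      finally show ?thesis .
    qed
  qed
  obtain e where e: "on (insert {} K) (Suc (Suc p)) e" "z + lin \<psi> z = bd e"
  proof (rule carrier_homotopy[of "insert {} K" \<psi> set "insert {} K" "Suc p" z])
    fix L M assume L: "set L \<in> insert {} K" and M: "M \<in> keys (\<psi> L)"
    show "set M \<subseteq> set L \<and> length M = length L"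
    proof (cases "L = []")
      case True
      then show ?thesis using M by (simp add: \<psi>_def)
    next
      case False
      then obtain q where q: "length L = Suc q" by (cases L) auto
      have LK: "set L \<in> K" using L False by simp
      from M obtain E where E: "E \<in> keys (sdn N (elist q))" "M = Lam q (sreal (inc L) E)"
        using False q by (auto simp: \<psi>_def Sd_def elim!: keys_mpE)
      have "lab (sreal (inc L) E (unitv i)) \<in> set L" if "i < Suc q" for i
      proof -
        have u: "unitv i \<in> standard_simplex q" using unitv_simplex[of i q] that by simp
        let ?x = "inc L (comb E (unitv i))"
        have x: "?x \<in> closed_cell (set L)"
          by (rule inc_point[OF comb_in_simplex[OF sdn_elist_keys[OF E(1)] u] q]) simp
        have "0 < ?x (lab ?x)" by (rule lab(2)[OF K closed_cell_realization[OF LK x]])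
        then have "lab ?x \<in> set L" using x unfolding closed_cell_def by (metis (mono_tags, lifting) less_irrefl mem_Collect_eq)
        then show ?thesis using u sdn_elist_keys(2)[OF E(1)] by (simp add: sreal_def)
      qed
      then show ?thesis using q unfolding E(2) by (auto simp: Lam_def simp del: upt_Suc)
    qed
  next
    show "set M \<subseteq> set L" if "M \<in> keys (bdl L)" for L M :: "'a list" using bdl_keys[OF that] by simp
  next
    show "S \<in> insert {} K" if "set L \<in> insert {} K" "finite S" "S \<subseteq> set L" for L S
      using down_aug[OF K] that unfolding down_def by blast
  qed (use down_aug[OF K] cm z in \<open>auto simp: \<psi>_def\<close>)
  let ?f = "mp (Lam (Suc p)) (Sd N (Suc p) c)"
  have "lin \<psi> z = mp (Lam p) (Sd N p (incc z))"
    by (rule \<psi>) (use z in \<open>auto simp: on_def\<close>)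
  also have "\<dots> = bd ?f" unfolding c(2) bd_Lam boundary2_Sd ..
  finally have "z = bd (e + ?f)" using e(2) by (simp add: chain_add_eq_iff)
  moreover have "on (insert {} K) (Suc (Suc p)) ?f"
    using on_Lam[OF K Sd_chain[OF c(1)]] Sd_small[OF N] by blast
  ultimately show thesis using that[of "e + ?f"] e(1) on_add by blast
qed

lemma incc_cycle:
  assumes K: "simp_cx K" and z: "on (insert {} K) (Suc p) z" "bd z = 0"
  shows "incc z \<in> reduced_cycles2 p (geometric_realization K)"
proof (cases p)
  case 0
  have "lin (\<lambda>_. sng []) z = bd z"
    unfolding bd_def
  proof (rule lin_cong)
    fix L assume "L \<in> keys z"
    then obtain v where "L = [v]" using z 0 by (cases L) (auto simp: on_def)
    then show "sng [] = bdl L" by simp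
  qed
  then have "lin (\<lambda>_. sng []) (incc z) = (0 :: 'a list \<Rightarrow>\<^sub>0 bit)"
    using z by (simp add: incc_def lin_mp)
  then have "augmentation2 (incc z) = 0"
    unfolding lin_const_sng augmentation2_eq by (metis lookup_single_eq lookup_zero)
  then show ?thesis using incc_chain[OF K z(1)] 0 by (simp add: reduced_cycles2_def)
next
  case (Suc q)
  have "boundary2 p (incc z) = incc (bd z)"
    unfolding Suc by (rule boundary2_incc) (use z Suc in \<open>auto simp: on_def\<close>)
  then show ?thesis using incc_chain[OF K z(1)] Suc z by (simp add: reduced_cycles2_def)
qed

lemma incc_boundary:
  assumes K: "simp_cx K" and d: "on (insert {} K) (Suc (Suc p)) d"
  shows "incc (bd d) \<in> boundaries2 p (geometric_realization K)"
proof -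
  have "boundary2 (Suc p) (incc d) = incc (bd d)"
    by (rule boundary2_incc) (use d in \<open>auto simp: on_def\<close>)
  then show ?thesis
    using incc_chain[OF K d] unfolding boundaries2_def by (metis imageI)
qed

section \<open>Vietoris--Rips complexes of round spheres at small scales\<close>

subsection \<open>Homology of the cross-polytope\<close>

definition neg :: "('i \<Rightarrow> real) \<Rightarrow> 'i \<Rightarrow> real" where
  "neg x = (\<lambda>i. - x i)"

lemma neg_neg [simp]: "neg (neg x) = x"
  by (simp add: neg_def)

text \<open>The boundary of the cross-polytope in dimension \<open>m\<close>, a triangulated sphere
  of dimension \<open>m - 1\<close>, together with the empty simplex.\<close>

definition cross :: "nat \<Rightarrow> (nat \<Rightarrow> real) set set" where
  "cross m = {S. S \<subseteq> unitv ` {..<m} \<union> (neg \<circ> unitv) ` {..<m} \<and> (\<forall>x\<in>S. neg x \<notin> S)}"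

lemma cross_finite: "S \<in> cross m \<Longrightarrow> finite S"
  unfolding cross_def by (rule finite_subset[of S "unitv ` {..<m} \<union> (neg \<circ> unitv) ` {..<m}"]) auto

lemma down_cross: "down (cross m)"
  unfolding down_def cross_def by blast

lemma unitv_inj: "unitv i = unitv j \<longleftrightarrow> i = j"
  by (metis unitv_def zero_neq_one)

lemma unitv_neq_neg: "unitv i \<noteq> neg (unitv j)"
proof
  assume "unitv i = neg (unitv j)"
  then have "unitv i i = neg (unitv j) i" by simp
  then show False by (simp add: unitv_def neg_def split: if_splits)
qed

lemma neg_inj: "neg x = neg y \<longleftrightarrow> x = y"
  by (metis neg_neg)

lemma cross_Suc_iff: "S \<in> cross m \<longleftrightarrow> S \<in> cross (Suc m) \<and> unitv m \<notin> S \<and> neg (unitv m) \<notin> S"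
proof
  assume S: "S \<in> cross m"
  then have sub: "S \<subseteq> unitv ` {..<m} \<union> (neg \<circ> unitv) ` {..<m}" unfolding cross_def by blast
  have "unitv m \<notin> unitv ` {..<m} \<union> (neg \<circ> unitv) ` {..<m}"
    using unitv_neq_neg[of m] by (auto simp: unitv_inj)
  moreover have "neg (unitv m) \<notin> unitv ` {..<m} \<union> (neg \<circ> unitv) ` {..<m}"
    using unitv_neq_neg[of _ m] by (force simp: unitv_inj neg_inj)
  moreover have "S \<in> cross (Suc m)" using S unfolding cross_def by auto
  ultimately show "S \<in> cross (Suc m) \<and> unitv m \<notin> S \<and> neg (unitv m) \<notin> S" using sub by blast
next
  assume S: "S \<in> cross (Suc m) \<and> unitv m \<notin> S \<and> neg (unitv m) \<notin> S"
  then show "S \<in> cross m" unfolding cross_def lessThan_Suc by auto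
qed

lemma cross_insert:
  assumes "S \<in> cross (Suc m)" "neg (unitv m) \<notin> S"
  shows "insert (unitv m) S \<in> cross (Suc m)"
  using assms unitv_neq_neg[of m m] unfolding cross_def
  by (auto simp del: neg_neg) (metis neg_neg)+

lemma cross_insert_neg:
  assumes "S \<in> cross (Suc m)" "unitv m \<notin> S"
  shows "insert (neg (unitv m)) S \<in> cross (Suc m)"
  using assms unitv_neq_neg[of m m] unfolding cross_def
  by (auto simp del: neg_neg) (metis neg_neg)+

text \<open>The fundamental cycle as an iterated suspension, starting from the empty list; its lists
  have length \<open>m\<close>, that is, dimension \<open>m - 1\<close>.\<close>

primrec beta :: "nat \<Rightarrow> ((nat \<Rightarrow> real) list \<Rightarrow>\<^sub>0 bit)" where
  "beta 0 = sng []"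
| "beta (Suc m) = lcone (unitv m) (beta m) + lcone (neg (unitv m)) (beta m)"

lemma on_beta: "on (cross m) m (beta m)"
proof (induction m)
  case (Suc m)
  have "insert (unitv m) S \<in> cross (Suc m)" "insert (neg (unitv m)) S \<in> cross (Suc m)" if "S \<in> cross m" for S
    using that cross_Suc_iff[of S m] cross_insert cross_insert_neg by auto
  then show ?case using Suc by (auto intro!: on_add on_lcone[of "cross m"])
qed (simp add: cross_def)

lemma bd_beta [simp]: "bd (beta m) = 0"
proof (induction m)
  case (Suc m)
  then show ?case by (simp add: bd_lcone)
qed simp

lemma mp_neg_beta: "mp (map neg) (beta m) = beta m"
proof (induction m)
  case (Suc m)
  have "mp (map neg) (lcone x (beta m)) = lcone (neg x) (mp (map neg) (beta m))" for x
    by (simp add: lcone_def mp_mp)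
  then show ?case by (simp add: Suc add.commute)
qed simp

section \<open>Mayer-Vietoris for the two cones that make up a cross-polytope\<close>

definition flt :: "('x \<Rightarrow> bool) \<Rightarrow> ('x \<Rightarrow>\<^sub>0 bit) \<Rightarrow> ('x \<Rightarrow>\<^sub>0 bit)" where
  "flt P c = lin (\<lambda>x. if P x then sng x else 0) c"

lemma flt_split: "flt P c + flt (\<lambda>x. \<not> P x) c = c"
proof -
  have "flt P c + flt (\<lambda>x. \<not> P x) c = lin sng c"
    unfolding flt_def lin_fun_add[symmetric] by (rule lin_cong) simp
  then show ?thesis by simp
qed

lemma keys_flt: "x \<in> keys (flt P c) \<Longrightarrow> x \<in> keys c \<and> P x"
  unfolding flt_def by (erule keys_linE) (auto split: if_splits)

lemma cross_split:
  assumes z: "on (cross (Suc m)) p z"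
  obtains z1 z2 where "z = z1 + z2"
    "on {S \<in> cross (Suc m). neg (unitv m) \<notin> S} p z1" "on {S \<in> cross (Suc m). unitv m \<notin> S} p z2"
proof
  let ?P = "\<lambda>L. neg (unitv m) \<notin> set L"
  show "z = flt ?P z + flt (\<lambda>L. \<not> ?P L) z" by (simp only: flt_split)
  show "on {S \<in> cross (Suc m). neg (unitv m) \<notin> S} p (flt ?P z)"
    using z by (auto simp: on_def dest: keys_flt)
  show "on {S \<in> cross (Suc m). unitv m \<notin> S} p (flt (\<lambda>L. \<not> ?P L) z)"
    using z by (auto simp: on_def cross_def dest!: keys_flt)
qed

lemma cross_meet:
  assumes "on {S \<in> cross (Suc m). neg (unitv m) \<notin> S} p y" "on {S \<in> cross (Suc m). unitv m \<notin> S} p y"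
  shows "on (cross m) p y"
  using assms unfolding on_def cross_Suc_iff[of _ m] by auto

lemma down_half: "down {S \<in> cross (Suc m). x \<notin> S}"
  using down_cross[of "Suc m"] unfolding down_def by auto

lemma cross_cone:
  assumes "on {S \<in> cross (Suc m). neg x \<notin> S} p z" "bd z = 0" "x = unitv m \<or> x = neg (unitv m)"
  shows "z = bd (lcone x z)" "on (cross (Suc m)) (Suc p) (lcone x z)"
proof -
  show "z = bd (lcone x z)" using assms(2) by (simp add: bd_lcone)
  show "on (cross (Suc m)) (Suc p) (lcone x z)"
    by (rule on_lcone[OF assms(1)]) (use assms(3) cross_insert cross_insert_neg in auto)
qed

text \<open>Mayer-Vietoris by hand. Split \<open>z\<close> between the two cones; the common
  boundary of the halves is a cycle on the equator \<open>cross m\<close>, and by induction it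
  bounds there or is homologous to \<open>beta m\<close>. In the second case the suspension
  \<open>beta (Suc m)\<close> splits off.\<close>

lemma cross_cycles:
  "on (cross m) p z \<Longrightarrow> bd z = 0 \<Longrightarrow>
    \<exists>d. on (cross m) (Suc p) d \<and> (z = bd d \<or> p = m \<and> z = beta m + bd d)"
proof (induction m arbitrary: p z)
  case 0
  have L: "L = []" if "set L \<in> cross 0" for L using that by (auto simp: cross_def)
  show ?case
  proof (cases "z = 0")
    case False
    then have "keys z \<noteq> {}" by simp
    then obtain L where "L \<in> keys z" by blast
    then have "p = 0" using 0 L by (auto simp: on_def)
    have "z = lin sng z" by simp
    also have "\<dots> = lin (\<lambda>_. sng []) z" by (rule lin_cong) (use 0 L in \<open>auto simp: on_def\<close>)
    also have "\<dots> = Poly_Mapping.single [] (lin (\<lambda>_. 1) z)" by (rule lin_const_sng)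
    finally have "z = sng []" using False by (cases "lin (\<lambda>_. 1::bit) z") auto
    then show ?thesis using \<open>p = 0\<close> by (intro exI[of _ 0]) simp
  qed (intro exI[of _ 0], simp)
next
  case (Suc m)
  let ?A = "{S \<in> cross (Suc m). neg (unitv m) \<notin> S}" and ?B = "{S \<in> cross (Suc m). unitv m \<notin> S}"
  obtain z1 z2 where z: "z = z1 + z2" and z1: "on ?A p z1" and z2: "on ?B p z2"
    by (rule cross_split[OF Suc.prems(1)])
  have bd12: "bd z2 = bd z1" using Suc.prems(2) by (simp add: z chain_add_eq_0_iff)
  have AB: "on ?A p e" "on ?B p e" if "on (cross m) p e" for p e
    using that unfolding on_def cross_Suc_iff[of _ m] by auto
  \<comment> \<open>\<open>e\<close> fills what bounds on the equator, while \<open>w1\<close> and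
    \<open>w2\<close> account for a multiple of \<open>beta m\<close>. The corrected halves are
    cycles in cones, so each is the boundary of its own cone.\<close>
  have main: "\<exists>d. on (cross (Suc m)) (Suc p) d \<and> z = w1 + w2 + bd d"
    if w1: "on ?A p w1" and w2: "on ?B p w2" and e: "on (cross m) p e"
      and b1: "bd (z1 + w1 + e) = 0" and b2: "bd (z2 + w2 + e) = 0" for w1 w2 e
  proof -
    have 1: "on ?A p (z1 + w1 + e)" "on {S \<in> cross (Suc m). neg (neg (unitv m)) \<notin> S} p (z2 + w2 + e)"
      using w1 w2 z1 z2 AB[OF e] by (auto intro!: on_add)
    note c1 = cross_cone[OF 1(1) b1] and c2 = cross_cone[OF 1(2) b2]
    let ?d = "lcone (unitv m) (z1 + w1 + e) + lcone (neg (unitv m)) (z2 + w2 + e)"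
    have "bd ?d = (z1 + w1 + e) + (z2 + w2 + e)"
      using c1(1) c2(1) by (metis bd_add)
    then have "z = w1 + w2 + bd ?d" by (simp add: z ac_simps)
    then show ?thesis using c1(2) c2(2) by (blast intro: on_add)
  qed
  show ?case
  proof (cases p)
    case 0
    obtain d where "on (cross (Suc m)) (Suc p) d" "z = 0 + 0 + bd d"
      using main[of 0 0 0] on_0_length[of ?A z1] on_0_length[of ?B z2] z1 z2 0 by auto
    then show ?thesis by (intro exI[of _ d]) simp
  next
    case (Suc q)
    have "on ?A q (bd z1)" using z1 unfolding Suc by (rule on_bd[OF _ down_half])
    moreover have "on ?B q (bd z2)" using z2 unfolding Suc by (rule on_bd[OF _ down_half])
    then have "on ?B q (bd z1)" by (simp only: bd12)
    ultimately have "on (cross m) q (bd z1)" by (rule cross_meet)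
    from Suc.IH[OF this] obtain e where e: "on (cross m) p e"
      and "bd z1 = bd e \<or> q = m \<and> bd z1 = beta m + bd e" using Suc by auto
    then consider "bd z1 = bd e" | "q = m" "bd z1 = beta m + bd e" by blast
    then show ?thesis
    proof cases
      case 1
      then obtain d where "on (cross (Suc m)) (Suc p) d" "z = 0 + 0 + bd d"
        using main[of 0 0 e] e bd12 by auto
      then show ?thesis by (intro exI[of _ d]) simp
    next
      case 2
      let ?w1 = "lcone (unitv m) (beta m)" and ?w2 = "lcone (neg (unitv m)) (beta m)"
      have ins: "insert (unitv m) S \<in> ?A \<and> insert (neg (unitv m)) S \<in> ?B" if "S \<in> cross m" for S
        using that cross_Suc_iff[of S m] cross_insert[of S m] cross_insert_neg[of S m] unitv_neq_neg[of m m]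
        by (metis (mono_tags, lifting) insertE mem_Collect_eq)
      have "on ?A p ?w1" "on ?B p ?w2"
        unfolding \<open>p = Suc q\<close> 2(1) by (rule on_lcone[OF on_beta]; use ins in blast)+
      then obtain d where "on (cross (Suc m)) (Suc p) d" "z = ?w1 + ?w2 + bd d"
        using main[of ?w1 ?w2 e] e bd12 2 by (auto simp: bd_lcone ac_simps)
      then show ?thesis using 2 Suc by (intro exI[of _ d]) simp
    qed
  qed
qed

text \<open>Splitting a filling of the suspension between the cones leaves a chain common to both,
  hence on the equator, whose boundary is \<open>beta m\<close>; the induction hypothesis forbids
  this.\<close>

lemma cross_fundamental: "on (cross m) (Suc m) d \<Longrightarrow> beta m \<noteq> bd d"
proof (induction m arbitrary: d)
  case 0
  have "keys d = {}"
  proof (rule ccontr)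
    assume "keys d \<noteq> {}"
    then obtain L where "L \<in> keys d" by blast
    then have "set L \<in> cross 0" "length L = Suc 0" using 0 by (auto simp: on_def)
    then show False by (auto simp: cross_def)
  qed
  then have "bd d = 0" by simp
  moreover have "sng [] \<noteq> (0 :: (nat \<Rightarrow> real) list \<Rightarrow>\<^sub>0 bit)"
    by (metis lookup_single_eq lookup_zero zero_neq_one)
  ultimately show ?case by simp
next
  case (Suc m)
  let ?A = "{S \<in> cross (Suc m). neg (unitv m) \<notin> S}" and ?B = "{S \<in> cross (Suc m). unitv m \<notin> S}"
  show ?case
  proof
    assume eq: "beta (Suc m) = bd d"
    obtain d1 d2 where d: "d = d1 + d2" and d1: "on ?A (Suc (Suc m)) d1" and d2: "on ?B (Suc (Suc m)) d2"
      by (rule cross_split[OF Suc.prems])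
    let ?w1 = "lcone (unitv m) (beta m)" and ?w2 = "lcone (neg (unitv m)) (beta m)"
    have ins: "insert (unitv m) S \<in> ?A \<and> insert (neg (unitv m)) S \<in> ?B" if "S \<in> cross m" for S
      using that cross_Suc_iff[of S m] cross_insert[of S m] cross_insert_neg[of S m] unitv_neq_neg[of m m]
      by (metis (mono_tags, lifting) insertE mem_Collect_eq)
    have w: "on ?A (Suc m) ?w1" "on ?B (Suc m) ?w2"
      by (rule on_lcone[OF on_beta]; use ins in blast)+
    have k: "?w1 + bd d1 = ?w2 + bd d2"
    proof -
      have "(?w1 + bd d1) + (?w2 + bd d2) = (?w1 + ?w2) + bd d"
        by (simp add: d ac_simps)
      also have "\<dots> = 0" using eq by (simp only: beta.simps chain_add_self)
      finally show ?thesis by (simp only: chain_add_eq_0_iff)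
    qed
    have "on ?A (Suc m) (?w1 + bd d1)" by (rule on_add[OF w(1) on_bd[OF d1 down_half]])
    moreover have "on ?B (Suc m) (?w1 + bd d1)" unfolding k by (rule on_add[OF w(2) on_bd[OF d2 down_half]])
    ultimately have "on (cross m) (Suc m) (?w1 + bd d1)" by (rule cross_meet)
    moreover have "bd (?w1 + bd d1) = beta m" by (simp add: bd_lcone)
    ultimately show False using Suc.IH by metis
  qed
qed

subsection \<open>Inner products and hulls\<close>

definition ip :: "nat \<Rightarrow> (nat \<Rightarrow> real) \<Rightarrow> (nat \<Rightarrow> real) \<Rightarrow> real" where
  "ip n x y = (\<Sum>i\<le>n. x i * y i)"

lemma ip_commute: "ip n x y = ip n y x"
  by (simp add: ip_def mult.commute)

lemma ip_neg [simp]: "ip n (neg x) y = - ip n x y" "ip n x (neg y) = - ip n x y"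
  by (simp_all add: ip_def neg_def sum_negf)

lemma ip_nonneg: "0 \<le> ip n x x"
  unfolding ip_def by (rule sum_nonneg) simp

lemma ip_scale: "ip n (\<lambda>i. a * x i) y = a * ip n x y" "ip n x (\<lambda>i. a * y i) = a * ip n x y"
  by (simp_all add: ip_def sum_distrib_left mult_ac)

lemma ip_unitv: "i \<le> n \<Longrightarrow> ip n x (unitv i) = x i"
proof -
  assume "i \<le> n"
  have "ip n x (unitv i) = (\<Sum>j\<le>n. if j = i then x j else 0)"
    unfolding ip_def by (rule sum.cong) (auto simp: unitv_def)
  then show ?thesis using \<open>i \<le> n\<close> by simp
qed

lemma ip_bary: "L \<noteq> [] \<Longrightarrow> ip n u (bary L) = (\<Sum>j<length L. ip n u (L ! j)) / real (length L)"
  unfolding ip_def bary_def sum_divide_distrib sum_distrib_left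
  by (subst sum.swap) (simp add: sum_divide_distrib)

lemma ip_polar: "ip n (\<lambda>i. x i - y i) (\<lambda>i. x i - y i) = ip n x x + ip n y y - 2 * ip n x y"
  by (simp add: ip_def algebra_simps sum.distrib sum_subtractf sum_distrib_left)

lemma ip_cauchy: "ip n x y \<le> sqrt (ip n x x) * sqrt (ip n y y)"
proof -
  have "(ip n x y)\<^sup>2 \<le> ip n x x * ip n y y"
    using Cauchy_Schwarz_ineq_sum[of x y "{..n}"] by (simp add: ip_def power2_eq_square)
  then have "\<bar>ip n x y\<bar> \<le> sqrt (ip n x x * ip n y y)" by (intro real_le_rsqrt) simp
  then show ?thesis by (simp add: real_sqrt_mult)
qed

lemma hul_ip_gt:
  assumes "x \<in> hul S" "\<And>y. y \<in> S \<Longrightarrow> c < ip n u y"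
  shows "c < ip n u x"
proof -
  have "hul S \<subseteq> {x. c < ip n u x}"
  proof (rule hul_closed)
    fix L assume L: "L \<noteq> []" "set L \<subseteq> {x. c < ip n u x}"
    have "(\<Sum>j<length L. c) < (\<Sum>j<length L. ip n u (L ! j))"
      by (rule sum_strict_mono) (use L(1) subsetD[OF L(2) nth_mem] in auto)
    then show "bary L \<in> {x. c < ip n u x}"
      using L(1) by (simp add: ip_bary divide_simps mult.commute)
  qed (use assms in auto)
  then show ?thesis using assms(1) by blast
qed

lemma hul_ip_le:
  assumes "x \<in> hul S" "\<And>y. y \<in> S \<Longrightarrow> ip n u y \<le> c"
  shows "ip n u x \<le> c"
proof -
  have "hul S \<subseteq> {x. ip n u x \<le> c}"
  proof (rule hul_closed)
    fix L assume L: "L \<noteq> []" "set L \<subseteq> {x. ip n u x \<le> c}"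
    have "(\<Sum>j<length L. ip n u (L ! j)) \<le> (\<Sum>j<length L. c)"
      by (rule sum_mono) (use L(1) subsetD[OF L(2) nth_mem] in auto)
    then show "bary L \<in> {x. ip n u x \<le> c}"
      using L(1) by (simp add: ip_bary divide_simps mult.commute)
  qed (use assms in auto)
  then show ?thesis using assms(1) by blast
qed

definition vecs :: "nat \<Rightarrow> (nat \<Rightarrow> real) set" where
  "vecs n = {x. \<forall>i>n. x i = 0}"

lemma hul_vecs: "S \<subseteq> vecs n \<Longrightarrow> hul S \<subseteq> vecs n"
proof (rule hul_closed)
  fix L :: "(nat \<Rightarrow> real) list" assume "L \<noteq> []" "set L \<subseteq> vecs n"
  then have "\<And>j i. j < length L \<Longrightarrow> i > n \<Longrightarrow> (L ! j) i = 0"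
    using nth_mem unfolding vecs_def by blast
  then show "bary L \<in> vecs n" by (simp add: vecs_def bary_def)
qed

definition nz :: "nat \<Rightarrow> real \<Rightarrow> (nat \<Rightarrow> real) \<Rightarrow> nat \<Rightarrow> real" where
  "nz n R x = (\<lambda>i. R / sqrt (ip n x x) * x i)"

lemma round_sphere_ip: "x \<in> round_sphere n R \<longleftrightarrow> ip n x x = R\<^sup>2 \<and> x \<in> vecs n"
  by (simp add: round_sphere_def ip_def vecs_def power2_eq_square)

lemma nz_sphere: "x \<in> vecs n \<Longrightarrow> 0 < ip n x x \<Longrightarrow> nz n R x \<in> round_sphere n R"
  unfolding round_sphere_ip nz_def ip_scale by (simp add: vecs_def power2_eq_square)

lemma nz_id: "x \<in> round_sphere n R \<Longrightarrow> R > 0 \<Longrightarrow> nz n R x = x"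
  unfolding round_sphere_ip nz_def by simp

lemma nz_neg: "nz n R (neg x) = neg (nz n R x)"
  by (simp add: nz_def neg_def ip_def)

lemma bary_neg: "L \<noteq> [] \<Longrightarrow> bary (map neg L) = neg (bary L)"
  by (rule ext) (simp add: bary_def neg_def sum_negf)

subsection \<open>Three complexes\<close>

text \<open>The Vietoris--Rips complex at scale \<open>r\<close> when \<open>c = cos (r / R)\<close>
  (\<open>vr_sphere\<close>), in the augmented form with the empty simplex.\<close>

definition sph :: "nat \<Rightarrow> real \<Rightarrow> real \<Rightarrow> (nat \<Rightarrow> real) set set" where
  "sph n R c = {S. finite S \<and> S \<subseteq> round_sphere n R \<and> (\<forall>x\<in>S. \<forall>y\<in>S. R\<^sup>2 * c < ip n x y)}"

text \<open>The common home of the comparison. It contains the cross-polytope and, for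
  \<open>c \<ge> 0\<close>, each \<open>sph n R c\<close>; a half-space is convex and stable under
  radial projection; and any of its simplices becomes arbitrarily fine on the sphere after
  subdivision and projection.\<close>

definition hsp :: "nat \<Rightarrow> (nat \<Rightarrow> real) set set" where
  "hsp n = {S. finite S \<and> S \<subseteq> vecs n \<and> (\<exists>u. \<forall>x\<in>S. 0 < ip n u x)}"

lemma down_sph: "down (sph n R c)"
  unfolding down_def sph_def using finite_subset by blast

lemma down_hsp: "down (hsp n)"
  unfolding down_def hsp_def using finite_subset by blast

lemma sph_hsp: "0 \<le> c \<Longrightarrow> sph n R c \<subseteq> hsp n"
proof
  fix S assume c: "0 \<le> c" and S: "S \<in> sph n R c"
  have "\<exists>u. \<forall>x\<in>S. 0 < ip n u x"
  proof (cases "S = {}")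
    case False
    then obtain u where "u \<in> S" by auto
    then have "\<forall>x\<in>S. R\<^sup>2 * c < ip n u x" using S by (auto simp: sph_def)
    moreover have "0 \<le> R\<^sup>2 * c" using c by simp
    ultimately show ?thesis by (meson le_less_trans)
  qed auto
  then show "S \<in> hsp n" using S by (auto simp: sph_def hsp_def round_sphere_ip)
qed

lemma cross_hsp: "cross (Suc n) \<subseteq> hsp n"
proof
  fix S assume S: "S \<in> cross (Suc n)"
  \<comment> \<open>Distinct vertices of a simplex of the cross-polytope are orthogonal, so their
    sum has inner product 1 with each of them.\<close>
  let ?u = "\<lambda>i. \<Sum>v\<in>S. v i"
  have fin: "finite S" by (rule cross_finite[OF S])
  have form: "\<exists>i\<le>n. x = unitv i \<or> x = neg (unitv i)" if "x \<in> S" for x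
  proof -
    have "x \<in> unitv ` {..<Suc n} \<union> (neg \<circ> unitv) ` {..<Suc n}" using S that unfolding cross_def by blast
    then show ?thesis by (auto simp: less_Suc_eq_le)
  qed
  have "0 < ip n ?u x" if x: "x \<in> S" for x
  proof -
    have "ip n ?u x = (\<Sum>v\<in>S. ip n v x)"
      unfolding ip_def sum_distrib_right by (rule sum.swap)
    also have "\<dots> = (\<Sum>v\<in>S. if v = x then 1 else 0)"
    proof (rule sum.cong)
      fix v assume v: "v \<in> S"
      have "neg x \<noteq> v" using S x v unfolding cross_def by blast
      with form[OF x] form[OF v] show "ip n v x = (if v = x then 1 else 0)"
        by (auto simp: ip_unitv unitv_inj neg_inj) (auto simp: unitv_def neg_def)
    qed simp
    also have "\<dots> = 1" using x fin by simp
    finally show ?thesis by simp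
  qed
  moreover have "S \<subseteq> vecs n"
    using form by (force simp: vecs_def unitv_def neg_def)
  ultimately show "S \<in> hsp n" using fin unfolding hsp_def by blast
qed

definition sub :: "nat \<Rightarrow> real \<Rightarrow> nat \<Rightarrow> (nat \<Rightarrow> real) list \<Rightarrow> ((nat \<Rightarrow> real) list \<Rightarrow>\<^sub>0 bit)" where
  "sub n R N L = mp (map (nz n R)) (sdn N L)"

lemma sub_Nil [simp]: "sub n R N [] = sng []"
  by (simp add: sub_def)

lemma bd_sub: "bd (sub n R N L) = lin (sub n R N) (bdl L)"
  unfolding sub_def by (simp add: bd_mp bd_sdn mp_lin)

lemma bd_lin_sub: "bd (lin (sub n R N) c) = lin (sub n R N) (bd c)"
  unfolding bd_lin bd_sub unfolding bd_def by (simp add: lin_lin)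

lemma sub_keys: "M \<in> keys (sub n R N L) \<Longrightarrow> set M \<subseteq> nz n R ` hul (set L) \<and> length M = length L"
  unfolding sub_def by (elim keys_mpE) (use sdn_keys in fastforce)

lemma sub_neg: "lin (sub n R N) (mp (map neg) c) = mp (map neg) (lin (sub n R N) c)"
proof -
  have "sub n R N (map neg L) = mp (map neg) (sub n R N L)" for L
    unfolding sub_def by (simp add: sdn_map bary_neg mp_mp nz_neg o_def)
  then show ?thesis by (simp add: lin_mp mp_lin)
qed

text \<open>Points of the hull have norm at most \<open>R\<close>, and their inner products stay
  above \<open>R\<^sup>2 * c\<close>. As these are positive, radial projection to the sphere can
  only increase them; so the projected hull of a simplex is again a full carrier in
  \<open>sph n R c\<close>.\<close>

lemma sub_sph_homologous:
  assumes R: "R > 0" and c: "0 \<le> c" and z: "on (sph n R c) p z" "bd z = 0"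
  obtains d where "on (sph n R c) (Suc p) d" "z + lin (sub n R N) z = bd d"
proof (rule carrier_homotopy[of "sph n R c" "sub n R N" "\<lambda>L. nz n R ` hul (set L)" "sph n R c" p z])
  fix L assume L: "set L \<in> sph n R c"
  have Ls: "x \<in> round_sphere n R" "ip n x x = R\<^sup>2" "x \<in> vecs n" if "x \<in> set L" for x
    using L that by (auto simp: sph_def round_sphere_ip)
  show "set L \<subseteq> nz n R ` hul (set L)"
    using nz_id[OF Ls(1) R] hul_base by (metis image_eqI subsetI)
  have gt: "R\<^sup>2 * c < ip n x y" if "x \<in> hul (set L)" "y \<in> hul (set L)" for x y
  proof -
    have "R\<^sup>2 * c < ip n v y" if "v \<in> set L" for v
      by (rule hul_ip_gt[OF \<open>y \<in> hul (set L)\<close>]) (use L that in \<open>auto simp: sph_def\<close>)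
    then show ?thesis
      by (subst ip_commute) (rule hul_ip_gt[OF that(1)], simp add: ip_commute)
  qed
  have le: "ip n x y \<le> R\<^sup>2" if "x \<in> hul (set L)" "y \<in> hul (set L)" for x y
  proof -
    have "ip n v w \<le> R\<^sup>2" if "v \<in> set L" "w \<in> set L" for v w
      using ip_cauchy[of n v w] Ls[OF that(1)] Ls[OF that(2)] R by (simp add: power2_eq_square)
    then have "ip n v y \<le> R\<^sup>2" if "v \<in> set L" for v
      by (intro hul_ip_le[OF \<open>y \<in> hul (set L)\<close>]) (use that in auto)
    then show ?thesis
      by (subst ip_commute) (rule hul_ip_le[OF that(1)], simp add: ip_commute)
  qed
  show "S \<in> sph n R c" if S: "finite S" "S \<subseteq> nz n R ` hul (set L)" for S
  proof -
    have c0: "0 \<le> R\<^sup>2 * c" using c by simp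
    have pos: "0 < ip n x x" if "x \<in> hul (set L)" for x using gt[OF that that] c0 by linarith
    have vecs: "hul (set L) \<subseteq> vecs n" using Ls by (intro hul_vecs) auto
    have "R\<^sup>2 * c < ip n (nz n R x) (nz n R y)" if "x \<in> hul (set L)" "y \<in> hul (set L)" for x y
    proof -
      let ?a = "sqrt (ip n x x)" and ?b = "sqrt (ip n y y)"
      have ab: "0 < ?a" "0 < ?b" using pos that by auto
      have "?a \<le> R" "?b \<le> R" using le that R by (auto intro!: real_le_lsqrt ip_nonneg simp: power2_eq_square)
      then have "?a * ?b \<le> R\<^sup>2" using ab R by (simp add: power2_eq_square mult_mono)
      then have "1 \<le> R\<^sup>2 / (?a * ?b)" using ab by (simp add: divide_simps)
      moreover have "0 < ip n x y" using gt[OF that] c0 by linarith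
      ultimately have "ip n x y \<le> R\<^sup>2 / (?a * ?b) * ip n x y"
        using mult_right_mono[of 1 "R\<^sup>2 / (?a * ?b)" "ip n x y"] by simp
      moreover have "ip n (nz n R x) (nz n R y) = R\<^sup>2 / (?a * ?b) * ip n x y"
        unfolding nz_def ip_scale by (simp add: power2_eq_square)
      ultimately show ?thesis using gt[OF that] by linarith
    qed
    moreover have "nz n R x \<in> round_sphere n R" if "x \<in> hul (set L)" for x
      using nz_sphere pos[OF that] vecs that by blast
    ultimately show ?thesis using S unfolding sph_def by blast
  qed
next
  show "nz n R ` hul (set M) \<subseteq> nz n R ` hul (set L)" if "M \<in> keys (bdl L)" for L M
    using bdl_keys[OF that] by (intro image_mono hul_mono) auto
qed (use down_sph z that bd_sub sub_keys in auto)

lemma sub_hsp_homologous: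
  assumes R: "R > 0" and z: "on (hsp n) p z" "bd z = 0"
  obtains d where "on (hsp n) (Suc p) d" "z + lin (sub n R N) z = bd d"
proof (rule carrier_homotopy[of "hsp n" "sub n R N" "\<lambda>L. hul (set L) \<union> nz n R ` hul (set L)" "hsp n" p z])
  fix L assume L: "set L \<in> hsp n"
  then obtain u where u: "\<forall>x\<in>set L. 0 < ip n u x" by (auto simp: hsp_def)
  have pos: "0 < ip n u x" if "x \<in> hul (set L)" for x
    by (rule hul_ip_gt[OF that]) (use u in auto)
  have vecs: "hul (set L) \<subseteq> vecs n" using L by (intro hul_vecs) (auto simp: hsp_def)
  show "S \<in> hsp n" if S: "finite S" "S \<subseteq> hul (set L) \<union> nz n R ` hul (set L)" for S
  proof -
    have "0 < ip n u (nz n R x)" if "x \<in> hul (set L)" for x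
    proof -
      have "ip n u x \<le> sqrt (ip n u u) * sqrt (ip n x x)" by (rule ip_cauchy)
      then have "0 < ip n x x" using pos[OF that] ip_nonneg[of n x] by (cases "ip n x x = 0") auto
      then show ?thesis unfolding nz_def ip_scale using R pos[OF that] by simp
    qed
    moreover have "nz n R x \<in> vecs n" if "x \<in> hul (set L)" for x
      using vecs that by (auto simp: nz_def vecs_def)
    ultimately have "\<forall>x\<in>S. 0 < ip n u x" "S \<subseteq> vecs n" using S(2) pos vecs by blast+
    then show ?thesis using S(1) unfolding hsp_def by blast
  qed
  show "set L \<subseteq> hul (set L) \<union> nz n R ` hul (set L)" using subset_hul by blast
  show "set M \<subseteq> hul (set L) \<union> nz n R ` hul (set L) \<and> length M = length L" if "M \<in> keys (sub n R N L)" for M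
    using sub_keys[OF that] by blast
next
  show "hul (set M) \<union> nz n R ` hul (set M) \<subseteq> hul (set L) \<union> nz n R ` hul (set L)" if "M \<in> keys (bdl L)" for L M
    using bdl_keys[OF that] hul_mono[of "set M" "set L"] by blast
qed (use down_hsp z that bd_sub in auto)

lemma finite_mesh:
  assumes "finite S" "S \<subseteq> vecs n"
  obtains B where "mesh B S"
proof
  define b where "b = (\<Sum>x\<in>S. \<Sum>i\<le>n. \<bar>x i\<bar>)"
  have *: "\<bar>x i\<bar> \<le> b" if x: "x \<in> S" for x i
  proof -
    have "\<bar>x i\<bar> \<le> (\<Sum>i\<le>n. \<bar>x i\<bar>)"
    proof (cases "i \<le> n")
      case True
      then show ?thesis by (intro member_le_sum) auto
    next
      case False
      then have "x i = 0" using assms x by (auto simp: vecs_def)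
      then show ?thesis by (simp add: sum_nonneg)
    qed
    also have "\<dots> \<le> b"
      unfolding b_def by (rule member_le_sum[OF x]) (use assms in \<open>auto intro: sum_nonneg\<close>)
    finally show ?thesis .
  qed
  have "\<bar>x i - y i\<bar> \<le> 2 * b" if "x \<in> S" "y \<in> S" for x y i
    using *[OF that(1), of i] *[OF that(2), of i] by linarith
  then show "mesh (2 * b) S" by (simp add: mesh_def)
qed

lemma sub_fine_list:
  assumes R: "R > 0" and c: "c < 1" and L: "set L \<in> hsp n"
  obtains N0 where "\<And>N. N \<ge> N0 \<Longrightarrow> on (sph n R c) (length L) (sub n R N L)"
proof (cases "L = []")
  case True
  then show ?thesis using that[of 0] by (simp add: sph_def)
next
  case False
  then obtain p where p: "length L = Suc p" by (cases L) auto
  from L obtain u where u: "\<forall>x\<in>set L. 0 < ip n u x" by (auto simp: hsp_def)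
  define k where "k = Min (ip n u ` set L) / 2"
  have k: "0 < k" using u False by (simp add: k_def)
  have ku: "k < ip n u x" if "x \<in> hul (set L)" for x
  proof (rule hul_ip_gt[OF that])
    fix y assume y: "y \<in> set L"
    then have "Min (ip n u ` set L) \<le> ip n u y" by simp
    moreover have "0 < ip n u y" using u y by blast
    ultimately show "k < ip n u y" unfolding k_def by linarith
  qed
  define su where "su = sqrt (ip n u u)"
  have suk: "k < su * sqrt (ip n x x)" if "x \<in> hul (set L)" for x
    using ku[OF that] ip_cauchy[of n u x] unfolding su_def by linarith
  have su: "0 < su"
  proof -
    obtain x where "x \<in> set L" using False by (cases L) auto
    then have "k < su * sqrt (ip n x x)" using suk hul_base by blast
    moreover have "0 \<le> su" by (simp add: su_def ip_nonneg)
    ultimately show ?thesis using k by (cases "su = 0") auto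
  qed
  \<comment> \<open>By Cauchy-Schwarz a lower bound for the norm on the whole hull, which keeps the
    radial projection under control.\<close>
  define k0 where "k0 = k / su"
  have k0: "0 < k0" using k su by (simp add: k0_def)
  have nrm: "k0 < sqrt (ip n x x)" if "x \<in> hul (set L)" for x
    using suk[OF that] su by (simp add: k0_def divide_simps mult.commute)
  \<comment> \<open>Mesh \<open>e\<close> forces squared distance at most
    \<open>k0\<^sup>2 * (1 - c)\<close>, which is less than \<open>1 - c\<close> times the product
    of the two norms; hence the cosine of the angle exceeds \<open>c\<close>.\<close>
  define e where "e = sqrt (k0\<^sup>2 * (1 - c) / (real n + 1))"
  have e: "0 < e" "(real n + 1) * e\<^sup>2 = k0\<^sup>2 * (1 - c)"
    using k0 c by (simp_all add: e_def)
  obtain B where B: "mesh B (set L)"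
    using finite_mesh[of "set L" n] L by (auto simp: hsp_def)
  obtain N0 where N0: "\<And>N L M. N \<ge> N0 \<Longrightarrow> length L = Suc p \<Longrightarrow> mesh B (set L) \<Longrightarrow>
      M \<in> keys (sdn N L) \<Longrightarrow> mesh e (set (M :: (nat \<Rightarrow> real) list))"
    using sdn_fine[OF e(1), of p B] by blast
  have vecs: "hul (set L) \<subseteq> vecs n" using L by (intro hul_vecs) (auto simp: hsp_def)
  show ?thesis
  proof (rule that)
    fix N assume N: "N \<ge> N0"
    show "on (sph n R c) (length L) (sub n R N L)"
      unfolding on_def
    proof
      fix M assume "M \<in> keys (sub n R N L)"
      then obtain M' where M': "M' \<in> keys (sdn N L)" "M = map (nz n R) M'"
        unfolding sub_def by (rule keys_mpE)
      have m: "mesh e (set M')" by (rule N0[OF N p B M'(1)])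
      have hM: "set M' \<subseteq> hul (set L)" "length M' = length L" using sdn_keys[OF M'(1)] by auto
      have "R\<^sup>2 * c < ip n (nz n R x) (nz n R y)" if xy: "x \<in> set M'" "y \<in> set M'" for x y
      proof -
        let ?a = "sqrt (ip n x x)" and ?b = "sqrt (ip n y y)"
        have ab: "k0 < ?a" "k0 < ?b" using nrm hM xy by auto
        have k2: "k0\<^sup>2 < ?a * ?b"
          unfolding power2_eq_square by (rule mult_strict_mono'[OF ab]) (use k0 in simp_all)
        have "ip n (\<lambda>i. x i - y i) (\<lambda>i. x i - y i) \<le> (\<Sum>i\<le>n. e\<^sup>2)"
          unfolding ip_def
        proof (rule sum_mono)
          fix i
          have "\<bar>x i - y i\<bar> \<le> e" using m xy unfolding mesh_def by blast
          then have "(x i - y i)\<^sup>2 \<le> e\<^sup>2" by (rule abs_le_square_iff[THEN iffD1, OF order_trans]) simp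
          then show "(x i - y i) * (x i - y i) \<le> e\<^sup>2" by (simp add: power2_eq_square)
        qed
        then have q: "ip n x x + ip n y y - 2 * ip n x y \<le> k0\<^sup>2 * (1 - c)"
          unfolding ip_polar using e(2) by (simp add: algebra_simps)
        have "0 \<le> (?a - ?b)\<^sup>2" by simp
        then have "2 * (?a * ?b) \<le> ip n x x + ip n y y"
          by (simp add: power2_diff ip_nonneg)
        moreover have "k0\<^sup>2 * (1 - c) < ?a * ?b * (1 - c)"
          using k2 c by (intro mult_strict_right_mono) auto
        moreover have pos: "0 < ?a * ?b" using k2 k0 by (meson less_trans zero_less_power)
        moreover have "0 < ?a * ?b * (1 - c)" using pos c by simp
        ultimately have "c * (?a * ?b) < ip n x y" using q by (simp add: algebra_simps)
        then have "c < ip n x y / (?a * ?b)" using pos by (simp add: divide_simps)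
        then have "R\<^sup>2 * c < R\<^sup>2 * (ip n x y / (?a * ?b))" using R by (intro mult_strict_left_mono) auto
        moreover have "ip n (nz n R x) (nz n R y) = R\<^sup>2 * (ip n x y / (?a * ?b))"
          unfolding nz_def ip_scale by (simp add: power2_eq_square)
        ultimately show ?thesis by simp
      qed
      moreover have "nz n R x \<in> round_sphere n R" if "x \<in> set M'" for x
      proof (rule nz_sphere)
        have "k0 < sqrt (ip n x x)" using nrm hM that by blast
        then show "0 < ip n x x" using k0 by (metis less_trans real_sqrt_gt_0_iff)
        show "x \<in> vecs n" using vecs hM that by blast
      qed
      ultimately show "set M \<in> sph n R c \<and> length M = length L"
        using hM unfolding M'(2) sph_def by auto
    qed
  qed
qed

lemma sub_fine:
  assumes R: "R > 0" and c: "c < 1" and z: "on (hsp n) p z"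
  obtains N0 where "\<And>N. N \<ge> N0 \<Longrightarrow> on (sph n R c) p (lin (sub n R N) z)"
proof -
  have "\<exists>N0. \<forall>N\<ge>N0. on (sph n R c) p (sub n R N L)" if "L \<in> keys z" for L
  proof -
    have "set L \<in> hsp n" "length L = p" using z that by (auto simp: on_def)
    then show ?thesis using sub_fine_list[OF R c, of L n] by metis
  qed
  then have "\<exists>N0. \<forall>L\<in>keys z. \<forall>N\<ge>N0 L. on (sph n R c) p (sub n R N L)"
    by (intro bchoice ballI)
  then obtain N0 where N0: "\<forall>L\<in>keys z. \<forall>N\<ge>N0 L. on (sph n R c) p (sub n R N L)" by blast
  show thesis
  proof (rule that)
    fix N assume N: "N \<ge> Max (N0 ` keys z)"
    show "on (sph n R c) p (lin (sub n R N) z)"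
    proof (rule on_lin)
      fix L assume L: "L \<in> keys z"
      then have "N0 L \<le> N" using N by (intro order_trans[OF Max_ge N]) auto
      then show "on (sph n R c) p (sub n R N L)" using N0 L by blast
    qed
  qed
qed

subsection \<open>Rounding to the vertices of the cross-polytope\<close>

definition peak :: "nat \<Rightarrow> (nat \<Rightarrow> real) \<Rightarrow> nat \<Rightarrow> bool" where
  "peak n x i \<longleftrightarrow> i \<le> n \<and> (\<forall>j\<le>n. \<bar>x j\<bar> \<le> \<bar>x i\<bar>)"

definition lam :: "nat \<Rightarrow> (nat \<Rightarrow> real) \<Rightarrow> nat \<Rightarrow> real" where
  "lam n x = (let i = SOME i. peak n x i in if 0 < x i then unitv i else neg (unitv i))"

lemma lam:
  obtains i where "peak n x i" "lam n x = (if 0 < x i then unitv i else neg (unitv i))"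
proof -
  have "\<exists>i. peak n x i"
  proof -
    have "Max ((\<lambda>j. \<bar>x j\<bar>) ` {..n}) \<in> (\<lambda>j. \<bar>x j\<bar>) ` {..n}" by (rule Max_in) auto
    then obtain i where i: "Max ((\<lambda>j. \<bar>x j\<bar>) ` {..n}) = \<bar>x i\<bar>" "i \<in> {..n}" by (rule imageE)
    have "\<bar>x j\<bar> \<le> \<bar>x i\<bar>" if "j \<le> n" for j
      unfolding i(1)[symmetric] by (rule Max_ge) (use that in auto)
    then show ?thesis unfolding peak_def using i(2) by blast
  qed
  then have "peak n x (SOME i. peak n x i)" by (rule someI_ex)
  then show thesis by (rule that) (simp add: lam_def Let_def)
qed

lemma peak_big:
  assumes "x \<in> round_sphere n R" "peak n x i"
  shows "R\<^sup>2 \<le> (real n + 1) * (x i)\<^sup>2"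
proof -
  have "R\<^sup>2 = (\<Sum>j\<le>n. (x j)\<^sup>2)" using assms by (simp add: round_sphere_def)
  also have "\<dots> \<le> (\<Sum>j\<le>n. (x i)\<^sup>2)"
    by (rule sum_mono) (use assms in \<open>simp add: peak_def abs_le_square_iff\<close>)
  finally show ?thesis by (simp add: algebra_simps)
qed

text \<open>Two points this close have squared distance below
  \<open>R\<^sup>2 / (4 (n + 1))\<close>, at most a quarter of the square of a peak coordinate by
  \<open>peak_big\<close>; so that coordinate cannot change sign between them.\<close>

definition tight :: "nat \<Rightarrow> real" where
  "tight n = 1 - 1 / (8 * (real n + 1))"

lemma tight: "0 \<le> tight n" "tight n < 1"
  by (simp_all add: tight_def divide_simps)

lemma peak_near:
  assumes x: "x \<in> round_sphere n R" and y: "y \<in> round_sphere n R" and R: "R > 0"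
    and near: "R\<^sup>2 * tight n < ip n x y" and i: "peak n x i"
  shows "0 < x i * y i"
proof -
  have "(x i - y i) * (x i - y i) \<le> ip n (\<lambda>i. x i - y i) (\<lambda>i. x i - y i)"
    unfolding ip_def by (rule member_le_sum) (use i in \<open>auto simp: peak_def\<close>)
  also have "\<dots> = 2 * R\<^sup>2 - 2 * ip n x y"
    using x y unfolding ip_polar by (simp add: round_sphere_ip)
  also have "\<dots> < 2 * R\<^sup>2 * (1 / (8 * (real n + 1)))"
    using near by (simp add: tight_def algebra_simps)
  also have "\<dots> \<le> 2 * ((real n + 1) * (x i)\<^sup>2) * (1 / (8 * (real n + 1)))"
    using peak_big[OF x i] by (intro mult_right_mono) auto
  also have "\<dots> = (x i)\<^sup>2 / 4" by (simp add: divide_simps)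
  finally have *: "4 * ((x i - y i) * (x i - y i)) < (x i)\<^sup>2" by simp
  have "(x i)\<^sup>2 + (y i)\<^sup>2 - 2 * (x i * y i) = (x i - y i) * (x i - y i)"
    by (simp add: power2_eq_square algebra_simps)
  with * have "4 * (x i)\<^sup>2 + 4 * (y i)\<^sup>2 - 8 * (x i * y i) < (x i)\<^sup>2" by linarith
  moreover have "0 \<le> (x i)\<^sup>2" "0 \<le> (y i)\<^sup>2" by simp_all
  ultimately show ?thesis by linarith
qed

text \<open>A peak coordinate of one point has the same sign at all points of \<open>S\<close>
  (\<open>peak_near\<close>). Hence no two roundings are antipodal, and any point of
  \<open>S\<close> has positive product with all points of \<open>S\<close> and all their
  roundings.\<close>

lemma lam_cross:
  assumes S: "S \<in> sph n R (tight n)" and R: "R > 0"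
  shows "lam n ` S \<in> cross (Suc n)" "S \<union> lam n ` S \<in> hsp n"
proof -
  have near: "0 < x i * y i" if "x \<in> S" "y \<in> S" "peak n x i" for x y i
    by (rule peak_near[OF _ _ R _ that(3)]) (use S that in \<open>auto simp: sph_def\<close>)
  have form: "lam n x \<in> unitv ` {..<Suc n} \<union> (neg \<circ> unitv) ` {..<Suc n}" for x
    by (rule lam[of n x]) (auto simp: peak_def)
  have "neg (lam n x) \<noteq> lam n y" if "x \<in> S" "y \<in> S" for x y
  proof
    assume eq: "neg (lam n x) = lam n y"
    obtain i where i: "peak n x i" "lam n x = (if 0 < x i then unitv i else neg (unitv i))" by (rule lam)
    obtain j where j: "peak n y j" "lam n y = (if 0 < y j then unitv j else neg (unitv j))" by (rule lam)
    have "i = j \<and> (0 < x i \<longleftrightarrow> \<not> 0 < y i)"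
      using eq unfolding i(2) j(2)
      by (auto simp: unitv_inj neg_inj unitv_neq_neg unitv_neq_neg[symmetric] split: if_splits)
    then show False using near[OF that(1,2) i(1)] by (auto simp: zero_less_mult_iff)
  qed
  then show "lam n ` S \<in> cross (Suc n)"
    unfolding cross_def using form by auto
  show "S \<union> lam n ` S \<in> hsp n"
  proof (cases "S = {}")
    case True
    then show ?thesis by (simp add: hsp_def)
  next
    case False
    then obtain u where u: "u \<in> S" by auto
    have "0 < ip n u x" if "x \<in> S" for x
    proof -
      have "R\<^sup>2 * tight n < ip n u x" using S u that by (auto simp: sph_def)
      moreover have "0 \<le> R\<^sup>2 * tight n" using tight by simp
      ultimately show ?thesis by linarith
    qed
    moreover have "0 < ip n u (lam n x)" if "x \<in> S" for x
    proof -
      obtain i where i: "peak n x i" "lam n x = (if 0 < x i then unitv i else neg (unitv i))" by (rule lam)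
      then show ?thesis using near[OF that u i(1)] by (auto simp: ip_unitv peak_def zero_less_mult_iff)
    qed
    moreover have "lam n x \<in> vecs n" for x
      by (rule lam[of n x]) (auto simp: peak_def vecs_def unitv_def neg_def)
    ultimately show ?thesis using S unfolding hsp_def sph_def by (auto simp: round_sphere_ip)
  qed
qed

lemma hul_cross_sign:
  assumes "x \<in> hul S"
  shows "(0 < x i \<longrightarrow> (\<exists>y\<in>S. 0 < y i)) \<and> (x i < 0 \<longrightarrow> (\<exists>y\<in>S. y i < 0))"
proof -
  have 1: "x i \<le> 0" if "\<forall>y\<in>S. y i \<le> 0"
  proof -
    have "hul S \<subseteq> {x. x i \<le> 0}"
      by (rule hul_closed) (use that in \<open>auto intro!: bary_le\<close>)
    then show ?thesis using assms by blast
  qed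
  have 2: "0 \<le> x i" if "\<forall>y\<in>S. 0 \<le> y i"
  proof -
    have "hul S \<subseteq> {x. 0 \<le> x i}"
      by (rule hul_closed) (use that in \<open>auto intro!: bary_ge\<close>)
    then show ?thesis using assms by blast
  qed
  show ?thesis using 1 2 by (meson not_le)
qed

text \<open>A point in the hull of a cross-polytope simplex has nonzero coordinates only where some
  vertex points, and with the sign of that vertex. So rounding after subdivision is carried by the
  simplex itself.\<close>

lemma lam_nz_cross:
  assumes S: "S \<in> cross (Suc n)" and x: "x \<in> hul S" and R: "R > 0"
  shows "lam n (nz n R x) \<in> S"
proof -
  obtain u where u: "\<forall>x\<in>S. 0 < ip n u x" using subsetD[OF cross_hsp S] by (auto simp: hsp_def)
  have "0 < ip n u x" by (rule hul_ip_gt[OF x]) (use u in auto)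
  then have pos: "0 < ip n x x"
    using ip_cauchy[of n u x] ip_nonneg[of n x] by (cases "ip n x x = 0") auto
  let ?y = "nz n R x"
  have a: "0 < R / sqrt (ip n x x)" using pos R by simp
  have sg: "0 < ?y i \<longleftrightarrow> 0 < x i" "?y i < 0 \<longleftrightarrow> x i < 0" for i
    using a unfolding nz_def by (simp_all only: zero_less_mult_iff mult_less_0_iff) auto
  obtain i where i: "peak n ?y i" "lam n ?y = (if 0 < ?y i then unitv i else neg (unitv i))" by (rule lam)
  have "?y i \<noteq> 0"
  proof
    assume "?y i = 0"
    then have "\<forall>j\<le>n. ?y j = 0" using i(1) by (auto simp: peak_def)
    then have "\<forall>j\<le>n. x j = 0" using sg by (metis linorder_neqE_linordered_idom less_irrefl)
    then have "ip n x x = 0" by (simp add: ip_def)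
    then show False using pos by simp
  qed
  have form: "\<exists>j. y = unitv j \<or> y = neg (unitv j)" if "y \<in> S" for y
    using S that unfolding cross_def by auto
  show ?thesis
  proof (cases "0 < ?y i")
    case True
    then obtain y where "y \<in> S" "0 < y i" using hul_cross_sign[OF x, of i] sg by blast
    moreover have "y = unitv i" using form[OF \<open>y \<in> S\<close>] \<open>0 < y i\<close> by (auto simp: unitv_def neg_def split: if_splits)
    ultimately show ?thesis using True by (simp add: i(2))
  next
    case False
    then have "?y i < 0" using \<open>?y i \<noteq> 0\<close> by simp
    then obtain y where "y \<in> S" "y i < 0" using hul_cross_sign[OF x, of i] sg by blast
    moreover have "y = neg (unitv i)" using form[OF \<open>y \<in> S\<close>] \<open>y i < 0\<close> by (auto simp: unitv_def neg_def split: if_splits)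
    ultimately show ?thesis using False by (simp add: i(2))
  qed
qed

lemma cross_round_homologous:
  assumes R: "R > 0" and z: "on (cross (Suc n)) p z" "bd z = 0"
  obtains d where "on (cross (Suc n)) (Suc p) d" "z + mp (map (lam n)) (lin (sub n R N) z) = bd d"
proof -
  let ?\<phi> = "\<lambda>L. mp (map (lam n)) (sub n R N L)"
  obtain d where "on (cross (Suc n)) (Suc p) d" "z + lin ?\<phi> z = bd d"
  proof (rule carrier_homotopy[of "cross (Suc n)" ?\<phi> set "cross (Suc n)" p z])
    show "bd (?\<phi> L) = lin ?\<phi> (bdl L)" for L
      by (simp add: bd_mp bd_sub mp_lin)
    fix L M assume L: "set L \<in> cross (Suc n)" and M: "M \<in> keys (?\<phi> L)"
    from M obtain M' where M': "M' \<in> keys (sub n R N L)" "M = map (lam n) M'" by (rule keys_mpE)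
    from sub_keys[OF M'(1)] have "lam n x \<in> set L" if "x \<in> set M'" for x
      using that lam_nz_cross[OF L _ R] by blast
    then show "set M \<subseteq> set L \<and> length M = length L" using M'(2) sub_keys[OF M'(1)] by auto
  next
    show "set M \<subseteq> set L" if "M \<in> keys (bdl L)" for L M :: "(nat \<Rightarrow> real) list" using bdl_keys[OF that] by simp
    show "S \<in> cross (Suc n)" if "set L \<in> cross (Suc n)" "finite S" "S \<subseteq> set L" for L S
      using down_cross that unfolding down_def by blast
  qed (use down_cross z in auto)
  then show thesis using that by (simp add: mp_lin)
qed

subsection \<open>Homology of small Vietoris--Rips complexes of spheres\<close>

lemma hsp_round:
  assumes R: "R > 0" and z: "on (hsp n) p z" "bd z = 0"
  obtains N w d where "on (cross (Suc n)) p w" "bd w = 0" "on (hsp n) (Suc p) d" "z = w + bd d"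
    "w = mp (map (lam n)) (lin (sub n R N) z)" 
proof -
  obtain N where N: "on (sph n R (tight n)) p (lin (sub n R N) z)"
    using sub_fine[OF R tight(2) z(1)] by blast
  let ?s = "lin (sub n R N) z"
  have s: "bd ?s = 0" using z by (simp add: bd_lin_sub)
  obtain d1 where d1: "on (hsp n) (Suc p) d1" "z + ?s = bd d1"
    by (rule sub_hsp_homologous[OF R z])
  obtain d2 where d2: "on (hsp n) (Suc p) d2" "?s + mp (map (lam n)) ?s = bd d2"
    by (rule contiguous_homologous[OF down_sph lam_cross(2)[OF _ R] down_hsp N s])
  have "z = mp (map (lam n)) ?s + bd (d1 + d2)"
    using d1(2) d2(2) by (metis (no_types, lifting) bd_add chain_add_eq_iff add.assoc add.commute chain_add_self_left)
  moreover have "on (cross (Suc n)) p (mp (map (lam n)) ?s)"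
    by (rule on_mp[OF N lam_cross(1)[OF _ R]])
  ultimately show thesis using that[of "mp (map (lam n)) ?s" "d1 + d2" N] d1(1) d2(1) s by (simp add: on_add bd_mp)
qed

text \<open>A filling is found in the large complex \<open>hsp n\<close> and brought back by
  subdividing it finely. The claim is made for all large \<open>N\<close>, so that in
  \<open>sph_top\<close> two cycles are compared with the same subdivided fundamental cycle.\<close>

lemma sph_cycles:
  assumes R: "R > 0" and c: "0 \<le> c" "c < 1" and z: "on (sph n R c) p z" "bd z = 0"
  shows "\<exists>N0. \<forall>N\<ge>N0. \<exists>d. on (sph n R c) (Suc p) d \<and>
    (z = bd d \<or> p = Suc n \<and> z = lin (sub n R N) (beta (Suc n)) + bd d)"
proof -
  have zh: "on (hsp n) p z" using z sph_hsp[OF c(1)] by (rule_tac on_mono)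
  obtain N1 w d1 where w: "on (cross (Suc n)) p w" "bd w = 0" and d1: "on (hsp n) (Suc p) d1" "z = w + bd d1"
    using hsp_round[OF R zh z(2)] by blast
  obtain e where e: "on (cross (Suc n)) (Suc p) e" "w = bd e \<or> p = Suc n \<and> w = beta (Suc n) + bd e"
    using cross_cycles[OF w] by blast
  have f: "on (hsp n) (Suc p) (d1 + e)" using d1 on_mono[OF e(1) cross_hsp] by (rule_tac on_add)
  have zf: "z = bd (d1 + e) \<or> p = Suc n \<and> z = beta (Suc n) + bd (d1 + e)"
    using e(2) d1(2) by (auto simp: ac_simps)
  obtain N0 where N0: "\<And>N. N \<ge> N0 \<Longrightarrow> on (sph n R c) (Suc p) (lin (sub n R N) (d1 + e))"
    using sub_fine[OF R c(2) f] by blast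
  show ?thesis
  proof (intro exI[of _ N0] allI impI)
    fix N assume N: "N \<ge> N0"
    obtain g where g: "on (sph n R c) (Suc p) g" "z + lin (sub n R N) z = bd g"
      by (rule sub_sph_homologous[OF R c(1) z])
    let ?d = "lin (sub n R N) (d1 + e) + g"
    define s where "s = lin (sub n R N) z"
    have zs: "z = s + bd g" using g(2) by (metis s_def chain_add_self_left add.commute)
    have "s = bd (lin (sub n R N) (d1 + e)) \<or>
        p = Suc n \<and> s = lin (sub n R N) (beta (Suc n)) + bd (lin (sub n R N) (d1 + e))"
      unfolding s_def using zf by (auto simp: bd_lin_sub)
    then have "z = bd ?d \<or> p = Suc n \<and> z = lin (sub n R N) (beta (Suc n)) + bd ?d"
      unfolding bd_add zs by (elim disjE conjE) (simp_all only: add.assoc simp_thms)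
    moreover have "on (sph n R c) (Suc p) ?d" by (rule on_add[OF N0[OF N] g(1)])
    ultimately show "\<exists>d. on (sph n R c) (Suc p) d \<and>
        (z = bd d \<or> p = Suc n \<and> z = lin (sub n R N) (beta (Suc n)) + bd d)" by blast
  qed
qed

theorem sph_acyclic:
  assumes "R > 0" "0 \<le> c" "c < 1" "on (sph n R c) p z" "bd z = 0" "p \<noteq> Suc n"
  obtains d where "on (sph n R c) (Suc p) d" "z = bd d"
  using sph_cycles[OF assms(1-5)] assms(6) by (metis order_refl)

theorem sph_top:
  assumes R: "R > 0" and c: "0 \<le> c" "c < 1" and z: "on (sph n R c) p z" "bd z = 0"
    and w: "on (sph n R c) p w" "bd w = 0"
    and nz: "\<And>d. on (sph n R c) (Suc p) d \<Longrightarrow> z \<noteq> bd d" "\<And>d. on (sph n R c) (Suc p) d \<Longrightarrow> w \<noteq> bd d"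
  obtains d where "on (sph n R c) (Suc p) d" "z + w = bd d"
proof -
  obtain N1 where N1: "\<forall>N\<ge>N1. \<exists>d. on (sph n R c) (Suc p) d \<and>
    (z = bd d \<or> p = Suc n \<and> z = lin (sub n R N) (beta (Suc n)) + bd d)"
    using sph_cycles[OF R c z] by (rule exE)
  obtain N2 where N2: "\<forall>N\<ge>N2. \<exists>d. on (sph n R c) (Suc p) d \<and>
    (w = bd d \<or> p = Suc n \<and> w = lin (sub n R N) (beta (Suc n)) + bd d)"
    using sph_cycles[OF R c w] by (rule exE)
  let ?b = "lin (sub n R (max N1 N2)) (beta (Suc n))"
  obtain d1 where d1: "on (sph n R c) (Suc p) d1" "z = ?b + bd d1"
    using N1[THEN spec, of "max N1 N2"] nz(1) by auto
  obtain d2 where d2: "on (sph n R c) (Suc p) d2" "w = ?b + bd d2"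
    using N2[THEN spec, of "max N1 N2"] nz(2) by auto
  have "z + w = bd (d1 + d2)" unfolding d1(2) d2(2) by (simp add: ac_simps)
  then show thesis using that on_add[OF d1(1) d2(1)] by blast
qed

text \<open>A filling in \<open>hsp n\<close> would, after fine subdivision and rounding, fill a
  cycle homologous to \<open>beta (Suc n)\<close> in the cross-polytope, against
  \<open>cross_fundamental\<close>.\<close>

lemma hsp_fundamental:
  assumes R: "R > 0" and d: "on (hsp n) (Suc (Suc n)) d"
  shows "lin (sub n R N) (beta (Suc n)) \<noteq> bd d"
proof
  assume eq: "lin (sub n R N) (beta (Suc n)) = bd d"
  have b: "on (hsp n) (Suc n) (beta (Suc n))" by (rule on_mono[OF on_beta cross_hsp])
  obtain d1 where d1: "on (hsp n) (Suc (Suc n)) d1" "beta (Suc n) + lin (sub n R N) (beta (Suc n)) = bd d1"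
    by (rule sub_hsp_homologous[OF R b bd_beta])
  define f where "f = d1 + d"
  have f: "on (hsp n) (Suc (Suc n)) f" "beta (Suc n) = bd f"
    using d1 d eq by (auto simp: f_def on_add chain_add_eq_iff ac_simps)
  obtain N' where N': "on (sph n R (tight n)) (Suc (Suc n)) (lin (sub n R N') f)"
    using sub_fine[OF R tight(2) f(1)] by blast
  let ?g = "mp (map (lam n)) (lin (sub n R N') f)"
  have g: "on (cross (Suc n)) (Suc (Suc n)) ?g" by (rule on_mp[OF N' lam_cross(1)[OF _ R]])
  obtain h where h: "on (cross (Suc n)) (Suc (Suc n)) h"
      "beta (Suc n) + mp (map (lam n)) (lin (sub n R N') (beta (Suc n))) = bd h"
    by (rule cross_round_homologous[OF R on_beta bd_beta])
  have "mp (map (lam n)) (lin (sub n R N') (beta (Suc n))) = bd ?g"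
    unfolding f(2) bd_mp bd_lin_sub ..
  then have "beta (Suc n) = bd (h + ?g)" using h(2) by (simp add: chain_add_eq_iff ac_simps)
  then show False using cross_fundamental[of "Suc n" "h + ?g"] on_add[OF h(1) g] by simp
qed

lemma cross_mono: "m \<le> m' \<Longrightarrow> cross m \<subseteq> cross m'"
  unfolding cross_def by fastforce

text \<open>Hemispheres of increasing dimension, each bounding a sphere made of two copies of the
  previous one.\<close>

theorem hemispheres:
  assumes R: "R > 0" and c: "c < 1"
  obtains h where "\<And>j. j \<le> n \<Longrightarrow> on (sph n R c) (Suc j) (h j)" "bd (h 0) = sng []"
    "\<And>j. bd (h (Suc j)) = h j + mp (map neg) (h j)"
    "\<And>d c'. 0 \<le> c' \<Longrightarrow> on (sph n R c') (Suc (Suc n)) d \<Longrightarrow> h n + mp (map neg) (h n) \<noteq> bd d"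
proof -
  define g where "g j = lcone (unitv j) (beta j)" for j
  have gg: "g j + mp (map neg) (g j) = beta (Suc j)" for j
  proof -
    have "mp (map neg) (lcone (unitv j) (beta j)) = lcone (neg (unitv j)) (mp (map neg) (beta j))"
      by (simp add: lcone_def mp_mp)
    then show ?thesis by (simp add: g_def mp_neg_beta)
  qed
  have bg: "bd (g j) = beta j" for j by (simp add: g_def bd_lcone)
  have og: "on (hsp n) (Suc j) (g j)" if "j \<le> n" for j
  proof -
    have "insert (unitv j) S \<in> cross (Suc j)" if "S \<in> cross j" for S
      using that cross_insert[of S j] cross_Suc_iff[of S j] by blast
    then have "on (cross (Suc j)) (Suc j) (g j)"
      unfolding g_def by (rule on_lcone[OF on_beta])
    moreover have "cross (Suc j) \<subseteq> hsp n" using cross_mono[of "Suc j" "Suc n"] cross_hsp[of n] that by auto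
    ultimately show ?thesis by (rule on_mono)
  qed
  have "\<exists>N0. \<forall>N\<ge>N0. on (sph n R c) (Suc j) (lin (sub n R N) (g j))" if "j \<in> {..n}" for j
    using sub_fine[OF R c og[of j]] that by (metis atMost_iff)
  then have "\<exists>N0. \<forall>j\<in>{..n}. \<forall>N\<ge>N0 j. on (sph n R c) (Suc j) (lin (sub n R N) (g j))"
    by (intro bchoice ballI)
  then obtain N0 where N0: "\<forall>j\<in>{..n}. \<forall>N\<ge>N0 j. on (sph n R c) (Suc j) (lin (sub n R N) (g j))" by blast
  define N where "N = Max (N0 ` {..n})"
  define h where "h j = lin (sub n R N) (g j)" for j
  have hh: "h j + mp (map neg) (h j) = lin (sub n R N) (beta (Suc j))" for j
    unfolding h_def gg[symmetric] by (simp add: sub_neg)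
  show thesis
  proof (rule that[of h])
    show "on (sph n R c) (Suc j) (h j)" if "j \<le> n" for j
    proof -
      have "N0 j \<le> N" unfolding N_def using that by (intro Max_ge) auto
      then show ?thesis using N0 that unfolding h_def by simp
    qed
    show "bd (h 0) = sng []" unfolding h_def bd_lin_sub bg by simp
    show "bd (h (Suc j)) = h j + mp (map neg) (h j)" for j
      unfolding hh by (simp only: h_def bd_lin_sub bg)
    show "h n + mp (map neg) (h n) \<noteq> bd d" if "0 \<le> c'" "on (sph n R c') (Suc (Suc n)) d" for d c'
      unfolding hh by (rule hsp_fundamental[OF R on_mono[OF that(2) sph_hsp[OF that(1)]]])
  qed
qed

declare add_bit_eq_xor [simp del] mult_bit_eq_and [simp del]

section \<open>Vietoris--Rips complexes of round projective spaces\<close>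

lemma geodesic_dist_less:
  assumes "x \<in> round_sphere n R" "y \<in> round_sphere n R" "R > 0" "0 < r" "r \<le> pi * R"
  shows "geodesic_dist n R x y < r \<longleftrightarrow> R\<^sup>2 * cos (r / R) < ip n x y"
proof -
  define a where "a = ip n x y / R\<^sup>2"
  have "\<bar>ip n x y\<bar> \<le> R\<^sup>2"
    using ip_cauchy[of n x y] ip_cauchy[of n "neg x" y] assms by (simp add: round_sphere_ip power2_eq_square)
  then have a: "\<bar>a\<bar> \<le> 1" using assms by (simp add: a_def abs_divide)
  have rr: "0 \<le> r / R" "r / R \<le> pi" using assms by (simp_all add: divide_simps mult.commute)
  have "geodesic_dist n R x y < r \<longleftrightarrow> arccos a < r / R"
    using assms by (simp add: geodesic_dist_def a_def ip_def divide_simps mult.commute)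
  also have "\<dots> \<longleftrightarrow> cos (r / R) < cos (arccos a)"
    using rr a arccos_lbound[of a] arccos_ubound[of a] by (subst cos_mono_less_eq) (auto simp: abs_le_iff)
  also have "\<dots> \<longleftrightarrow> cos (r / R) < a"
    using a by (simp add: cos_arccos_abs)
  also have "\<dots> \<longleftrightarrow> R\<^sup>2 * cos (r / R) < ip n x y"
    using assms by (simp add: a_def divide_simps mult.commute)
  finally show ?thesis .
qed

lemma vr_sphere:
  assumes "R > 0" "0 < r" "r \<le> pi * R"
  shows "insert {} (vr_complex (round_sphere n R) (geodesic_dist n R) r) = sph n R (cos (r / R))"
  using geodesic_dist_less[OF _ _ assms]
  by (auto simp: vr_complex_iff sph_def subset_iff)

subsection \<open>Cup powers of a degree one cocycle on lists\<close>

fun edges :: "('v \<Rightarrow> 'v \<Rightarrow> bit) \<Rightarrow> 'v list \<Rightarrow> bit" where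
  "edges w (x # y # L) = w x y * edges w (y # L)"
| "edges w [x] = 1"
| "edges w [] = 1"

lemma chain_add_eqD: "(x::'x \<Rightarrow>\<^sub>0 bit) + d = e \<Longrightarrow> x = e + d"
  by (metis chain_add_self_left add.commute)

lemma lin_mult: "lin (\<lambda>x. a * f x) z = a * lin f z" for a :: bit
  unfolding lin_def by (rule sum_distrib_left[symmetric])

text \<open>The cocycle identity for a power of the coboundary of \<open>l\<close>, evaluated on
  \<open>x # N\<close>, with the face that omits \<open>x\<close> moved to the right-hand side; in
  this form it can be proved by induction over \<open>N\<close> for arbitrary
  \<open>x\<close>.\<close>

lemma edges_bdl:
  assumes "N \<noteq> []"
  shows "lin (\<lambda>M. edges (\<lambda>x y. l x + l y) (x # M)) (bdl N) = edges (\<lambda>x y. l x + l y) N"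
  using assms
proof (induction N arbitrary: x)
  case (Cons y M)
  let ?e = "edges (\<lambda>x y. l x + l y)"
  have "lin (\<lambda>T. ?e (x # T)) (bdl (y # M)) = ?e (x # M) + lin (\<lambda>T. (l x + l y) * ?e (y # T)) (bdl M)"
    unfolding bdl.simps lcone_def
    by (subst lin_add, rule bit_add_self, subst lin_mp, rule bit_add_self) (simp only: lin_sng edges.simps)
  also have "lin (\<lambda>T. (l x + l y) * ?e (y # T)) (bdl M) = (l x + l y) * lin (\<lambda>T. ?e (y # T)) (bdl M)"
    by (rule lin_mult)
  finally have *: "lin (\<lambda>T. ?e (x # T)) (bdl (y # M)) = ?e (x # M) + (l x + l y) * lin (\<lambda>T. ?e (y # T)) (bdl M)" .
  show ?case
  proof (cases M)
    case Nil
    then show ?thesis unfolding * by simp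
  next
    case (Cons z M')
    then have IH: "lin (\<lambda>T. ?e (y # T)) (bdl M) = ?e M" using Cons.IH by simp
    have "(a + b) * E + (a + d) * E = (d + b) * (E::bit)" for a b d E
      by (cases a; cases b; cases d; cases E) simp_all
    then show ?thesis unfolding * IH unfolding Cons edges.simps by blast
  qed
qed simp

lemma edges_cocycle:
  assumes "length L \<ge> 2"
  shows "lin (edges (\<lambda>x y. l x + l y)) (bdl L) = 0"
proof -
  obtain x N where L: "L = x # N" using assms by (cases L) auto
  then have N: "N \<noteq> []" using assms by auto
  show ?thesis
    unfolding L bdl.simps lcone_def
    by (subst lin_add, rule bit_add_self, subst lin_mp, rule bit_add_self)
      (simp only: lin_sng edges_bdl[OF N] bit_add_self)
qed

text \<open>If \<open>w\<close> is the coboundary of \<open>l\<close>, its \<open>q\<close>-th power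
  is the coboundary of \<open>l\<close> cup the power of exponent \<open>q - 1\<close>; the factor
  \<open>l (hd M)\<close> is this cup product on a list.\<close>

lemma edges_coboundary:
  assumes "length L \<ge> 2"
  shows "lin (\<lambda>M. l (hd M) * edges (\<lambda>x y. l x + l y) M) (bdl L) = edges (\<lambda>x y. l x + l y) L"
proof -
  obtain x y M where L: "L = x # y # M" using assms by (cases L; cases "tl L") auto
  let ?e = "edges (\<lambda>x y. l x + l y)"
  have "lin (\<lambda>M. l (hd M) * ?e M) (bdl L) = l y * ?e (y # M) + lin (\<lambda>T. l x * ?e (x # T)) (bdl (y # M))"
    unfolding L bdl.simps(2)[of x] lcone_def
    by (subst lin_add, rule bit_add_self, subst lin_mp, rule bit_add_self) (simp only: lin_sng list.sel)
  also have "lin (\<lambda>T. l x * ?e (x # T)) (bdl (y # M)) = l x * lin (\<lambda>T. ?e (x # T)) (bdl (y # M))"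
    by (rule lin_mult)
  also have "\<dots> = l x * ?e (y # M)" by (subst edges_bdl) simp_all
  also have "l y * ?e (y # M) + l x * ?e (y # M) = ?e L"
    unfolding L edges.simps by (simp only: distrib_right add.commute)
  finally show ?thesis .
qed

subsection \<open>Smith theory of the antipodal action\<close>

definition pr :: "(nat \<Rightarrow> real) \<Rightarrow> (nat \<Rightarrow> real) set" where
  "pr x = {x, neg x}"

definition rep :: "(nat \<Rightarrow> real) set \<Rightarrow> nat \<Rightarrow> real" where
  "rep P = (SOME x. x \<in> P)"

lemma pr_neg [simp]: "pr (neg x) = pr x"
  by (auto simp: pr_def)

lemma rep_pr: "rep (pr x) = x \<or> rep (pr x) = neg x"
proof -
  have "rep (pr x) \<in> pr x" unfolding rep_def by (rule someI[of _ x]) (simp add: pr_def)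
  then show ?thesis by (auto simp: pr_def)
qed

lemma rp_space_pr: "rp_space n = pr ` round_sphere n 2"
  by (auto simp: rp_space_def pr_def neg_def)

lemma neg_sphere [simp]: "neg x \<in> round_sphere n R \<longleftrightarrow> x \<in> round_sphere n R"
  by (simp add: neg_def)

lemma sphere_neg_neq: "x \<in> round_sphere n R \<Longrightarrow> R > 0 \<Longrightarrow> neg x \<noteq> x"
proof
  assume x: "x \<in> round_sphere n R" "R > 0" "neg x = x"
  then have "ip n x x = - ip n x x" by (metis ip_neg(1))
  then show False using x by (simp add: round_sphere_ip)
qed

text \<open>On the double cover of radius 2, distance below \<open>r\<close> is an angle below
  \<open>r / 2 \<le> pi / 3\<close>, hence an inner product above \<open>4 c\<close> with
  \<open>c \<ge> 1/2\<close>. This threshold makes lifts of simplices coherent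
  (\<open>near_trans\<close>).\<close>

locale smith =
  fixes n :: nat and r :: real
  assumes n: "1 \<le> n" and r: "0 < r" "r \<le> 2 * pi / 3"
begin

definition c :: real where "c = cos (r / 2)"

lemma c: "1 / 2 \<le> c" "0 \<le> c" "c < 1"
proof -
  have "cos (pi / 3) \<le> cos (r / 2)" using r pi_gt_zero by (intro cos_monotone_0_pi_le) auto
  then show 1: "1 / 2 \<le> c" by (simp add: c_def cos_60)
  then show "0 \<le> c" by simp
  have "cos (r / 2) < cos 0" using r pi_gt_zero by (intro cos_monotone_0_pi) auto
  then show "c < 1" by (simp add: c_def)
qed

abbreviation "S \<equiv> sph n 2 c"
abbreviation "P \<equiv> insert {} (vr_complex (rp_space n) (rp_dist n) r)"

definition near :: "(nat \<Rightarrow> real) \<Rightarrow> (nat \<Rightarrow> real) \<Rightarrow> bool" where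
  "near x y \<longleftrightarrow> 4 * c < ip n x y"

lemma near_neg: "near (neg x) y \<longleftrightarrow> near x (neg y)" "near (neg x) (neg y) \<longleftrightarrow> near x y"
  by (simp_all add: near_def)

lemma S_iff: "X \<in> S \<longleftrightarrow> finite X \<and> X \<subseteq> round_sphere n 2 \<and> (\<forall>x\<in>X. \<forall>y\<in>X. near x y)"
  by (simp add: sph_def near_def)

lemma not_near: "near x y \<Longrightarrow> \<not> near x (neg y)"
  using c by (simp add: near_def)

text \<open>Otherwise \<open>0 \<le> |x - y - z|\<^sup>2 = 12 - 2 <x,y> - 2 <x,z> + 2 <y,z>\<close>
  would be less than \<open>12 - 24 c\<close>, which is not positive for
  \<open>c \<ge> 1/2\<close>.\<close>

lemma near_trans:
  assumes "x \<in> round_sphere n 2" "y \<in> round_sphere n 2" "z \<in> round_sphere n 2" "near x y" "near x z"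
  shows "\<not> near y (neg z)"
proof
  assume "near y (neg z)"
  have "0 \<le> ip n (\<lambda>i. (x i - y i) - z i) (\<lambda>i. (x i - y i) - z i)" by (rule ip_nonneg)
  also have "\<dots> = ip n x x + ip n y y + ip n z z - 2 * ip n x y - 2 * ip n x z + 2 * ip n y z"
    by (simp add: ip_def algebra_simps sum.distrib sum_subtractf sum_distrib_left)
  finally show False
    using assms \<open>near y (neg z)\<close> c by (simp add: near_def round_sphere_ip)
qed

lemma rp_dist_near:
  assumes "x \<in> round_sphere n 2" "y \<in> round_sphere n 2"
  shows "rp_dist n (pr x) (pr y) < r \<longleftrightarrow> near x y \<or> near x (neg y)"
proof -
  have "rp_dist n (pr x) (pr y) = min (geodesic_dist n 2 x y) (geodesic_dist n 2 x (neg y))"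
    unfolding pr_def neg_def by (rule rp_dist)
  moreover have "geodesic_dist n 2 x z < r \<longleftrightarrow> near x z" if "z \<in> round_sphere n 2" for z
    using geodesic_dist_less[OF assms(1) that, of r] r pi_gt_zero by (simp add: near_def c_def)
  ultimately show ?thesis using assms by (auto simp: min_less_iff_disj)
qed

lemma P_iff: "pr ` X \<in> P \<longleftrightarrow> finite (pr ` X) \<and> (\<forall>x\<in>X. \<forall>y\<in>X. near x y \<or> near x (neg y))"
  if "X \<subseteq> round_sphere n 2"
  using that rp_dist_near unfolding insert_iff vr_complex_iff rp_space_pr by (auto simp: subset_iff)

definition lf :: "(nat \<Rightarrow> real) \<Rightarrow> (nat \<Rightarrow> real) set \<Rightarrow> nat \<Rightarrow> real" where
  "lf x Q = (if near x (rep Q) then rep Q else neg (rep Q))"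

text \<open>The preferred lift: the first vertex goes to its chosen representative, every other
  vertex to the representative near that one. The only other coherent lift is its antipode
  (\<open>lift_pr\<close>).\<close>

definition lift :: "(nat \<Rightarrow> real) set list \<Rightarrow> (nat \<Rightarrow> real) list" where
  "lift L = map (lf (rep (hd L))) L"

lemma rep_P:
  assumes "set L \<in> P" "Q \<in> set L"
  shows "rep Q \<in> round_sphere n 2" "pr (rep Q) = Q"
proof -
  obtain x where "x \<in> round_sphere n 2" "Q = pr x"
    using assms by (auto simp: vr_complex_iff rp_space_pr)
  then show "rep Q \<in> round_sphere n 2" "pr (rep Q) = Q" using rep_pr[of x] by auto
qed

lemma lift_P:
  assumes L: "set L \<in> P" "L \<noteq> []"
  shows "set (lift L) \<in> S" "map pr (lift L) = L"
proof -
  let ?x = "rep (hd L)"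
  have hd: "hd L \<in> set L" using L by simp
  note x = rep_P[OF L(1) hd]
  have dist: "rp_dist n Q Q' < r" if "Q \<in> set L" "Q' \<in> set L" for Q Q'
    using L that by (auto simp: vr_complex_iff)
  have lf: "lf ?x Q \<in> round_sphere n 2" "pr (lf ?x Q) = Q" "near ?x (lf ?x Q)" if Q: "Q \<in> set L" for Q
  proof -
    note q = rep_P[OF L(1) Q]
    show "lf ?x Q \<in> round_sphere n 2" "pr (lf ?x Q) = Q" using q by (auto simp: lf_def)
    have "rp_dist n (pr ?x) (pr (rep Q)) < r" using dist[OF hd Q] x q by simp
    then show "near ?x (lf ?x Q)" using rp_dist_near[OF x(1) q(1)] by (auto simp: lf_def)
  qed
  have "near (lf ?x Q) (lf ?x Q')" if "Q \<in> set L" "Q' \<in> set L" for Q Q'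
  proof -
    have "rp_dist n (pr (lf ?x Q)) (pr (lf ?x Q')) < r" using dist that lf by simp
    then have "near (lf ?x Q) (lf ?x Q') \<or> near (lf ?x Q) (neg (lf ?x Q'))"
      using rp_dist_near lf that by blast
    then show ?thesis using near_trans[of ?x "lf ?x Q" "lf ?x Q'"] x lf that by blast
  qed
  then show "set (lift L) \<in> S" unfolding S_iff lift_def using lf(1) by auto
  show "map pr (lift L) = L" unfolding lift_def using lf(2) by (simp add: map_idI)
qed

lemma pr_S: "X \<in> S \<Longrightarrow> pr ` X \<in> P"
  using P_iff[of X] by (auto simp: S_iff)

lemma lift_pr:
  assumes X: "set X \<in> S" "X \<noteq> []"
  shows "lift (map pr X) = X \<or> lift (map pr X) = map neg X"
proof -
  have near: "near (hd X) y" "\<not> near (hd X) (neg y)" if "y \<in> set X" for y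
    using X that not_near by (auto simp: S_iff)
  have 1: "lf (hd X) (pr y) = y" if "y \<in> set X" for y
    using near[OF that] rep_pr[of y] by (auto simp: lf_def)
  have 2: "lf (neg (hd X)) (pr y) = neg y" if "y \<in> set X" for y
    using near[OF that] rep_pr[of y] by (auto simp: lf_def near_neg)
  have "hd (map pr X) = pr (hd X)" using X by (simp add: hd_map)
  then have "lift (map pr X) = map (\<lambda>y. lf (rep (pr (hd X))) (pr y)) X"
    by (simp add: lift_def o_def)
  then show ?thesis using rep_pr[of "hd X"] 1 2 by (auto cong: map_cong)
qed

section \<open>The Smith sequence of the antipodal action\<close>

abbreviation "A \<equiv> mp (map neg)"
abbreviation "p \<equiv> mp (map pr)"

lemma A_A [simp]: "A (A x) = x"
  by (simp add: mp_mp o_def mp_id)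

lemma p_A [simp]: "p (A x) = p x"
  by (simp add: mp_mp o_def)

lemma neg_S: "X \<in> S \<Longrightarrow> neg ` X \<in> S"
  by (auto simp: S_iff near_neg)

lemma on_A: "on S q x \<Longrightarrow> on S q (A x)"
  by (erule on_mp) (rule neg_S)

lemma on_p: "on S q x \<Longrightarrow> on P q (p x)"
  by (erule on_mp) (rule pr_S)

text \<open>Selects the lists that are antipodes of preferred lifts. Exactly for these does
  replacing \<open>X\<close> by the preferred lift of its projection change anything, namely by
  \<open>X + A X\<close>.\<close>

definition half :: "(nat \<Rightarrow> real) list \<Rightarrow> ((nat \<Rightarrow> real) list \<Rightarrow>\<^sub>0 bit)" where
  "half X = (if X = lift (map pr X) then 0 else sng X)"

lemma smith_split:
  assumes "on S (Suc q) x"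
  shows "x + mp lift (p x) = lin half x + A (lin half x)"
proof -
  have "x + mp lift (p x) = lin (\<lambda>X. sng X + sng (lift (map pr X))) x"
    by (simp add: lin_fun_add mp_def lin_lin)
  also have "\<dots> = lin (\<lambda>X. half X + A (half X)) x"
  proof (rule lin_cong)
    fix X assume "X \<in> keys x"
    then have X: "set X \<in> S" "X \<noteq> []" using assms by (auto simp: on_def)
    from lift_pr[OF X] show "sng X + sng (lift (map pr X)) = half X + A (half X)"
      by (auto simp: half_def)
  qed
  finally show ?thesis by (simp add: lin_fun_add mp_lin)
qed

lemma on_half: "on S q x \<Longrightarrow> on S q (lin half x)"
  by (rule on_lin) (auto simp: half_def on_def)

text \<open>Exactness in the middle of the Smith sequence: the kernel of the projection is the image
  of \<open>1 + A\<close>.\<close>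

lemma smith_kernel:
  assumes "on S (Suc q) x" "p x = 0"
  obtains s where "on S (Suc q) s" "x = s + A s"
  using smith_split[OF assms(1)] assms(2) on_half[OF assms(1)] that by simp

lemma on_lift:
  assumes "on P (Suc q) z"
  shows "on S (Suc q) (mp lift z)" "p (mp lift z) = z"
proof -
  have L: "set L \<in> P" "L \<noteq> []" "length L = Suc q" if "L \<in> keys z" for L
    using assms that by (auto simp: on_def)
  show "on S (Suc q) (mp lift z)"
    unfolding on_def using lift_P L by (auto simp: lift_def elim!: keys_mpE)
  show "p (mp lift z) = z"
    unfolding mp_mp by (rule mp_id) (use lift_P L in auto)
qed

text \<open>The lift of \<open>p x\<close> is again invariant by \<open>smith_split\<close>. A list
  occurring in it would occur together with its antipode, both as preferred lifts of one projected
  list, so it would equal its antipode; the action on the sphere is free.\<close>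

lemma smith_invariant:
  assumes x: "on S (Suc q) x" "A x = x"
  shows "p x = 0"
proof -
  let ?y = "mp lift (p x)"
  note px = on_lift[OF on_p[OF x(1)]]
  have "x + ?y = lin half x + A (lin half x)" by (rule smith_split[OF x(1)])
  then have "A x + A ?y = x + ?y" by (metis (no_types, lifting) A_A add.commute mp_add)
  then have inv: "A ?y = ?y" using x(2) by simp
  have "keys ?y = {}"
  proof (rule ccontr)
    assume "keys ?y \<noteq> {}"
    then obtain M where M: "M \<in> keys ?y" by blast
    then obtain L where L: "L \<in> keys (p x)" "M = lift L" by (rule keys_mpE)
    from M inv have "M \<in> keys (A ?y)" by simp
    then obtain M' where M': "M' \<in> keys ?y" "M = map neg M'" by (rule keys_mpE)
    from M'(1) obtain L' where L': "L' \<in> keys (p x)" "M' = lift L'" by (rule keys_mpE)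
    have K: "set L \<in> P" "L \<noteq> []" "set L' \<in> P" "L' \<noteq> []"
      using on_p[OF x(1)] L(1) L'(1) by (auto simp: on_def)
    have "L = map pr M" using lift_P(2)[OF K(1,2)] L(2) by simp
    also have "\<dots> = map pr M'" by (simp add: M'(2))
    also have "\<dots> = L'" using lift_P(2)[OF K(3,4)] L'(2) by simp
    finally have "M = map neg M" using L(2) L'(2) M'(2) by simp
    moreover have "set M \<in> S" "M \<noteq> []" using px(1) M by (auto simp: on_def)
    ultimately show False
      using sphere_neg_neq[of "hd M" n 2] by (cases M) (auto simp: S_iff)
  qed
  then have "?y = 0" by simp
  then show ?thesis using px(2) by simp
qed

lemma S_acyclic:
  assumes "on S q x" "bd x = 0" "q \<noteq> Suc n"
  obtains d where "on S (Suc q) d" "x = bd d"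
  by (rule sph_acyclic[of 2 c n q x]) (use assms c in auto)

context
  fixes h :: "nat \<Rightarrow> ((nat \<Rightarrow> real) list \<Rightarrow>\<^sub>0 bit)"
  assumes h: "\<And>j. j \<le> n \<Longrightarrow> on S (Suc j) (h j)" "bd (h 0) = sng []"
    "\<And>j. bd (h (Suc j)) = h j + A (h j)"
    "\<And>d c'. 0 \<le> c' \<Longrightarrow> on (sph n 2 c') (Suc (Suc n)) d \<Longrightarrow> h n + A (h n) \<noteq> bd d"
begin

text \<open>The hypothesis says that \<open>p x\<close> is a cycle downstairs, and the conclusion is
  a normal form modulo the kernel of \<open>p\<close> and boundaries. The induction passes to
  \<open>e\<close>, which satisfies the same hypothesis one dimension lower because
  \<open>bd e\<close> is invariant.\<close>

lemma smith_main:
  "on S (Suc m) x \<Longrightarrow> m = 0 \<or> (\<exists>e. on S m e \<and> bd x = e + A e) \<Longrightarrow>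
   \<exists>s t. on S (Suc m) s \<and> on S (Suc (Suc m)) t \<and>
      (x = s + A s + bd t \<or> m \<le> n \<and> x = h m + s + A s + bd t)"
proof (induction m arbitrary: x)
  case 0
  have "on S 0 (bd x)" by (rule on_bd[OF 0(1) down_sph])
  then have "lin sng (bd x) = lin (\<lambda>_. sng []) (bd x)"
    by (intro lin_cong) (auto simp: on_def)
  then have "bd x = lin (\<lambda>_. sng []) (bd x)" by simp
  then have "bd x = 0 \<or> bd x = sng []"
    unfolding lin_const_sng by (cases "lin (\<lambda>_. 1::bit) (bd x)") auto
  then show ?case
  proof
    assume b: "bd x = 0"
    obtain d where "on S (Suc (Suc 0)) d" "x = bd d"
      by (rule S_acyclic[OF 0(1) b]) (use n in auto)
    then show ?thesis by (intro exI[of _ 0] exI[of _ d]) simp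
  next
    assume b: "bd x = sng []"
    have "on S (Suc 0) (h 0 + x)" "bd (h 0 + x) = 0" using h(1)[of 0] h(2) 0 b by (auto intro: on_add)
    then obtain d where "on S (Suc (Suc 0)) d" "h 0 + x = bd d"
      by (rule S_acyclic) (use n in auto)
    then show ?thesis by (intro exI[of _ 0] exI[of _ d]) (simp add: chain_add_eq_iff)
  qed
next
  case (Suc m)
  then obtain e where e: "on S (Suc m) e" "bd x = e + A e" by auto
  have "m = 0 \<or> (\<exists>f. on S m f \<and> bd e = f + A f)"
  proof (cases m)
    case (Suc q)
    have be: "on S (Suc q) (bd e)" using on_bd[OF e(1) down_sph] by (simp add: Suc)
    have "bd e + A (bd e) = bd (bd x)" unfolding e(2) by (simp add: bd_mp)
    then have "A (bd e) = bd e" by (simp add: chain_add_eq_0_iff)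
    then have "p (bd e) = 0" by (rule smith_invariant[OF be])
    then show ?thesis using smith_kernel[OF be] Suc by metis
  qed simp
  from Suc.IH[OF e(1) this] obtain s t where st: "on S (Suc m) s" "on S (Suc (Suc m)) t"
    "e = s + A s + bd t \<or> m \<le> n \<and> e = h m + s + A s + bd t" by blast
  let ?t = "t + A t"
  have t: "on S (Suc (Suc m)) ?t" by (rule on_add[OF st(2) on_A[OF st(2)]])
  have sum: "e + A e = f + A f + bd ?t" if "e = f + s + A s + bd t" for f
    unfolding that by (simp add: bd_mp ac_simps)
  \<comment> \<open>A cycle upstairs bounds or, in dimension \<open>n\<close>, differs by a boundary
    from the fundamental cycle \<open>h n + A (h n)\<close>, which is itself in the image of
    \<open>1 + A\<close>.\<close>
  have fill: "\<exists>s t. on S (Suc (Suc m)) s \<and> on S (Suc (Suc (Suc m))) t \<and> k = s + A s + bd t"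
    if k: "on S (Suc (Suc m)) k" "bd k = 0" for k
  proof (cases "Suc m = n")
    case False
    obtain d where "on S (Suc (Suc (Suc m))) d" "k = bd d"
      by (rule S_acyclic[OF k]) (use False in auto)
    then show ?thesis by (intro exI[of _ 0] exI[of _ d]) simp
  next
    case True
    show ?thesis
    proof (cases "\<exists>d. on S (Suc (Suc (Suc m))) d \<and> k = bd d")
      case True
      then obtain d where "on S (Suc (Suc (Suc m))) d" "k = bd d" by blast
      then show ?thesis by (intro exI[of _ 0] exI[of _ d]) simp
    next
      case False
      have hn: "on S (Suc (Suc m)) (h n)" using h(1)[of n] True by simp
      have b: "on S (Suc (Suc m)) (h n + A (h n))" by (rule on_add[OF hn on_A[OF hn]])
      have b0: "bd (h n + A (h n)) = 0"
        using True h(3)[of m] by (metis (no_types, lifting) A_A add.commute bd_add bd_mp chain_add_self mp_add)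
      have nb: "h n + A (h n) \<noteq> bd d" if "on S (Suc (Suc (Suc m))) d" for d
        using h(4)[of c d] that True c by simp
      obtain d where "on S (Suc (Suc (Suc m))) d" "k + (h n + A (h n)) = bd d"
        by (rule sph_top[of 2 c n "Suc (Suc m)" k "h n + A (h n)"]) (use c k b b0 nb False in auto)
      moreover then have "k = h n + A (h n) + bd d" by (metis chain_add_eqD add.commute)
      ultimately show ?thesis using hn by blast
    qed
  qed
  from st(3) show ?case
  proof
    assume *: "e = s + A s + bd t"
    have "bd x = 0 + A 0 + bd ?t" unfolding e(2) by (rule sum) (simp add: *)
    then have "bd (x + ?t) = 0" unfolding bd_add[of x] by (simp only: mp_0 add_0 chain_add_self)
    then obtain s' t' where s't': "on S (Suc (Suc m)) s'" "on S (Suc (Suc (Suc m))) t'" "x + ?t = s' + A s' + bd t'"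
      using fill[of "x + ?t"] on_add[OF Suc.prems(1) t] by blast
    have "x = (s' + t) + A (s' + t) + bd t'" using chain_add_eqD[OF s't'(3)] by (simp add: ac_simps)
    then show ?thesis using on_add[OF s't'(1) st(2)] s't'(2) by blast
  next
    assume *: "m \<le> n \<and> e = h m + s + A s + bd t"
    have bx: "bd x = h m + A (h m) + bd ?t" unfolding e(2) by (rule sum) (use * in blast)
    show ?thesis
    \<comment> \<open>For \<open>m = n\<close> the chain \<open>x + ?t\<close> would fill the
      fundamental cycle upstairs. Below that, \<open>h (Suc m)\<close> has the boundary
      \<open>h m + A (h m)\<close> and can be split off.\<close>
    proof (cases "m = n")
      case True
      have "h n + A (h n) = bd (x + ?t)" using bx True by simp
      moreover have "on (sph n 2 c) (Suc (Suc n)) (x + ?t)" using on_add[OF Suc.prems(1) t] True by simp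
      ultimately show ?thesis using h(4) c(2) by blast
    next
      case False
      then have m: "Suc m \<le> n" using * by simp
      have "bd (x + (h (Suc m) + ?t)) = 0" using bx h(3)[of m] by (simp del: mp_add)
      moreover have "on S (Suc (Suc m)) (x + (h (Suc m) + ?t))"
        by (intro on_add Suc.prems(1) t h(1) m)
      ultimately obtain s' t' where s't': "on S (Suc (Suc m)) s'" "on S (Suc (Suc (Suc m))) t'"
        "x + (h (Suc m) + ?t) = s' + A s' + bd t'" using fill by blast
      have "x = h (Suc m) + (s' + t) + A (s' + t) + bd t'" using chain_add_eqD[OF s't'(3)] by (simp add: ac_simps)
      then show ?thesis using on_add[OF s't'(1) st(2)] s't'(2) m by blast
    qed
  qed
qed

text \<open>Apply the normal form to the lift of \<open>z\<close> and project: \<open>p\<close>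
  kills \<open>s + A s\<close>. In dimension 0 the projected hemisphere does not occur, since a
  reduced 0-cycle lifts to a reduced 0-cycle, which bounds on the connected sphere.\<close>

lemma rp_cycles:
  assumes z: "on P (Suc m) z" "bd z = 0"
  shows "\<exists>d. on P (Suc (Suc m)) d \<and> (z = bd d \<or> 1 \<le> m \<and> m \<le> n \<and> z = p (h m) + bd d)"
proof -
  let ?x = "mp lift z"
  note x = on_lift[OF z(1)]
  show ?thesis
  proof (cases m)
    case 0
    have "bd ?x = lin (\<lambda>L. bdl (lift L)) z" by (simp add: bd_def lin_mp)
    also have "\<dots> = lin (\<lambda>_. sng []) z"
    proof (rule lin_cong)
      fix L assume "L \<in> keys z"
      then obtain y where "L = [y]" using z(1) 0 by (cases L) (auto simp: on_def)
      then show "bdl (lift L) = sng []" by (simp add: lift_def)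
    qed
    also have "\<dots> = Poly_Mapping.single [] (lin (\<lambda>_. 1) z)" by (rule lin_const_sng)
    finally have 1: "bd ?x = Poly_Mapping.single [] (lin (\<lambda>_. 1) z)" .
    have "bd z = lin (\<lambda>_. sng []) z"
      unfolding bd_def
    proof (rule lin_cong)
      fix L assume "L \<in> keys z"
      then obtain y where "L = [y]" using z(1) 0 by (cases L) (auto simp: on_def)
      then show "bdl L = sng []" by simp
    qed
    then have "lin (\<lambda>_. 1::bit) z = 0"
      using z(2) unfolding lin_const_sng by (metis lookup_single_eq lookup_zero)
    then have "bd ?x = 0" using 1 by simp
    then obtain d where "on S (Suc (Suc m)) d" "?x = bd d"
      by (rule S_acyclic[OF x(1)]) (use 0 n in auto)
    then show ?thesis using x(2) on_p by (metis bd_mp)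
  next
    case (Suc q)
    have "p (bd ?x) = bd z" using x(2) by (simp flip: bd_mp)
    then obtain e where "on S m e" "bd ?x = e + A e"
      using smith_kernel[of q "bd ?x"] on_bd[OF x(1) down_sph] z(2) Suc by metis
    then obtain s t where st: "on S (Suc m) s" "on S (Suc (Suc m)) t"
      "?x = s + A s + bd t \<or> m \<le> n \<and> ?x = h m + s + A s + bd t"
      using smith_main[OF x(1)] by blast
    have "z = bd (p t) \<or> m \<le> n \<and> z = p (h m) + bd (p t)"
    proof -
      have "p ?x = bd (p t) \<or> m \<le> n \<and> p ?x = p (h m) + bd (p t)"
        using st(3) by (elim disjE) (simp_all add: bd_mp ac_simps)
      then show ?thesis unfolding x(2) .
    qed
    then show ?thesis using on_p[OF st(2)] Suc by auto
  qed
qed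

text \<open>By \<open>edges_coboundary\<close> the value on \<open>h (Suc m)\<close> is a sum over
  its boundary \<open>h m + A (h m)\<close>. The antipodal map preserves the edge product and flips
  \<open>l\<close>, so the two halves together give the value on \<open>h m\<close>.\<close>

lemma edges_hemisphere:
  assumes l: "\<And>x. x \<in> round_sphere n 2 \<Longrightarrow> l (neg x) = l x + 1" and m: "m \<le> n"
  shows "lin (edges (\<lambda>x y. l x + l y)) (h m) = (1::bit)"
  using m
proof (induction m)
  case 0
  let ?e = "edges (\<lambda>x y. l x + l y)"
  have len: "length L = 1" if "L \<in> keys (h 0)" for L using h(1)[of 0] that by (auto simp: on_def)
  have "sng [] = bd (h 0)" by (simp add: h)
  also have "bd (h 0) = lin (\<lambda>_. sng []) (h 0)"
    unfolding bd_def
  proof (rule lin_cong)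
    fix L assume "L \<in> keys (h 0)"
    then obtain y where "L = [y]" using len[of L] by (cases L) auto
    then show "bdl L = sng []" by simp
  qed
  finally have "lin (\<lambda>_. 1::bit) (h 0) = 1" unfolding lin_const_sng by (metis lookup_single_eq)
  moreover have "lin ?e (h 0) = lin (\<lambda>_. 1) (h 0)"
  proof (rule lin_cong)
    fix L assume "L \<in> keys (h 0)"
    then obtain y where "L = [y]" using len[of L] by (cases L) auto
    then show "?e L = 1" by simp
  qed
  ultimately show ?case by simp
next
  case (Suc m)
  let ?e = "edges (\<lambda>x y. l x + l y)"
  have inv: "?e (map neg L) = ?e L" if "set L \<subseteq> round_sphere n 2" for L
    using that by (induction L rule: edges.induct[of _ "\<lambda>_ _. 0"]) (auto simp: l add.assoc add.left_commute)
  have "lin ?e (h (Suc m)) = lin (\<lambda>L. lin (\<lambda>M. l (hd M) * ?e M) (bdl L)) (h (Suc m))"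
    by (rule lin_cong, rule edges_coboundary[symmetric]) (use h(1)[OF Suc.prems] in \<open>auto simp: on_def\<close>)
  also have "\<dots> = lin (\<lambda>M. l (hd M) * ?e M) (bd (h (Suc m)))"
    by (simp add: bd_def lin_lin)
  also have "\<dots> = lin (\<lambda>M. l (hd M) * ?e M + l (hd (map neg M)) * ?e (map neg M)) (h m)"
    by (simp add: h(3) lin_fun_add lin_mp)
  also have "\<dots> = lin ?e (h m)"
  proof (rule lin_cong)
    fix M assume "M \<in> keys (h m)"
    then have M: "set M \<subseteq> round_sphere n 2" "M \<noteq> []"
      using h(1)[of m] Suc.prems by (auto simp: on_def S_iff)
    then have "l (hd (map neg M)) = l (hd M) + 1" using l by (cases M) auto
    then show "l (hd M) * ?e M + l (hd (map neg M)) * ?e (map neg M) = ?e M"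
      by (simp add: inv[OF M(1)] algebra_simps)
  qed
  finally show ?case using Suc by simp
qed

end

end

abbreviation vrl :: "'a set \<Rightarrow> ('a \<Rightarrow> 'a \<Rightarrow> real) \<Rightarrow> real \<Rightarrow> 'a set set" where
  "vrl M d r \<equiv> insert {} (vr_complex M d r)"

lemma vrl_iff: "S \<in> vrl M d r \<longleftrightarrow> S = {} \<or> finite S \<and> S \<subseteq> M \<and> (\<forall>x\<in>S. \<forall>y\<in>S. d x y < r)"
  by (auto simp: vr_complex_iff)

lemma down_vrl: "down (vrl M d r)"
  by (rule down_aug[OF simp_cx_vr])

definition nonbdry :: "'v set set \<Rightarrow> nat \<Rightarrow> ('v list \<Rightarrow>\<^sub>0 bit) \<Rightarrow> bool" where
  "nonbdry K p z \<longleftrightarrow> (\<forall>d. on K (Suc p) d \<longrightarrow> z \<noteq> bd d)"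

section \<open>Fundamental classes of projective spaces\<close>

context smith
begin

text \<open>The characteristic cocycle of the double cover: on an edge it records whether the chosen
  representatives of the ends are near or one of them must be replaced by its antipode.\<close>

definition w0 :: "(nat \<Rightarrow> real) set \<Rightarrow> (nat \<Rightarrow> real) set \<Rightarrow> bit" where
  "w0 Q Q' = (if near (rep Q) (rep Q') then 0 else 1)"

definition l0 :: "(nat \<Rightarrow> real) \<Rightarrow> bit" where
  "l0 x = (if rep (pr x) = x then 0 else 1)"

lemma l0_neg: "x \<in> round_sphere n 2 \<Longrightarrow> l0 (neg x) = l0 x + 1"
  using sphere_neg_neq[of x n 2] rep_pr[of x] unfolding l0_def pr_neg by auto

text \<open>Upstairs \<open>w0\<close> is the coboundary of \<open>l0\<close>, which tells on which
  of the two sheets a point lies.\<close>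

lemma w0_pr:
  assumes "x \<in> round_sphere n 2" "y \<in> round_sphere n 2" "near x y"
  shows "w0 (pr x) (pr y) = l0 x + l0 y"
proof -
  have xy: "neg x \<noteq> x" "neg y \<noteq> y" using sphere_neg_neq[of _ n 2] assms by auto
  have "\<not> near x (neg y)" "\<not> near (neg x) y" "near (neg x) (neg y)"
    using not_near[OF assms(3)] assms(3) by (auto simp: near_neg)
  then show ?thesis
    using rep_pr[of x] rep_pr[of y] xy assms(3) by (auto simp: w0_def l0_def)
qed

lemma edges_pr:
  assumes w: "\<And>x y. x \<in> round_sphere n 2 \<Longrightarrow> y \<in> round_sphere n 2 \<Longrightarrow> near x y \<Longrightarrow> w (pr x) (pr y) = l x + l y"
  shows "set X \<in> S \<Longrightarrow> edges w (map pr X) = edges (\<lambda>x y. l x + l y) X"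
proof (induction X)
  case (Cons x X)
  have X: "set X \<in> S" using Cons.prems down_sph unfolding down_def by (metis set_subset_Cons)
  show ?case
  proof (cases X)
    case (Cons y L)
    then show ?thesis using Cons.IH[OF X] Cons.prems w[of x y] by (simp add: S_iff)
  qed simp
qed simp

lemma w0_cocycle:
  assumes L: "set L \<in> P" "length L \<ge> 2"
  shows "lin (edges w0) (bdl L) = 0"
proof -
  have ne: "L \<noteq> []" using L by auto
  note X = lift_P[OF L(1) ne]
  have "lin (edges w0) (bdl (map pr (lift L))) = lin (\<lambda>M. edges w0 (map pr M)) (bdl (lift L))"
    unfolding bdl_map by (rule lin_mp) simp
  also have "\<dots> = lin (edges (\<lambda>x y. l0 x + l0 y)) (bdl (lift L))"
  proof (rule lin_cong)
    fix M assume "M \<in> keys (bdl (lift L))"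
    then have "set M \<in> S" using bdl_keys[of M "lift L"] X(1) down_sph unfolding down_def by blast
    then show "edges w0 (map pr M) = edges (\<lambda>x y. l0 x + l0 y) M"
      by (rule edges_pr[rotated]) (rule w0_pr)
  qed
  also have "\<dots> = 0" by (rule edges_cocycle) (use L in \<open>simp add: lift_def\<close>)
  finally show ?thesis unfolding X(2) .
qed

lemma w0_bd:
  assumes "on P (Suc (Suc m)) d"
  shows "lin (edges w0) (bd d) = 0"
proof -
  have "lin (edges w0) (bd d) = lin (\<lambda>L. lin (edges w0) (bdl L)) d" by (simp add: bd_def lin_lin)
  also have "\<dots> = lin (\<lambda>L. 0) d"
    by (rule lin_cong) (use assms in \<open>auto simp: on_def intro!: w0_cocycle\<close>)
  finally show ?thesis by simp
qed

end

lemma smith_near_mono: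
  assumes "smith n r" "smith n r'" "r \<le> r'" "smith.near n r x y"
  shows "smith.near n r' x y"
proof -
  have "cos (r' / 2) \<le> cos (r / 2)"
    using assms pi_gt_zero by (intro cos_monotone_0_pi_le) (auto simp: smith_def)
  then show ?thesis
    using assms(4) unfolding smith.near_def[OF assms(1)] smith.near_def[OF assms(2)]
      smith.c_def[OF assms(1)] smith.c_def[OF assms(2)] by linarith
qed

abbreviation RPc :: "nat \<Rightarrow> real \<Rightarrow> (nat \<Rightarrow> real) set set set" where
  "RPc n r \<equiv> vrl (rp_space n) (rp_dist n) r"

text \<open>In the last clause \<open>b\<close> is the projected hemisphere. Points near at scale
  \<open>r\<close> are near at scale \<open>r'\<close>, so the cocycle of the larger scale still
  pulls back to the coboundary of \<open>l0\<close> on it; the value 1 shows that one chain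
  represents a nonzero class at all scales up to 2 pi/3.\<close>

theorem rp_homology:
  assumes n: "1 \<le> n" and r: "0 < r" "r \<le> 2 * pi / 3"
  shows "\<And>m z. on (RPc n r) (Suc m) z \<Longrightarrow> bd z = 0 \<Longrightarrow> m = 0 \<or> n < m \<Longrightarrow> \<not> nonbdry (RPc n r) (Suc m) z"
    "\<And>m z w. on (RPc n r) (Suc m) z \<Longrightarrow> bd z = 0 \<Longrightarrow> nonbdry (RPc n r) (Suc m) z \<Longrightarrow>
      on (RPc n r) (Suc m) w \<Longrightarrow> bd w = 0 \<Longrightarrow> nonbdry (RPc n r) (Suc m) w \<Longrightarrow> \<not> nonbdry (RPc n r) (Suc m) (z + w)"
    "\<And>m. 1 \<le> m \<Longrightarrow> m \<le> n \<Longrightarrow> \<exists>b. on (RPc n r) (Suc m) b \<and> bd b = 0 \<and>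
      (\<forall>r'. r \<le> r' \<and> r' \<le> 2 * pi / 3 \<longrightarrow> lin (edges (smith.w0 n r')) b = 1)"
proof -
  interpret smith n r by unfold_locales (use assms in auto)
  obtain h where h: "\<And>j. j \<le> n \<Longrightarrow> on S (Suc j) (h j)" "bd (h 0) = sng []"
    "\<And>j. bd (h (Suc j)) = h j + A (h j)"
    "\<And>d c'. 0 \<le> c' \<Longrightarrow> on (sph n 2 c') (Suc (Suc n)) d \<Longrightarrow> h n + A (h n) \<noteq> bd d"
    using hemispheres[of 2 c n] c by auto
  have cyc: "\<exists>d. on P (Suc (Suc m)) d \<and> (z = bd d \<or> 1 \<le> m \<and> m \<le> n \<and> z = p (h m) + bd d)"
    if "on P (Suc m) z" "bd z = 0" for m z by (rule rp_cycles[of h m z, OF h that])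
  show "\<not> nonbdry P (Suc m) z" if "on P (Suc m) z" "bd z = 0" "m = 0 \<or> n < m" for m z
    using cyc[OF that(1,2)] that(3) unfolding nonbdry_def by auto
  show "\<not> nonbdry P (Suc m) (z + w)" if z: "on P (Suc m) z" "bd z = 0" "nonbdry P (Suc m) z"
    and w: "on P (Suc m) w" "bd w = 0" "nonbdry P (Suc m) w" for m z w
  proof -
    obtain d where d: "on P (Suc (Suc m)) d" "z = p (h m) + bd d" using cyc[OF z(1,2)] z(3) unfolding nonbdry_def by blast
    obtain e where e: "on P (Suc (Suc m)) e" "w = p (h m) + bd e" using cyc[OF w(1,2)] w(3) unfolding nonbdry_def by blast
    have "z + w = bd (d + e)" unfolding d(2) e(2) by (simp add: ac_simps)
    then show ?thesis using on_add[OF d(1) e(1)] unfolding nonbdry_def by blast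
  qed
  show "\<exists>b. on P (Suc m) b \<and> bd b = 0 \<and>
      (\<forall>r'. r \<le> r' \<and> r' \<le> 2 * pi / 3 \<longrightarrow> lin (edges (smith.w0 n r')) b = 1)" if m: "1 \<le> m" "m \<le> n" for m
  proof (intro exI[of _ "p (h m)"] conjI allI impI)
    show "on P (Suc m) (p (h m))" by (rule on_p[OF h(1)[OF m(2)]])
    obtain q where "m = Suc q" using m by (cases m) auto
    then show "bd (p (h m)) = 0" by (simp add: bd_mp h(3))
    fix r' assume r': "r \<le> r' \<and> r' \<le> 2 * pi / 3"
    have s': "smith n r'" using n r r' by unfold_locales auto
    interpret s: smith n r' by (rule s')
    have "lin (edges s.w0) (p (h m)) = lin (\<lambda>X. edges s.w0 (map pr X)) (h m)" by (rule lin_mp) simp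
    also have "\<dots> = lin (edges (\<lambda>x y. s.l0 x + s.l0 y)) (h m)"
    proof (rule lin_cong)
      fix X assume "X \<in> keys (h m)"
      then have "set X \<in> S" using h(1)[OF m(2)] by (auto simp: on_def)
      then show "edges s.w0 (map pr X) = edges (\<lambda>x y. s.l0 x + s.l0 y) X"
        by (rule edges_pr[rotated]) (use s.w0_pr smith_near_mono[OF smith_axioms s'] r' in blast)
    qed
    also have "\<dots> = 1" by (rule edges_hemisphere[of h s.l0 m, OF h s.l0_neg m(2)])
    finally show "lin (edges s.w0) (p (h m)) = 1" .
  qed
qed

theorem rp_fundamental:
  assumes n: "1 \<le> n" and r: "0 < r" "r \<le> 2 * pi / 3" and m: "1 \<le> m" "m \<le> n"
  obtains b where "on (RPc n r) (Suc m) b" "bd b = 0"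
    "\<And>r'. r \<le> r' \<Longrightarrow> r' \<le> 2 * pi / 3 \<Longrightarrow> nonbdry (RPc n r') (Suc m) b"
proof -
  obtain b where b: "on (RPc n r) (Suc m) b" "bd b = 0"
    "\<forall>r'. r \<le> r' \<and> r' \<le> 2 * pi / 3 \<longrightarrow> lin (edges (smith.w0 n r')) b = 1"
    using rp_homology(3)[OF n r m] by blast
  show thesis
  proof (rule that[OF b(1,2)])
    fix r' assume r': "r \<le> r'" "r' \<le> 2 * pi / 3"
    interpret s: smith n r' using n r r' by unfold_locales auto
    show "nonbdry (RPc n r') (Suc m) b"
      unfolding nonbdry_def using s.w0_bd b(3) r' by (metis zero_neq_one)
  qed
qed

section \<open>Null-homotopic inclusions\<close>

text \<open>Push every point a distance \<open>a\<close> towards the base point, then cone off.\<close>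

definition pushable :: "'a set \<Rightarrow> ('a \<Rightarrow> 'a \<Rightarrow> real) \<Rightarrow> bool" where
  "pushable M d \<longleftrightarrow> (\<exists>p\<in>M. \<forall>a. 0 \<le> a \<and> a \<le> pi \<longrightarrow> (\<forall>v\<in>M. \<exists>v'\<in>M. d v v' \<le> a \<and> d v' p \<le> pi - a))"

text \<open>The first bound on \<open>s\<close> makes a simplex and its pushed copy span a simplex,
  so pushing is contiguous to the inclusion; the second brings all pushed points within reach of the
  cone point.\<close>

theorem pushable_bounds:
  assumes M: "Metric_space M d" and p: "pushable M d" and a: "0 \<le> a" "a \<le> pi"
    and s: "r + 2 * a \<le> s" "pi - a < s"
    and z: "on (vrl M d r) (Suc m) z" "bd z = 0"
  shows "\<not> nonbdry (vrl M d s) (Suc m) z"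
proof -
  interpret Metric_space M d by (rule M)
  obtain p where p: "p \<in> M" "\<forall>v\<in>M. \<exists>v'\<in>M. d v v' \<le> a \<and> d v' p \<le> pi - a"
    using assms(2) a unfolding pushable_def by blast
  then obtain f where f: "\<And>v. v \<in> M \<Longrightarrow> f v \<in> M \<and> d v (f v) \<le> a \<and> d (f v) p \<le> pi - a" by metis
  have s0: "0 < s" using s a by linarith
  have near: "d v w < s" "d v (f w) < s" "d (f v) w < s" "d (f v) (f w) < s"
    if "v \<in> M" "w \<in> M" "d v w < r" for v w
  proof -
    have 1: "d v (f w) \<le> d v w + d w (f w)" using that f triangle by blast
    have 2: "d (f v) w \<le> d (f v) v + d v w" using that f triangle by blast
    have 3: "d (f v) (f w) \<le> d (f v) w + d w (f w)" using that f triangle by blast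
    have 4: "d (f v) v = d v (f v)" by (rule commute)
    show "d v w < s" "d v (f w) < s" "d (f v) w < s" "d (f v) (f w) < s"
      using 1 2 3 4 f[OF that(1)] f[OF that(2)] that(3) s(1) a by linarith+
  qed
  have 1: "S \<union> f ` S \<in> vrl M d s" if "S \<in> vrl M d r" for S
    using that near f unfolding vrl_iff by (auto simp: subset_iff)
  obtain e where e: "on (vrl M d s) (Suc (Suc m)) e" "z + mp (map f) z = bd e"
    by (rule contiguous_homologous[OF down_vrl 1 down_vrl z])
  have c: "insert p (f ` S) \<in> vrl M d s" if "S \<in> vrl M d r" for S
  proof (cases "S = {}")
    case True
    then show ?thesis using p(1) s0 unfolding vrl_iff by simp
  next
    case False
    then have S: "finite S" "S \<subseteq> M" "\<And>x y. x \<in> S \<Longrightarrow> y \<in> S \<Longrightarrow> d x y < r" using that unfolding vrl_iff by auto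
    have "d (f v) p < s" "d p (f v) < s" if "v \<in> S" for v
      using f[of v] S(2) that s(2) commute[of p "f v"] by auto
    then show ?thesis using S near f p s0 unfolding vrl_iff by (auto simp: subset_iff)
  qed
  have "on ((`) f ` vrl M d r) (Suc m) (mp (map f) z)" by (rule on_mp[OF z(1)]) blast
  then have "on (vrl M d s) (Suc (Suc m)) (lcone p (mp (map f) z))"
    by (rule on_lcone) (use c in blast)
  moreover have "z = bd (e + lcone p (mp (map f) z))"
    using e(2) z(2) by (simp add: bd_lcone bd_mp) (metis chain_add_eqD)
  ultimately show ?thesis using on_add[OF e(1)] unfolding nonbdry_def by blast
qed

section \<open>Moving along great circles towards a base point\<close>

lemma geodesic_cos:
  assumes "x \<in> round_sphere n R" "y \<in> round_sphere n R" "R > 0" "0 \<le> t" "t \<le> pi" "ip n x y = R\<^sup>2 * cos t"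
  shows "geodesic_dist n R x y = R * t"
  using assms by (simp add: geodesic_dist_def ip_def arccos_cos)

lemma orthogonal_exists:
  assumes n: "1 \<le> n" and R: "R > 0"
  obtains u where "u \<in> round_sphere n R" "ip n u p = 0"
proof -
  \<comment> \<open>A nonzero vector in the plane of the first two coordinates, orthogonal to the
    part of \<open>p\<close> in that plane.\<close>
  define v :: "nat \<Rightarrow> real" where "v = (if p 0 = 0 then unitv 0 else (\<lambda>i. if i = 0 then - p 1 else if i = 1 then p 0 else 0))"
  have ip2: "ip n v y = v 0 * y 0 + v 1 * y 1" for y
  proof -
    have "ip n v y = (\<Sum>i\<in>{0,1}. v i * y i)"
      unfolding ip_def by (rule sum.mono_neutral_right) (use n in \<open>auto simp: v_def unitv_def\<close>)
    then show ?thesis by simp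
  qed
  have "0 < ip n v v" unfolding ip2 by (auto simp: v_def unitv_def power2_eq_square[symmetric] add_nonneg_pos)
  moreover have "v \<in> vecs n" using n by (auto simp: v_def unitv_def vecs_def)
  ultimately have "nz n R v \<in> round_sphere n R" by (intro nz_sphere)
  moreover have "ip n (nz n R v) p = 0" unfolding nz_def ip_scale ip2 by (auto simp: v_def unitv_def)
  ultimately show thesis by (rule that)
qed

text \<open>Write \<open>x\<close> as \<open>cos \<theta> p + sin \<theta> u\<close> with
  \<open>u\<close> orthogonal to \<open>p\<close>; the point sought is at angle
  \<open>\<theta> - t / R\<close> on this great circle.\<close>

lemma geodesic_point:
  assumes n: "1 \<le> n" and R: "R > 0" and x: "x \<in> round_sphere n R" and p: "p \<in> round_sphere n R"
    and t: "0 \<le> t" "t \<le> geodesic_dist n R x p"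
  obtains y where "y \<in> round_sphere n R" "geodesic_dist n R x y = t" "geodesic_dist n R y p = geodesic_dist n R x p - t"
proof -
  interpret Metric_space "round_sphere n R" "geodesic_dist n R" by (rule Metric_space_round_sphere[OF R])
  define a where "a = ip n x p / R\<^sup>2"
  have "\<bar>ip n x p\<bar> \<le> R\<^sup>2"
    using ip_cauchy[of n x p] ip_cauchy[of n "neg x" p] x p R by (simp add: round_sphere_ip power2_eq_square)
  then have a1: "\<bar>a\<bar> \<le> 1" using R by (simp add: a_def abs_divide)
  define \<theta> where "\<theta> = arccos a"
  have th: "0 \<le> \<theta>" "\<theta> \<le> pi" "cos \<theta> = a"
    using a1 by (auto simp: \<theta>_def arccos_lbound arccos_ubound abs_le_iff cos_arccos_abs)
  have d: "geodesic_dist n R x p = R * \<theta>" using x p by (simp add: geodesic_dist_def \<theta>_def a_def ip_def)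
  have ipxp: "ip n x p = R\<^sup>2 * cos \<theta>" using R by (simp add: th a_def)
  note xx = x[unfolded round_sphere_ip] and pp = p[unfolded round_sphere_ip]
  have "\<exists>u. u \<in> round_sphere n R \<and> ip n u p = 0 \<and> x = (\<lambda>i. cos \<theta> * p i + sin \<theta> * u i)"
  \<comment> \<open>Here \<open>x\<close> is \<open>p\<close> or its antipode, and any orthogonal
    \<open>u\<close> gives a great circle through both.\<close>
  proof (cases "sin \<theta> = 0")
    case True
    obtain u where u: "u \<in> round_sphere n R" "ip n u p = 0" by (rule orthogonal_exists[OF n R])
    have c2: "cos \<theta> * cos \<theta> = 1" using sin_cos_squared_add[of \<theta>] True by (simp add: power2_eq_square)
    have "ip n (\<lambda>i. x i - cos \<theta> * p i) (\<lambda>i. x i - cos \<theta> * p i) = 0"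
      unfolding ip_polar ip_scale using xx pp ipxp c2 by (simp add: algebra_simps)
    then have "(\<Sum>i\<le>n. (x i - cos \<theta> * p i)\<^sup>2) = 0" by (simp add: ip_def power2_eq_square)
    then have le: "\<forall>i\<in>{..n}. (x i - cos \<theta> * p i)\<^sup>2 = 0" by (subst (asm) sum_nonneg_eq_0_iff) auto
    have "x i = cos \<theta> * p i + sin \<theta> * u i" for i
    proof (cases "i \<le> n")
      case False
      then show ?thesis using xx pp True by (simp add: vecs_def)
    qed (use le True in auto)
    then show ?thesis using u by blast
  next
    case False
    define u where "u = (\<lambda>i. 1 / sin \<theta> * (x i - cos \<theta> * p i))"
    have s2: "sin \<theta> * sin \<theta> = 1 - cos \<theta> * cos \<theta>" using sin_cos_squared_add[of \<theta>] by (simp add: power2_eq_square)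
    have "ip n (\<lambda>i. x i - cos \<theta> * p i) (\<lambda>i. x i - cos \<theta> * p i) = R\<^sup>2 * (sin \<theta> * sin \<theta>)"
      unfolding ip_polar ip_scale s2 using xx pp ipxp by (simp add: algebra_simps)
    then have "ip n u u = R\<^sup>2" unfolding u_def ip_scale using False by simp
    moreover have "ip n (\<lambda>i. x i - cos \<theta> * p i) p = 0"
      using pp ipxp by (simp add: ip_def algebra_simps sum_subtractf flip: sum_distrib_left)
    then have "ip n u p = 0" unfolding u_def ip_scale by simp
    moreover have "u \<in> vecs n" using xx pp by (simp add: u_def vecs_def)
    ultimately show ?thesis using False by (intro exI[of _ u]) (auto simp: round_sphere_ip u_def)
  qed
  then obtain u where u: "u \<in> round_sphere n R" "ip n u p = 0" "x = (\<lambda>i. cos \<theta> * p i + sin \<theta> * u i)" by blast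
  note uu = u(1)[unfolded round_sphere_ip]
  define \<phi> where "\<phi> = \<theta> - t / R"
  have ph: "0 \<le> \<phi>" "\<phi> \<le> \<theta>" "R * \<phi> = R * \<theta> - t" "0 \<le> t / R" "t / R \<le> pi" "\<theta> - \<phi> = t / R"
  proof -
    have tR: "t \<le> R * \<theta>" "R * \<theta> \<le> R * pi" using t d th(2) R by (auto intro: mult_left_mono)
    then have "t / R \<le> \<theta>" using R by (simp add: divide_simps mult.commute)
    moreover show "0 \<le> t / R" using t R by simp
    ultimately show "0 \<le> \<phi>" "\<phi> \<le> \<theta>" "t / R \<le> pi" "\<theta> - \<phi> = t / R" using th(2) by (simp_all add: \<phi>_def)
    show "R * \<phi> = R * \<theta> - t" using R by (simp add: \<phi>_def right_diff_distrib)
  qed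
  define y where "y = (\<lambda>i. cos \<phi> * p i + sin \<phi> * u i)"
  have lin2: "ip n (\<lambda>i. a * p i + b * u i) z = a * ip n p z + b * ip n u z" for a b z
    by (simp add: ip_def algebra_simps sum.distrib sum_distrib_left)
  have pu: "ip n p u = 0" using u(2) by (simp add: ip_commute)
  have yp: "ip n y p = R\<^sup>2 * cos \<phi>" unfolding y_def lin2 using u(2) pp by simp
  have yu: "ip n y u = R\<^sup>2 * sin \<phi>" unfolding y_def lin2 using pu uu by simp
  have "ip n y y = cos \<phi> * ip n p y + sin \<phi> * ip n u y" by (subst (1) y_def) (rule lin2)
  also have "\<dots> = R\<^sup>2 * ((cos \<phi>)\<^sup>2 + (sin \<phi>)\<^sup>2)"
    unfolding ip_commute[of n p y] ip_commute[of n u y] yp yu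
    by (simp only: power2_eq_square distrib_left ac_simps)
  finally have "ip n y y = R\<^sup>2" by simp
  moreover have "y \<in> vecs n" using pp uu by (simp add: y_def vecs_def)
  ultimately have y: "y \<in> round_sphere n R" by (simp add: round_sphere_ip)
  have "ip n x y = cos \<theta> * ip n p y + sin \<theta> * ip n u y" by (subst u(3)) (rule lin2)
  also have "\<dots> = R\<^sup>2 * cos (\<theta> - \<phi>)"
    using yp yu by (simp add: ip_commute[of n p y] ip_commute[of n u y] cos_diff algebra_simps)
  finally have xy: "ip n x y = R\<^sup>2 * cos (t / R)" by (simp add: ph)
  show thesis
  proof (rule that[OF y])
    show "geodesic_dist n R x y = t" using geodesic_cos[OF x y R ph(4,5) xy] R by simp
    show "geodesic_dist n R y p = geodesic_dist n R x p - t"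
      using geodesic_cos[OF y p R ph(1) _ yp] ph(2,3) th(2) d by simp
  qed
qed

lemma geodesic_push:
  assumes n: "1 \<le> n" and R: "R > 0" and x: "x \<in> round_sphere n R" and p: "p \<in> round_sphere n R"
    and a: "0 \<le> a" "a \<le> pi" and D: "geodesic_dist n R x p \<le> pi"
  obtains y where "y \<in> round_sphere n R" "geodesic_dist n R x y \<le> a" "geodesic_dist n R y p \<le> pi - a"
proof (cases "geodesic_dist n R x p \<le> a")
  case True
  interpret Metric_space "round_sphere n R" "geodesic_dist n R" by (rule Metric_space_round_sphere[OF R])
  show ?thesis by (rule that[OF p True]) (use a p in simp)
next
  case False
  then obtain y where "y \<in> round_sphere n R" "geodesic_dist n R x y = a" "geodesic_dist n R y p = geodesic_dist n R x p - a"
    using geodesic_point[OF n R x p a(1)] by auto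
  then show ?thesis using that D by simp
qed

lemma geodesic_diam:
  assumes "x \<in> round_sphere n R" "y \<in> round_sphere n R" "R > 0"
  shows "geodesic_dist n R x y \<le> pi * R"
proof -
  have "\<bar>ip n x y\<bar> \<le> R\<^sup>2"
    using ip_cauchy[of n x y] ip_cauchy[of n "neg x" y] assms by (simp add: round_sphere_ip power2_eq_square)
  then have "\<bar>ip n x y / R\<^sup>2\<bar> \<le> 1" using assms by (simp add: abs_divide)
  then have "- 1 \<le> ip n x y / R\<^sup>2" "ip n x y / R\<^sup>2 \<le> 1" by linarith+
  then have "arccos (ip n x y / R\<^sup>2) \<le> pi" by (rule arccos_ubound)
  then show ?thesis using assms by (simp add: geodesic_dist_def ip_def mult.commute)
qed

lemma pushable_rp:
  assumes n: "1 \<le> n"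
  shows "pushable (rp_space n) (rp_dist n)"
proof -
  let ?d = "geodesic_dist n 2"
  have rd: "rp_dist n (pr x) (pr y) = min (?d x y) (?d x (neg y))" for x y
    unfolding pr_def neg_def by (rule rp_dist)
  obtain p where p: "p \<in> round_sphere n 2" using orthogonal_exists[OF n, of 2] by auto
  show ?thesis
    unfolding pushable_def
  proof (rule bexI[of _ "pr p"], intro allI impI ballI)
    show "pr p \<in> rp_space n" using p by (simp add: rp_space_pr)
    fix a v assume a: "0 \<le> a \<and> a \<le> pi" and v: "v \<in> rp_space n"
    then obtain x where x: "x \<in> round_sphere n 2" "v = pr x" by (auto simp: rp_space_pr)
    \<comment> \<open>The distances from \<open>p\<close> to \<open>x\<close> and to its antipode
      add up to 2 pi on the sphere of radius 2.\<close>
    have "?d x p \<le> pi \<or> ?d (neg x) p \<le> pi"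
    proof -
      let ?t = "ip n x p / 4"
      have "\<bar>ip n x p\<bar> \<le> 4"
        using ip_cauchy[of n x p] ip_cauchy[of n "neg x" p] x p by (simp add: round_sphere_ip)
      then have t: "- 1 \<le> ?t" "?t \<le> 1" by (simp_all add: abs_le_iff)
      have "?d x p = 2 * arccos ?t" "?d (neg x) p = 2 * arccos (- ?t)"
        using x p by (simp_all add: geodesic_dist_def ip_def neg_def sum_negf)
      then show ?thesis using arccos_minus[OF t] by linarith
    qed
    then obtain x' where x': "x' \<in> round_sphere n 2" "v = pr x'" "?d x' p \<le> pi"
      using x by (metis neg_sphere pr_neg)
    obtain y where y: "y \<in> round_sphere n 2" "?d x' y \<le> a" "?d y p \<le> pi - a"
      using geodesic_push[OF n _ x'(1) p _ _ x'(3), of a] a by auto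
    then show "\<exists>v'\<in>rp_space n. rp_dist n v v' \<le> a \<and> rp_dist n v' (pr p) \<le> pi - a"
      by (intro bexI[of _ "pr y"]) (auto simp: rp_space_pr x'(2) rd min_le_iff_disj)
  qed
qed

section \<open>Wedges of spheres\<close>

lemma sum_const_even:
  "finite I \<Longrightarrow> (\<Sum>i\<in>I. c) = (if even (card I) then 0 else (c :: 'x \<Rightarrow>\<^sub>0 bit))"
  by (induction I rule: finite_induct) auto

locale wedge =
  fixes n :: nat and b :: "nat \<Rightarrow> nat \<Rightarrow> real"
  assumes n: "1 \<le> n" and b: "\<forall>i\<in>{1..n}. b i \<in> round_sphere i 1"
begin

abbreviation "J \<equiv> {1..n}"
abbreviation "W \<equiv> sphere_wedge b n"
abbreviation "D \<equiv> sphere_wedge_dist b"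
abbreviation "geo i \<equiv> geodesic_dist i 1"
abbreviation "sp i \<equiv> round_sphere i 1"

definition cl :: "nat \<Rightarrow> (nat \<Rightarrow> real) \<Rightarrow> (nat \<times> (nat \<Rightarrow> real)) set" where
  "cl i x = wedge_rel J (\<lambda>i. round_sphere i 1) b `` {(i, x)}"

lemma geo: "Metric_space (sp i) (geo i)"
  by (rule Metric_space_round_sphere) simp

lemma MW: "Metric_space W D"
  by (rule Metric_space_sphere_wedge) (use b in blast)

lemma W_eq: "W = {cl i x | i x. i \<in> J \<and> x \<in> sp i}"
  unfolding sphere_wedge_def wedge_space_def quotient_def cl_def by blast

lemma cl_W: "i \<in> J \<Longrightarrow> x \<in> sp i \<Longrightarrow> cl i x \<in> W"
  unfolding W_eq by blast

lemma D_cl: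
  assumes "i \<in> J" "x \<in> sp i" "j \<in> J" "y \<in> sp j"
  shows "D (cl i x) (cl j y) = (if i = j then geo i x y else geo i x (b i) + geo j y (b j))"
  unfolding sphere_wedge_dist_def cl_def
  by (rule wedge_dist[of "\<lambda>i. sp i" "\<lambda>i. geo i" J b i x j y]) (use assms b geo in auto)

lemma geo_nonneg: "0 \<le> geo i x y"
  using Metric_space.nonneg[OF geo] .

lemma geo_zero: "x \<in> sp i \<Longrightarrow> y \<in> sp i \<Longrightarrow> geo i x y = 0 \<longleftrightarrow> x = y"
  using Metric_space.zero[OF geo] by blast

lemma geo_commute: "geo i x y = geo i y x"
  using Metric_space.commute[OF geo] .

lemma cl_eq:
  assumes "i \<in> J" "x \<in> sp i" "j \<in> J" "y \<in> sp j"
  shows "cl i x = cl j y \<longleftrightarrow> (if i = j then x = y else x = b i \<and> y = b j)"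
proof -
  have "cl i x = cl j y \<longleftrightarrow> D (cl i x) (cl j y) = 0"
    using Metric_space.zero[OF MW cl_W[OF assms(1,2)] cl_W[OF assms(3,4)]] by simp
  also have "\<dots> \<longleftrightarrow> (if i = j then x = y else x = b i \<and> y = b j)"
    unfolding D_cl[OF assms] using assms b geo_zero geo_nonneg[of i x "b i"] geo_nonneg[of j y "b j"]
    by (auto simp: add_nonneg_eq_0_iff)
  finally show ?thesis .
qed

definition pt :: "(nat \<times> (nat \<Rightarrow> real)) set" where "pt = cl 1 (b 1)"

lemma pt: "j \<in> J \<Longrightarrow> cl j (b j) = pt"
  unfolding pt_def using n b by (subst cl_eq) auto

lemma D_pt: "i \<in> J \<Longrightarrow> x \<in> sp i \<Longrightarrow> D (cl i x) pt = geo i x (b i)"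
  using D_cl[of i x i "b i"] pt[of i] b by auto

definition ret :: "nat \<Rightarrow> (nat \<times> (nat \<Rightarrow> real)) set \<Rightarrow> nat \<Rightarrow> real" where
  "ret j Q = (if \<exists>x\<in>sp j. Q = cl j x then SOME x. x \<in> sp j \<and> Q = cl j x else b j)"

lemma ret_cl:
  assumes "i \<in> J" "x \<in> sp i" "j \<in> J"
  shows "ret j (cl i x) = (if i = j then x else b j)"
proof (cases "\<exists>y\<in>sp j. cl i x = cl j y")
  case True
  then have "\<exists>y. y \<in> sp j \<and> cl i x = cl j y" by blast
  then have *: "ret j (cl i x) \<in> sp j \<and> cl i x = cl j (ret j (cl i x))"
  proof -
    have "ret j (cl i x) = (SOME y. y \<in> sp j \<and> cl i x = cl j y)" using True by (simp add: ret_def)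
    then show ?thesis using someI_ex[OF \<open>\<exists>y. y \<in> sp j \<and> cl i x = cl j y\<close>] by simp
  qed
  then show ?thesis using cl_eq[OF assms(1,2,3)] by metis
next
  case False
  then have "i \<noteq> j" using assms by auto
  then show ?thesis using False by (simp add: ret_def)
qed

lemma ret_sp: "j \<in> J \<Longrightarrow> Q \<in> W \<Longrightarrow> ret j Q \<in> sp j"
  using b ret_cl unfolding W_eq by fastforce

lemma ret_D:
  assumes "j \<in> J" "P \<in> W" "Q \<in> W"
  shows "geo j (ret j P) (ret j Q) \<le> D P Q"
proof -
  obtain i x k y where P: "P = cl i x" "i \<in> J" "x \<in> sp i" and Q: "Q = cl k y" "k \<in> J" "y \<in> sp k"
    using assms(2,3) unfolding W_eq by blast
  have bj: "geo j (b j) (b j) = 0" using b assms(1) geo_zero by blast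
  show ?thesis
    unfolding P(1) Q(1) D_cl[OF P(2,3) Q(2,3)] ret_cl[OF P(2,3) assms(1)] ret_cl[OF Q(2,3) assms(1)]
    using bj geo_nonneg[of i x y] geo_nonneg[of i x "b i"] geo_nonneg[of k y "b k"] geo_commute[of j "b j" y]
    by auto
qed

definition sngl :: "(nat \<times> (nat \<Rightarrow> real)) set set \<Rightarrow> bool" where
  "sngl X \<longleftrightarrow> (\<exists>i\<in>J. X \<subseteq> cl i ` sp i)"

text \<open>Each point \<open>P\<close> of such a simplex has a partner \<open>Q\<close> on another
  sphere, and the path from \<open>P\<close> to \<open>Q\<close> passes through the base point; so
  \<open>pt\<close> is no farther from \<open>P\<close> than \<open>Q\<close> is.\<close>

lemma mixed_insert:
  assumes X: "X \<in> vrl W D r" "\<not> sngl X"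
  shows "insert pt X \<in> vrl W D r"
proof -
  have "X \<noteq> {}" using X(2) n unfolding sngl_def by fastforce
  then have X': "finite X" "X \<subseteq> W" "\<And>P Q. P \<in> X \<Longrightarrow> Q \<in> X \<Longrightarrow> D P Q < r" using X(1) unfolding vrl_iff by auto
  have ptW: "pt \<in> W" unfolding pt_def using n b by (intro cl_W) auto
  have near: "D P pt < r" if P: "P \<in> X" for P
  proof -
    obtain i x where i: "P = cl i x" "i \<in> J" "x \<in> sp i" using X'(2) P unfolding W_eq by blast
    have "\<not> X \<subseteq> cl i ` sp i" using X(2) i(2) unfolding sngl_def by blast
    then obtain Q where Q: "Q \<in> X" "Q \<notin> cl i ` sp i" by blast
    obtain k y where k: "Q = cl k y" "k \<in> J" "y \<in> sp k" using X'(2) Q unfolding W_eq by blast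
    have "i \<noteq> k" using Q(2) k i by auto
    then have "D P Q = geo i x (b i) + geo k y (b k)" using D_cl[OF i(2,3) k(2,3)] i k by simp
    then show ?thesis using X'(3)[OF P Q(1)] D_pt[OF i(2,3)] geo_nonneg[of k y "b k"] unfolding i(1) by linarith
  qed
  obtain P where "P \<in> X" using \<open>X \<noteq> {}\<close> by blast
  then have "0 < r" using near Metric_space.nonneg[OF MW, of P pt] by (meson le_less_trans)
  moreover have "D pt pt = 0" using Metric_space.zero[OF MW] ptW by blast
  moreover have "D pt P < r" if "P \<in> X" for P using near[OF that] Metric_space.commute[OF MW, of pt P] by simp
  ultimately show ?thesis unfolding vrl_iff using X' near ptW by auto
qed

text \<open>The sum of the retractions onto the spheres, corrected by \<open>n - 1\<close> constant
  maps: on a simplex inside one sphere the other \<open>n - 1\<close> retractions are constant and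
  cancel against them, so that \<open>foldw\<close> is the identity there
  (\<open>fold_single\<close>).\<close>

definition foldw :: "(nat \<times> (nat \<Rightarrow> real)) set list \<Rightarrow> ((nat \<times> (nat \<Rightarrow> real)) set list \<Rightarrow>\<^sub>0 bit)" where
  "foldw L = (\<Sum>j\<in>J. sng (map (\<lambda>Q. cl j (ret j Q)) L)) + (\<Sum>j\<in>{2..n}. sng (map (\<lambda>_. pt) L))"

lemma fold_single:
  assumes "i \<in> J" "set L \<subseteq> cl i ` sp i"
  shows "foldw L = sng L"
proof -
  have 1: "map (\<lambda>Q. cl j (ret j Q)) L = (if j = i then L else map (\<lambda>_. pt) L)" if j: "j \<in> J" for j
  proof -
    have "cl j (ret j Q) = (if j = i then Q else pt)" if "Q \<in> set L" for Q
    proof -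
      from assms(2) that have "Q \<in> cl i ` sp i" by blast
      then obtain x where "x \<in> sp i" "Q = cl i x" by blast
      then show ?thesis using ret_cl[OF assms(1) _ j] pt[OF j] by auto
    qed
    then show ?thesis by (auto simp: map_idI)
  qed
  have "(\<Sum>j\<in>J. sng (map (\<lambda>Q. cl j (ret j Q)) L)) = (\<Sum>j\<in>J. sng (if j = i then L else map (\<lambda>_. pt) L))"
    by (rule sum.cong) (simp_all add: 1)
  also have "\<dots> = sng L + (\<Sum>j\<in>J - {i}. sng (map (\<lambda>_. pt) L))"
    using assms(1) by (subst sum.remove[of J i]) auto
  also have "(\<Sum>j\<in>J - {i}. sng (map (\<lambda>_. pt) L)) = (\<Sum>j\<in>{2..n}. sng (map (\<lambda>_. pt) L))"
    using assms(1) by (simp add: sum_const_even)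
  finally have e: "(\<Sum>j\<in>J. sng (map (\<lambda>Q. cl j (ret j Q)) L)) = sng L + (\<Sum>j\<in>{2..n}. sng (map (\<lambda>_. pt) L))" .
  show ?thesis unfolding foldw_def e by (simp add: add.assoc)
qed

lemma bd_fold: "bd (foldw L) = lin foldw (bdl L)"
proof -
  have 1: "lin (\<lambda>M. sng (map f M)) (bdl L) = bdl (map f L)" for f :: "(nat \<times> (nat \<Rightarrow> real)) set \<Rightarrow> (nat \<times> (nat \<Rightarrow> real)) set"
    by (simp add: bdl_map mp_def)
  have 2: "bd (\<Sum>j\<in>I. c j) = (\<Sum>j\<in>I. bd (c j))" for I :: "nat set" and c :: "nat \<Rightarrow> ('v list \<Rightarrow>\<^sub>0 bit)"
    by (simp add: bd_def lin_sum)
  show ?thesis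
    unfolding foldw_def lin_fun_add lin_fun_sum 1 bd_add 2 bd_sng ..
qed

text \<open>A simplex in one sphere is its own carrier, since \<open>foldw\<close> fixes it; for any
  other simplex the base point may be added by \<open>mixed_insert\<close>.\<close>

lemma retraction_homologous:
  assumes z: "on (vrl W D r) p z" "bd z = 0"
  obtains d where "on (vrl W D r) (Suc p) d" "z + lin foldw z = bd d"
proof (rule carrier_homotopy[of "vrl W D r" foldw "\<lambda>L. if sngl (set L) then set L else insert pt (set L)" "vrl W D r" p z])
  show "foldw [] = sng []"
    by (rule fold_single[of 1]) (use n in auto)
  fix L assume L: "set L \<in> vrl W D r"
  show "set M \<subseteq> (if sngl (set L) then set L else insert pt (set L)) \<and> length M = length L" if "M \<in> keys (foldw L)" for M
  proof (cases "sngl (set L)")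
    case True
    then show ?thesis using fold_single that unfolding sngl_def by auto
  next
    case False
    have "set L \<subseteq> W" using L unfolding vrl_iff by auto
    have *: "cl j (ret j Q) \<in> insert pt (set L)" if j: "j \<in> J" and Q: "Q \<in> set L" for j Q
    proof -
      obtain i x where i: "Q = cl i x" "i \<in> J" "x \<in> sp i" using \<open>set L \<subseteq> W\<close> Q unfolding W_eq by blast
      show ?thesis using ret_cl[OF i(2,3) j] pt[OF j] i(1) Q by auto
    qed
    have "keys (\<Sum>j\<in>J. sng (map (\<lambda>Q. cl j (ret j Q)) L)) \<subseteq> (\<Union>j\<in>J. {map (\<lambda>Q. cl j (ret j Q)) L})"
      "keys (\<Sum>j\<in>{2..n}. sng (map (\<lambda>_. pt) L)) \<subseteq> {map (\<lambda>_. pt) L}"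
      by (rule order_trans[OF keys_sum], force)+
    then have "M \<in> (\<Union>j\<in>J. {map (\<lambda>Q. cl j (ret j Q)) L}) \<union> {map (\<lambda>_. pt) L}"
      using that unfolding foldw_def by (elim keys_addE) blast+
    then consider j where "j \<in> J" "M = map (\<lambda>Q. cl j (ret j Q)) L" | "M = map (\<lambda>_. pt) L" by blast
    then have "set M \<subseteq> insert pt (set L) \<and> length M = length L"
    proof cases
      case 1
      show ?thesis unfolding 1(2) length_map set_map using *[OF 1(1)] by blast
    qed auto
    then show ?thesis using False by (simp only: if_False)
  qed
  show "S \<in> vrl W D r" if S: "finite S" "S \<subseteq> (if sngl (set L) then set L else insert pt (set L))" for S
    using S(2) L mixed_insert[OF L] down_vrl[of W D r] unfolding down_def by (auto split: if_splits)
next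
  fix L M :: "(nat \<times> (nat \<Rightarrow> real)) set list" assume "M \<in> keys (bdl L)"
  then have "set M \<subseteq> set L" using bdl_keys by blast
  moreover then have "sngl (set L) \<Longrightarrow> sngl (set M)" unfolding sngl_def by blast
  ultimately show "(if sngl (set M) then set M else insert pt (set M)) \<subseteq> (if sngl (set L) then set L else insert pt (set L))"
    by auto
qed (use z down_vrl that bd_fold in auto)

lemma on_ret:
  assumes "j \<in> J" "on (vrl W D r) p z"
  shows "on (vrl (sp j) (geo j) r) p (mp (map (ret j)) z)"
proof (rule on_mp[OF assms(2)])
  fix S assume S: "S \<in> vrl W D r"
  have "geo j (ret j P) (ret j Q) < r" if "P \<in> S" "Q \<in> S" for P Q
  proof -
    have "P \<in> W" "Q \<in> W" "D P Q < r" using S that unfolding vrl_iff by auto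
    then show ?thesis using ret_D[OF assms(1), of P Q] by simp
  qed
  then show "ret j ` S \<in> vrl (sp j) (geo j) r"
    using S ret_sp[OF assms(1)] unfolding vrl_iff by auto
qed

lemma on_cl:
  assumes "j \<in> J" "on (vrl (sp j) (geo j) r) p z"
  shows "on (vrl W D r) p (mp (map (cl j)) z)"
proof (rule on_mp[OF assms(2)])
  fix S assume S: "S \<in> vrl (sp j) (geo j) r"
  have "D (cl j x) (cl j y) = geo j x y" if "x \<in> sp j" "y \<in> sp j" for x y
    using D_cl[OF assms(1) that(1) assms(1) that(2)] by simp
  then show "cl j ` S \<in> vrl W D r"
    using S cl_W[OF assms(1)] unfolding vrl_iff by (auto simp: subset_iff)
qed

lemma ret_cl_chain:
  assumes "j \<in> J" "on (vrl (sp j) (geo j) r) p z"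
  shows "mp (map (ret j)) (mp (map (cl j)) z) = z"
  unfolding mp_mp
proof (rule mp_id)
  fix L assume "L \<in> keys z"
  then have "set L \<in> vrl (sp j) (geo j) r" using assms(2) unfolding on_def by blast
  then have "set L \<subseteq> sp j" unfolding vrl_iff by auto
  then show "map (ret j) (map (cl j) L) = L"
    using ret_cl[OF assms(1) _ assms(1)] by (auto intro!: map_idI)
qed

context
  fixes r :: real
  assumes r: "0 < r" "r \<le> pi / 2"
begin

lemma cosr: "0 \<le> cos r" "cos r < 1"
proof -
  show "0 \<le> cos r" using r by (intro cos_ge_zero) auto
  have "cos r < cos 0" using r pi_gt_zero by (intro cos_monotone_0_pi) auto
  then show "cos r < 1" by simp
qed

lemma vr_sp: "vrl (sp j) (geo j) r = sph j 1 (cos r)"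
  using vr_sphere[of 1 r j] r pi_gt_zero by simp

text \<open>\<open>z\<close> is homologous to the sum of its retractions onto the spheres, up to
  constant chains, which bound cones at \<open>pt\<close>. The complex of the
  \<open>j\<close>-sphere is acyclic in every degree but \<open>j\<close>, so only the summand
  \<open>j = m\<close> can survive.\<close>

lemma cycle_on_sphere:
  assumes z: "on (vrl W D r) (Suc m) z" "bd z = 0"
  shows "m \<in> J \<Longrightarrow> \<exists>d. on (vrl W D r) (Suc (Suc m)) d \<and> z = mp (map (cl m)) (mp (map (ret m)) z) + bd d"
    and "m \<notin> J \<Longrightarrow> \<not> nonbdry (vrl W D r) (Suc m) z"
proof -
  obtain d0 where d0: "on (vrl W D r) (Suc (Suc m)) d0" "z + lin foldw z = bd d0"
    by (rule retraction_homologous[OF z])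
  let ?e = "\<lambda>j. mp (map (cl j)) (mp (map (ret j)) z)"
  have "\<exists>d. on (vrl W D r) (Suc (Suc m)) d \<and> ?e j = bd d" if j: "j \<in> J - {m}" for j
  proof -
    have jJ: "j \<in> J" using j by simp
    have o: "on (sph j 1 (cos r)) (Suc m) (mp (map (ret j)) z)" using on_ret[OF jJ z(1)] by (simp add: vr_sp)
    have c: "bd (mp (map (ret j)) z) = 0" using z(2) by (simp add: bd_mp)
    have jm: "Suc m \<noteq> Suc j" using j by auto
    obtain d where d: "on (sph j 1 (cos r)) (Suc (Suc m)) d" "mp (map (ret j)) z = bd d"
      by (rule sph_acyclic[OF zero_less_one cosr o c jm])
    then have "on (vrl W D r) (Suc (Suc m)) (mp (map (cl j)) d)" by (intro on_cl[OF jJ]) (simp add: vr_sp)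
    moreover have "?e j = bd (mp (map (cl j)) d)" by (simp add: d(2) bd_mp)
    ultimately show ?thesis by blast
  qed
  then have "\<exists>d. \<forall>j\<in>J - {m}. on (vrl W D r) (Suc (Suc m)) (d j) \<and> ?e j = bd (d j)" by (intro bchoice ballI)
  then obtain d where d: "\<And>j. j \<in> J - {m} \<Longrightarrow> on (vrl W D r) (Suc (Suc m)) (d j) \<and> ?e j = bd (d j)" by blast
  let ?k = "mp (map (\<lambda>_. pt)) z"
  have "pt \<in> W" unfolding pt_def using n b by (intro cl_W) auto
  then have pt_r: "{pt} \<in> vrl W D r"
    using Metric_space.zero[OF MW, of pt pt] r unfolding vrl_iff by simp
  have "on {{pt}, {}} (Suc m) ?k" by (rule on_mp[OF z(1)]) auto
  then have k1: "on (vrl W D r) (Suc (Suc m)) (lcone pt ?k)" by (rule on_lcone) (use pt_r in auto)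
  have k2: "?k = bd (lcone pt ?k)" using z(2) by (simp add: bd_lcone bd_mp)
  define F where "F = (\<Sum>j\<in>J - {m}. d j) + (\<Sum>j\<in>{2..n}. lcone pt ?k)"
  have F: "on (vrl W D r) (Suc (Suc m)) F" unfolding F_def using d k1 by (intro on_add on_sum) auto
  have bds: "bd (\<Sum>j\<in>I. c j) = (\<Sum>j\<in>I. bd (c j))" for I :: "nat set" and c :: "nat \<Rightarrow> ('v list \<Rightarrow>\<^sub>0 bit)"
    by (simp add: bd_def lin_sum)
  have "lin foldw z = (\<Sum>j\<in>J. ?e j) + (\<Sum>j\<in>{2..n}. ?k)"
  proof -
    have "?e j = lin (\<lambda>L. sng (map (\<lambda>Q. cl j (ret j Q)) L)) z" for j
      unfolding mp_mp map_map o_def unfolding mp_def ..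
    moreover have "?k = lin (\<lambda>L. sng (map (\<lambda>_. pt) L)) z" unfolding mp_def ..
    ultimately show ?thesis unfolding foldw_def lin_fun_add lin_fun_sum by simp
  qed
  moreover have "bd F = (\<Sum>j\<in>J - {m}. ?e j) + (\<Sum>j\<in>{2..n}. ?k)"
    unfolding F_def bd_add bds using d k2 by simp
  moreover have "z = lin foldw z + bd d0" using d0(2) by (metis chain_add_eqD add.commute)
  ultimately have zz: "z = (\<Sum>j\<in>J. ?e j) + (\<Sum>j\<in>J - {m}. ?e j) + bd F + bd d0"
    by (simp add: ac_simps)
  have G: "on (vrl W D r) (Suc (Suc m)) (F + d0)" by (rule on_add[OF F d0(1)])
  show "\<exists>d. on (vrl W D r) (Suc (Suc m)) d \<and> z = ?e m + bd d" if "m \<in> J"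
  proof -
    have "(\<Sum>j\<in>J. ?e j) = ?e m + (\<Sum>j\<in>J - {m}. ?e j)" using that by (intro sum.remove) auto
    then have "z = ?e m + bd (F + d0)" using zz by (simp add: ac_simps)
    then show ?thesis using G by blast
  qed
  show "\<not> nonbdry (vrl W D r) (Suc m) z" if "m \<notin> J"
  proof -
    have "J - {m} = J" using that by blast
    then have "z = bd (F + d0)" using zz by (simp add: ac_simps)
    then show ?thesis using G unfolding nonbdry_def by blast
  qed
qed

lemma wedge_dim:
  assumes z: "on (vrl W D r) (Suc m) z" "bd z = 0" "nonbdry (vrl W D r) (Suc m) z"
    and w: "on (vrl W D r) (Suc m) w" "bd w = 0" "nonbdry (vrl W D r) (Suc m) w"
  shows "\<not> nonbdry (vrl W D r) (Suc m) (z + w)"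
proof -
  have m: "m \<in> J" using cycle_on_sphere(2)[OF z(1,2)] z(3) by blast
  let ?r = "mp (map (ret m))" and ?c = "mp (map (cl m))"
  have key: "?r v \<noteq> bd d" if v: "on (vrl W D r) (Suc m) v" "bd v = 0" "nonbdry (vrl W D r) (Suc m) v"
    and d: "on (sph m 1 (cos r)) (Suc (Suc m)) d" for v d
  proof
    assume eq: "?r v = bd d"
    obtain e where e: "on (vrl W D r) (Suc (Suc m)) e" "v = ?c (?r v) + bd e" using cycle_on_sphere(1)[OF v(1,2) m] by blast
    have "v = bd (?c d + e)" using e(2) unfolding eq by (simp add: bd_mp)
    moreover have "on (vrl W D r) (Suc (Suc m)) (?c d + e)"
      using on_cl[OF m, of r "Suc (Suc m)" d] d e(1) by (intro on_add) (simp_all add: vr_sp)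
    ultimately show False using v(3) unfolding nonbdry_def by blast
  qed
  have rr: "on (sph m 1 (cos r)) (Suc m) (?r v)" if "on (vrl W D r) (Suc m) v" for v
    using on_ret[OF m that] by (simp add: vr_sp)
  obtain d where d: "on (sph m 1 (cos r)) (Suc (Suc m)) d" "?r z + ?r w = bd d"
    by (rule sph_top[of 1 "cos r" m "Suc m" "?r z" "?r w"]) (use cosr rr z w key in \<open>auto simp: bd_mp\<close>)
  obtain e where e: "on (vrl W D r) (Suc (Suc m)) e" "z = ?c (?r z) + bd e" using cycle_on_sphere(1)[OF z(1,2) m] by blast
  obtain f where f: "on (vrl W D r) (Suc (Suc m)) f" "w = ?c (?r w) + bd f" using cycle_on_sphere(1)[OF w(1,2) m] by blast
  have "z + w = (?c (?r z) + bd e) + (?c (?r w) + bd f)" using e(2) f(2) by simp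
  also have "\<dots> = ?c (?r z + ?r w) + bd (e + f)" by (simp add: ac_simps)
  also have "\<dots> = bd (?c d + (e + f))" unfolding d(2) by (simp add: bd_mp)
  finally have "z + w = bd (?c d + (e + f))" .
  moreover have "on (vrl W D r) (Suc (Suc m)) (?c d + (e + f))"
    using on_cl[OF m, of r "Suc (Suc m)" d] d e(1) f(1) by (intro on_add) (simp_all add: vr_sp)
  ultimately show ?thesis unfolding nonbdry_def by blast
qed

text \<open>The image of the fundamental cycle of the \<open>m\<close>-sphere; \<open>ret m\<close>
  would turn a filling in the wedge into a filling in the sphere.\<close>

lemma wedge_fundamental:
  assumes m: "m \<in> J"
  obtains z where "on (vrl W D r) (Suc m) z" "bd z = 0"
    "\<And>r'. r \<le> r' \<Longrightarrow> r' \<le> pi / 2 \<Longrightarrow> nonbdry (vrl W D r') (Suc m) z"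
proof -
  obtain h where h: "\<And>j. j \<le> m \<Longrightarrow> on (sph m 1 (cos r)) (Suc j) (h j)" "bd (h 0) = sng []"
    "\<And>j. bd (h (Suc j)) = h j + mp (map neg) (h j)"
    "\<And>d c'. 0 \<le> c' \<Longrightarrow> on (sph m 1 c') (Suc (Suc m)) d \<Longrightarrow> h m + mp (map neg) (h m) \<noteq> bd d"
    using hemispheres[of 1 "cos r" m] cosr by auto
  let ?s = "h m + mp (map neg) (h m)"
  have "neg ` S \<in> sph m 1 (cos r)" if "S \<in> sph m 1 (cos r)" for S using that by (auto simp: sph_def)
  then have s: "on (sph m 1 (cos r)) (Suc m) ?s" using h(1)[of m] on_mp[of "sph m 1 (cos r)" "Suc m" "h m" neg] by (auto intro: on_add)
  obtain q where q: "m = Suc q" using m by (cases m) auto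
  have s0: "bd ?s = 0"
    unfolding bd_add bd_mp unfolding q h(3) by (simp add: mp_mp o_def mp_id ac_simps)
  have sv: "on (vrl (sp m) (geo m) r) (Suc m) ?s" unfolding vr_sp by (rule s)
  show thesis
  proof (rule that[of "mp (map (cl m)) ?s"])
    show "on (vrl W D r) (Suc m) (mp (map (cl m)) ?s)" by (rule on_cl[OF m sv])
    show "bd (mp (map (cl m)) ?s) = 0" using s0 by (simp only: bd_mp mp_0)
    fix r' assume r': "r \<le> r'" "r' \<le> pi / 2"
    show "nonbdry (vrl W D r') (Suc m) (mp (map (cl m)) ?s)"
      unfolding nonbdry_def
    proof (intro allI impI notI)
      fix d assume d: "on (vrl W D r') (Suc (Suc m)) d" "mp (map (cl m)) ?s = bd d"
      have "mp (map (ret m)) (mp (map (cl m)) ?s) = ?s" by (rule ret_cl_chain[OF m sv])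
      then have "?s = bd (mp (map (ret m)) d)" unfolding d(2) by (simp only: bd_mp)
      moreover have "vrl (sp m) (geo m) r' = sph m 1 (cos r')"
        using vr_sphere[of 1 r' m] r r' pi_gt_zero by simp
      then have "on (sph m 1 (cos r')) (Suc (Suc m)) (mp (map (ret m)) d)" using on_ret[OF m d(1)] by simp
      moreover have "0 \<le> cos r'" using r r' by (intro cos_ge_zero) auto
      ultimately show False using h(4) by blast
    qed
  qed
qed

end

lemma pushable_wedge: "pushable W D"
  unfolding pushable_def
proof (rule bexI[of _ pt], intro allI impI ballI)
  show "pt \<in> W" unfolding pt_def using n b by (intro cl_W) auto
  fix a v assume a: "0 \<le> a \<and> a \<le> pi" and "v \<in> W"
  then obtain i x where i: "v = cl i x" "i \<in> J" "x \<in> sp i" unfolding W_eq by blast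
  have bi: "b i \<in> sp i" using b i by blast
  have "geo i x (b i) \<le> pi" using geodesic_diam[OF i(3) bi] by simp
  then obtain y where y: "y \<in> sp i" "geo i x y \<le> a" "geo i y (b i) \<le> pi - a"
    using geodesic_push[of i 1 x "b i" a] i bi a by auto
  show "\<exists>v'\<in>W. D v v' \<le> a \<and> D v' pt \<le> pi - a"
    using D_cl[OF i(2,3) i(2) y(1)] D_pt[OF i(2) y(1)] y i by (intro bexI[of _ "cl i y"]) (auto intro: cl_W)
qed

end

section \<open>The homology modules\<close>

definition cls :: "'c set \<Rightarrow> 'c \<Rightarrow> 'c::plus set" where
  "cls B x = (\<lambda>h. h + x) ` B"

lemma map_zero_one [simp]: "Poly_Mapping.map ((*) (0::bit)) c = 0" "Poly_Mapping.map ((*) (1::bit)) c = c"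
  by (rule poly_mapping_eqI, simp add: Poly_Mapping.map.rep_eq when_def)+

lemma boundaries2_0 [simp]: "0 \<in> boundaries2 p X"
  unfolding boundaries2_def by (rule image_eqI[of _ _ 0]) simp_all

lemma cls_eq_iff: "cls (boundaries2 p X) x = cls (boundaries2 p X) y \<longleftrightarrow> x + y \<in> boundaries2 p X"
proof
  assume "cls (boundaries2 p X) x = cls (boundaries2 p X) y"
  moreover have "x \<in> cls (boundaries2 p X) x" unfolding cls_def by (rule image_eqI[of _ _ 0]) simp_all
  ultimately obtain h where "h \<in> boundaries2 p X" "x = h + y" unfolding cls_def by blast
  then show "x + y \<in> boundaries2 p X" by (simp add: add.assoc)
next
  have *: "cls (boundaries2 p X) x \<subseteq> cls (boundaries2 p X) y" if "x + y \<in> boundaries2 p X" for x y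
  proof
    fix z assume "z \<in> cls (boundaries2 p X) x"
    then obtain h where h: "h \<in> boundaries2 p X" "z = h + x" unfolding cls_def by blast
    have "z = (h + (x + y)) + y" by (simp add: h(2) add.assoc)
    then show "z \<in> cls (boundaries2 p X) y" unfolding cls_def using boundaries2_add[OF h(1) that] by blast
  qed
  assume "x + y \<in> boundaries2 p X"
  then show "cls (boundaries2 p X) x = cls (boundaries2 p X) y"
    using *[of x y] *[of y x] by (simp add: add.commute)
qed

lemma cls_0: "cls (boundaries2 p X) 0 = boundaries2 p X"
  by (simp add: cls_def)

lemma cls_zero_iff: "cls (boundaries2 p X) x = boundaries2 p X \<longleftrightarrow> x \<in> boundaries2 p X"
  using cls_eq_iff[of p X x 0] by (simp add: cls_0)

lemma coset_cls: "boundaries2 p X +>\<^bsub>reduced_cycle_module2 p X\<^esub> x = cls (boundaries2 p X) x"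
  by (auto simp: a_r_coset_def r_coset_def reduced_cycle_module2_def cls_def)

lemma homology_carrier: "carrier (reduced_homology2 p X) = cls (boundaries2 p X) ` reduced_cycles2 p X"
  by (auto simp: reduced_homology2_def quot_module_def A_RCOSETS_def RCOSETS_def cls_def
      a_r_coset_def r_coset_def reduced_cycle_module2_def)

lemma homology_add:
  "cls (boundaries2 p X) x \<oplus>\<^bsub>reduced_homology2 p X\<^esub> cls (boundaries2 p X) y = cls (boundaries2 p X) (x + y)"
proof -
  have "cls (boundaries2 p X) x \<oplus>\<^bsub>reduced_homology2 p X\<^esub> cls (boundaries2 p X) y =
      {h + k | h k. h \<in> cls (boundaries2 p X) x \<and> k \<in> cls (boundaries2 p X) y}"
    by (auto simp: reduced_homology2_def quot_module_def set_add_def set_mult_def reduced_cycle_module2_def)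
  also have "\<dots> = cls (boundaries2 p X) (x + y)"
  proof (intro equalityI subsetI)
    fix z assume "z \<in> {h + k | h k. h \<in> cls (boundaries2 p X) x \<and> k \<in> cls (boundaries2 p X) y}"
    then obtain h k where "h \<in> boundaries2 p X" "k \<in> boundaries2 p X" "z = (h + x) + (k + y)" by (auto simp: cls_def)
    then show "z \<in> cls (boundaries2 p X) (x + y)"
      unfolding cls_def by (intro image_eqI[of _ _ "h + k"] boundaries2_add) (simp_all add: ac_simps)
  next
    fix z assume "z \<in> cls (boundaries2 p X) (x + y)"
    then obtain h where h: "h \<in> boundaries2 p X" "z = h + (x + y)" by (auto simp: cls_def)
    have "h + x \<in> cls (boundaries2 p X) x" "y \<in> cls (boundaries2 p X) y"
      using h by (auto simp: cls_def intro: image_eqI[of _ _ 0])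
    then show "z \<in> {h + k | h k. h \<in> cls (boundaries2 p X) x \<and> k \<in> cls (boundaries2 p X) y}"
      using h(2) by (auto simp: add.assoc[symmetric])
  qed
  finally show ?thesis .
qed

lemma homology_smult:
  "a \<odot>\<^bsub>reduced_homology2 p X\<^esub> cls (boundaries2 p X) x = (if a = 0 then boundaries2 p X else cls (boundaries2 p X) x)"
proof -
  have ne: "x \<in> cls (boundaries2 p X) x" unfolding cls_def by (rule image_eqI[of _ _ 0]) simp_all
  have "a \<odot>\<^bsub>reduced_homology2 p X\<^esub> cls (boundaries2 p X) x =
      (\<Union>y\<in>cls (boundaries2 p X) x. cls (boundaries2 p X) (Poly_Mapping.map ((*) a) y))"
    unfolding coset_cls[symmetric] by (simp add: reduced_homology2_def quot_module_def reduced_cycle_module2_def)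
  moreover have "cls (boundaries2 p X) y = cls (boundaries2 p X) x" if "y \<in> cls (boundaries2 p X) x" for y
    using that by (subst cls_eq_iff) (auto simp: cls_def add.assoc)
  ultimately have "a \<odot>\<^bsub>reduced_homology2 p X\<^esub> cls (boundaries2 p X) x =
      (\<Union>y\<in>cls (boundaries2 p X) x. if a = 0 then boundaries2 p X else cls (boundaries2 p X) x)"
    by (cases a) (simp_all add: cls_0)
  moreover have "cls (boundaries2 p X) x \<noteq> {}" using ne by blast
  ultimately show ?thesis by (simp only: UN_constant if_False)
qed

lemma simplex_realization_mono:
  assumes "K \<subseteq> K'" "singular_simplex p (geometric_realization K) \<sigma>"
  shows "singular_simplex p (geometric_realization K') \<sigma>"
proof -
  have "continuous_map (geometric_realization K) (geometric_realization K') (\<lambda>x. x)"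
    unfolding continuous_map_def
  proof (intro conjI allI impI)
    show "(\<lambda>x. x) \<in> topspace (geometric_realization K) \<rightarrow> topspace (geometric_realization K')"
      using assms(1) by (auto simp: topspace_geometric_realization)
    fix U assume U: "openin (geometric_realization K') U"
    have "{x \<in> topspace (geometric_realization K). x \<in> U} \<inter> closed_cell S = U \<inter> closed_cell S" if "S \<in> K" for S
      using that by (auto simp: topspace_geometric_realization)
    then show "openin (geometric_realization K) {x \<in> topspace (geometric_realization K). x \<in> U}"
      using U assms(1) unfolding openin_geometric_realization by (auto simp: topspace_geometric_realization)
  qed
  then show ?thesis
    using assms(2) continuous_map_compose[of _ "geometric_realization K" \<sigma> "geometric_realization K'" "\<lambda>x. x"]
    by (auto simp: singular_simplex_def o_def)
qed

lemma vr_complex_mono: "r \<le> s \<Longrightarrow> vr_complex M d r \<subseteq> vr_complex M d s"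
  by (auto simp: vr_complex_def)

lemma chain2_vr_mono: "r \<le> s \<Longrightarrow> chain2_set p (vr_space M d r) \<subseteq> chain2_set p (vr_space M d s)"
  unfolding chain2_set_def vr_space_def using simplex_realization_mono[OF vr_complex_mono] by blast

abbreviation "vZ m M d r \<equiv> reduced_cycles2 m (vr_space M d r)"
abbreviation "vB m M d r \<equiv> boundaries2 m (vr_space M d r)"

lemma vZ_mono: "r \<le> s \<Longrightarrow> vZ m M d r \<subseteq> vZ m M d s"
  unfolding reduced_cycles2_def using chain2_vr_mono[of r s m M d] by blast

lemma vB_mono: "r \<le> s \<Longrightarrow> vB m M d r \<subseteq> vB m M d s"
  unfolding boundaries2_def using chain2_vr_mono[of r s "Suc m" M d] by (rule image_mono)

lemma chain_map2_id: "c \<in> chain2_set p X \<Longrightarrow> chain_map2 p id c = c"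
proof -
  assume c: "c \<in> chain2_set p X"
  have "chain_map2 p id c = mp (simplex_map p id) c"
    unfolding chain_map2_def mp_def lin_def by (rule sum.cong) (simp_all add: lookup_keys)
  also have "\<dots> = c"
  proof (rule mp_id)
    fix \<sigma> assume "\<sigma> \<in> keys c"
    then have "\<sigma> \<in> extensional (standard_simplex p)" using c by (auto simp: chain2_set_def singular_simplex_def)
    then show "simplex_map p id \<sigma> = \<sigma>" by (simp add: simplex_map_def extensional_restrict)
  qed
  finally show ?thesis .
qed

lemma boundary2_chain:
  assumes "c \<in> chain2_set (Suc p) X"
  shows "boundary2 (Suc p) c \<in> chain2_set p X"
  unfolding boundary2_eq
proof (rule chain2_set_lin)
  fix \<sigma> assume "\<sigma> \<in> keys c"
  then have "singular_simplex (Suc p) X \<sigma>" using assms by (auto simp: chain2_set_def)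
  then have "singular_simplex p X (singular_face (Suc p) k \<sigma>)" if "k \<le> Suc p" for k
    using singular_simplex_singular_face[of "Suc p" X \<sigma> k] that by simp
  then have "k \<le> Suc p \<Longrightarrow> sng (singular_face (Suc p) k \<sigma>) \<in> chain2_set p X" for k
    by (auto simp: chain2_set_def)
  then show "(\<Sum>k\<le>Suc p. sng (singular_face (Suc p) k \<sigma>)) \<in> chain2_set p X"
    unfolding chain2_set_def using keys_sum[of "\<lambda>k. sng (singular_face (Suc p) k \<sigma>)" "{..Suc p}"] by blast
qed

lemma homology_map_cls:
  assumes "r \<le> s" "x \<in> vZ m M d r"
  shows "homology_map2 m (vr_space M d s) id (cls (vB m M d r) x) = cls (vB m M d s) x"
proof -
  have x: "x \<in> cls (vB m M d r) x" unfolding cls_def by (rule image_eqI[of _ _ 0]) simp_all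
  have "cls (vB m M d s) (chain_map2 m id y) = cls (vB m M d s) x" if y: "y \<in> cls (vB m M d r) x" for y
  proof -
    obtain h where h: "h \<in> vB m M d r" "y = h + x" using y by (auto simp: cls_def)
    obtain e where e: "e \<in> chain2_set (Suc m) (vr_space M d r)" "h = boundary2 (Suc m) e"
      using h(1) by (auto simp: boundaries2_def)
    have "h \<in> chain2_set m (vr_space M d r)"
      unfolding e(2) by (rule boundary2_chain[OF e(1)])
    moreover have "x \<in> chain2_set m (vr_space M d r)" using assms(2) by (simp add: reduced_cycles2_def)
    ultimately have "chain_map2 m id y = y" unfolding h(2) by (rule chain_map2_id[OF chain2_set_add])
    moreover have "y + x \<in> vB m M d s" using h vB_mono[OF assms(1)] by (auto simp: add.assoc)
    ultimately show ?thesis by (simp add: cls_eq_iff)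
  qed
  then show ?thesis unfolding homology_map2_def coset_cls using x by blast
qed

lemma vZ_nonpos:
  assumes "r \<le> 0" "Metric_space M d"
  shows "vZ m M d r \<subseteq> vB m M d r"
proof
  fix z assume "z \<in> vZ m M d r"
  then have z: "keys z \<subseteq> singular_simplex_set m (vr_space M d r)" by (simp add: reduced_cycles2_def chain2_set_def)
  have "vr_complex M d r = {}"
  proof (rule equals0I)
    fix S assume S: "S \<in> vr_complex M d r"
    then obtain x where "x \<in> S" by (auto simp: vr_complex_def)
    then have "d x x < r" using S by (auto simp: vr_complex_iff)
    then show False using assms Metric_space.nonneg[OF assms(2), of x x] by linarith
  qed
  then have "topspace (vr_space M d r) = {}" by (simp add: vr_space_def topspace_geometric_realization)
  then have "keys z = {}" using z singular_simplex_empty by blast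
  then show "z \<in> vB m M d r" by simp
qed

section \<open>The interleaving\<close>

text \<open>One fundamental class that lives at all scales in \<open>(0, \<pi>/2]\<close>, present or absent, and
  nothing else up to classes that die within \<open>\<pi>/3\<close>.\<close>

definition one_bar :: "bool \<Rightarrow> nat \<Rightarrow> 'a set \<Rightarrow> ('a \<Rightarrow> 'a \<Rightarrow> real) \<Rightarrow> bool" where
  "one_bar flag m M d \<longleftrightarrow>
     Metric_space M d \<and> pushable M d \<and>
     (\<forall>r. 0 < r \<and> r \<le> pi / 2 \<longrightarrow>
        (\<forall>z w. on (vrl M d r) (Suc m) z \<and> bd z = 0 \<and> nonbdry (vrl M d r) (Suc m) z \<and>
            on (vrl M d r) (Suc m) w \<and> bd w = 0 \<and> nonbdry (vrl M d r) (Suc m) w \<longrightarrow>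
            \<not> nonbdry (vrl M d r) (Suc m) (z + w)) \<and>
        (if flag
         then \<exists>z. on (vrl M d r) (Suc m) z \<and> bd z = 0 \<and> nonbdry (vrl M d (pi / 2)) (Suc m) z
         else \<forall>z. on (vrl M d r) (Suc m) z \<and> bd z = 0 \<longrightarrow> \<not> nonbdry (vrl M d r) (Suc m) z))"

locale bars =
  fixes flag :: bool and m :: nat and M :: "'a set" and d :: "'a \<Rightarrow> 'a \<Rightarrow> real"
  assumes one: "one_bar flag m M d"
begin

abbreviation "Z \<equiv> vZ m M d"
abbreviation "B \<equiv> vB m M d"

lemma rep_bounds:
  assumes "x \<in> Z r" "r \<le> s"
  obtains z where "on (vrl M d r) (Suc m) z" "bd z = 0" "x + incc z \<in> B r"
    "\<not> nonbdry (vrl M d s) (Suc m) z \<Longrightarrow> x \<in> B s"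
proof -
  obtain z where z: "on (vrl M d r) (Suc m) z" "bd z = 0" "x + incc z \<in> B r"
    using simplicial_representative[OF simp_cx_vr, of x m M d r] assms(1) by (auto simp: vr_space_def)
  show thesis
  proof (rule that[OF z])
    assume "\<not> nonbdry (vrl M d s) (Suc m) z"
    then obtain e where "on (vrl M d s) (Suc (Suc m)) e" "z = bd e" by (auto simp: nonbdry_def)
    then have "incc z \<in> B s" using incc_boundary[OF simp_cx_vr] by (simp add: vr_space_def)
    moreover have "x + incc z \<in> B s" using z(3) vB_mono[OF assms(2)] by blast
    ultimately have "(x + incc z) + incc z \<in> B s" by (metis boundaries2_add)
    then show "x \<in> B s" by (simp add: add.assoc)
  qed
qed

lemma dim:
  assumes r: "0 < r" "r \<le> pi / 2" and x: "x \<in> Z r" "x \<notin> B r" and y: "y \<in> Z r" "y \<notin> B r"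
  shows "x + y \<in> B r"
proof -
  obtain z where z: "on (vrl M d r) (Suc m) z" "bd z = 0" "x + incc z \<in> B r" "nonbdry (vrl M d r) (Suc m) z"
    using rep_bounds[OF x(1) order_refl] x(2) by metis
  obtain w where w: "on (vrl M d r) (Suc m) w" "bd w = 0" "y + incc w \<in> B r" "nonbdry (vrl M d r) (Suc m) w"
    using rep_bounds[OF y(1) order_refl] y(2) by metis
  have "\<not> nonbdry (vrl M d r) (Suc m) (z + w)"
    using one r z w unfolding one_bar_def by blast
  then obtain e where "on (vrl M d r) (Suc (Suc m)) e" "z + w = bd e" by (auto simp: nonbdry_def)
  then have "incc (z + w) \<in> B r" using incc_boundary[OF simp_cx_vr] by (simp add: vr_space_def)
  from boundaries2_add[OF boundaries2_add[OF z(3) w(3)] this]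
  have "((x + y) + incc (z + w)) + incc (z + w) \<in> B r" by (simp add: ac_simps incc_add)
  then show ?thesis by (simp add: add.assoc)
qed

lemma fundamental:
  assumes flag and r: "0 < r" "r \<le> pi / 2"
  obtains b where "b \<in> Z r" "b \<notin> B (pi / 2)"
proof -
  obtain z where z: "on (vrl M d r) (Suc m) z" "bd z = 0" "nonbdry (vrl M d (pi / 2)) (Suc m) z"
    using one r \<open>flag\<close> unfolding one_bar_def by auto
  have z2: "on (vrl M d (pi / 2)) (Suc m) z"
    by (rule on_mono[OF z(1)]) (use vr_complex_mono[OF r(2)] in blast)
  have "incc z \<in> Z r" using incc_cycle[OF simp_cx_vr z(1,2)] by (simp add: vr_space_def)
  moreover have "incc z \<notin> B (pi / 2)"
    using simplicial_boundary[OF simp_cx_vr z2 z(2)] z(3) unfolding nonbdry_def vr_space_def by metis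
  ultimately show thesis by (rule that)
qed

lemma no_flag: "\<not> flag \<Longrightarrow> 0 < r \<Longrightarrow> r \<le> pi / 2 \<Longrightarrow> x \<in> Z r \<Longrightarrow> x \<in> B r"
  using rep_bounds[of x r r] one unfolding one_bar_def by (metis order_refl)

text \<open>If \<open>x\<close> died by \<open>s\<close> without being zero at \<open>r\<close>, it
  would be homologous to the fundamental class at \<open>r\<close>, which would then also be zero at
  pi/2.\<close>

lemma persists:
  assumes r: "0 < r" "r \<le> s" "s \<le> pi / 2" and x: "x \<in> Z r" "x \<in> B s"
  shows "x \<in> B r"
proof (rule ccontr)
  assume nx: "x \<notin> B r"
  have r': "r \<le> pi / 2" using r by linarith
  have flag using nx no_flag[OF _ r(1) r' x(1)] by blast
  obtain b where b: "b \<in> Z r" "b \<notin> B (pi / 2)" by (rule fundamental[OF \<open>flag\<close> r(1) r'])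
  have bs: "B r \<subseteq> B (pi / 2)" "B s \<subseteq> B (pi / 2)" by (rule vB_mono[OF r'], rule vB_mono[OF r(3)])
  have "b \<notin> B r" using b(2) bs(1) by blast
  then have "x + b \<in> B r" by (rule dim[OF r(1) r' x(1) nx b(1)])
  then have "x + (x + b) \<in> B (pi / 2)" using x(2) bs boundaries2_add by blast
  then show False using b(2) by simp
qed

lemma pushed:
  assumes "0 \<le> a" "a \<le> pi" "r + 2 * a \<le> s" "pi - a < s" "x \<in> Z r"
  shows "x \<in> B s"
proof -
  have "r \<le> s" using assms by linarith
  show ?thesis
    using rep_bounds[OF assms(5) \<open>r \<le> s\<close>] pushable_bounds[of M d a r s m] assms one unfolding one_bar_def by metis
qed

text \<open>A push by pi/6 requires \<open>r + pi/3 \<le> s\<close> and \<open>5 pi/6 < s\<close>,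
  and for \<open>s = r + pi/3\<close> the latter is \<open>pi/2 < r\<close>. In \<open>early\<close>
  a push by pi/3 requires \<open>r + 2 pi/3 \<le> s\<close> and \<open>2 pi/3 < s\<close>.\<close>

lemma late: "pi / 2 < r \<Longrightarrow> x \<in> Z r \<Longrightarrow> x \<in> B (r + pi / 3)"
  by (rule pushed[of "pi / 6" r]) auto

lemma early: "0 < r \<Longrightarrow> r + 2 * pi / 3 \<le> s \<Longrightarrow> x \<in> Z r \<Longrightarrow> x \<in> B s"
  by (rule pushed[of "pi / 3" r]) auto

lemma nonpos: "r \<le> 0 \<Longrightarrow> x \<in> Z r \<Longrightarrow> x \<in> B r"
  using vZ_nonpos[of r M d m] one unfolding one_bar_def by blast

text \<open>Pushing at scale \<open>r\<close> would give only death by \<open>r + 2 pi/3\<close>.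
  But the nonzero class at \<open>r\<close> is already represented at an earlier scale
  \<open>q \<le> s - 2 pi/3\<close>, so it is dead at every \<open>s > 2 pi/3\<close>.\<close>

lemma dies:
  assumes r: "r \<le> pi / 2" and s: "2 * pi / 3 < s" "r \<le> s" and x: "x \<in> Z r"
  shows "x \<in> B s"
proof (cases "0 < r \<and> x \<notin> B r")
  case True
  then have flag using no_flag r x by blast
  define q where "q = min r (s - 2 * pi / 3)"
  have q: "0 < q" "q \<le> r" "q + 2 * pi / 3 \<le> s" using True s by (auto simp: q_def)
  obtain b where b: "b \<in> Z q" "b \<notin> B (pi / 2)" using fundamental[OF \<open>flag\<close> q(1)] q r by auto
  have "b \<in> Z r" "b \<notin> B r" using b vZ_mono[OF q(2)] vB_mono[OF r] by blast+
  then have "x + b \<in> B r" using dim True r x by blast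
  then have "x + b \<in> B s" using vB_mono[OF s(2)] by blast
  moreover have "b \<in> B s" by (rule early[OF q(1,3) b(1)])
  ultimately have "(x + b) + b \<in> B s" by (rule boundaries2_add)
  then show ?thesis by (simp add: add.assoc)
next
  case False
  then have "x \<in> B r" using nonpos[OF _ x] by (meson linorder_not_less)
  then show ?thesis using vB_mono[OF s(2)] by blast
qed

end

text \<open>There is at most one nonzero class at each scale up to pi/2, so sending it to the class
  of \<open>c\<close> is linear; \<open>c\<close> exists at \<open>r + pi/6\<close> for every
  \<open>r > 0\<close>. Naturality across pi/2 holds because for \<open>s > pi/2\<close> the class
  of \<open>c\<close> is dead at \<open>s + pi/6 > 2 pi/3\<close>.\<close>

lemma one_bar_shift:
  fixes F :: "(bit, ('a \<Rightarrow> real) chain2 set) persistence" and G :: "(bit, ('b \<Rightarrow> real) chain2 set) persistence"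
  assumes F: "one_bar flag m M d" and G: "one_bar flag m N e"
    and c: "c \<in> vZ m N e (pi / 6)"
  defines "\<phi> \<equiv> \<lambda>r \<alpha>. if 0 < r \<and> r \<le> pi / 2 \<and> \<alpha> \<noteq> vB m M d r then cls (vB m N e (r + pi / 6)) c else vB m N e (r + pi / 6)"
  shows "shift_map F2 (pi / 6) (vr_homology m M d) (vr_homology m N e) \<phi>"
proof -
  interpret F: bars flag m M d by (unfold_locales) (rule F)
  interpret G: bars flag m N e by (unfold_locales) (rule G)
  have F2: "carrier F2 = UNIV" by (simp add: F2_def)
  have cZ: "c \<in> G.Z (r + pi / 6)" if "0 < r" for r using c vZ_mono[of "pi / 6" "r + pi / 6" m N e] that by auto
  have \<phi>: "\<phi> r (cls (F.B r) x) = (if 0 < r \<and> r \<le> pi / 2 \<and> x \<notin> F.B r then cls (G.B (r + pi / 6)) c else cls (G.B (r + pi / 6)) 0)" for r x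
    by (simp add: \<phi>_def cls_zero_iff cls_0)
  have Z0: "0 \<in> G.Z s" for s by (simp add: reduced_cycles2_def augmentation2_def)
  have "\<phi> r \<in> linear_maps F2 (reduced_homology2 m (vr_space M d r)) (reduced_homology2 m (vr_space N e (r + pi / 6)))" for r
    unfolding linear_maps_def F2
  proof (intro CollectI conjI ballI)
    show "\<phi> r \<in> carrier (reduced_homology2 m (vr_space M d r)) \<rightarrow> carrier (reduced_homology2 m (vr_space N e (r + pi / 6)))"
      unfolding homology_carrier using cZ Z0 by (auto simp: \<phi>)
    fix \<alpha> assume "\<alpha> \<in> carrier (reduced_homology2 m (vr_space M d r))"
    then obtain x where x: "x \<in> F.Z r" "\<alpha> = cls (F.B r) x" by (auto simp: homology_carrier)
    { fix \<beta> assume "\<beta> \<in> carrier (reduced_homology2 m (vr_space M d r))"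
      then obtain y where y: "y \<in> F.Z r" "\<beta> = cls (F.B r) y" by (auto simp: homology_carrier)
      have xy: "x + y \<in> F.B r \<longleftrightarrow> (x \<in> F.B r \<longleftrightarrow> y \<in> F.B r)" if r: "0 < r" "r \<le> pi / 2"
      proof -
        have "y \<in> F.B r" if "x + y \<in> F.B r" "x \<in> F.B r" using boundaries2_add[OF that(2,1)] by simp
        moreover have "x \<in> F.B r" if "x + y \<in> F.B r" "y \<in> F.B r" using boundaries2_add[OF that] by (simp add: add.assoc)
        ultimately show ?thesis using F.dim[OF r x(1) _ y(1)] boundaries2_add[of x m "vr_space M d r" y] by blast
      qed
      show "\<phi> r (\<alpha> \<oplus>\<^bsub>reduced_homology2 m (vr_space M d r)\<^esub> \<beta>) =
          \<phi> r \<alpha> \<oplus>\<^bsub>reduced_homology2 m (vr_space N e (r + pi / 6))\<^esub> \<phi> r \<beta>"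
        unfolding x(2) y(2) homology_add \<phi> using xy by (auto simp: homology_add) }
    fix a :: bit
    show "\<phi> r (a \<odot>\<^bsub>reduced_homology2 m (vr_space M d r)\<^esub> \<alpha>) = a \<odot>\<^bsub>reduced_homology2 m (vr_space N e (r + pi / 6))\<^esub> \<phi> r \<alpha>"
      unfolding x(2) homology_smult by (cases a) (simp_all add: \<phi> homology_smult, simp_all add: \<phi>_def)
  qed
  moreover have "\<phi> s (homology_map2 m (vr_space M d s) id \<alpha>) =
      homology_map2 m (vr_space N e (s + pi / 6)) id (\<phi> r \<alpha>)"
    if rs: "r \<le> s" and \<alpha>: "\<alpha> \<in> carrier (reduced_homology2 m (vr_space M d r))" for r s \<alpha>
  proof -
    obtain x where x: "x \<in> F.Z r" "\<alpha> = cls (F.B r) x" using \<alpha> by (auto simp: homology_carrier)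
    have map: "homology_map2 m (vr_space N e (s + pi / 6)) id (cls (G.B (r + pi / 6)) y) = cls (G.B (s + pi / 6)) y"
      if "y \<in> G.Z (r + pi / 6)" for y using homology_map_cls[of "r + pi / 6" "s + pi / 6" y m N e] rs that by simp
    show ?thesis
    proof (cases "0 < r \<and> r \<le> pi / 2 \<and> x \<notin> F.B r")
      case True
      have "homology_map2 m (vr_space N e (s + pi / 6)) id (\<phi> r \<alpha>) = cls (G.B (s + pi / 6)) c"
        unfolding x(2) \<phi> using True map cZ by simp
      moreover have "x \<in> F.B s \<longrightarrow> \<not> s \<le> pi / 2" using F.persists[of r s x] True rs x(1) by blast
      moreover have "c \<in> G.B (s + pi / 6)" if s: "pi / 2 < s"
      proof (rule G.dies[OF _ _ _ c])
        show "2 * pi / 3 < s + pi / 6" "pi / 6 \<le> s + pi / 6" using s pi_gt_zero by linarith+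
      qed simp
      ultimately show ?thesis
        unfolding x(2) homology_map_cls[OF rs x(1)] \<phi> using True rs by (auto simp: cls_eq_iff)
    next
      case False
      then have "x \<in> F.B s \<or> \<not> (0 < s \<and> s \<le> pi / 2)"
        using F.nonpos[of r x] x(1) vB_mono[OF rs] rs by (meson linorder_not_less order_trans subsetD)
      then show ?thesis
        unfolding x(2) homology_map_cls[OF rs x(1)] \<phi> using False map[OF Z0] by auto
    qed
  qed
  ultimately show ?thesis
    unfolding shift_map_def by (simp add: vr_homology_def)
qed

text \<open>If \<open>r + pi/6 \<le> pi/2\<close>, both maps are in their nonzero range. For larger
  \<open>r\<close> up to pi/2, the target scale \<open>r + pi/3\<close> exceeds 2 pi/3, where the
  class is dead by \<open>dies\<close>; beyond pi/2 \<open>late\<close> applies.\<close>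

lemma one_bar_compose:
  assumes F: "one_bar flag m M d" and G: "one_bar flag m N e"
    and b: "b \<in> vZ m M d (pi / 6)" "flag \<longrightarrow> b \<notin> vB m M d (pi / 2)"
    and c: "c \<in> vZ m N e (pi / 6)" "flag \<longrightarrow> c \<notin> vB m N e (pi / 2)"
  defines "\<phi> \<equiv> \<lambda>r \<alpha>. if 0 < r \<and> r \<le> pi / 2 \<and> \<alpha> \<noteq> vB m M d r then cls (vB m N e (r + pi / 6)) c else vB m N e (r + pi / 6)"
    and "\<psi> \<equiv> \<lambda>r \<alpha>. if 0 < r \<and> r \<le> pi / 2 \<and> \<alpha> \<noteq> vB m N e r then cls (vB m M d (r + pi / 6)) b else vB m M d (r + pi / 6)"
  assumes \<alpha>: "\<alpha> \<in> carrier (reduced_homology2 m (vr_space M d r))"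
  shows "\<psi> (r + pi / 6) (\<phi> r \<alpha>) = homology_map2 m (vr_space M d (r + 2 * (pi / 6))) id \<alpha>"
proof -
  interpret F: bars flag m M d by (unfold_locales) (rule F)
  interpret G: bars flag m N e by (unfold_locales) (rule G)
  obtain x where x: "x \<in> F.Z r" "\<alpha> = cls (F.B r) x" using \<alpha> by (auto simp: homology_carrier)
  have s: "r + 2 * (pi / 6) = r + pi / 3" "r + pi / 6 + pi / 6 = r + pi / 3" by simp_all
  have rhs: "homology_map2 m (vr_space M d (r + pi / 3)) id \<alpha> = cls (F.B (r + pi / 3)) x"
    unfolding x(2) by (rule homology_map_cls[OF _ x(1)]) simp
  show ?thesis
  proof (cases "0 < r \<and> r \<le> pi / 2 \<and> x \<notin> F.B r")
    case True
    then have flag using F.no_flag x(1) by blast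
    have \<phi>: "\<phi> r \<alpha> = cls (G.B (r + pi / 6)) c" using True by (simp add: \<phi>_def x(2) cls_zero_iff)
    show ?thesis
    proof (cases "r + pi / 6 \<le> pi / 2")
      case le: True
      have "c \<notin> G.B (r + pi / 6)" using c(2) \<open>flag\<close> vB_mono[OF le] by blast
      then have "\<psi> (r + pi / 6) (\<phi> r \<alpha>) = cls (F.B (r + pi / 3)) b"
        unfolding \<phi> using le True by (simp add: \<psi>_def s cls_zero_iff add.assoc)
      moreover have "b + x \<in> F.B (r + pi / 3)"
      proof -
        \<comment> \<open>\<open>x\<close> starts at \<open>r\<close> and \<open>b\<close> at
          \<open>pi / 6\<close>; this is the first scale at which both are defined and can be
          compared, and it is still below the target scale.\<close>
        define q where "q = max r (pi / 6)"
        have q: "0 < q" "q \<le> pi / 2" "r \<le> q" "pi / 6 \<le> q" "q \<le> r + pi / 3" using le True by (auto simp: q_def)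
        have "b \<in> F.Z q" "b \<notin> F.B q" using b \<open>flag\<close> vZ_mono[OF q(4)] vB_mono[OF q(2)] by blast+
        moreover have "x \<in> F.Z q" "x \<notin> F.B q" using x(1) vZ_mono[OF q(3)] F.persists[of r q x] True q by blast+
        ultimately have "b + x \<in> F.B q" using F.dim q by blast
        then show ?thesis using vB_mono[OF q(5)] by blast
      qed
      ultimately show ?thesis unfolding s rhs by (simp add: cls_eq_iff)
    next
      case False
      then have "\<psi> (r + pi / 6) (\<phi> r \<alpha>) = cls (F.B (r + pi / 3)) 0"
        by (simp add: \<psi>_def s cls_0)
      moreover have "x \<in> F.B (r + pi / 3)" using F.dies[of r "r + pi / 3" x] True False x(1) by simp
      ultimately show ?thesis unfolding s rhs by (simp add: cls_eq_iff)
    qed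
  next
    case False
    then have "\<phi> r \<alpha> = G.B (r + pi / 6)" by (auto simp: \<phi>_def x(2) cls_zero_iff)
    then have "\<psi> (r + pi / 6) (\<phi> r \<alpha>) = cls (F.B (r + pi / 3)) 0"
      by (simp add: \<psi>_def s cls_0)
    moreover have "x \<in> F.B (r + pi / 3)"
    proof (cases "pi / 2 < r")
      case True
      then show ?thesis using F.late x(1) by blast
    next
      case le: False
      then have "x \<in> F.B r" using False F.nonpos[OF _ x(1)] by (meson linorder_not_less)
      then show ?thesis using vB_mono[of r "r + pi / 3"] by auto
    qed
    ultimately show ?thesis unfolding s rhs by (simp add: cls_eq_iff)
  qed
qed

theorem one_bar_interleaved:
  assumes F: "one_bar flag m M d" and G: "one_bar flag m N e"
  shows "interleaved F2 (pi / 6) (vr_homology m M d) (vr_homology m N e)"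
proof -
  have ex: "\<exists>b. b \<in> vZ m L f (pi / 6) \<and> (flag \<longrightarrow> b \<notin> vB m L f (pi / 2))" if "one_bar flag m L f"
    for L and f :: "'c \<Rightarrow> 'c \<Rightarrow> real"
  proof -
    interpret bars flag m L f by (unfold_locales) (rule that)
    show ?thesis
    proof (cases flag)
      case True
      then show ?thesis using fundamental[of "pi / 6"] by auto
    next
      case False
      then show ?thesis by (intro exI[of _ 0]) (simp add: reduced_cycles2_def augmentation2_def)
    qed
  qed
  obtain b where b: "b \<in> vZ m M d (pi / 6)" "flag \<longrightarrow> b \<notin> vB m M d (pi / 2)" using ex[OF F] by blast
  obtain c where c: "c \<in> vZ m N e (pi / 6)" "flag \<longrightarrow> c \<notin> vB m N e (pi / 2)" using ex[OF G] by blast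
  show ?thesis
    unfolding interleaved_def
  proof (intro exI conjI allI ballI)
    show "shift_map F2 (pi / 6) (vr_homology m M d) (vr_homology m N e)
      (\<lambda>r \<alpha>. if 0 < r \<and> r \<le> pi / 2 \<and> \<alpha> \<noteq> vB m M d r then cls (vB m N e (r + pi / 6)) c else vB m N e (r + pi / 6))"
      by (rule one_bar_shift[OF F G c(1)])
    show "shift_map F2 (pi / 6) (vr_homology m N e) (vr_homology m M d)
      (\<lambda>r \<alpha>. if 0 < r \<and> r \<le> pi / 2 \<and> \<alpha> \<noteq> vB m N e r then cls (vB m M d (r + pi / 6)) b else vB m M d (r + pi / 6))"
      by (rule one_bar_shift[OF G F b(1)])
  qed (use one_bar_compose[OF F G b c] one_bar_compose[OF G F c b] in \<open>simp_all add: vr_homology_def\<close>)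
qed

section \<open>The two families as instances, and the upper bound\<close>

lemma one_bar_rp:
  assumes n: "1 \<le> n"
  shows "one_bar (1 \<le> m \<and> m \<le> n) m (rp_space n) (rp_dist n)"
  unfolding one_bar_def
proof (intro conjI allI impI Metric_space_rp pushable_rp[OF n])
  fix r :: real assume r: "0 < r \<and> r \<le> pi / 2"
  then have r': "0 < r" "r \<le> 2 * pi / 3" using pi_gt_zero by linarith+
  note H = rp_homology[OF n r']
  show "\<not> nonbdry (RPc n r) (Suc m) (z + w)"
    if "on (RPc n r) (Suc m) z \<and> bd z = 0 \<and> nonbdry (RPc n r) (Suc m) z \<and>
            on (RPc n r) (Suc m) w \<and> bd w = 0 \<and> nonbdry (RPc n r) (Suc m) w" for z w
    using H(2) that by blast
  have p: "r \<le> pi / 2" "pi / 2 \<le> 2 * pi / 3" using r by simp_all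
  show "if 1 \<le> m \<and> m \<le> n then \<exists>z. on (RPc n r) (Suc m) z \<and> bd z = 0 \<and> nonbdry (RPc n (pi / 2)) (Suc m) z
    else \<forall>z. on (RPc n r) (Suc m) z \<and> bd z = 0 \<longrightarrow> \<not> nonbdry (RPc n r) (Suc m) z"
  proof (cases "1 \<le> m \<and> m \<le> n")
    case True
    then show ?thesis using rp_fundamental[OF n r', of m] p by metis
  next
    case False
    then have "m = 0 \<or> n < m" by linarith
    then show ?thesis unfolding if_not_P[OF False] using H(1)[of m] by blast
  qed
qed

context wedge begin

lemma one_bar_wedge: "one_bar (1 \<le> m \<and> m \<le> n) m W D"
  unfolding one_bar_def
proof (intro conjI allI impI MW pushable_wedge)
  fix r :: real assume r: "0 < r \<and> r \<le> pi / 2"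
  then have r0: "0 < r" "r \<le> pi / 2" by auto
  show "\<not> nonbdry (vrl W D r) (Suc m) (z + w)"
    if "on (vrl W D r) (Suc m) z \<and> bd z = 0 \<and> nonbdry (vrl W D r) (Suc m) z \<and>
            on (vrl W D r) (Suc m) w \<and> bd w = 0 \<and> nonbdry (vrl W D r) (Suc m) w" for z w
    using wedge_dim[OF r0] that by blast
  show "if 1 \<le> m \<and> m \<le> n then \<exists>z. on (vrl W D r) (Suc m) z \<and> bd z = 0 \<and> nonbdry (vrl W D (pi / 2)) (Suc m) z
    else \<forall>z. on (vrl W D r) (Suc m) z \<and> bd z = 0 \<longrightarrow> \<not> nonbdry (vrl W D r) (Suc m) z"
  proof (cases "m \<in> J")
    case True
    then have m: "1 \<le> m \<and> m \<le> n" by auto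
    show ?thesis unfolding if_P[OF m] using wedge_fundamental[OF r0 True] r0(2) by (metis order_refl)
  next
    case False
    then have m: "\<not> (1 \<le> m \<and> m \<le> n)" by auto
    show ?thesis unfolding if_not_P[OF m] using cycle_on_sphere(2)[OF r0 _ _ False] by blast
  qed
qed

end

lemma zeta_bounds:
  assumes "1 \<le> n"
  shows "pi / 2 < zeta n" "zeta n \<le> 2 * pi / 3"
proof -
  define a where "a = 1 / (real n + 1)"
  have a: "0 < a" "a \<le> 1 / 2" using assms by (auto simp: a_def divide_simps)
  have z: "zeta n = arccos (- a)" by (simp add: zeta_def a_def)
  have c: "cos (zeta n) = - a" "0 \<le> zeta n" "zeta n \<le> pi"
    unfolding z using a by (auto intro: cos_arccos arccos_lbound arccos_ubound)
  show "pi / 2 < zeta n"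
  proof (rule ccontr)
    assume "\<not> pi / 2 < zeta n"
    then have "0 \<le> cos (zeta n)" using c by (intro cos_ge_zero) auto
    then show False using c a by simp
  qed
  show "zeta n \<le> 2 * pi / 3"
  proof (rule ccontr)
    assume "\<not> zeta n \<le> 2 * pi / 3"
    then have "cos (zeta n) < cos (2 * pi / 3)" using c by (intro cos_monotone_0_pi) auto
    then show False using c a by (simp add: cos_120)
  qed
qed

theorem homology_interleaving:
  assumes n: "1 \<le> n" and b: "\<forall>i\<in>{1..n}. b i \<in> round_sphere i 1"
  shows "interleaving_dist F2 (vr_homology m (sphere_wedge b n) (sphere_wedge_dist b))
           (vr_homology m (rp_space n) (rp_dist n)) \<le> ereal ((pi - zeta n) / 2)"
    and "(pi - zeta n) / 2 < pi / 4"
proof -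
  interpret wedge n b by unfold_locales (use assms in auto)
  have "interleaved F2 (pi / 6) (vr_homology m W D) (vr_homology m (rp_space n) (rp_dist n))"
    by (rule one_bar_interleaved[OF one_bar_wedge one_bar_rp[OF n]])
  then have "interleaving_dist F2 (vr_homology m W D) (vr_homology m (rp_space n) (rp_dist n)) \<le> ereal (pi / 6)"
    unfolding interleaving_dist_def by (intro Inf_lower CollectI exI[of _ "pi / 6"]) simp
  also have "\<dots> \<le> ereal ((pi - zeta n) / 2)" using zeta_bounds[OF n] by simp
  finally show "interleaving_dist F2 (vr_homology m W D) (vr_homology m (rp_space n) (rp_dist n)) \<le> ereal ((pi - zeta n) / 2)" .
  show "(pi - zeta n) / 2 < pi / 4" using zeta_bounds[OF n] by simp
qed

section \<open>Cochains as functionals\<close>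

text \<open>Duality over a field: \<open>g\<close> factors through \<open>f\<close> by
  \<open>ker\<close>, and the induced functional on the image of \<open>V\<close> extends to all
  chains. Over the field with two elements the image is a subspace as soon as \<open>V\<close>
  contains 0 and is closed under addition, so \<open>V\<close> can be a set of pairs of
  chains.\<close>

lemma additive_extension:
  fixes f :: "'c::ab_group_add \<Rightarrow> ('x \<Rightarrow>\<^sub>0 bit)" and g :: "'c \<Rightarrow> bit"
  assumes V: "0 \<in> V" "\<And>x y. x \<in> V \<Longrightarrow> y \<in> V \<Longrightarrow> x + y \<in> V"
    and f: "\<And>x y. f (x + y) = f x + f y" and g: "\<And>x y. x \<in> V \<Longrightarrow> y \<in> V \<Longrightarrow> g (x + y) = g x + g y"
    and ker: "\<And>x. x \<in> V \<Longrightarrow> f x = 0 \<Longrightarrow> g x = 0"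
  obtains a where "\<And>x. x \<in> V \<Longrightarrow> lin a (f x) = g x"
proof -
  define s1 :: "bit \<Rightarrow> ('x \<Rightarrow>\<^sub>0 bit) \<Rightarrow> ('x \<Rightarrow>\<^sub>0 bit)" where "s1 c v = (if c = 0 then 0 else v)" for c v
  interpret vs1: vector_space s1
    by unfold_locales (auto simp: s1_def bit_not_zero_iff)
  interpret vs2: vector_space "(*) :: bit \<Rightarrow> bit \<Rightarrow> bit"
    by unfold_locales (simp_all add: algebra_simps)
  interpret vp: vector_space_pair s1 "(*) :: bit \<Rightarrow> bit \<Rightarrow> bit" by unfold_locales
  define \<theta> where "\<theta> v = g (SOME x. x \<in> V \<and> f x = v)" for v
  have \<theta>: "\<theta> (f x) = g x" if "x \<in> V" for x
  proof -
    let ?y = "SOME y. y \<in> V \<and> f y = f x"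
    have y: "?y \<in> V \<and> f ?y = f x" by (rule someI[of _ x]) (simp add: that)
    then have "f (x + ?y) = 0" by (simp add: f)
    then have "g x + g ?y = 0" using ker[of "x + ?y"] g[of x ?y] V(2)[of x ?y] that y by simp
    then show ?thesis unfolding \<theta>_def by (metis bit_add_self_left add.right_neutral)
  qed
  obtain B where B: "B \<subseteq> f ` V" "vs1.independent B" "f ` V \<subseteq> vs1.span B" by (rule vs1.maximal_independent_subset)
  obtain h where h: "Vector_Spaces.linear s1 (*) h" "\<forall>x\<in>B. h x = \<theta> x" using vp.linear_independent_extend[OF B(2)] by blast
  interpret h: Vector_Spaces.linear s1 "(*)" h by (rule h(1))
  have f0: "f 0 = 0" using f[of 0 0] by (simp add: chain_add_eq_iff)
  have g0: "g 0 = 0" using V ker[of 0] f0 by simp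
  have "vs1.subspace {v \<in> f ` V. h v = \<theta> v}"
  proof (rule vs1.subspaceI)
    show "0 \<in> {v \<in> f ` V. h v = \<theta> v}" using V(1) f0 \<theta>[OF V(1)] g0 by (auto intro: image_eqI[of _ _ 0])
    fix u v assume u: "u \<in> {v \<in> f ` V. h v = \<theta> v}" and v: "v \<in> {v \<in> f ` V. h v = \<theta> v}"
    then obtain x y where xy: "x \<in> V" "u = f x" "y \<in> V" "v = f y" by blast
    have uv: "u + v = f (x + y)" "x + y \<in> V" using xy f V by simp_all
    have "h (u + v) = h u + h v" by (rule h.add)
    also have "\<dots> = g x + g y" using u v \<theta>[OF xy(1)] \<theta>[OF xy(3)] xy by simp
    also have "\<dots> = \<theta> (u + v)" using \<theta>[OF uv(2)] g[OF xy(1,3)] uv by simp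
    finally show "u + v \<in> {v \<in> f ` V. h v = \<theta> v}" using uv by blast
  next
    fix c u assume u: "u \<in> {v \<in> f ` V. h v = \<theta> v}"
    show "s1 c u \<in> {v \<in> f ` V. h v = \<theta> v}"
      using u V(1) f0 \<theta>[OF V(1)] g0 by (cases "c = 0") (auto simp: s1_def intro: image_eqI[of _ _ 0])
  qed
  then have "vs1.span B \<subseteq> {v \<in> f ` V. h v = \<theta> v}" using B(1) h(2) by (intro vs1.span_minimal) auto
  then have "f ` V \<subseteq> {v. h v = \<theta> v}" using B(3) by blast
  then have hf: "h (f x) = g x" if "x \<in> V" for x using that \<theta>[OF that] by force
  have "lin (\<lambda>y. h (sng y)) v = h v" for v
    by (rule chain_induct[OF subset_UNIV]) (simp_all add: h.add)
  then show thesis using that[of "\<lambda>y. h (sng y)"] hf by simp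
qed

lemma chain2_set_sng [simp]: "sng \<sigma> \<in> chain2_set p X \<longleftrightarrow> singular_simplex p X \<sigma>"
  by (simp add: chain2_set_def)

text \<open>A singular simplex is the realization of the list of its corners, so the identity is
  inherited from \<open>bd_bdl\<close>.\<close>

lemma boundary2_boundary2:
  assumes c: "c \<in> chain2_set (Suc (Suc q)) X"
  shows "boundary2 (Suc q) (boundary2 (Suc (Suc q)) c) = 0"
proof -
  have "boundary2 (Suc q) (boundary2 (Suc (Suc q)) (sng \<sigma>)) = 0" if "\<sigma> \<in> keys c" for \<sigma>
  proof -
    have "singular_simplex (Suc (Suc q)) X \<sigma>" using c that by (auto simp: chain2_set_def)
    then have "sng \<sigma> = mp (sreal \<sigma>) (sng (elist (Suc (Suc q))))" by (simp add: sreal_elist)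
    then have "boundary2 (Suc (Suc q)) (sng \<sigma>) = mp (sreal \<sigma>) (bdl (elist (Suc (Suc q))))"
      using boundary2_sreal[of "sng (elist (Suc (Suc q)))" "Suc q" \<sigma>] by simp
    moreover have "length M = Suc (Suc q)" if "M \<in> keys (bdl (elist (Suc (Suc q))))" for M
      using bdl_keys[OF that] by simp
    ultimately show ?thesis by (simp add: boundary2_sreal)
  qed
  then have "lin (\<lambda>\<sigma>. boundary2 (Suc q) (boundary2 (Suc (Suc q)) (sng \<sigma>))) c = lin (\<lambda>_. 0) c"
    by (intro lin_cong) simp
  then show ?thesis by (simp flip: boundary2_lin)
qed

lemma lin_coboundary2:
  assumes "z \<in> chain2_set (Suc q) X"
  shows "lin (coboundary2 q X a) z = lin a (boundary2 (Suc q) z)"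
proof -
  have "lin (coboundary2 q X a) z = lin (\<lambda>\<sigma>. \<Sum>k\<le>Suc q. a (singular_face (Suc q) k \<sigma>)) z"
    by (rule lin_cong) (use assms in \<open>auto simp: coboundary2_def chain2_set_def\<close>)
  also have "\<dots> = lin a (boundary2 (Suc q) z)"
    unfolding boundary2_eq by (simp add: lin_lin lin_sum)
  finally show ?thesis .
qed

lemma coboundary_vanishes:
  assumes "c \<in> reduced_coboundaries2 (Suc q) X" "z \<in> reduced_cycles2 (Suc q) X"
  shows "lin c z = 0"
  using assms by (auto simp: reduced_coboundaries2_def reduced_cycles2_def lin_coboundary2)

lemma cocycle_on_boundary:
  assumes "c \<in> cocycles2 q X" "z \<in> boundaries2 q X"
  shows "lin c z = 0"
proof -
  obtain e where e: "e \<in> chain2_set (Suc q) X" "z = boundary2 (Suc q) e" using assms(2) by (auto simp: boundaries2_def)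
  have "lin c z = lin (coboundary2 q X c) e" by (simp add: e lin_coboundary2)
  also have "\<dots> = 0" using assms(1) by (simp add: cocycles2_def)
  finally show ?thesis .
qed

text \<open>A cochain that vanishes on cycles factors through the boundary map; the extension of the
  resulting functional, cut down to the singular simplices of \<open>X\<close>, has \<open>c\<close>
  as its coboundary.\<close>

theorem coboundary_criterion:
  assumes c: "c \<in> cochain2_set (Suc q) X" and z: "\<And>z. z \<in> reduced_cycles2 (Suc q) X \<Longrightarrow> lin c z = 0"
  shows "c \<in> reduced_coboundaries2 (Suc q) X"
proof -
  obtain a where a: "\<And>x. x \<in> chain2_set (Suc q) X \<Longrightarrow> lin a (boundary2 (Suc q) x) = lin c x"
  proof (rule additive_extension[of "chain2_set (Suc q) X" "boundary2 (Suc q)" "lin c"])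
    show "boundary2 (Suc q) (x + y) = boundary2 (Suc q) x + boundary2 (Suc q) y" for x y :: "'a chain2"
      by (rule boundary2_add)
  qed (use z in \<open>auto intro: chain2_set_add simp: reduced_cycles2_def\<close>)
  let ?a = "\<lambda>\<sigma>. if singular_simplex q X \<sigma> then a \<sigma> else 0"
  have "coboundary2 q X ?a = c"
  proof
    fix \<sigma>
    show "coboundary2 q X ?a \<sigma> = c \<sigma>"
    proof (cases "singular_simplex (Suc q) X \<sigma>")
      case True
      then have "singular_simplex q X (singular_face (Suc q) k \<sigma>)" if "k \<le> Suc q" for k
        using singular_simplex_singular_face[of "Suc q" X \<sigma> k] that by simp
      then have "coboundary2 q X ?a \<sigma> = lin a (boundary2 (Suc q) (sng \<sigma>))"
        using True by (simp add: coboundary2_def boundary2_sng lin_sum del: sum.atMost_Suc)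
      also have "\<dots> = c \<sigma>" using a[of "sng \<sigma>"] True by simp
      finally show ?thesis .
    next
      case False
      then show ?thesis using c by (simp add: coboundary2_def cochain2_set_def)
    qed
  qed
  moreover have "?a \<in> cochain2_set q X" by (simp add: cochain2_set_def)
  ultimately show ?thesis unfolding reduced_coboundaries2_def by auto
qed

lemma acyclic_cocycle:
  assumes "c \<in> cocycles2 (Suc q) X" "reduced_cycles2 (Suc q) X \<subseteq> boundaries2 (Suc q) X"
  obtains b where "b \<in> cochain2_set q X" "c = coboundary2 q X b"
proof -
  have "c \<in> reduced_coboundaries2 (Suc q) X"
  proof (rule coboundary_criterion)
    show "c \<in> cochain2_set (Suc q) X" using assms(1) by (simp add: cocycles2_def)
    show "lin c z = 0" if "z \<in> reduced_cycles2 (Suc q) X" for z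
      using cocycle_on_boundary[OF assms(1)] assms(2) that by blast
  qed
  then show thesis using that by (auto simp: reduced_coboundaries2_def)
qed

section \<open>Extending a simplicial cocycle to singular simplices\<close>

lemma lab_unitv: "lab (unitv v) = v"
proof -
  have "\<forall>w. unitv v w \<le> unitv v (lab (unitv v))"
    unfolding lab_def by (rule someI[of _ v]) (simp add: unitv_def)
  then have "unitv v v \<le> unitv v (lab (unitv v))" by blast
  then show ?thesis by (simp add: unitv_def split: if_splits)
qed

lemma Lam_inc: "length L = Suc p \<Longrightarrow> Lam p (inc L) = L"
proof (rule nth_equalityI)
  fix i assume L: "length L = Suc p" and "i < length (Lam p (inc L))"
  then have i: "i < Suc p" by simp
  have "inc L (unitv i) = unitv (L ! i)"
  proof
    fix v
    have "comb (map unitv L) (unitv i) v = (\<Sum>j<length L. if j = i then (if L ! i = v then 1 else 0) else 0)"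
      unfolding comb_unitv by (rule sum.cong) (auto simp: unitv_def)
    also have "\<dots> = unitv (L ! i) v" using i L by (simp add: unitv_def)
    finally show "inc L (unitv i) v = unitv (L ! i) v"
      using i L unitv_simplex[of i p] by (simp add: inc_def sreal_def)
  qed
  then show "Lam p (inc L) ! i = L ! i" using i by (simp add: Lam_def lab_unitv del: upt_Suc)
qed simp

lemma incc_inj:
  assumes "incc x = 0" "\<And>L. L \<in> keys x \<Longrightarrow> length L = Suc p"
  shows "x = 0"
proof -
  have "x = mp (\<lambda>L. Lam p (inc L)) x" by (rule mp_id[symmetric]) (simp add: Lam_inc assms(2))
  also have "\<dots> = mp (Lam p) (incc x)" by (simp add: incc_def mp_mp)
  finally show ?thesis using assms(1) by simp
qed

text \<open>Prescribe \<open>v\<close> on the image of the ordered chains and 0 on singular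
  boundaries. This is consistent: if \<open>incc x\<close> is a singular boundary, then
  \<open>x = bd d\<close> by \<open>simplicial_boundary\<close>, and \<open>v\<close> vanishes on
  \<open>bd d\<close>.\<close>

theorem singular_cocycle_extension:
  assumes K: "simp_cx K" and v: "\<And>d. on (insert {} K) (Suc (Suc (Suc q))) d \<Longrightarrow> lin v (bd d) = (0::bit)"
  obtains w where "w \<in> cocycles2 (Suc q) (geometric_realization K)"
    "\<And>L. set L \<in> K \<Longrightarrow> length L = Suc (Suc q) \<Longrightarrow> w (inc L) = v L"
proof -
  let ?X = "geometric_realization K"
  let ?V = "{(x, c). on (insert {} K) (Suc (Suc q)) x \<and> c \<in> chain2_set (Suc (Suc q)) ?X}"
  obtain a where a: "\<And>xc. xc \<in> ?V \<Longrightarrow> lin a (incc (fst xc) + boundary2 (Suc (Suc q)) (snd xc)) = lin v (fst xc)"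
  proof (rule additive_extension[of ?V "\<lambda>xc. incc (fst xc) + boundary2 (Suc (Suc q)) (snd xc)" "\<lambda>xc. lin v (fst xc)"])
    fix xc assume xc: "xc \<in> ?V" "incc (fst xc) + boundary2 (Suc (Suc q)) (snd xc) = 0"
    obtain x c where xc': "xc = (x, c)" by fastforce
    have x: "on (insert {} K) (Suc (Suc q)) x" "c \<in> chain2_set (Suc (Suc q)) ?X" "incc x = boundary2 (Suc (Suc q)) c"
      using xc xc' by (auto simp: chain_add_eq_0_iff)
    have "incc (bd x) = boundary2 (Suc q) (incc x)"
      by (rule boundary2_incc[symmetric]) (use x(1) in \<open>auto simp: on_def\<close>)
    also have "\<dots> = 0" unfolding x(3) by (rule boundary2_boundary2[OF x(2)])
    finally have "bd x = 0"
      by (rule incc_inj[of _ q]) (use on_bd[OF x(1) down_aug[OF K]] in \<open>auto simp: on_def\<close>)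
    moreover have "incc x \<in> boundaries2 (Suc q) ?X" using x(2,3) by (auto simp: boundaries2_def)
    ultimately obtain d where "on (insert {} K) (Suc (Suc (Suc q))) d" "x = bd d"
      using simplicial_boundary[OF K x(1)] by blast
    then show "lin v (fst xc) = 0" using v xc' by simp
  qed (auto intro: chain2_set_add on_add simp: boundary2_add ac_simps zero_prod_def)
  define w where "w \<sigma> = (if singular_simplex (Suc q) ?X \<sigma> then a \<sigma> else 0)" for \<sigma>
  have "coboundary2 (Suc q) ?X w \<sigma> = 0" for \<sigma>
  proof (cases "singular_simplex (Suc (Suc q)) ?X \<sigma>")
    case True
    then have "singular_simplex (Suc q) ?X (singular_face (Suc (Suc q)) k \<sigma>)" if "k \<le> Suc (Suc q)" for k
      using singular_simplex_singular_face[of "Suc (Suc q)" ?X \<sigma> k] that by simp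
    then have "coboundary2 (Suc q) ?X w \<sigma> = lin a (boundary2 (Suc (Suc q)) (sng \<sigma>))"
      using True by (simp add: coboundary2_def boundary2_sng lin_sum w_def del: sum.atMost_Suc)
    also have "\<dots> = 0" using a[of "(0, sng \<sigma>)"] True by simp
    finally show ?thesis .
  qed (simp add: coboundary2_def)
  then have "w \<in> cocycles2 (Suc q) ?X" by (auto simp: cocycles2_def cochain2_set_def w_def)
  moreover have "w (inc L) = v L" if L: "set L \<in> K" "length L = Suc (Suc q)" for L
    using a[of "(sng L, 0)"] L inc_simplex[OF K L] by (simp add: w_def incc_def)
  ultimately show thesis by (rule that)
qed

section \<open>The cohomology modules\<close>

definition ccls :: "'a cochain2 set \<Rightarrow> 'a cochain2 \<Rightarrow> 'a cochain2 set" where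
  "ccls B x = (\<lambda>h \<sigma>. h \<sigma> + x \<sigma>) ` B"

lemma coset_ccls: "B +>\<^bsub>cocycle_module2 q X\<^esub> x = ccls B x"
  by (auto simp: a_r_coset_def r_coset_def cocycle_module2_def ccls_def)

lemma zero_coboundary: "(\<lambda>_. 0) \<in> reduced_coboundaries2 q X"
proof (cases q)
  case 0
  then show ?thesis unfolding reduced_coboundaries2_def by (auto intro!: image_eqI[of _ _ 0])
next
  case (Suc p)
  have "(\<lambda>_. 0) = coboundary2 p X (\<lambda>_. 0)" by (simp add: coboundary2_def fun_eq_iff)
  then show ?thesis unfolding reduced_coboundaries2_def Suc by (auto simp: cochain2_set_def)
qed

lemma add_coboundary:
  assumes "x \<in> reduced_coboundaries2 (Suc q) X" "y \<in> reduced_coboundaries2 (Suc q) X"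
  shows "(\<lambda>\<sigma>. x \<sigma> + y \<sigma>) \<in> reduced_coboundaries2 (Suc q) X"
proof -
  obtain a b where ab: "a \<in> cochain2_set q X" "x = coboundary2 q X a" "b \<in> cochain2_set q X" "y = coboundary2 q X b"
    using assms by (auto simp: reduced_coboundaries2_def)
  have "(\<lambda>\<sigma>. x \<sigma> + y \<sigma>) = coboundary2 q X (\<lambda>\<sigma>. a \<sigma> + b \<sigma>)"
    unfolding ab by (simp add: coboundary2_def fun_eq_iff sum.distrib)
  moreover have "(\<lambda>\<sigma>. a \<sigma> + b \<sigma>) \<in> cochain2_set q X" using ab by (simp add: cochain2_set_def)
  ultimately show ?thesis unfolding reduced_coboundaries2_def by auto
qed

lemma ccls_self: "x \<in> ccls (reduced_coboundaries2 q X) x"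
  unfolding ccls_def by (rule image_eqI[OF _ zero_coboundary]) simp

lemma ccls_coboundary:
  assumes "x \<in> reduced_coboundaries2 (Suc q) X"
  shows "ccls (reduced_coboundaries2 (Suc q) X) x = reduced_coboundaries2 (Suc q) X"
proof
  show "ccls (reduced_coboundaries2 (Suc q) X) x \<subseteq> reduced_coboundaries2 (Suc q) X"
    unfolding ccls_def using add_coboundary[OF _ assms] by blast
  show "reduced_coboundaries2 (Suc q) X \<subseteq> ccls (reduced_coboundaries2 (Suc q) X) x"
  proof
    fix y assume "y \<in> reduced_coboundaries2 (Suc q) X"
    then have "(\<lambda>\<sigma>. y \<sigma> + x \<sigma>) \<in> reduced_coboundaries2 (Suc q) X" using add_coboundary assms by blast
    then show "y \<in> ccls (reduced_coboundaries2 (Suc q) X) x"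
      unfolding ccls_def by (rule image_eqI[rotated]) (simp add: add.assoc)
  qed
qed

lemma cohomology_carrier: "carrier (reduced_cohomology2 q X) = ccls (reduced_coboundaries2 q X) ` cocycles2 q X"
  by (auto simp: reduced_cohomology2_def quot_module_def A_RCOSETS_def RCOSETS_def ccls_def
      a_r_coset_def r_coset_def cocycle_module2_def)

lemma coboundary2_coboundary2: "coboundary2 (Suc q) X (coboundary2 q X a) = (\<lambda>_. 0)"
proof
  fix \<sigma>
  show "coboundary2 (Suc q) X (coboundary2 q X a) \<sigma> = 0"
  proof (cases "singular_simplex (Suc (Suc q)) X \<sigma>")
    case True
    have "coboundary2 (Suc q) X (coboundary2 q X a) \<sigma> = lin (coboundary2 (Suc q) X (coboundary2 q X a)) (sng \<sigma>)" by simp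
    also have "\<dots> = lin a (boundary2 (Suc q) (boundary2 (Suc (Suc q)) (sng \<sigma>)))"
      using True boundary2_chain[of "sng \<sigma>" "Suc q" X] by (simp add: lin_coboundary2 del: lin_sng)
    finally show ?thesis using True by (subst (asm) boundary2_boundary2[of _ _ X]) simp_all
  qed (simp add: coboundary2_def)
qed

text \<open>Expresses the zero coset as a multiple of any element. \<open>linear_maps\<close> speaks
  of sums and scalars, so preservation of zero is obtained from the scalar 0.\<close>

lemma steenrod_zero_smult:
  assumes "A \<noteq> {}"
  shows "0 \<odot>\<^bsub>steenrod_image k m X\<^esub> A = reduced_coboundaries2 m X"
proof -
  have "0 \<odot>\<^bsub>steenrod_image k m X\<^esub> A = (\<Union>x\<in>A. ccls (reduced_coboundaries2 m X) (\<lambda>_. 0))"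
    unfolding coset_ccls[symmetric, where q = m and X = X]
    by (simp add: steenrod_image_def reduced_cohomology2_def quot_module_def cocycle_module2_def)
  also have "\<dots> = reduced_coboundaries2 m X" using assms by (simp add: ccls_def)
  finally show ?thesis .
qed

lemma steenrod_carrier:
  assumes "k \<le> m" "k \<le> m - k"
  shows "carrier (steenrod_image k m X) =
    (\<lambda>\<alpha>. \<Union>c\<in>\<alpha>. ccls (reduced_coboundaries2 m X) (cup_i (m - k - k) (m - k) (m - k) X c c)) `
      ccls (reduced_coboundaries2 (m - k) X) ` cocycles2 (m - k) X"
  unfolding steenrod_image_def steenrod_square_def coset_ccls using assms by (simp add: cohomology_carrier)

section \<open>Faces spanned by lists of vertices\<close>

definition face :: "nat list \<Rightarrow> 'a sing_simplex \<Rightarrow> 'a sing_simplex" where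
  "face L \<sigma> = sreal \<sigma> (map unitv L)"

lemma comb_comb_unitv:
  assumes "set M \<subseteq> {..<length L}"
  shows "comb (map unitv L) (comb (map unitv M) t) = comb (map unitv (map ((!) L) M)) t"
proof
  fix v
  have "comb (map unitv L) (comb (map unitv M) t) v =
      (\<Sum>j<length L. \<Sum>i<length M. if L ! j = v \<and> M ! i = j then t i else 0)"
    unfolding comb_unitv by (rule sum.cong) auto
  also have "\<dots> = (\<Sum>i<length M. \<Sum>j<length L. if L ! j = v \<and> M ! i = j then t i else 0)"
    by (rule sum.swap)
  also have "\<dots> = (\<Sum>i<length M. if L ! (M ! i) = v then t i else 0)"
  proof (rule sum.cong)
    fix i assume "i \<in> {..<length M}"
    then have "M ! i < length L" using assms by (metis lessThan_iff nth_mem subsetD)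
    then have "(\<Sum>j<length L. if L ! j = v \<and> M ! i = j then t i else 0) =
        (\<Sum>j<length L. if j = M ! i then (if L ! (M ! i) = v then t i else 0) else 0)"
      by (intro sum.cong) auto
    also have "\<dots> = (if L ! (M ! i) = v then t i else 0)" using \<open>M ! i < length L\<close> by simp
    finally show "(\<Sum>j<length L. if L ! j = v \<and> M ! i = j then t i else 0) = (if L ! (M ! i) = v then t i else 0)" .
  qed simp
  also have "\<dots> = comb (map unitv (map ((!) L) M)) t v"
    unfolding comb_unitv by (rule sum.cong) auto
  finally show "comb (map unitv L) (comb (map unitv M) t) v = comb (map unitv (map ((!) L) M)) t v" .
qed

lemma sreal_unitv_sreal:
  fixes L :: "'i list"
  assumes "set M \<subseteq> {..<length L}" "M \<noteq> []"
  shows "sreal (sreal H (map unitv L)) (map unitv M) = sreal H (map unitv (map ((!) L) M))"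
proof
  fix t
  have L: "length L = Suc (length L - 1)" using assms by (cases L; cases M) auto
  have M: "length (map unitv M) = Suc (length M - 1)" using assms by (cases M) auto
  show "sreal (sreal H (map unitv L)) (map unitv M) t = sreal H (map unitv (map ((!) L) M)) t"
  proof (cases "t \<in> standard_simplex (length M - 1)")
    case True
    have "unitv j \<in> standard_simplex (length L - 1)" if "j \<in> set M" for j
      using assms(1) that by (intro unitv_simplex) force
    then have "set (map unitv M) \<subseteq> standard_simplex (length L - 1)" by auto
    then have "comb (map unitv M) t \<in> standard_simplex (length L - 1)"
      by (rule comb_in_simplex[OF _ M True])
    then show ?thesis using True comb_comb_unitv[OF assms(1), of t] by (simp add: sreal_def o_def)
  qed (simp add: sreal_def)
qed

lemma face_face: "set M \<subseteq> {..<length L} \<Longrightarrow> M \<noteq> [] \<Longrightarrow> face M (face L \<sigma>) = face (map ((!) L) M) \<sigma>"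
  unfolding face_def by (rule sreal_unitv_sreal)

lemma face_inc: "set M \<subseteq> {..<length L} \<Longrightarrow> M \<noteq> [] \<Longrightarrow> face M (inc L) = inc (map ((!) L) M)"
  unfolding face_def inc_def by (rule sreal_unitv_sreal)

lemma face_simplex:
  assumes "singular_simplex n X \<sigma>" "set L \<subseteq> {..n}" "length L = Suc q"
  shows "singular_simplex q X (face L \<sigma>)"
  unfolding face_def
proof (rule piece_simplex[OF assms(1)])
  show "set (map unitv L) \<subseteq> standard_simplex n" using assms(2) unitv_simplex by auto
qed (simp add: assms)

abbreviation "sl \<equiv> sorted_list_of_set :: nat set \<Rightarrow> nat list"

lemma sl_nth_rank:
  assumes "finite S" "v \<in> S"
  shows "card {w \<in> S. w < v} < length (sl S)" "sl S ! card {w \<in> S. w < v} = v"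
proof -
  obtain j where j: "j < length (sl S)" "sl S ! j = v" using assms by (metis in_set_conv_nth set_sorted_list_of_set)
  have less: "sl S ! i < sl S ! k \<longleftrightarrow> i < k" if "i < length (sl S)" "k < length (sl S)" for i k
    using that sorted_wrt_nth_less[OF strict_sorted_list_of_set[of S]] by (metis linorder_neqE_nat order_less_asym)
  have "{w \<in> S. w < v} = (!) (sl S) ` {..<j}"
  proof (intro equalityI subsetI)
    fix w assume w: "w \<in> {w \<in> S. w < v}"
    then obtain i where "i < length (sl S)" "sl S ! i = w" using assms(1) by (metis (no_types, lifting) in_set_conv_nth mem_Collect_eq set_sorted_list_of_set)
    then show "w \<in> (!) (sl S) ` {..<j}" using w j less by auto
  next
    fix w assume "w \<in> (!) (sl S) ` {..<j}"
    then obtain i where "i < j" "w = sl S ! i" by blast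
    then show "w \<in> {w \<in> S. w < v}" using j less[of i j] assms(1) nth_mem[of i "sl S"] by auto
  qed
  moreover have "inj_on ((!) (sl S)) {..<j}" using j(1) by (intro inj_on_nth) auto
  ultimately have "card {w \<in> S. w < v} = j" by (simp add: card_image)
  then show "card {w \<in> S. w < v} < length (sl S)" "sl S ! card {w \<in> S. w < v} = v" using j by simp_all
qed

lemma vertex_face_eq:
  assumes "finite S"
  shows "vertex_face S \<sigma> = face (sl S) \<sigma>"
proof -
  have "comb (map unitv (sl S)) t = (\<lambda>v. if v \<in> S then t (card {w \<in> S. w < v}) else 0)" for t
  proof
    fix v
    show "comb (map unitv (sl S)) t v = (if v \<in> S then t (card {w \<in> S. w < v}) else 0)"
    proof (cases "v \<in> S")
      case True
      have "sl S ! j = v \<longleftrightarrow> j = card {w \<in> S. w < v}" if "j < length (sl S)" for j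
        using sl_nth_rank[OF assms True] that by (metis distinct_sorted_list_of_set nth_eq_iff_index_eq)
      then have "comb (map unitv (sl S)) t v = (\<Sum>j<length (sl S). if j = card {w \<in> S. w < v} then t (card {w \<in> S. w < v}) else 0)"
        unfolding comb_unitv by (intro sum.cong) auto
      then show ?thesis using True sl_nth_rank(1)[OF assms True] by simp
    next
      case False
      then have "sl S ! j \<noteq> v" if "j < length (sl S)" for j using that assms nth_mem[of j "sl S"] by auto
      then show ?thesis using False unfolding comb_unitv by (auto intro: sum.neutral)
    qed
  qed
  then show ?thesis unfolding vertex_face_def face_def sreal_def by simp
qed

lemma sl_image:
  assumes "strict_mono s" "finite T"
  shows "map s (sl T) = sl (s ` T)"
proof (rule sorted_list_of_set_unique[THEN iffD1, symmetric])
  show "finite (s ` T)" using assms by simp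
  have "sorted_wrt (\<lambda>x y. s x < s y) (sl T)"
    by (rule sorted_wrt_mono_rel[OF _ strict_sorted_list_of_set]) (rule strict_monoD[OF assms(1)])
  moreover have "card (s ` T) = card T" using assms by (intro card_image strict_mono_imp_inj_on)
  ultimately show "sorted_wrt (<) (map s (sl T)) \<and> set (map s (sl T)) = s ` T \<and> length (map s (sl T)) = card (s ` T)"
    using assms by (simp add: sorted_wrt_map)
qed

definition skip :: "nat \<Rightarrow> nat \<Rightarrow> nat" where
  "skip v j = (if j < v then j else Suc j)"

lemma strict_mono_skip: "strict_mono (skip v)"
  by (auto simp: strict_mono_def skip_def)

lemma skip_image:
  assumes "v \<le> Suc n"
  shows "skip v ` {..n} = {..Suc n} - {v}"
proof (intro equalityI subsetI)
  fix j assume j: "j \<in> {..Suc n} - {v}"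
  show "j \<in> skip v ` {..n}"
  proof (cases "j < v")
    case True then show ?thesis using assms j by (intro image_eqI[of _ _ j]) (auto simp: skip_def)
  next
    case False then show ?thesis using j by (intro image_eqI[of _ _ "j - 1"]) (auto simp: skip_def)
  qed
qed (use assms in \<open>auto simp: skip_def\<close>)

lemma vertex_face_singular_face:
  assumes \<sigma>: "singular_simplex (Suc n) X \<sigma>" and v: "v \<le> Suc n" and T: "T \<subseteq> {..n}" "T \<noteq> {}"
  shows "vertex_face T (singular_face (Suc n) v \<sigma>) = vertex_face (skip v ` T) \<sigma>"
proof -
  have fin: "finite T" using T finite_subset by blast
  let ?E = "map (skip v) [0..<Suc n]"
  have "singular_face (Suc n) v (sreal \<sigma> (elist (Suc n))) =
      sreal \<sigma> (take v (elist (Suc n)) @ drop (Suc v) (elist (Suc n)))"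
    by (rule singular_face_sreal) (use v in simp_all)
  also have "take v (elist (Suc n)) @ drop (Suc v) (elist (Suc n)) = map unitv ?E"
    unfolding elist_def delete_map_upt[OF v] by (simp add: skip_def del: upt_Suc)
  finally have "singular_face (Suc n) v \<sigma> = face ?E \<sigma>" by (simp add: sreal_elist[OF \<sigma>] face_def)
  moreover have "face (sl T) (face ?E \<sigma>) = face (map ((!) ?E) (sl T)) \<sigma>"
  proof (rule face_face)
    have "length ?E = Suc n" by (simp only: length_map length_upt)
    then show "set (sl T) \<subseteq> {..<length ?E}" using T fin by (simp only: set_sorted_list_of_set lessThan_Suc_atMost)
    show "sl T \<noteq> []" using T fin by simp
  qed
  moreover have "map ((!) ?E) (sl T) = map (skip v) (sl T)"
  proof -
    have "?E ! j = skip v j" if "j \<in> T" for j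
    proof -
      have "j < Suc n" using T(1) that by (simp add: subset_iff less_Suc_eq_le)
      then show ?thesis using nth_map[of j "[0..<Suc n]" "skip v"] nth_upt[of 0 j "Suc n"] by (simp only: length_upt diff_zero add_0)
    qed
    then show ?thesis using fin by (simp only: map_eq_conv set_sorted_list_of_set) blast
  qed
  ultimately have "face (sl T) (singular_face (Suc n) v \<sigma>) = face (sl (skip v ` T)) \<sigma>"
    by (simp only: sl_image[OF strict_mono_skip fin])
  then show ?thesis using fin by (simp only: vertex_face_eq finite_imageI)
qed

lemma singular_face_vertex_face:
  assumes T: "card T = Suc (Suc q)" and k: "k \<le> Suc q"
  shows "singular_face (Suc q) k (vertex_face T \<sigma>) = vertex_face (T - {sl T ! k}) \<sigma>"
proof -
  have fin: "finite T" using T card.infinite by fastforce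
  have len: "length (sl T) = Suc (Suc q)" using T by simp
  have "singular_face (Suc q) k (face (sl T) \<sigma>) = sreal \<sigma> (take k (map unitv (sl T)) @ drop (Suc k) (map unitv (sl T)))"
    unfolding face_def by (rule singular_face_sreal) (use k len in simp_all)
  also have "\<dots> = face (take k (sl T) @ drop (Suc k) (sl T)) \<sigma>"
    by (simp add: face_def take_map drop_map)
  also have "take k (sl T) @ drop (Suc k) (sl T) = sl (T - {sl T ! k})"
  proof -
    have "take k (sl T) @ drop (Suc k) (sl T) = remove1 (sl T ! k) (sl T)"
    proof -
      have e: "sl T = take k (sl T) @ sl T ! k # drop (Suc k) (sl T)" using k len by (simp add: id_take_nth_drop)
      have "distinct (take k (sl T) @ sl T ! k # drop (Suc k) (sl T))" unfolding e[symmetric] by simp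
      then have "remove1 (sl T ! k) (take k (sl T) @ sl T ! k # drop (Suc k) (sl T)) = take k (sl T) @ drop (Suc k) (sl T)"
        by (simp add: remove1_append)
      then show ?thesis unfolding e[symmetric] by simp
    qed
    then show ?thesis using fin by (simp add: sorted_list_of_set_remove)
  qed
  finally show ?thesis using fin by (simp add: vertex_face_eq)
qed

text \<open>Evaluates a cochain on all vertex sets of one simplex, with value 0 at the wrong
  cardinality. The dimension conditions in \<open>cup_i\<close> thus become vanishing factors, and
  the coboundary becomes a sum over deleted vertices (\<open>fc_coboundary\<close>).\<close>

definition fc :: "nat \<Rightarrow> 'a cochain2 \<Rightarrow> 'a sing_simplex \<Rightarrow> nat set \<Rightarrow> bit" where
  "fc p a \<sigma> T = (if card T = Suc p then a (vertex_face T \<sigma>) else 0)"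

lemma fc_empty [simp]: "fc p a \<sigma> {} = 0"
  by (simp add: fc_def)

lemma fc_zero [simp]: "fc p (\<lambda>_. 0) \<sigma> T = 0"
  by (simp add: fc_def)

lemma vertex_face_simplex:
  assumes "singular_simplex n X \<sigma>" "T \<subseteq> {..n}" "card T = Suc q"
  shows "singular_simplex q X (vertex_face T \<sigma>)"
proof -
  have "finite T" using assms(2) finite_subset by blast
  then show ?thesis using face_simplex[OF assms(1), of "sl T" q] assms by (simp add: vertex_face_eq)
qed

lemma fc_coboundary:
  assumes \<sigma>: "singular_simplex n X \<sigma>" and T: "T \<subseteq> {..n}"
  shows "fc (Suc q) (coboundary2 q X a) \<sigma> T = (\<Sum>v\<in>T. fc q a \<sigma> (T - {v}))"
proof (cases "card T = Suc (Suc q)")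
  case True
  have fin: "finite T" using T finite_subset by blast
  have "fc (Suc q) (coboundary2 q X a) \<sigma> T = (\<Sum>k\<le>Suc q. a (singular_face (Suc q) k (vertex_face T \<sigma>)))"
    using vertex_face_simplex[OF \<sigma> T True] True by (simp add: fc_def coboundary2_def)
  also have "\<dots> = (\<Sum>k<Suc (Suc q). a (vertex_face (T - {sl T ! k}) \<sigma>))"
    by (rule sum.cong) (auto simp: singular_face_vertex_face[OF True])
  also have "\<dots> = (\<Sum>v\<in>T. a (vertex_face (T - {v}) \<sigma>))"
  proof (rule sum.reindex_bij_betw)
    show "bij_betw ((!) (sl T)) {..<Suc (Suc q)} T"
      using bij_betw_nth[of "sl T" "{..<Suc (Suc q)}" T] True fin by simp
  qed
  also have "\<dots> = (\<Sum>v\<in>T. fc q a \<sigma> (T - {v}))"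
    by (rule sum.cong) (use True fin in \<open>auto simp: fc_def\<close>)
  finally show ?thesis .
next
  case False
  have fin: "finite T" using T finite_subset by blast
  have "fc q a \<sigma> (T - {v}) = 0" if "v \<in> T" for v
    using False that fin card_gt_0_iff[of T] by (auto simp: fc_def)
  then show ?thesis using False by (simp add: fc_def)
qed

section \<open>The coboundary formula for the cup-\<open>i\<close> products\<close>

text \<open>The split of \<open>cup_first\<close> and \<open>cup_second\<close> relative to an
  arbitrary set \<open>S\<close> of vertices, so that a face of the simplex is
  \<open>S - {v}\<close> without renumbering.\<close>

definition cf :: "nat set \<Rightarrow> nat set \<Rightarrow> nat set" where
  "cf S U = {v \<in> S. v \<in> U \<or> even (card {u \<in> U. u < v})}"

definition cs :: "nat set \<Rightarrow> nat set \<Rightarrow> nat set" where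
  "cs S U = {v \<in> S. v \<in> U \<or> odd (card {u \<in> U. u < v})}"

text \<open>The cup-\<open>(k - 1)\<close> product on the vertex set \<open>S\<close>. The index
  counts the cut points, so that the coboundary formula for the cup-0 product can refer to
  \<open>DD 0\<close>.\<close>

definition DD :: "nat \<Rightarrow> (nat set \<Rightarrow> bit) \<Rightarrow> (nat set \<Rightarrow> bit) \<Rightarrow> nat set \<Rightarrow> bit" where
  "DD k A B S = (\<Sum>U | U \<subseteq> S \<and> card U = k. A (cf S U) * B (cs S U))"

abbreviation "dA A \<equiv> \<lambda>T. \<Sum>v\<in>T. A (T - {v})"

lemma DD_cong: "(\<And>T. T \<subseteq> S \<Longrightarrow> A T = A' T) \<Longrightarrow> (\<And>T. T \<subseteq> S \<Longrightarrow> B T = B' T) \<Longrightarrow> DD k A B S = DD k A' B' S"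
  unfolding DD_def cf_def cs_def by (intro sum.cong arg_cong2[of _ _ _ _ "(*)"]) auto

lemma bit_telescope: "(\<Sum>u<N. P u + P (Suc u)) = P 0 + (P N :: bit)"
  by (induction N) (simp_all add: ac_simps)

text \<open>Below \<open>t\<close> the split given by \<open>V\<close>, from \<open>t\<close> on the
  same split with the faces exchanged. Deleting \<open>u\<close> from one of the two faces belonging
  to \<open>insert u V\<close> yields such a split at \<open>u\<close> or at \<open>Suc u\<close>,
  depending on a parity.\<close>

definition cutf :: "nat set \<Rightarrow> nat set \<Rightarrow> nat \<Rightarrow> nat set" where
  "cutf S V t = {v \<in> S. v \<in> V \<or> (if v < t then even (card {u \<in> V. u < v}) else odd (card {u \<in> V. u < v}))}"

definition cuts :: "nat set \<Rightarrow> nat set \<Rightarrow> nat \<Rightarrow> nat set" where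
  "cuts S V t = {v \<in> S. v \<in> V \<or> (if v < t then odd (card {u \<in> V. u < v}) else even (card {u \<in> V. u < v}))}"

lemma rank_insert:
  assumes "finite V" "u \<notin> V"
  shows "card {w \<in> insert u V. w < v} = card {w \<in> V. w < v} + (if u < v then 1 else 0)"
proof -
  have "{w \<in> insert u V. w < v} = (if u < v then insert u {w \<in> V. w < v} else {w \<in> V. w < v})" by auto
  then show ?thesis using assms by simp
qed

lemma cut_step:
  assumes "finite S" "V \<subseteq> S" "u \<in> S - V"
  shows "A (cf S (insert u V) - {u}) * B (cs S (insert u V)) + A (cf S (insert u V)) * B (cs S (insert u V) - {u}) =
    A (cutf S V u) * B (cuts S V u) + A (cutf S V (Suc u)) * (B (cuts S V (Suc u)) :: bit)"
proof -
  have fin: "finite V" "u \<notin> V" "u \<in> S" using assms finite_subset by auto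
  note r = rank_insert[OF fin(1,2)]
  have e: "w \<in> (if even (card {w \<in> V. w < u}) then cutf S V u else cutf S V (Suc u)) \<longleftrightarrow> w \<in> cf S (insert u V) - {u}"
    "w \<in> (if even (card {w \<in> V. w < u}) then cuts S V u else cuts S V (Suc u)) \<longleftrightarrow> w \<in> cs S (insert u V)"
    "w \<in> (if even (card {w \<in> V. w < u}) then cutf S V (Suc u) else cutf S V u) \<longleftrightarrow> w \<in> cf S (insert u V)"
    "w \<in> (if even (card {w \<in> V. w < u}) then cuts S V (Suc u) else cuts S V u) \<longleftrightarrow> w \<in> cs S (insert u V) - {u}" for w
    unfolding if_distrib[of "\<lambda>X. w \<in> X"] cutf_def cuts_def cf_def cs_def Diff_iff mem_Collect_eq r
    by (cases w u rule: linorder_cases; simp add: fin)+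
  have sets: "(if even (card {w \<in> V. w < u}) then cutf S V u else cutf S V (Suc u)) = cf S (insert u V) - {u}"
    "(if even (card {w \<in> V. w < u}) then cuts S V u else cuts S V (Suc u)) = cs S (insert u V)"
    "(if even (card {w \<in> V. w < u}) then cutf S V (Suc u) else cutf S V u) = cf S (insert u V)"
    "(if even (card {w \<in> V. w < u}) then cuts S V (Suc u) else cuts S V u) = cs S (insert u V) - {u}"
    by (simp_all only: set_eq_iff e simp_thms)
  show ?thesis
    using sets by (cases "even (card {w \<in> V. w < u})") (simp_all add: add.commute)
qed

lemma cut_const:
  assumes "u \<notin> S - V"
  shows "cutf S V (Suc u) = cutf S V u" "cuts S V (Suc u) = cuts S V u"
proof -
  have "v < Suc u \<longleftrightarrow> v < u" if "v \<in> S" "v \<notin> V" for v using assms that by (auto simp: less_Suc_eq)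
  then show "cutf S V (Suc u) = cutf S V u" "cuts S V (Suc u) = cuts S V u"
    unfolding cutf_def cuts_def by auto
qed

text \<open>A vertex removed outside \<open>U\<close> lies in exactly one of the two faces; these terms are the ones on
  the left-hand side. Removing \<open>u \<in> U\<close> from one of the faces shifts the cut between them past \<open>u\<close>,
  so for fixed \<open>V = U - {u}\<close> these terms telescope to the two extreme cuts.\<close>

theorem cup_coboundary_formula:
  assumes S: "finite S"
  shows "(\<Sum>v\<in>S. DD (Suc k) A B (S - {v})) =
    DD (Suc k) (dA A) B S + DD (Suc k) A (dA B) S + (DD k A B S + DD k B A S)"
proof -
  let ?\<U> = "\<lambda>k. {U. U \<subseteq> S \<and> card U = k}"
  have finU: "finite (?\<U> k)" for k using S by simp
  have finS: "finite U" if "U \<subseteq> S" for U using S that finite_subset by blast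
  let ?T = "\<lambda>U u. A (cf S U - {u}) * B (cs S U) + A (cf S U) * B (cs S U - {u})"
  have "(\<Sum>v\<in>S. DD (Suc k) A B (S - {v})) =
      (\<Sum>v\<in>S. \<Sum>U\<in>{U \<in> ?\<U> (Suc k). v \<notin> U}. A (cf S U - {v}) * B (cs S U - {v}))"
  proof (rule sum.cong[OF refl])
    fix v
    have "cf (S - {v}) U = cf S U - {v}" "cs (S - {v}) U = cs S U - {v}" for U by (auto simp: cf_def cs_def)
    moreover have "{U. U \<subseteq> S - {v} \<and> card U = Suc k} = {U \<in> ?\<U> (Suc k). v \<notin> U}" by auto
    ultimately show "DD (Suc k) A B (S - {v}) = (\<Sum>U\<in>{U \<in> ?\<U> (Suc k). v \<notin> U}. A (cf S U - {v}) * B (cs S U - {v}))"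
      unfolding DD_def by simp
  qed
  also have "\<dots> = (\<Sum>U\<in>?\<U> (Suc k). \<Sum>v\<in>{v \<in> S. v \<notin> U}. A (cf S U - {v}) * B (cs S U - {v}))"
    by (rule sum.swap_restrict[OF S finU])
  also have "\<dots> = (\<Sum>U\<in>?\<U> (Suc k). dA A (cf S U) * B (cs S U) + A (cf S U) * dA B (cs S U) + (\<Sum>u\<in>U. ?T U u))"
  proof (rule sum.cong[OF refl])
    fix U assume U: "U \<in> ?\<U> (Suc k)"
    define F G where "F = {v \<in> S. v \<notin> U \<and> even (card {u \<in> U. u < v})}" and "G = {v \<in> S. v \<notin> U \<and> odd (card {u \<in> U. u < v})}"
    have fin: "finite F" "finite G" "finite U" using S U finS by (auto simp: F_def G_def)
    have sets: "cf S U = U \<union> F" "cs S U = U \<union> G" "{v \<in> S. v \<notin> U} = F \<union> G" "U \<inter> F = {}" "U \<inter> G = {}" "F \<inter> G = {}"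
      using U by (auto simp: F_def G_def cf_def cs_def)
    have "(\<Sum>v\<in>F. A (U \<union> F - {v}) * B (U \<union> G - {v})) = (\<Sum>v\<in>F. A (U \<union> F - {v}) * B (U \<union> G))"
      by (rule sum.cong) (use sets in \<open>auto intro!: arg_cong[of _ _ B]\<close>)
    moreover have "(\<Sum>v\<in>G. A (U \<union> F - {v}) * B (U \<union> G - {v})) = (\<Sum>v\<in>G. A (U \<union> F) * B (U \<union> G - {v}))"
      by (rule sum.cong) (use sets in \<open>auto intro!: arg_cong[of _ _ A]\<close>)
    ultimately show "(\<Sum>v\<in>{v \<in> S. v \<notin> U}. A (cf S U - {v}) * B (cs S U - {v})) =
        dA A (cf S U) * B (cs S U) + A (cf S U) * dA B (cs S U) + (\<Sum>u\<in>U. ?T U u)"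
      unfolding sets(1-3) using fin sets(4-6)
      by (simp add: sum.union_disjoint sum.distrib sum_distrib_left sum_distrib_right distrib_left distrib_right ac_simps)
  qed
  also have "\<dots> = DD (Suc k) (dA A) B S + DD (Suc k) A (dA B) S + (\<Sum>U\<in>?\<U> (Suc k). \<Sum>u\<in>U. ?T U u)"
    by (simp add: sum.distrib DD_def)
  also have "(\<Sum>U\<in>?\<U> (Suc k). \<Sum>u\<in>U. ?T U u) = (\<Sum>V\<in>?\<U> k. \<Sum>u\<in>S - V. ?T (insert u V) u)"
  proof -
    have "(\<Sum>U\<in>?\<U> (Suc k). \<Sum>u\<in>U. ?T U u) = (\<Sum>(U, u)\<in>Sigma (?\<U> (Suc k)) (\<lambda>U. U). ?T U u)"
      by (rule sum.Sigma) (use finU finS in auto)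
    also have "\<dots> = (\<Sum>(V, u)\<in>Sigma (?\<U> k) (\<lambda>V. S - V). ?T (insert u V) u)"
      by (rule sum.reindex_bij_witness[of _ "\<lambda>(V, u). (insert u V, u)" "\<lambda>(U, u). (U - {u}, u)"])
        (use finS in \<open>auto simp: insert_absorb card_insert_if\<close>)
    also have "\<dots> = (\<Sum>V\<in>?\<U> k. \<Sum>u\<in>S - V. ?T (insert u V) u)"
      by (rule sum.Sigma[symmetric]) (use finU S in auto)
    finally show ?thesis .
  qed
  also have "\<dots> = (\<Sum>V\<in>?\<U> k. A (cs S V) * B (cf S V) + A (cf S V) * B (cs S V))"
  proof (rule sum.cong[OF refl])
    fix V assume V: "V \<in> ?\<U> k"
    define P where "P t = A (cutf S V t) * B (cuts S V t)" for t
    obtain N where N: "S \<subseteq> {..<N}" using S finite_nat_iff_bounded by blast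
    have "(\<Sum>u\<in>S - V. ?T (insert u V) u) = (\<Sum>u\<in>S - V. P u + P (Suc u))"
    proof (rule sum.cong[OF refl])
      fix u assume "u \<in> S - V"
      then show "?T (insert u V) u = P u + P (Suc u)" unfolding P_def using cut_step[OF S] V by blast
    qed
    also have "\<dots> = (\<Sum>u<N. P u + P (Suc u))"
      by (rule sum.mono_neutral_left) (use N cut_const in \<open>auto simp: P_def\<close>)
    also have "\<dots> = P 0 + P N" by (rule bit_telescope)
    finally have e: "(\<Sum>u\<in>S - V. ?T (insert u V) u) = P 0 + P N" .
    have "cutf S V 0 = cs S V" "cuts S V 0 = cf S V" "cutf S V N = cf S V" "cuts S V N = cs S V"
      using N by (auto simp: cutf_def cuts_def cf_def cs_def)
    then show "(\<Sum>u\<in>S - V. ?T (insert u V) u) = A (cs S V) * B (cf S V) + A (cf S V) * B (cs S V)"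
      unfolding e P_def by simp
  qed
  also have "\<dots> = DD k A B S + DD k B A S"
    by (simp add: DD_def sum.distrib ac_simps)
  finally show ?thesis .
qed

lemma cup_i_DD:
  assumes "singular_simplex (p + q - i) X \<sigma>"
  shows "cup_i i p q X a b \<sigma> = DD (Suc i) (fc p a \<sigma>) (fc q b \<sigma>) {..p + q - i}"
proof -
  let ?n = "p + q - i"
  have e: "cup_first ?n U = cf {..?n} U" "cup_second ?n U = cs {..?n} U" for U
    by (auto simp: cup_first_def cup_second_def cf_def cs_def)
  have "cup_i i p q X a b \<sigma> = (\<Sum>U | U \<subseteq> {..?n} \<and> card U = i + 1 \<and> card (cf {..?n} U) = p + 1 \<and> card (cs {..?n} U) = q + 1.
      a (vertex_face (cf {..?n} U) \<sigma>) * b (vertex_face (cs {..?n} U) \<sigma>))"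
    using assms by (simp add: cup_i_def Let_def e)
  also have "\<dots> = (\<Sum>U | U \<subseteq> {..?n} \<and> card U = i + 1 \<and> card (cf {..?n} U) = p + 1 \<and> card (cs {..?n} U) = q + 1.
      fc p a \<sigma> (cf {..?n} U) * fc q b \<sigma> (cs {..?n} U))"
    by (rule sum.cong) (auto simp: fc_def)
  also have "\<dots> = DD (Suc i) (fc p a \<sigma>) (fc q b \<sigma>) {..?n}"
    unfolding DD_def by (rule sum.mono_neutral_left) (auto simp: fc_def)
  finally show ?thesis .
qed

lemma DD_image:
  assumes s: "strict_mono s" and S: "finite S"
  shows "DD k (\<lambda>T. A (s ` T)) (\<lambda>T. B (s ` T)) S = DD k A B (s ` S)"
proof -
  have inj: "inj s" using s by (rule strict_mono_imp_inj_on)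
  have card: "card (s ` T) = card T" for T by (rule card_image) (use inj inj_on_subset in blast)
  have r: "card {u \<in> s ` U. u < s v} = card {u \<in> U. u < v}" for U v
  proof -
    have "{u \<in> s ` U. u < s v} = s ` {u \<in> U. u < v}" using s by (auto simp: strict_mono_less)
    then show ?thesis by (simp add: card)
  qed
  have e: "cf (s ` S) (s ` U) = s ` cf S U" "cs (s ` S) (s ` U) = s ` cs S U" for U
  proof -
    have "s v \<in> s ` U \<longleftrightarrow> v \<in> U" for v using inj by (auto dest: injD)
    then show "cf (s ` S) (s ` U) = s ` cf S U" "cs (s ` S) (s ` U) = s ` cs S U"
      unfolding cf_def cs_def using r by auto
  qed
  show ?thesis
    unfolding DD_def
  proof (rule sum.reindex_bij_betw[of "(`) s", THEN trans[rotated]])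
    show "bij_betw ((`) s) {U. U \<subseteq> S \<and> card U = k} {U. U \<subseteq> s ` S \<and> card U = k}"
    proof (rule bij_betw_imageI)
      show "inj_on ((`) s) {U. U \<subseteq> S \<and> card U = k}" using inj by (auto simp: inj_on_def inj_image_eq_iff)
      show "(`) s ` {U. U \<subseteq> S \<and> card U = k} = {U. U \<subseteq> s ` S \<and> card U = k}"
        using card by (auto simp: subset_image_iff)
    qed
  qed (simp add: e)
qed

lemma cup_i_singular_face:
  assumes \<sigma>: "singular_simplex (Suc n) X \<sigma>" and v: "v \<le> Suc n" and n: "n = p + q - i"
  shows "cup_i i p q X a b (singular_face (Suc n) v \<sigma>) = DD (Suc i) (fc p a \<sigma>) (fc q b \<sigma>) ({..Suc n} - {v})"
proof -
  have s: "singular_simplex (p + q - i) X (singular_face (Suc n) v \<sigma>)"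
    using singular_simplex_singular_face[OF \<sigma> _ v] n by simp
  have fc: "fc p a (singular_face (Suc n) v \<sigma>) T = fc p a \<sigma> (skip v ` T)" if "T \<subseteq> {..n}" for p T and a :: "'a cochain2"
  proof (cases "T = {}")
    case False
    moreover have "card (skip v ` T) = card T"
      by (rule card_image) (use strict_mono_skip strict_mono_imp_inj_on inj_on_subset in blast)
    ultimately show ?thesis by (simp add: fc_def vertex_face_singular_face[OF \<sigma> v that])
  qed simp
  have "cup_i i p q X a b (singular_face (Suc n) v \<sigma>) =
      DD (Suc i) (fc p a (singular_face (Suc n) v \<sigma>)) (fc q b (singular_face (Suc n) v \<sigma>)) {..n}"
    unfolding n by (rule cup_i_DD[OF s, unfolded n])
  also have "\<dots> = DD (Suc i) (\<lambda>T. fc p a \<sigma> (skip v ` T)) (\<lambda>T. fc q b \<sigma> (skip v ` T)) {..n}"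
    by (rule DD_cong) (simp_all add: fc)
  also have "\<dots> = DD (Suc i) (fc p a \<sigma>) (fc q b \<sigma>) ({..Suc n} - {v})"
    by (simp add: DD_image[OF strict_mono_skip] skip_image[OF v])
  finally show ?thesis .
qed

lemma cup_i_cochain: "cup_i i p q X a b \<in> cochain2_set (p + q - i) X"
  by (simp add: cup_i_def Let_def cochain2_set_def)

text \<open>For equal factors the two lower terms of the coboundary formula coincide and cancel; the
  other two contain the coboundary of \<open>c\<close>.\<close>

theorem cup_square_cocycle:
  assumes c: "c \<in> cocycles2 q X"
  shows "cup_i i q q X c c \<in> cocycles2 (q + q - i) X"
proof -
  have "coboundary2 (q + q - i) X (cup_i i q q X c c) \<sigma> = 0" for \<sigma>
  proof (cases "singular_simplex (Suc (q + q - i)) X \<sigma>")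
    case True
    let ?S = "{..Suc (q + q - i)}"
    let ?A = "fc q c \<sigma>"
    have z: "dA ?A T = 0" if "T \<subseteq> ?S" for T
      using fc_coboundary[OF True that, of q c] c by (simp add: cocycles2_def)
    have 0: "DD k (dA ?A) ?A ?S = DD k (\<lambda>_. 0) ?A ?S" "DD k ?A (dA ?A) ?S = DD k ?A (\<lambda>_. 0) ?S" for k
      by (rule DD_cong; simp add: z)+
    have "coboundary2 (q + q - i) X (cup_i i q q X c c) \<sigma> = (\<Sum>v\<in>?S. DD (Suc i) ?A ?A (?S - {v}))"
      unfolding coboundary2_def if_P[OF True] by (rule sum.cong[OF refl], rule cup_i_singular_face[OF True]) auto
    also have "\<dots> = 0" by (subst cup_coboundary_formula) (simp_all only: finite_atMost 0, simp add: DD_def)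
    finally show ?thesis .
  qed (simp add: coboundary2_def)
  then show ?thesis using cup_i_cochain by (auto simp: cocycles2_def)
qed

text \<open>The cochain is the cup-i product of \<open>b\<close> and \<open>c\<close> plus the
  cup-\<open>(i-1)\<close> square of \<open>b\<close>. The coboundary of the first is the cup-i
  square of \<open>c\<close> plus the cup-\<open>(i-1)\<close> products of \<open>b\<close> and
  \<open>c\<close> in both orders, and the coboundary of the second cancels the latter.\<close>

theorem cup_square_coboundary:
  fixes b :: "'a cochain2"
  assumes i: "i \<le> p" and c: "c = coboundary2 p X b"
  obtains e where "e \<in> cochain2_set (p + Suc p - i) X"
    "cup_i i (Suc p) (Suc p) X c c = coboundary2 (p + Suc p - i) X e"
proof -
  let ?n = "p + Suc p - i"
  \<comment> \<open>For \<open>i = 0\<close> there is nothing to cancel: without cut points the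
    second face is empty, where \<open>fc\<close> is 0.\<close>
  define f where "f = (if i = 0 then (\<lambda>_. 0) else cup_i (i - 1) p p X b b)"
  define e where "e \<sigma> = cup_i i p (Suc p) X b c \<sigma> + f \<sigma>" for \<sigma>
  have n: "Suc p + Suc p - i = Suc ?n" using i by simp
  have "f \<in> cochain2_set ?n X"
    using cup_i_cochain[of "i - 1" p p X b b] i unfolding f_def by (cases i) (auto simp: cochain2_set_def)
  then have 1: "e \<in> cochain2_set ?n X"
    using cup_i_cochain[of i p "Suc p" X b c] unfolding e_def cochain2_set_def by simp
  have "cup_i i (Suc p) (Suc p) X c c \<sigma> = coboundary2 ?n X e \<sigma>" for \<sigma>
  proof (cases "singular_simplex (Suc ?n) X \<sigma>")
    case True
    let ?S = "{..Suc ?n}"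
    let ?A = "fc p b \<sigma>" and ?C = "fc (Suc p) c \<sigma>"
    have dA: "dA ?A T = ?C T" if "T \<subseteq> ?S" for T
      using fc_coboundary[OF True that, of p b] by (simp add: c)
    have dC: "dA ?C T = 0" if "T \<subseteq> ?S" for T
      using fc_coboundary[OF True that, of "Suc p" c] by (simp add: c coboundary2_coboundary2)
    have f: "(\<Sum>v\<in>?S. f (singular_face (Suc ?n) v \<sigma>)) = DD i ?A ?C ?S + DD i ?C ?A ?S"
    proof (cases i)
      case 0
      have "cs ?S {} = {}" by (auto simp: cs_def)
      moreover have "{U. U \<subseteq> ?S \<and> card U = 0} = {{}}" by (auto dest: finite_subset)
      ultimately show ?thesis using 0 by (simp add: f_def DD_def)
    next
      case (Suc j)
      have "f (singular_face (Suc ?n) v \<sigma>) = DD i ?A ?A (?S - {v})" if "v \<in> ?S" for v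
        using cup_i_singular_face[OF True, of v p p j b b] that Suc i by (simp add: f_def)
      then have "(\<Sum>v\<in>?S. f (singular_face (Suc ?n) v \<sigma>)) = (\<Sum>v\<in>?S. DD (Suc j) ?A ?A (?S - {v}))"
        unfolding Suc[symmetric] by (rule sum.cong[OF refl])
      also have "\<dots> = DD i (dA ?A) ?A ?S + DD i ?A (dA ?A) ?S"
        by (subst cup_coboundary_formula) (simp_all add: Suc)
      also have "\<dots> = DD i ?C ?A ?S + DD i ?A ?C ?S"
        by (intro arg_cong2[of _ _ _ _ "(+)"] DD_cong dA refl)
      finally show ?thesis by (simp add: add.commute)
    qed
    have "(\<Sum>v\<in>?S. cup_i i p (Suc p) X b c (singular_face (Suc ?n) v \<sigma>)) = (\<Sum>v\<in>?S. DD (Suc i) ?A ?C (?S - {v}))"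
      by (rule sum.cong[OF refl], rule cup_i_singular_face[OF True]) auto
    also have "\<dots> = DD (Suc i) (dA ?A) ?C ?S + DD (Suc i) ?A (dA ?C) ?S + (DD i ?A ?C ?S + DD i ?C ?A ?S)"
      by (rule cup_coboundary_formula) simp
    also have "DD (Suc i) (dA ?A) ?C ?S = DD (Suc i) ?C ?C ?S" by (intro DD_cong dA refl)
    also have "DD (Suc i) ?A (dA ?C) ?S = DD (Suc i) ?A (\<lambda>_. 0) ?S" by (intro DD_cong dC refl)
    also have "DD (Suc i) ?A (\<lambda>_. 0) ?S = 0" by (simp add: DD_def)
    finally have "coboundary2 ?n X e \<sigma> = DD (Suc i) ?C ?C ?S"
      using True f by (simp add: coboundary2_def e_def sum.distrib add.assoc del: sum.atMost_Suc)
    also have "\<dots> = cup_i i (Suc p) (Suc p) X c c \<sigma>"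
      using cup_i_DD[of "Suc p" "Suc p" i X \<sigma> c c] True by (simp only: n)
    finally show ?thesis ..
  next
    case False
    then show ?thesis using cup_i_cochain[of i "Suc p" "Suc p" X c c] by (simp add: coboundary2_def cochain2_set_def n del: add_Suc add_Suc_right)
  qed
  then show thesis using that[OF 1] by blast
qed

section \<open>Counting modulo two\<close>

text \<open>With \<open>odd_binomial_Suc\<close> this is the recursion of Lucas on the last binary
  digits, proved by Pascal's rule.\<close>

lemma odd_binomial_double:
  "odd ((2 * a) choose (2 * b)) \<longleftrightarrow> odd (a choose b)" and even_binomial: "even ((2 * a) choose Suc (2 * b))"
proof (induction a arbitrary: b)
  case 0
  { case 1 show ?case by (cases b) simp_all next case 2 show ?case by simp }
next
  case (Suc a)
  { case 1 show ?case using Suc.IH(1)[of b] Suc.IH(1)[of "b - 1"] Suc.IH(2)[of "b - 1"] by (cases b) auto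
    next case 2 show ?case using Suc.IH(1)[of b] Suc.IH(2)[of b] Suc.IH(2)[of "b - 1"] by (cases b) auto }
qed

lemma odd_binomial_Suc:
  "odd (Suc (2 * a) choose (2 * b)) \<longleftrightarrow> odd (a choose b)" "odd (Suc (2 * a) choose Suc (2 * b)) \<longleftrightarrow> odd (a choose b)"
proof -
  show "odd (Suc (2 * a) choose (2 * b)) \<longleftrightarrow> odd (a choose b)"
    using odd_binomial_double[of a b] odd_binomial_double[of a "b - 1"] even_binomial[of a "b - 1"] by (cases b) auto
  show "odd (Suc (2 * a) choose Suc (2 * b)) \<longleftrightarrow> odd (a choose b)"
    using odd_binomial_double[of a b] even_binomial[of a b] by auto
qed

text \<open>In increasing order the elements of \<open>T\<close> alternate in parity, and the least
  one has the parity of \<open>e\<close>.\<close>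

definition alt :: "nat \<Rightarrow> nat set \<Rightarrow> bool" where
  "alt e T \<longleftrightarrow> (\<forall>v\<in>T. even v \<longleftrightarrow> even (e + card {w \<in> T. w < v}))"

lemma alt_insert:
  assumes "T \<subseteq> {..<n}"
  shows "alt e (insert n T) \<longleftrightarrow> alt e T \<and> (even n \<longleftrightarrow> even (e + card T))"
proof -
  have "{w \<in> insert n T. w < v} = {w \<in> T. w < v}" if "v \<in> T" for v using assms that by auto
  moreover have "{w \<in> insert n T. w < n} = T" using assms by auto
  ultimately show ?thesis by (auto simp: alt_def)
qed

text \<open>Of the vertices below \<open>n\<close>, the cut points, \<open>c\<close> in number, lie
  on both faces, \<open>x\<close> further ones on the first and \<open>y\<close> on the second. The
  first face alternates in parity from an even vertex, the second from one of the parity of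
  \<open>e\<close>.\<close>

definition Pd :: "nat \<Rightarrow> nat \<Rightarrow> nat \<Rightarrow> nat \<Rightarrow> nat \<Rightarrow> nat set \<Rightarrow> bool" where
  "Pd e n c x y U \<longleftrightarrow> card U = c \<and> card (cf {..<n} U) = c + x \<and> card (cs {..<n} U) = c + y \<and>
     alt 0 (cf {..<n} U) \<and> alt e (cs {..<n} U)"

lemma cut_Suc:
  assumes "U \<subseteq> {..<n}"
  shows "cf {..<Suc n} (insert n U) = insert n (cf {..<n} U)" "cs {..<Suc n} (insert n U) = insert n (cs {..<n} U)"
    "cf {..<Suc n} U = (if even (card U) then insert n (cf {..<n} U) else cf {..<n} U)"
    "cs {..<Suc n} U = (if even (card U) then cs {..<n} U else insert n (cs {..<n} U))"
proof -
  have "finite U" "n \<notin> U" using assms finite_subset by auto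
  note r = rank_insert[OF this]
  have n: "{u \<in> U. u < n} = U" "n \<notin> U" using assms by auto
  have c: "cf (insert n S) U = (if n \<in> U \<or> even (card {u \<in> U. u < n}) then insert n (cf S U) else cf S U)"
    "cs (insert n S) U = (if n \<in> U \<or> odd (card {u \<in> U. u < n}) then insert n (cs S U) else cs S U)" for S
    unfolding cf_def cs_def by auto
  show "cf {..<Suc n} (insert n U) = insert n (cf {..<n} U)" "cs {..<Suc n} (insert n U) = insert n (cs {..<n} U)"
    unfolding cf_def cs_def r by (auto simp: less_Suc_eq)
  show "cf {..<Suc n} U = (if even (card U) then insert n (cf {..<n} U) else cf {..<n} U)"
    "cs {..<Suc n} U = (if even (card U) then cs {..<n} U else insert n (cs {..<n} U))"
    unfolding lessThan_Suc c n(1) using n(2) by simp_all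
qed

lemma cut_subsets: "cf S U \<subseteq> S" "cs S U \<subseteq> S" "U \<subseteq> S \<Longrightarrow> U \<subseteq> cf S U" "U \<subseteq> S \<Longrightarrow> U \<subseteq> cs S U"
  by (auto simp: cf_def cs_def)

lemma Pd_insert:
  assumes U: "U \<subseteq> {..<n}"
  shows "Pd e (Suc n) c x y (insert n U) \<longleftrightarrow>
    (\<exists>c'. c = Suc c' \<and> (even n \<longleftrightarrow> even (c' + x)) \<and> (even n \<longleftrightarrow> even (e + c' + y)) \<and> Pd e n c' x y U)"
proof -
  have fin: "finite U" "finite (cf {..<n} U)" "finite (cs {..<n} U)" and n: "n \<notin> U" "n \<notin> cf {..<n} U" "n \<notin> cs {..<n} U"
    using U finite_subset cut_subsets(1,2)[of "{..<n}" U] by auto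
  show ?thesis
    unfolding Pd_def cut_Suc[OF U] alt_insert[OF cut_subsets(1)] alt_insert[OF cut_subsets(2)]
    using fin n by (cases c) auto
qed

lemma Pd_keep:
  assumes U: "U \<subseteq> {..<n}"
  shows "Pd e (Suc n) c x y U \<longleftrightarrow>
    (if even c then (\<exists>x'. x = Suc x' \<and> (even n \<longleftrightarrow> even (c + x')) \<and> Pd e n c x' y U)
     else (\<exists>y'. y = Suc y' \<and> (even n \<longleftrightarrow> even (e + c + y')) \<and> Pd e n c x y' U))"
proof -
  have fin: "finite U" "finite (cf {..<n} U)" "finite (cs {..<n} U)" and n: "n \<notin> cf {..<n} U" "n \<notin> cs {..<n} U"
    using U finite_subset cut_subsets(1,2)[of "{..<n}" U] by auto
  have le: "card U \<le> card (cf {..<n} U)" "card U \<le> card (cs {..<n} U)"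
    using cut_subsets(3,4)[OF U] fin by (auto intro: card_mono)
  show ?thesis
  proof (cases "card U = c")
    case c: True
    show ?thesis
    proof (cases "even c")
      case True
      then show ?thesis
        unfolding Pd_def cut_Suc(3,4)[OF U] using c fin n le
        by (cases x) (auto simp: alt_insert[OF cut_subsets(1)])
    next
      case False
      then show ?thesis
        unfolding Pd_def cut_Suc(3,4)[OF U] using c fin n le
        by (cases y) (auto simp: alt_insert[OF cut_subsets(2)])
    qed
  qed (auto simp: Pd_def)
qed

text \<open>The solution of the recurrence \<open>HH_unfold\<close>. The cut points separate
  intervals belonging alternately to the first and the second face; up to parity conditions at the
  two ends, the other vertices come in consecutive pairs, and the binomials distribute these pairs
  over the intervals of each face.\<close>

fun cnt :: "nat \<Rightarrow> nat \<Rightarrow> nat \<Rightarrow> nat \<Rightarrow> nat" where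
  "cnt e 0 x y = (if y = 0 then 1 else 0)"
| "cnt e (Suc c) x y =
    (if even c then (if even (x + e) then ((c div 2 + x div 2) choose (x div 2)) * ((c div 2 + y div 2) choose (y div 2)) else 0)
     else (if even y \<and> e \<le> x then ((Suc (c div 2) + (x - e) div 2) choose ((x - e) div 2)) * ((c div 2 + y div 2) choose (y div 2)) else 0))"

definition HH :: "nat \<Rightarrow> nat \<Rightarrow> nat \<Rightarrow> nat \<Rightarrow> nat" where
  "HH e c x y = card {U. U \<subseteq> {..<c + x + y} \<and> Pd e (c + x + y) c x y U}"

lemma card_subsets_Suc:
  "card {U. U \<subseteq> {..<Suc n} \<and> P U} = card {U. U \<subseteq> {..<n} \<and> P U} + card {U. U \<subseteq> {..<n} \<and> P (insert n U)}"
proof -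
  have "{U. U \<subseteq> {..<Suc n} \<and> P U} = {U. U \<subseteq> {..<n} \<and> P U} \<union> insert n ` {U. U \<subseteq> {..<n} \<and> P (insert n U)}"
  proof (intro equalityI subsetI)
    fix U assume U: "U \<in> {U. U \<subseteq> {..<Suc n} \<and> P U}"
    show "U \<in> {U. U \<subseteq> {..<n} \<and> P U} \<union> insert n ` {U. U \<subseteq> {..<n} \<and> P (insert n U)}"
    proof (cases "n \<in> U")
      case True
      then have "U = insert n (U - {n})" by blast
      moreover have "U - {n} \<subseteq> {..<n}" using U by (auto simp: less_Suc_eq)
      ultimately show ?thesis using U by (metis (mono_tags, lifting) UnI2 image_eqI mem_Collect_eq)
    next
      case False
      then have "U \<subseteq> {..<n}" using U by (auto simp: less_Suc_eq)
      then show ?thesis using U by blast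
    qed
  qed auto
  moreover have "inj_on (insert n) {U. U \<subseteq> {..<n} \<and> P (insert n U)}"
  proof (rule inj_onI)
    fix U V assume "U \<in> {U. U \<subseteq> {..<n} \<and> P (insert n U)}" "V \<in> {U. U \<subseteq> {..<n} \<and> P (insert n U)}" "insert n U = insert n V"
    moreover then have "n \<notin> U" "n \<notin> V" by auto
    ultimately show "U = V" by (metis Diff_insert_absorb)
  qed
  moreover have "{U. U \<subseteq> {..<n} \<and> P U} \<inter> insert n ` {U. U \<subseteq> {..<n} \<and> P (insert n U)} = {}" by auto
  moreover have "finite {U. U \<subseteq> {..<n} \<and> P U}" for P by simp
  ultimately show ?thesis by (simp add: card_Un_disjoint card_image)
qed

text \<open>The last vertex is a cut point, or it lies on one face alone: on the first if
  \<open>c\<close> is even, on the second if \<open>c\<close> is odd. Its parity must continue the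
  alternation of the faces that contain it.\<close>

lemma HH_unfold:
  "HH e c x y = (if c = 0 \<and> x = 0 \<and> y = 0 then 1 else
     (if even c then (case x of 0 \<Rightarrow> 0 | Suc x' \<Rightarrow> if even y then HH e c x' y else 0)
      else (case y of 0 \<Rightarrow> 0 | Suc y' \<Rightarrow> if even (x + e) then HH e c x y' else 0)) +
     (case c of 0 \<Rightarrow> 0 | Suc c' \<Rightarrow> if even y \<and> even (x + e) then HH e c' x y else 0))"
proof (cases "c + x + y")
  case 0
  have "Pd e 0 0 0 0 {}" by (auto simp: Pd_def cf_def cs_def alt_def)
  then have "{U. U \<subseteq> {..<0} \<and> Pd e 0 0 0 0 U} = {{}}" by auto
  then show ?thesis using 0 by (simp add: HH_def)
next
  case (Suc n)
  have keep: "card {U. U \<subseteq> {..<n} \<and> Pd e (Suc n) c x y U} =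
     (if even c then (case x of 0 \<Rightarrow> 0 | Suc x' \<Rightarrow> if even y then HH e c x' y else 0)
      else (case y of 0 \<Rightarrow> 0 | Suc y' \<Rightarrow> if even (x + e) then HH e c x y' else 0))"
  proof (cases "even c")
    case True
    have eq: "{U. U \<subseteq> {..<n} \<and> Pd e (Suc n) c x y U} =
        {U. U \<subseteq> {..<n} \<and> (\<exists>x'. x = Suc x' \<and> (even n \<longleftrightarrow> even (c + x')) \<and> Pd e n c x' y U)}"
      using Pd_keep[of _ n e c x y] True by auto
    have "card {U. U \<subseteq> {..<n} \<and> (\<exists>x'. x = Suc x' \<and> (even n \<longleftrightarrow> even (c + x')) \<and> Pd e n c x' y U)} = (case x of 0 \<Rightarrow> 0 | Suc x' \<Rightarrow> if even y then HH e c x' y else 0)"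
    proof (cases x)
      case 0
      then show ?thesis by simp
    next
      case x: (Suc x')
      then have n: "n = c + x' + y" using Suc by simp
      have "(even n \<longleftrightarrow> even (c + x')) \<longleftrightarrow> even y" unfolding n by auto
      then show ?thesis using x n by (simp add: HH_def)
    qed
    then show ?thesis unfolding eq if_P[OF True] .
  next
    case False
    have eq: "{U. U \<subseteq> {..<n} \<and> Pd e (Suc n) c x y U} =
        {U. U \<subseteq> {..<n} \<and> (\<exists>y'. y = Suc y' \<and> (even n \<longleftrightarrow> even (e + c + y')) \<and> Pd e n c x y' U)}"
      using Pd_keep[of _ n e c x y] False by auto
    have "card {U. U \<subseteq> {..<n} \<and> (\<exists>y'. y = Suc y' \<and> (even n \<longleftrightarrow> even (e + c + y')) \<and> Pd e n c x y' U)} = (case y of 0 \<Rightarrow> 0 | Suc y' \<Rightarrow> if even (x + e) then HH e c x y' else 0)"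
    proof (cases y)
      case 0
      then show ?thesis by simp
    next
      case y: (Suc y')
      then have n: "n = c + x + y'" using Suc by simp
      have "(even n \<longleftrightarrow> even (e + c + y')) \<longleftrightarrow> even (x + e)" unfolding n by auto
      then show ?thesis using y n by (simp add: HH_def)
    qed
    then show ?thesis unfolding eq if_not_P[OF False] .
  qed
  have eq: "{U. U \<subseteq> {..<n} \<and> Pd e (Suc n) c x y (insert n U)} =
      {U. U \<subseteq> {..<n} \<and> (\<exists>c'. c = Suc c' \<and> (even n \<longleftrightarrow> even (c' + x)) \<and> (even n \<longleftrightarrow> even (e + c' + y)) \<and> Pd e n c' x y U)}"
    using Pd_insert[of _ n e c x y] by auto
  have "card {U. U \<subseteq> {..<n} \<and> (\<exists>c'. c = Suc c' \<and> (even n \<longleftrightarrow> even (c' + x)) \<and> (even n \<longleftrightarrow> even (e + c' + y)) \<and> Pd e n c' x y U)} = (case c of 0 \<Rightarrow> 0 | Suc c' \<Rightarrow> if even y \<and> even (x + e) then HH e c' x y else 0)"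
  proof (cases c)
    case 0
    then show ?thesis by simp
  next
    case c: (Suc c')
    then have n: "n = c' + x + y" using Suc by simp
    have "(even n \<longleftrightarrow> even (c' + x)) \<and> (even n \<longleftrightarrow> even (e + c' + y)) \<longleftrightarrow> even y \<and> even (x + e)" unfolding n by auto
    then show ?thesis using c n by (auto simp: HH_def)
  qed
  then have ins: "card {U. U \<subseteq> {..<n} \<and> Pd e (Suc n) c x y (insert n U)} =
    (case c of 0 \<Rightarrow> 0 | Suc c' \<Rightarrow> if even y \<and> even (x + e) then HH e c' x y else 0)"
    unfolding eq .
  show ?thesis
    unfolding HH_def[of e c x y] Suc card_subsets_Suc keep ins using Suc by auto
qed

lemma half_diff:
  assumes "e = 0 \<or> e = (1::nat)"
  shows "even (x + e) \<Longrightarrow> (x - e) div 2 = x div 2" "even (x + e) \<Longrightarrow> x = 2 * (x div 2) + e"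
    "odd (Suc x + e) \<Longrightarrow> (x - e) div 2 = (Suc x - e) div 2" "odd (Suc x + e) \<Longrightarrow> e \<le> Suc x"
proof -
  obtain a where "x = 2 * a \<or> x = Suc (2 * a)" by (metis evenE oddE Suc_eq_plus1)
  then show "even (x + e) \<Longrightarrow> (x - e) div 2 = x div 2" "even (x + e) \<Longrightarrow> x = 2 * (x div 2) + e"
    "odd (Suc x + e) \<Longrightarrow> (x - e) div 2 = (Suc x - e) div 2" "odd (Suc x + e) \<Longrightarrow> e \<le> Suc x"
    using assms by auto
qed

lemma HH_cnt:
  assumes e: "e = 0 \<or> e = 1"
  shows "HH e c x y = cnt e c x y"
proof (induction "c + x + y" arbitrary: c x y rule: less_induct)
  case less
  have cx: "\<And>c'. c = Suc c' \<Longrightarrow> HH e c' x y = cnt e c' x y" "\<And>x'. x = Suc x' \<Longrightarrow> HH e c x' y = cnt e c x' y"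
    "\<And>y'. y = Suc y' \<Longrightarrow> HH e c x y' = cnt e c x y'"
    by (rule less; simp)+
  consider "c = 0" | j where "c = Suc (2 * j)" | j where "c = Suc (Suc (2 * j))"
    by (metis odd_Suc_minus_one oddE evenE not0_implies_Suc Suc_eq_plus1 even_Suc)
  then show ?case
  proof cases
    case 1
    then show ?thesis using cx(2) by (subst HH_unfold) (auto split: nat.split)
  next
    case (2 j)
    show ?thesis
    proof (cases "even (x + e)")
      case False
      then show ?thesis using 2 by (subst HH_unfold) (auto split: nat.split)
    next
      case True
      have c': "HH e (2 * j) x y = cnt e (2 * j) x y" by (rule cx) (simp add: 2)
      have c'v: "cnt e (2 * j) x y = (if j = 0 then (if y = 0 then 1 else 0) else ((j + x div 2) choose (x div 2)) * ((j - 1 + y div 2) choose (y div 2)))"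
        if "even y"
      proof (cases j)
        case (Suc i)
        have "e \<le> x" using True e by (cases x) auto
        moreover have "(x - e) div 2 = x div 2" by (rule half_diff(1)[OF e True])
        ultimately show ?thesis using that Suc by simp
      qed simp
      show ?thesis
      proof (cases "even y")
        case y: False
        then obtain y' where y': "y = Suc y'" "even y'" by (cases y) auto
        have "HH e c x y = cnt e c x y'" using True y y'(1) cx(3)[OF y'(1)] 2 by (subst HH_unfold) simp
        then show ?thesis using y' 2 by simp
      next
        case y: True
        then obtain Y where Y: "y = 2 * Y" by (auto elim: evenE)
        show ?thesis
        proof (cases Y)
          case 0
          then show ?thesis using True y Y c' c'v 2 by (subst HH_unfold) simp
        next
          case (Suc Z)
          then have y': "y = Suc (Suc (2 * Z))" using Y by simp
          have "HH e c x y = cnt e c x (Suc (2 * Z)) + cnt e (2 * j) x y"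
            using True y y' cx(3)[OF y'] c' 2 by (subst HH_unfold) simp
          also have "\<dots> = ((j + x div 2) choose (x div 2)) * ((j + Z) choose Z) +
              ((j + x div 2) choose (x div 2)) * ((j + Z) choose Suc Z)"
            using c'v[OF y] True 2 y' by (cases j) simp_all
          also have "\<dots> = cnt e c x y"
            using 2 True y' by (simp flip: distrib_left)
          finally show ?thesis .
        qed
      qed
    qed
  next
    case (3 j)
    have c': "HH e (Suc (2 * j)) x y = cnt e (Suc (2 * j)) x y" by (rule cx) (simp add: 3)
    show ?thesis
    proof (cases "even y")
      case False
      then show ?thesis using 3 by (subst HH_unfold) (auto split: nat.split)
    next
      case y: True
      show ?thesis
      proof (cases x)
        case 0
        then show ?thesis using y c' 3 e by (subst HH_unfold) auto
      next
        case (Suc x')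
        have h: "HH e c x y = cnt e c x' y + (if even (x + e) then cnt e (Suc (2 * j)) x y else 0)"
          using y c' 3 cx(2)[OF Suc] Suc by (subst HH_unfold) simp
        show ?thesis
        proof (cases "even (x + e)")
          case False
          have "e \<le> x'" using e Suc False by (cases x') auto
          moreover have "(x' - e) div 2 = (x - e) div 2" using half_diff(3)[OF e, of x'] Suc False by simp
          moreover have "e \<le> x" using \<open>e \<le> x'\<close> Suc by simp
          ultimately show ?thesis using h False 3 y by simp
        next
          case True
          define X where "X = (x - e) div 2"
          have X: "x = 2 * X + e" unfolding X_def half_diff(1)[OF e True] by (rule half_diff(2)[OF e True])
          show ?thesis
          proof (cases X)
            case 0
            then have "e = 1" "x' = 0" using X e Suc by auto
            then show ?thesis using h True 3 y Suc 0 by simp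
          next
            case (Suc Z)
            then have "x' - e = Suc (2 * Z)" "e \<le> x'" "x div 2 = Suc Z" "x - e = Suc (Suc (2 * Z))" "e \<le> x"
              using X \<open>x = Suc x'\<close> e by auto
            then show ?thesis using h True 3 y by (simp flip: distrib_right)
          qed
        qed
      qed
    qed
  qed
qed

text \<open>Put \<open>j = i div 2\<close> and \<open>K = k div 2\<close>. For even \<open>i\<close>
  only one of the two counts is nonzero, and it is the square of \<open>(j + K) choose K\<close>.
  For odd \<open>i\<close> and even \<open>k\<close> the sum is congruent to that square by Pascal's
  rule. For \<open>i\<close> and \<open>k\<close> both odd the assumption fails.\<close>

lemma odd_cnt:
  assumes k: "0 < k" and o: "odd ((i + k) choose k)"
  shows "odd (HH 0 (Suc i) k k + HH 1 (Suc i) k k)"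
proof -
  have d: "Suc (2 * a) div 2 = a" "Suc (Suc (2 * a)) div 2 = Suc a" for a :: nat by simp_all
  obtain j where j: "i = 2 * j \<or> i = Suc (2 * j)" by (metis evenE oddE Suc_eq_plus1)
  obtain K where K: "k = 2 * K \<or> k = Suc (2 * K)" by (metis evenE oddE Suc_eq_plus1)
  from j K consider "i = 2 * j" "k = 2 * K" | "i = 2 * j" "k = Suc (2 * K)" | "i = Suc (2 * j)" "k = 2 * K" |
    "i = Suc (2 * j)" "k = Suc (2 * K)" by blast
  then show ?thesis
  proof cases
    case 1
    then have "i + k = 2 * (j + K)" by simp
    then have "odd ((j + K) choose K)" using o 1 odd_binomial_double(1) by metis
    then show ?thesis using 1 by (simp add: HH_cnt)
  next
    case 2
    then have "i + k = Suc (2 * (j + K))" by simp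
    then have "odd ((j + K) choose K)" using o 2 odd_binomial_Suc(2) by metis
    then show ?thesis using 2 by (simp add: HH_cnt)
  next
    case 3
    then have "i + k = Suc (2 * (j + K))" by simp
    then have c: "odd ((j + K) choose K)" using o 3 odd_binomial_Suc(1) by metis
    obtain L where L: "K = Suc L" using k 3 by (cases K) auto
    have "k - 1 = Suc (2 * L)" using 3 L by simp
    then show ?thesis using 3 c L by (simp add: HH_cnt d)
  next
    case 4
    then have "i + k = 2 * (Suc (j + K))" by simp
    then have "even ((i + k) choose k)" using 4 even_binomial by metis
    then show ?thesis using o by simp
  qed
qed

section \<open>Powers of a one-dimensional cocycle\<close>

lemma edges_prod: "edges w L = (\<Prod>j<length L - 1. w (L ! j) (L ! Suc j))"
proof (induction w L rule: edges.induct)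
  case (1 w x y L)
  have "(\<Prod>j<length (x # y # L) - 1. w ((x # y # L) ! j) ((x # y # L) ! Suc j)) =
      w x y * (\<Prod>j<length (y # L) - 1. w ((y # L) ! j) ((y # L) ! Suc j))"
    by (simp add: prod.lessThan_Suc_shift del: prod.lessThan_Suc)
  then show ?case using 1 by simp
qed simp_all

lemma edges_map: "edges w (map f L) = edges (\<lambda>a b. w (f a) (f b)) L"
  by (induction "\<lambda>a b. w (f a) (f b)" L rule: edges.induct) simp_all

lemma edges_cong: "(\<And>a b. a \<in> set L \<Longrightarrow> b \<in> set L \<Longrightarrow> w a b = w' a b) \<Longrightarrow> edges w L = edges w' L"
  by (induction w L rule: edges.induct) simp_all

lemma edges_cong_sorted:
  "sorted_wrt (<) L \<Longrightarrow> (\<And>a b. a \<in> set L \<Longrightarrow> b \<in> set L \<Longrightarrow> a < b \<Longrightarrow> w a b = w' a b) \<Longrightarrow> edges w L = edges w' L"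
  for L :: "nat list"
  by (induction w L rule: edges.induct) simp_all

definition wpow :: "nat \<Rightarrow> 'a topology \<Rightarrow> 'a cochain2 \<Rightarrow> 'a cochain2" where
  "wpow q X w \<sigma> = (if singular_simplex q X \<sigma> then edges (\<lambda>a b. w (face [a, b] \<sigma>)) [0..<Suc q] else 0)"

lemma wpow_face:
  assumes \<tau>: "singular_simplex n X \<tau>" and M: "set M \<subseteq> {..n}" "length M = Suc q"
  shows "wpow q X w (face M \<tau>) = edges (\<lambda>a b. w (face [a, b] \<tau>)) M"
proof -
  have "wpow q X w (face M \<tau>) = edges (\<lambda>a b. w (face [a, b] (face M \<tau>))) [0..<Suc q]"
    using face_simplex[OF \<tau> M] by (simp add: wpow_def del: upt_Suc)
  also have "\<dots> = edges (\<lambda>a b. w (face [M ! a, M ! b] \<tau>)) [0..<Suc q]"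
    by (rule edges_cong) (use M in \<open>simp add: face_face del: upt_Suc\<close>)
  also have "\<dots> = edges (\<lambda>a b. w (face [a, b] \<tau>)) (map ((!) M) [0..<Suc q])"
    by (simp only: edges_map)
  also have "map ((!) M) [0..<Suc q] = M" using map_nth[of M] M by simp
  finally show ?thesis .
qed

lemma wpow_inc:
  assumes K: "simp_cx K" "set L \<in> K" "length L = Suc q"
  shows "wpow q (geometric_realization K) w (inc L) = edges (\<lambda>P Q. w (inc [P, Q])) L"
proof -
  have "wpow q (geometric_realization K) w (inc L) = edges (\<lambda>a b. w (face [a, b] (inc L))) [0..<Suc q]"
    using inc_simplex[OF K] by (simp add: wpow_def del: upt_Suc)
  also have "\<dots> = edges (\<lambda>a b. w (inc [L ! a, L ! b])) [0..<Suc q]"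
    by (rule edges_cong) (use K in \<open>simp add: face_inc del: upt_Suc\<close>)
  also have "\<dots> = edges (\<lambda>P Q. w (inc [P, Q])) (map ((!) L) [0..<Suc q])"
    by (simp only: edges_map)
  also have "map ((!) L) [0..<Suc q] = L" using map_nth[of L] K by simp
  finally show ?thesis .
qed

lemma cocycle_triangle:
  assumes w: "w \<in> cocycles2 (Suc 0) X" and \<tau>: "singular_simplex n X \<tau>" and a: "a < b" "b < c" "c \<le> n"
  shows "w (face [a, c] \<tau>) = w (face [a, b] \<tau>) + w (face [b, c] \<tau>)"
proof -
  have p: "fc (Suc 0) w \<tau> {u, v} = w (face [u, v] \<tau>)" if "u < v" for u v
  proof -
    have "sl {u, v} = [u, v]" using that sorted_list_of_set.idem_if_sorted_distinct[of "[u, v]"] by simp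
    then show ?thesis using that by (simp add: fc_def vertex_face_eq)
  qed
  have "(\<Sum>v\<in>{a, b, c}. fc (Suc 0) w \<tau> ({a, b, c} - {v})) = 0"
    using fc_coboundary[OF \<tau>, of "{a, b, c}" "Suc 0" w] a w by (simp add: cocycles2_def)
  moreover have "{a, b, c} - {a} = {b, c}" "{a, b, c} - {b} = {a, c}" "{a, b, c} - {c} = {a, b}" using a by auto
  ultimately have "w (face [b, c] \<tau>) + (w (face [a, c] \<tau>) + w (face [a, b] \<tau>)) = 0"
    using a p[of b c] p[of a c] p[of a b] by (simp add: insert_Diff_if)
  moreover have "y = z + x" if "x + (y + z) = 0" for x y z :: bit using that by (cases x; cases y; cases z) simp_all
  ultimately show ?thesis by blast
qed

text \<open>On a single simplex the cocycle \<open>w\<close> is a coboundary; this is its potential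
  normalized at vertex 0.\<close>

definition pot :: "'a cochain2 \<Rightarrow> 'a sing_simplex \<Rightarrow> nat \<Rightarrow> bit" where
  "pot w \<tau> a = (if a = 0 then 0 else w (face [0, a] \<tau>))"

lemma cocycle_pot:
  assumes "w \<in> cocycles2 (Suc 0) X" "singular_simplex n X \<tau>" "a < b" "b \<le> n"
  shows "w (face [a, b] \<tau>) = pot w \<tau> a + pot w \<tau> b"
  using cocycle_triangle[OF assms(1,2), of 0 a b] assms(3,4) by (cases "a = 0") (simp_all add: pot_def)

lemma wpow_pot:
  assumes "w \<in> cocycles2 (Suc 0) X" "singular_simplex n X \<tau>" "set M \<subseteq> {..n}" "length M = Suc q" "sorted_wrt (<) M"
  shows "wpow q X w (face M \<tau>) = edges (\<lambda>a b. pot w \<tau> a + pot w \<tau> b) M"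
  unfolding wpow_face[OF assms(2-4)]
  by (rule edges_cong_sorted[OF assms(5)]) (use cocycle_pot[OF assms(1,2)] assms(3) in auto)

lemma face_id: "singular_simplex n X \<tau> \<Longrightarrow> face [0..<Suc n] \<tau> = \<tau>"
  using sreal_elist[of n X \<tau>] by (simp only: face_def elist_def)

lemma wpow_cocycle:
  assumes w: "w \<in> cocycles2 (Suc 0) X" and q: "0 < q"
  shows "wpow q X w \<in> cocycles2 q X"
proof -
  have "coboundary2 q X (wpow q X w) \<sigma> = 0" for \<sigma>
  proof (cases "singular_simplex (Suc q) X \<sigma>")
    case True
    let ?L = "[0..<Suc (Suc q)]"
    let ?f = "\<lambda>a b. pot w \<sigma> a + pot w \<sigma> b"
    have "wpow q X w (singular_face (Suc q) k \<sigma>) = edges ?f (take k ?L @ drop (Suc k) ?L)" if k: "k \<le> Suc q" for k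
    proof -
      have "singular_face (Suc q) k (face ?L \<sigma>) = face (take k ?L @ drop (Suc k) ?L) \<sigma>"
        using singular_face_sreal[OF k, of "map unitv ?L" \<sigma>] by (simp add: face_def take_map drop_map del: upt_Suc)
      moreover have "sorted_wrt (<) (take k ?L @ drop (Suc k) ?L)"
        by (auto simp: sorted_wrt_append take_upt drop_upt simp del: upt_Suc)
      moreover have "set (take k ?L @ drop (Suc k) ?L) \<subseteq> {..Suc q}" "length (take k ?L @ drop (Suc k) ?L) = Suc q"
        using k by (auto simp: take_upt drop_upt simp del: upt_Suc)
      ultimately show ?thesis using wpow_pot[OF w True] face_id[OF True] by (simp del: upt_Suc)
    qed
    then have "coboundary2 q X (wpow q X w) \<sigma> = (\<Sum>k\<le>Suc q. edges ?f (take k ?L @ drop (Suc k) ?L))"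
      unfolding coboundary2_def if_P[OF True] by (intro sum.cong) auto
    also have "\<dots> = lin (edges ?f) (bdl ?L)"
      by (simp add: bdl_eq_sum lin_sum lessThan_Suc_atMost del: upt_Suc sum.atMost_Suc)
    also have "\<dots> = 0" by (rule edges_cocycle) simp
    finally show ?thesis .
  qed (simp add: coboundary2_def)
  then show ?thesis by (auto simp: cocycles2_def cochain2_set_def wpow_def)
qed

section \<open>The cup-i square of a power as a count of alternating faces\<close>

fun altl :: "bool \<Rightarrow> nat list \<Rightarrow> bool" where
  "altl b [] = True"
| "altl b (x # L) = ((even x \<longleftrightarrow> b) \<and> altl (\<not> b) L)"

lemma of_nat_bit: "(of_nat n :: bit) = of_bool (odd n)"
  by (induction n) auto

text \<open>With vertex numbers modulo 2 as potential, an edge contributes 1 exactly when its ends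
  differ in parity. The two summands are the two possible starting parities, which exclude each
  other on a nonempty list.\<close>

lemma edges_altl: "L \<noteq> [] \<Longrightarrow> edges (\<lambda>a b. of_nat a + of_nat b) L = (of_bool (altl True L) + of_bool (altl False L) :: bit)"
  by (induction "\<lambda>a b. of_nat a + of_nat b :: bit" L rule: edges.induct) (auto simp: of_nat_bit)

lemma altl_nth: "altl b L \<longleftrightarrow> (\<forall>j<length L. even (L ! j) \<longleftrightarrow> (b \<longleftrightarrow> even j))"
proof (induction L arbitrary: b)
  case (Cons x L)
  have "((\<not> b) \<longleftrightarrow> even j) \<longleftrightarrow> (b \<longleftrightarrow> even (Suc j))" for j by auto
  then show ?case by (simp only: altl.simps Cons length_Cons All_less_Suc2 nth_Cons_0 nth_Cons_Suc even_zero simp_thms)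
qed simp

lemma alt_altl:
  assumes "finite T"
  shows "alt e T \<longleftrightarrow> altl (even e) (sl T)"
proof -
  have r: "card {w \<in> T. w < sl T ! j} = j" if "j < length (sl T)" for j
  proof -
    have "sl T ! j \<in> T" using that assms nth_mem[of j "sl T"] by auto
    then show ?thesis using sl_nth_rank[OF assms, of "sl T ! j"] that by (metis distinct_sorted_list_of_set nth_eq_iff_index_eq)
  qed
  have "alt e T \<longleftrightarrow> (\<forall>v\<in>set (sl T). even v \<longleftrightarrow> even (e + card {w \<in> T. w < v}))"
    unfolding alt_def set_sorted_list_of_set[OF assms] ..
  also have "\<dots> \<longleftrightarrow> altl (even e) (sl T)"
    unfolding all_set_conv_all_nth altl_nth
  proof (intro all_cong)
    fix j assume "j < length (sl T)"
    from r[OF this] show "(even (sl T ! j) \<longleftrightarrow> even (e + card {w \<in> T. w < sl T ! j})) \<longleftrightarrow> (even (sl T ! j) \<longleftrightarrow> (even e \<longleftrightarrow> even j))"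
      by (simp only: even_add)
  qed
  finally show ?thesis .
qed

text \<open>If the cocycle vanishes on some edge \<open>{t, t + 1}\<close>, both sides vanish, because \<open>t\<close> and \<open>t + 1\<close>
  are consecutive in one of the two faces. Otherwise a factor is nonzero exactly when the
  vertices of the face alternate in parity.\<close>

theorem cup_power:
  assumes w: "w \<in> cocycles2 (Suc 0) X" and k: "0 < k" and o: "odd ((i + k) choose k)"
  shows "cup_i i (i + k) (i + k) X (wpow (i + k) X w) (wpow (i + k) X w) = wpow (i + k + k) X w"
proof
  fix \<tau>
  define q m where "q = i + k" and "m = i + k + k"
  have qm: "q + q - i = m" by (simp add: q_def m_def)
  show "cup_i i (i + k) (i + k) X (wpow (i + k) X w) (wpow (i + k) X w) \<tau> = wpow (i + k + k) X w \<tau>"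
    unfolding m_def[symmetric] unfolding q_def[symmetric]
  proof (cases "singular_simplex m X \<tau>")
    case False
    then show "cup_i i q q X (wpow q X w) (wpow q X w) \<tau> = wpow m X w \<tau>"
      using cup_i_cochain[of i q q X] by (simp add: wpow_def cochain2_set_def qm)
  next
    case True
    let ?A = "fc q (wpow q X w) \<tau>" and ?l = "pot w \<tau>"
    have A: "?A T = (if card T = Suc q then edges (\<lambda>a b. ?l a + ?l b) (sl T) else 0)" if "T \<subseteq> {..m}" for T
    proof (cases "card T = Suc q")
      case c: True
      have "finite T" using that finite_subset by blast
      then show ?thesis using c that by (simp add: fc_def vertex_face_eq wpow_pot[OF w True])
    qed (simp add: fc_def)
    have lhs: "cup_i i q q X (wpow q X w) (wpow q X w) \<tau> = DD (Suc i) ?A ?A {..m}"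
      using cup_i_DD[of q q i X \<tau>] True by (simp only: qm)
    have rhs: "wpow m X w \<tau> = (\<Prod>j<m. ?l j + ?l (Suc j))"
    proof -
      have "wpow m X w \<tau> = edges (\<lambda>a b. ?l a + ?l b) [0..<Suc m]"
        using wpow_pot[OF w True, of "[0..<Suc m]" m] face_id[OF True] by (simp add: subset_iff del: upt_Suc)
      then show ?thesis by (simp add: edges_prod del: upt_Suc)
    qed
    show "cup_i i q q X (wpow q X w) (wpow q X w) \<tau> = wpow m X w \<tau>"
    proof (cases "\<exists>t<m. ?l t + ?l (Suc t) = 0")
      case ex: True
      then obtain t where t: "t < m" "?l t + ?l (Suc t) = 0" by blast
      have z: "?A T = 0" if T: "T \<subseteq> {..m}" "t \<in> T" "Suc t \<in> T" for T
      proof (cases "card T = Suc q")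
        case c: True
        have fin: "finite T" using T finite_subset by blast
        define j where "j = card {w \<in> T. w < t}"
        have j: "j < length (sl T)" "sl T ! j = t" unfolding j_def by (rule sl_nth_rank[OF fin T(2)])+
        have "{w \<in> T. w < Suc t} = insert t {w \<in> T. w < t}" using T(2) by (auto simp: less_Suc_eq)
        then have "card {w \<in> T. w < Suc t} = Suc j" using fin by (simp add: j_def)
        then have "Suc j < length (sl T)" "sl T ! Suc j = Suc t" using sl_nth_rank[OF fin T(3)] by simp_all
        then have "(\<Prod>j<length (sl T) - 1. ?l (sl T ! j) + ?l (sl T ! Suc j)) = 0"
          using j t by (intro prod_zero bexI[of _ j]) auto
        then show ?thesis unfolding A[OF T(1)] if_P[OF c] edges_prod .
      qed (simp add: fc_def)
      have "?A (cf {..m} U) * ?A (cs {..m} U) = 0" if "U \<subseteq> {..m}" for U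
      proof -
        have fin: "finite U" using that finite_subset by blast
        let ?F = "cf {..m} U" and ?G = "cs {..m} U"
        have 1: "v \<in> ?F \<or> v \<in> ?G" if "v \<le> m" for v unfolding cf_def cs_def using that by blast
        have 2: "v \<in> ?F \<and> v \<in> ?G" if "v \<in> U" for v unfolding cf_def cs_def using that \<open>U \<subseteq> {..m}\<close> by blast
        have 3: "(t \<in> ?F \<longleftrightarrow> Suc t \<in> ?F) \<and> (t \<in> ?G \<longleftrightarrow> Suc t \<in> ?G)" if "t \<notin> U" "Suc t \<notin> U"
        proof -
          have "{u \<in> U. u < Suc t} = {u \<in> U. u < t}" using that by (auto simp: less_Suc_eq)
          then show ?thesis using that t(1) by (simp add: cf_def cs_def)
        qed
        have "t \<in> ?F \<and> Suc t \<in> ?F \<or> t \<in> ?G \<and> Suc t \<in> ?G"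
          using 1[of t] 1[of "Suc t"] 2[of t] 2[of "Suc t"] 3 t(1) by linarith
        then show ?thesis using z[of "cf {..m} U"] z[of "cs {..m} U"] cut_subsets(1,2)[of "{..m}" U] by auto
      qed
      then have "DD (Suc i) ?A ?A {..m} = 0" unfolding DD_def by (intro sum.neutral) blast
      moreover have "wpow m X w \<tau> = 0" unfolding rhs using t by (intro prod_zero) auto
      ultimately show ?thesis using lhs by simp
    next
      case False
      then have step: "?l (Suc t) = ?l t + 1" if "t < m" for t
        using that by (cases "?l t"; cases "?l (Suc t)") auto
      \<comment> \<open>All consecutive edges have value 1, so the potential is the vertex number
        modulo 2 and the problem becomes independent of \<open>w\<close>.\<close>
      have l: "?l t = of_nat t" if "t \<le> m" for t
        using that by (induction t) (simp_all add: step, simp add: pot_def)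
      have "wpow m X w \<tau> = 1" unfolding rhs by (intro prod.neutral) (simp add: step)
      moreover have "DD (Suc i) ?A ?A {..m} = 1"
      proof -
        have AT: "?A T = of_bool (card T = Suc q \<and> alt 0 T) + of_bool (card T = Suc q \<and> alt 1 T)" if T: "T \<subseteq> {..m}" for T
        proof (cases "card T = Suc q")
          case c: True
          have fin: "finite T" using T finite_subset by blast
          have ne: "sl T \<noteq> []" using c fin by auto
          have "edges (\<lambda>a b. ?l a + ?l b) (sl T) = edges (\<lambda>a b. of_nat a + of_nat b) (sl T)"
          proof (rule edges_cong)
            fix a b assume "a \<in> set (sl T)" "b \<in> set (sl T)"
            then have "a \<le> m" "b \<le> m" using T fin by auto
            then show "?l a + ?l b = of_nat a + of_nat b" using l by simp
          qed
          then show ?thesis using c fin by (simp add: A[OF T] edges_altl[OF ne] alt_altl)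
        qed (simp add: A[OF T])
        have n: "{..m} = {..<Suc i + k + k}" by (auto simp: m_def)
        have tm: "?A (cf {..m} U) * ?A (cs {..m} U) =
            of_bool (Pd 0 (Suc i + k + k) (Suc i) k k U) + of_bool (Pd 1 (Suc i + k + k) (Suc i) k k U)"
          if U: "U \<subseteq> {..m}" "card U = Suc i" for U
        proof -
          \<comment> \<open>Vertex 0 always lies on the first face, so that face can only alternate
            starting from an even vertex; the two starting parities remain for the second
            face.\<close>
          have "0 \<in> cf {..m} U" by (simp add: cf_def)
          then have "\<not> alt 1 (cf {..m} U)" by (force simp: alt_def)
          then show ?thesis
            using U(2) unfolding AT[OF cut_subsets(1)] AT[OF cut_subsets(2)] Pd_def n[symmetric]
            by (auto simp: q_def)
        qed
        have "DD (Suc i) ?A ?A {..m} = (\<Sum>U | U \<subseteq> {..m} \<and> card U = Suc i.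
            of_bool (Pd 0 (Suc i + k + k) (Suc i) k k U) + of_bool (Pd 1 (Suc i + k + k) (Suc i) k k U))"
          unfolding DD_def by (rule sum.cong) (use tm in auto)
        also have "\<dots> = of_nat (HH 0 (Suc i) k k) + of_nat (HH 1 (Suc i) k k)"
        proof -
          have "{U. U \<subseteq> {..m} \<and> card U = Suc i} \<inter> {U. Pd e (Suc i + k + k) (Suc i) k k U} =
              {U. U \<subseteq> {..<Suc i + k + k} \<and> Pd e (Suc i + k + k) (Suc i) k k U}" for e
            unfolding n by (auto simp: Pd_def)
          then show ?thesis by (simp add: sum.distrib HH_def)
        qed
        also have "\<dots> = 1" using odd_cnt[OF k o] unfolding of_nat_add[symmetric] of_nat_bit by simp
        finally show ?thesis .
      qed
      ultimately show ?thesis using lhs by simp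
    qed
  qed
qed

section \<open>Squares on wedges of spheres\<close>

lemma cocycle_add_coboundary:
  assumes "h \<in> reduced_coboundaries2 (Suc p) X" "c \<in> cocycles2 (Suc p) X"
  shows "(\<lambda>\<sigma>. h \<sigma> + c \<sigma>) \<in> cocycles2 (Suc p) X"
proof -
  obtain a where a: "h = coboundary2 p X a" using assms(1) by (auto simp: reduced_coboundaries2_def)
  have "coboundary2 (Suc p) X (\<lambda>\<sigma>. h \<sigma> + c \<sigma>) \<sigma> = coboundary2 (Suc p) X h \<sigma> + coboundary2 (Suc p) X c \<sigma>" for \<sigma>
    by (simp add: coboundary2_def sum.distrib del: sum.atMost_Suc)
  also have "\<dots> \<sigma> = 0" for \<sigma> using assms(2) by (simp add: a coboundary2_coboundary2 cocycles2_def)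
  finally have "coboundary2 (Suc p) X (\<lambda>\<sigma>. h \<sigma> + c \<sigma>) = (\<lambda>_. 0)" by auto
  moreover have "h \<in> cochain2_set (Suc p) X" by (simp add: a cochain2_set_def coboundary2_def)
  ultimately show ?thesis using assms(2) by (simp add: cocycles2_def cochain2_set_def)
qed

lemma restrict_cocycle:
  assumes c: "c \<in> cocycles2 q X" and sub: "\<And>p \<sigma>. singular_simplex p Y \<sigma> \<Longrightarrow> singular_simplex p X \<sigma>"
  shows "(\<lambda>\<sigma>. if singular_simplex q Y \<sigma> then c \<sigma> else 0) \<in> cocycles2 q Y"
proof -
  have "coboundary2 q Y (\<lambda>\<sigma>. if singular_simplex q Y \<sigma> then c \<sigma> else 0) \<sigma> = 0" for \<sigma>
  proof (cases "singular_simplex (Suc q) Y \<sigma>")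
    case True
    have "singular_simplex q Y (singular_face (Suc q) k \<sigma>)" if "k \<le> Suc q" for k
      using singular_simplex_singular_face[OF True _ that] by simp
    then have "coboundary2 q Y (\<lambda>\<sigma>. if singular_simplex q Y \<sigma> then c \<sigma> else 0) \<sigma> = coboundary2 q X c \<sigma>"
      using True sub[OF True] by (simp add: coboundary2_def del: sum.atMost_Suc)
    then show ?thesis using c by (simp add: cocycles2_def)
  qed (simp add: coboundary2_def)
  then show ?thesis by (auto simp: cocycles2_def cochain2_set_def)
qed

context wedge begin

lemma on_cl_image:
  assumes "j \<in> J" "on (vrl (sp j) (geo j) r) p z"
  shows "on (insert {} {S \<in> vr_complex W D r. S \<subseteq> cl j ` sp j}) p (mp (map (cl j)) z)"
proof -
  have 1: "on (vrl W D r) p (mp (map (cl j)) z)" by (rule on_cl[OF assms])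
  show ?thesis
    unfolding on_def
  proof
    fix L assume L: "L \<in> keys (mp (map (cl j)) z)"
    then obtain M where M: "M \<in> keys z" "L = map (cl j) M" by (rule keys_mpE)
    have "set M \<in> vrl (sp j) (geo j) r" using M(1) assms(2) unfolding on_def by blast
    then have "set M \<subseteq> sp j" unfolding vrl_iff by auto
    then have "set L \<subseteq> cl j ` sp j" unfolding M(2) by auto
    then show "set L \<in> insert {} {S \<in> vr_complex W D r. S \<subseteq> cl j ` sp j} \<and> length L = p"
      using 1 L unfolding on_def by blast
  qed
qed

text \<open>Via \<open>cl m\<close> and \<open>ret m\<close> the subcomplex is a copy of the complex
  of the \<open>m\<close>-sphere, which has no reduced homology except in degree
  \<open>m\<close>.\<close>

lemma acyclic_below:
  assumes r: "0 < r" "r \<le> pi / 2" and m: "m \<in> J" "q < m"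
  shows "reduced_cycles2 q (geometric_realization {S \<in> vr_complex W D r. S \<subseteq> cl m ` sp m}) \<subseteq>
    boundaries2 q (geometric_realization {S \<in> vr_complex W D r. S \<subseteq> cl m ` sp m})"
proof
  let ?K = "{S \<in> vr_complex W D r. S \<subseteq> cl m ` sp m}"
  let ?ret = "mp (map (ret m))" and ?cl = "mp (map (cl m))"
  have K: "simp_cx ?K" using simp_cx_vr[of W D r] unfolding simp_cx_def by blast
  fix z assume "z \<in> reduced_cycles2 q (geometric_realization ?K)"
  then obtain x where x: "on (insert {} ?K) (Suc q) x" "bd x = 0" "z + incc x \<in> boundaries2 q (geometric_realization ?K)"
    by (rule simplicial_representative[OF K])
  have "on (vrl W D r) (Suc q) x" by (rule on_mono[OF x(1)]) blast
  from on_ret[OF m(1) this] have "on (sph m 1 (cos r)) (Suc q) (?ret x)" unfolding vr_sp[OF r] .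
  moreover have "bd (?ret x) = 0" using x(2) by (simp add: bd_mp)
  moreover have "Suc q \<noteq> Suc m" using m(2) by simp
  ultimately obtain f where f: "on (sph m 1 (cos r)) (Suc (Suc q)) f" "?ret x = bd f"
    using sph_acyclic[OF zero_less_one cosr[OF r]] by blast
  have "?cl (?ret x) = x"
    unfolding mp_mp
  proof (rule mp_id)
    fix L assume "L \<in> keys x"
    then have "set L \<in> insert {} ?K" using x(1) unfolding on_def by blast
    then have "set L \<subseteq> cl m ` sp m" by (elim insertE CollectE conjE) (simp, assumption)
    then have "cl m (ret m P) = P" if "P \<in> set L" for P using that ret_cl[OF m(1) _ m(1)] by auto
    then show "map (cl m) (map (ret m) L) = L" by (auto intro!: map_idI)
  qed
  then have "x = bd (?cl f)" using f(2) by (simp add: bd_mp)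
  moreover have "on (insert {} ?K) (Suc (Suc q)) (?cl f)"
    by (rule on_cl_image[OF m(1)]) (unfold vr_sp[OF r], rule f(1))
  ultimately have "incc x \<in> boundaries2 q (geometric_realization ?K)" using incc_boundary[OF K] by simp
  with x(3) have "(z + incc x) + incc x \<in> boundaries2 q (geometric_realization ?K)" by (rule boundaries2_add)
  then show "z \<in> boundaries2 q (geometric_realization ?K)" by (simp add: add.assoc)
qed

theorem square_trivial:
  assumes r: "0 < r" "r \<le> pi / 2" and c: "c \<in> cocycles2 (Suc p) (vr_space W D r)"
    and i: "i \<le> p" and m: "Suc p + Suc p - i \<le> n"
  shows "cup_i i (Suc p) (Suc p) (vr_space W D r) c c \<in> reduced_coboundaries2 (Suc p + Suc p - i) (vr_space W D r)"
proof -
  let ?X = "vr_space W D r" and ?K = "{S \<in> vr_complex W D r. S \<subseteq> cl (Suc p + Suc p - i) ` sp (Suc p + Suc p - i)}"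
  let ?Y = "geometric_realization ?K"
  define m' where "m' = p + Suc p - i"
  have m': "Suc p + Suc p - i = Suc m'" using i by (simp add: m'_def)
  have mJ: "Suc m' \<in> J" using m m' by simp
  have K: "simp_cx ?K" using simp_cx_vr[of W D r] unfolding simp_cx_def by blast
  have sub: "singular_simplex p ?Y \<sigma> \<Longrightarrow> singular_simplex p ?X \<sigma>" for p \<sigma>
    unfolding vr_space_def by (rule simplex_realization_mono[of ?K]) auto
  let ?e = "cup_i i (Suc p) (Suc p) ?X c c"
  let ?c = "\<lambda>\<sigma>. if singular_simplex (Suc p) ?Y \<sigma> then c \<sigma> else 0"
  let ?e' = "cup_i i (Suc p) (Suc p) ?Y ?c ?c"
  have e: "?e \<in> cocycles2 (Suc m') ?X" using cup_square_cocycle[OF c, of i] by (simp only: m')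
  have c': "?c \<in> cocycles2 (Suc p) ?Y" by (rule restrict_cocycle[OF c sub])
  have "reduced_cycles2 (Suc p) ?Y \<subseteq> boundaries2 (Suc p) ?Y"
    unfolding m' by (rule acyclic_below[OF r mJ]) (use i in \<open>simp add: m'_def\<close>)
  then obtain b where b: "?c = coboundary2 p ?Y b" by (rule acyclic_cocycle[OF c'])
  obtain f where f: "f \<in> cochain2_set (p + Suc p - i) ?Y" "?e' = coboundary2 (p + Suc p - i) ?Y f"
    by (rule cup_square_coboundary[OF i b])
  have e': "?e' \<in> reduced_coboundaries2 (Suc m') ?Y"
    using f unfolding m'_def reduced_coboundaries2_def by auto
  \<comment> \<open>A cup-i product on a simplex of \<open>?Y\<close> evaluates the cocycle only on
    faces of that simplex, so it agrees with the product of the restricted cocycles.\<close>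
  have same: "?e \<sigma> = ?e' \<sigma>" if \<sigma>: "singular_simplex (Suc m') ?Y \<sigma>" for \<sigma>
  proof -
    have "fc (Suc p) c \<sigma> T = fc (Suc p) ?c \<sigma> T" if "T \<subseteq> {..Suc m'}" for T
      using vertex_face_simplex[OF \<sigma> that] by (simp add: fc_def)
    then have "DD (Suc i) (fc (Suc p) c \<sigma>) (fc (Suc p) c \<sigma>) {..Suc m'} = DD (Suc i) (fc (Suc p) ?c \<sigma>) (fc (Suc p) ?c \<sigma>) {..Suc m'}"
      by (intro DD_cong)
    then show ?thesis
      using cup_i_DD[of "Suc p" "Suc p" i ?X \<sigma>] cup_i_DD[of "Suc p" "Suc p" i ?Y \<sigma>] \<sigma> sub[OF \<sigma>] by (simp only: m')
  qed
  show ?thesis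
    unfolding m'
  proof (rule coboundary_criterion)
    show "?e \<in> cochain2_set (Suc m') ?X" using e by (simp add: cocycles2_def)
    fix z assume "z \<in> reduced_cycles2 (Suc m') ?X"
    then obtain z' where z': "on (vrl W D r) (Suc (Suc m')) z'" "bd z' = 0" "z + incc z' \<in> boundaries2 (Suc m') ?X"
      using simplicial_representative[OF simp_cx_vr] unfolding vr_space_def by blast
    let ?v = "mp (map (cl (Suc m'))) (mp (map (ret (Suc m'))) z')"
    obtain d where d: "on (vrl W D r) (Suc (Suc (Suc m'))) d" "z' = ?v + bd d"
      using cycle_on_sphere(1)[OF r z'(1,2) mJ] by blast
    have "on (insert {} ?K) (Suc (Suc m')) ?v"
      unfolding m' by (rule on_cl_image[OF mJ on_ret[OF mJ z'(1)]])
    moreover have "bd ?v = 0" using z'(2) by (simp add: bd_mp)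
    ultimately have v: "incc ?v \<in> reduced_cycles2 (Suc m') ?Y" by (rule incc_cycle[OF K])
    have "incc (bd d) \<in> boundaries2 (Suc m') ?X" using incc_boundary[OF simp_cx_vr d(1)] by (simp add: vr_space_def)
    moreover have "incc z' = incc ?v + incc (bd d)" using arg_cong[OF d(2), of incc] by (simp only: incc_add)
    ultimately have "z + (incc ?v + incc (bd d)) + incc (bd d) \<in> boundaries2 (Suc m') ?X"
      using boundaries2_add[OF z'(3)] by (simp only:)
    then have "z + incc ?v \<in> boundaries2 (Suc m') ?X" by (simp only: add.assoc chain_add_self add.right_neutral)
    then have "lin ?e (z + incc ?v) = 0" by (rule cocycle_on_boundary[OF e])
    moreover have "lin ?e (incc ?v) = lin ?e' (incc ?v)"
      by (rule lin_cong) (use v same in \<open>auto simp: reduced_cycles2_def chain2_set_def\<close>)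
    moreover have "lin ?e' (incc ?v) = 0" by (rule coboundary_vanishes[OF e' v])
    ultimately show "lin ?e z = 0" by simp
  qed
qed

end

section \<open>Squares on projective spaces\<close>

text \<open>Two scales appear because the interleaving controls the structure map: the cocycle lives
  at the outer scale \<open>R\<close>, while its square is detected after restriction to
  \<open>r\<close>, on a cycle of that smaller scale.\<close>

theorem rp_square:
  assumes n: "1 \<le> n" and r: "0 < r" "r \<le> R" "R \<le> 2 * pi / 3"
    and k: "0 < k" "odd ((i + k) choose k)" "i + k + k \<le> n"
  defines "X \<equiv> vr_space (rp_space n) (rp_dist n)"
  obtains c where "c \<in> cocycles2 (i + k) (X R)"
    "cochain_pullback2 (i + k + k) (X r) id (cup_i i (i + k) (i + k) (X R) c c) \<notin> reduced_coboundaries2 (i + k + k) (X r)"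
proof -
  let ?K = "vr_complex (rp_space n) (rp_dist n)"
  have R: "0 < R" using r by linarith
  interpret sm: smith n R by unfold_locales (use n R r in auto)
  obtain w where w: "w \<in> cocycles2 (Suc 0) (X R)" "\<And>L. set L \<in> ?K R \<Longrightarrow> length L = Suc (Suc 0) \<Longrightarrow> w (inc L) = edges sm.w0 L"
  proof (rule singular_cocycle_extension[of "?K R" 0 "edges sm.w0"])
    show "simp_cx (?K R)" by (rule simp_cx_vr)
    show "lin (edges sm.w0) (bd d) = 0" if "on (RPc n R) (Suc (Suc (Suc 0))) d" for d by (rule sm.w0_bd[OF that])
  qed (auto simp: X_def vr_space_def)
  let ?m = "i + k + k"
  have m: "1 \<le> ?m" "?m \<le> n" using k by auto
  obtain b where b: "on (RPc n r) (Suc ?m) b" "bd b = 0"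
    "\<forall>r'. r \<le> r' \<and> r' \<le> 2 * pi / 3 \<longrightarrow> lin (edges (smith.w0 n r')) b = 1"
    using rp_homology(3)[OF n r(1) order_trans[OF r(2,3)] m] by blast
  have z: "incc b \<in> reduced_cycles2 ?m (X r)" unfolding X_def vr_space_def by (rule incc_cycle[OF simp_cx_vr b(1,2)])
  have "lin (cochain_pullback2 ?m (X r) id (wpow ?m (X R) w)) (incc b) = lin (edges sm.w0) b"
    unfolding incc_def
  proof (subst lin_mp)
    show "lin (\<lambda>L. cochain_pullback2 ?m (X r) id (wpow ?m (X R) w) (inc L)) b = lin (edges sm.w0) b"
    proof (rule lin_cong)
      fix L assume "L \<in> keys b"
      then have "set L \<in> RPc n r" and len: "length L = Suc ?m" using b(1) by (auto simp: on_def)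
      then have L: "set L \<in> ?K r" by (cases L) auto
      have LR: "set L \<in> ?K R" using L vr_complex_mono[OF r(2)] by blast
      have s: "singular_simplex ?m (X r) (inc L)" unfolding X_def vr_space_def by (rule inc_simplex[OF simp_cx_vr L len])
      then have "inc L \<in> extensional (standard_simplex ?m)" by (simp add: singular_simplex_def)
      then have "simplex_map ?m id (inc L) = inc L" by (simp add: simplex_map_def extensional_restrict)
      then have "cochain_pullback2 ?m (X r) id (wpow ?m (X R) w) (inc L) = wpow ?m (X R) w (inc L)"
        using s by (simp add: cochain_pullback2_def)
      also have "\<dots> = edges (\<lambda>P Q. w (inc [P, Q])) L"
        unfolding X_def vr_space_def by (rule wpow_inc[OF simp_cx_vr LR len])
      also have "\<dots> = edges sm.w0 L"
      proof (rule edges_cong)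
        fix P Q assume "P \<in> set L" "Q \<in> set L"
        then have "set [P, Q] \<in> ?K R" using LR simp_cx_vr[of "rp_space n" "rp_dist n" R] unfolding simp_cx_def by simp
        then show "w (inc [P, Q]) = sm.w0 P Q" using w(2)[of "[P, Q]"] by simp
      qed
      finally show "cochain_pullback2 ?m (X r) id (wpow ?m (X R) w) (inc L) = edges sm.w0 L" .
    qed
  qed simp
  also have "\<dots> = 1" using b(3) r by simp
  finally have one: "lin (cochain_pullback2 ?m (X r) id (wpow ?m (X R) w)) (incc b) = 1" .
  have "cochain_pullback2 ?m (X r) id (wpow ?m (X R) w) \<notin> reduced_coboundaries2 ?m (X r)"
  proof
    obtain m' where m': "?m = Suc m'" using k by (cases ?m) auto
    assume "cochain_pullback2 ?m (X r) id (wpow ?m (X R) w) \<in> reduced_coboundaries2 ?m (X r)"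
    then have "lin (cochain_pullback2 ?m (X r) id (wpow ?m (X R) w)) (incc b) = 0"
      using z unfolding m' by (rule coboundary_vanishes)
    then show False using one by simp
  qed
  then have "cochain_pullback2 ?m (X r) id (cup_i i (i + k) (i + k) (X R) (wpow (i + k) (X R) w) (wpow (i + k) (X R) w)) \<notin> reduced_coboundaries2 ?m (X r)"
    unfolding cup_power[OF w(1) k(1,2)] .
  moreover have "wpow (i + k) (X R) w \<in> cocycles2 (i + k) (X R)" by (rule wpow_cocycle[OF w(1)]) (use k in simp)
  ultimately show thesis using that by blast
qed

section \<open>The lower bound\<close>

lemma steenrod_carrierE:
  assumes "k \<le> m" "k \<le> m - k" "A \<in> carrier (steenrod_image k m X)"
  obtains c where "c \<in> cocycles2 (m - k) X"
    "A = (\<Union>c\<in>ccls (reduced_coboundaries2 (m - k) X) c. ccls (reduced_coboundaries2 m X) (cup_i (m - k - k) (m - k) (m - k) X c c))"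
  using assms(3) unfolding steenrod_carrier[OF assms(1,2)] by (elim imageE) (rule that, assumption, simp only:)

lemma steenrod_carrier_nonempty:
  assumes "k \<le> m" "k \<le> m - k" "A \<in> carrier (steenrod_image k m X)"
  shows "A \<noteq> {}"
proof -
  obtain c where "A = (\<Union>c\<in>ccls (reduced_coboundaries2 (m - k) X) c. ccls (reduced_coboundaries2 m X) (cup_i (m - k - k) (m - k) (m - k) X c c))"
    by (rule steenrod_carrierE[OF assms])
  then show ?thesis using ccls_self[of c "m - k" X] ccls_self[of _ m X] by blast
qed

theorem steenrod_interleaving:
  assumes k: "0 < k" "k \<le> m" "m \<le> n" "odd ((m - k) choose k)" and b: "\<forall>i\<in>{1..n}. b i \<in> round_sphere i 1"
    and \<delta>: "0 \<le> \<delta>"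
    and int: "op_interleaved F2 \<delta> (vr_steenrod_image k m (sphere_wedge b n) (sphere_wedge_dist b))
      (vr_steenrod_image k m (rp_space n) (rp_dist n))"
  shows "pi / 3 \<le> \<delta>"
proof (rule ccontr)
  assume "\<not> pi / 3 \<le> \<delta>"
  then have \<delta>3: "\<delta> < pi / 3" by simp
  have n: "1 \<le> n" using k by linarith
  interpret wedge n b by unfold_locales (use n b in auto)
  let ?X = "vr_space W D" and ?Y = "vr_space (rp_space n) (rp_dist n)"
  \<comment> \<open>Otherwise the binomial coefficient would be 0, hence even. This places the
    square in the range where it is given by a cup-i product.\<close>
  have kq: "k \<le> m - k" using k(4) by (metis binomial_eq_0 even_zero linorder_not_le)
  define i p where "i = m - k - k" and "p = m - k - 1"
  have ikp: "m - k = i + k" "m = i + k + k" "m - k = Suc p" "i \<le> p" "m = Suc p + Suc p - i" "m - k - k = i" "i + k = Suc p"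
    using k kq by (auto simp: i_def p_def)
  obtain m' where m': "m = Suc m'" using k by (cases m) auto
  \<comment> \<open>Since \<open>\<delta> < pi / 3\<close>, this is positive, keeps the middle scale
    \<open>r + \<delta>\<close> on the wedge within pi/2, and keeps the outer scale
    \<open>r + 2 * \<delta>\<close> on the projective space within 2 pi/3.\<close>
  define r where "r = min (pi / 6) (2 * pi / 3 - 2 * \<delta>)"
  have r: "0 < r" "0 < r + \<delta>" "r + \<delta> \<le> pi / 2" "r \<le> r + 2 * \<delta>" "r + 2 * \<delta> \<le> 2 * pi / 3"
    using \<delta> \<delta>3 pi_gt_zero unfolding r_def by (auto simp: min_def field_simps)
  obtain \<phi> \<psi> where
    \<phi>: "\<And>r. \<phi> r \<in> linear_maps F2 (steenrod_image k m (?X (r + \<delta>))) (steenrod_image k m (?Y r))" and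
    \<psi>: "\<And>r. \<psi> r \<in> linear_maps F2 (steenrod_image k m (?Y (r + \<delta>))) (steenrod_image k m (?X r))" and
    comp: "\<And>r y. y \<in> carrier (steenrod_image k m (?Y (r + 2 * \<delta>))) \<Longrightarrow> \<phi> r (\<psi> (r + \<delta>) y) = cohomology_map2 m (?Y r) id y"
    using int unfolding op_interleaved_def op_shift_map_def vr_steenrod_image_def persistence.select_convs by metis
  obtain c where c: "c \<in> cocycles2 (i + k) (?Y (r + 2 * \<delta>))"
    "cochain_pullback2 (i + k + k) (?Y r) id (cup_i i (i + k) (i + k) (?Y (r + 2 * \<delta>)) c c) \<notin> reduced_coboundaries2 (i + k + k) (?Y r)"
    using rp_square[OF n r(1,4,5) k(1), of i] k(3,4) ikp by metis
  define y where "y = (\<Union>c\<in>ccls (reduced_coboundaries2 (m - k) (?Y (r + 2 * \<delta>))) c.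
    ccls (reduced_coboundaries2 m (?Y (r + 2 * \<delta>))) (cup_i (m - k - k) (m - k) (m - k) (?Y (r + 2 * \<delta>)) c c))"
  have y: "y \<in> carrier (steenrod_image k m (?Y (r + 2 * \<delta>)))"
    unfolding steenrod_carrier[OF k(2) kq] y_def using c(1) by (intro imageI) (simp add: ikp(1))
  have cy: "cup_i i (i + k) (i + k) (?Y (r + 2 * \<delta>)) c c \<in> y"
    unfolding y_def using ccls_self[of c "m - k"] ccls_self[of "cup_i i (i + k) (i + k) (?Y (r + 2 * \<delta>)) c c" m] ikp(1,6) by auto
  let ?B = "reduced_coboundaries2 m (?X (r + \<delta>))"
  have triv: "A = ?B" if A: "A \<in> carrier (steenrod_image k m (?X (r + \<delta>)))" for A
  proof -
    obtain c0 where c0: "c0 \<in> cocycles2 (m - k) (?X (r + \<delta>))"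
      "A = (\<Union>c\<in>ccls (reduced_coboundaries2 (m - k) (?X (r + \<delta>))) c0. ccls ?B (cup_i (m - k - k) (m - k) (m - k) (?X (r + \<delta>)) c c))"
      by (rule steenrod_carrierE[OF k(2) kq A])
    have "ccls ?B (cup_i (m - k - k) (m - k) (m - k) (?X (r + \<delta>)) c c) = ?B"
      if cc: "c \<in> ccls (reduced_coboundaries2 (m - k) (?X (r + \<delta>))) c0" for c
    proof -
      obtain h where "h \<in> reduced_coboundaries2 (Suc p) (?X (r + \<delta>))" "c = (\<lambda>\<sigma>. h \<sigma> + c0 \<sigma>)"
        using cc unfolding ccls_def ikp(3) by blast
      then have "c \<in> cocycles2 (Suc p) (?X (r + \<delta>))"
        using cocycle_add_coboundary c0(1) unfolding ikp(3) by blast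
      from square_trivial[OF r(2,3) this ikp(4)] k(3)
      have "cup_i i (Suc p) (Suc p) (?X (r + \<delta>)) c c \<in> ?B" unfolding ikp(5)[symmetric] by blast
      then have "cup_i (m - k - k) (m - k) (m - k) (?X (r + \<delta>)) c c \<in> ?B" unfolding ikp(6) unfolding ikp(3) .
      then show ?thesis unfolding m' by (rule ccls_coboundary)
    qed
    then show ?thesis unfolding c0(2) using ccls_self[of c0 "m - k"] by auto
  qed
  have F2: "0 \<in> carrier F2" by (simp add: F2_def)
  have "\<psi> (r + \<delta>) y \<in> carrier (steenrod_image k m (?X (r + \<delta>)))"
    using \<psi>[of "r + \<delta>"] y by (auto simp: linear_maps_def add.assoc)
  then have B: "\<psi> (r + \<delta>) y = ?B" "?B \<in> carrier (steenrod_image k m (?X (r + \<delta>)))" using triv by auto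
  have ne: "?B \<noteq> {}" using zero_coboundary by blast
  have img: "\<phi> r ?B \<in> carrier (steenrod_image k m (?Y r))" using \<phi>[of r] B(2) by (auto simp: linear_maps_def)
  have "\<phi> r ?B = \<phi> r (0 \<odot>\<^bsub>steenrod_image k m (?X (r + \<delta>))\<^esub> ?B)" by (simp only: steenrod_zero_smult[OF ne])
  also have "\<dots> = 0 \<odot>\<^bsub>steenrod_image k m (?Y r)\<^esub> \<phi> r ?B" using \<phi>[of r] B(2) F2 unfolding linear_maps_def by blast
  also have "\<dots> = reduced_coboundaries2 m (?Y r)"
    by (rule steenrod_zero_smult[OF steenrod_carrier_nonempty[OF k(2) kq img]])
  finally have "cohomology_map2 m (?Y r) id y = reduced_coboundaries2 m (?Y r)"
    using comp[OF y] B(1) by simp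
  moreover have "cochain_pullback2 m (?Y r) id (cup_i i (i + k) (i + k) (?Y (r + 2 * \<delta>)) c c) \<in> cohomology_map2 m (?Y r) id y"
    unfolding cohomology_map2_def coset_ccls using cy ccls_self by blast
  ultimately show False using c(2) unfolding ikp(2)[symmetric] by simp
qed

theorem mainTheorem5:
  shows "(\<forall>(n::nat) (m::nat) (b :: nat \<Rightarrow> nat \<Rightarrow> real).
            n \<ge> 1 \<and> (\<forall>i\<in>{1..n}. b i \<in> round_sphere i 1) \<longrightarrow>
              interleaving_dist F2
                (vr_homology m (sphere_wedge b n) (sphere_wedge_dist b))
                (vr_homology m (rp_space n) (rp_dist n))
                \<le> ereal ((pi - zeta n) / 2)
              \<and> (pi - zeta n) / 2 < pi / 4)
       \<and> (\<forall>(n::nat) (m::nat) (k::nat) (b :: nat \<Rightarrow> nat \<Rightarrow> real).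
            0 < k \<and> k \<le> m \<and> m \<le> n \<and> odd ((m - k) choose k)
              \<and> (\<forall>i\<in>{1..n}. b i \<in> round_sphere i 1) \<longrightarrow>
              ereal (pi / 3) \<le>
                op_interleaving_dist F2
                  (vr_steenrod_image k m (sphere_wedge b n) (sphere_wedge_dist b))
                  (vr_steenrod_image k m (rp_space n) (rp_dist n)))"
proof (intro conjI allI impI)
  fix n m :: nat and b :: "nat \<Rightarrow> nat \<Rightarrow> real"
  assume "n \<ge> 1 \<and> (\<forall>i\<in>{1..n}. b i \<in> round_sphere i 1)"
  then show "interleaving_dist F2 (vr_homology m (sphere_wedge b n) (sphere_wedge_dist b))
        (vr_homology m (rp_space n) (rp_dist n)) \<le> ereal ((pi - zeta n) / 2)"
    "(pi - zeta n) / 2 < pi / 4"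
    using homology_interleaving by blast+
next
  fix n m k :: nat and b :: "nat \<Rightarrow> nat \<Rightarrow> real"
  assume "0 < k \<and> k \<le> m \<and> m \<le> n \<and> odd ((m - k) choose k) \<and> (\<forall>i\<in>{1..n}. b i \<in> round_sphere i 1)"
  then show "ereal (pi / 3) \<le> op_interleaving_dist F2
      (vr_steenrod_image k m (sphere_wedge b n) (sphere_wedge_dist b)) (vr_steenrod_image k m (rp_space n) (rp_dist n))"
    unfolding op_interleaving_dist_def using steenrod_interleaving[of k m n b] by (intro Inf_greatest) auto
qed

end
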